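(* Let $G=G_1*_HG_2$ be an injective amalgamated free product, or let $G=G_1*_H\{t\}$ be an injective HNN extension. Let $C$ be a finite f.g. free $\mathbb{Z}[G]$-module chain complex. Then the canonical infinite Mayer--Vietoris splitting ${\mathcal E}(\infty)$ of $C$ is a union of finite Mayer--Vietoris splittings ${\mathcal E}\subset{\mathcal E}(\infty)$ of $C$: $${\mathcal E}(\infty)=\bigcup{\mathcal E}.$$ In particular, there exist finite Mayer--Vietoris splittings ${\mathcal E}$ of $C$.
   Context: Groups. Case (A): $G=G_1*_HG_2$ is the amalgamated free product (pushout of groups) determined by group morphisms $i_1:H\to G_1$, $i_2:H\to G_2$, with canonical morphisms $j_1:G_1\to G$, $j_2:G_2\to G$; it is injective if $i_1,i_2$ are injective (then so are $j_1,j_2$, and $G_1\cap G_2=H\subseteq G$). Put $k=j_1i_1=j_2i_2:H\to G$. Case (B): $G=G_1*_H\{t\}$ is the HNN extension determined by group morphisms $i_1,i_2:H\to G_1$, with canonical morphism $j_1:G_1\to G$ and $t\in G$ such that $j_1i_1(h)t=tj_1i_2(h)$ for all $h\in H$; it is injective if $i_1,i_2$ are injective (then so is $j_1$, and $G_1\cap tG_1t^{-1}=i_1(H)=t\,i_2(H)t^{-1}\subseteq G$). Put $k=j_1i_1:H\to G$; $H$ is regarded as a subgroup of $G$ via $k$. Modules are left modules. For a group morphism $i:A\to B$, $i_!M=\mathbb{Z}[B]\otimes_{\mathbb{Z}[A]}M$ denotes induction and $i^!N=N$ (regarded as a $\mathbb{Z}[A]$-module via $i$) denotes restriction. A chain complex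 is finite f.g. free if it is concentrated in finitely many degrees and each of its modules is finitely generated free. A Mayer--Vietoris splitting ${\mathcal E}$ of a $\mathbb{Z}[G]$-module chain complex $C$ is, in case (A), an exact sequence of $\mathbb{Z}[G]$-module chain complexes $${\mathcal E}: 0\to k_!D\xrightarrow{\begin{pmatrix}1\otimes e_1\\1\otimes e_2\end{pmatrix}}(j_1)_!C_1\oplus(j_2)_!C_2\to C\to 0$$ with $C_1$ a $\mathbb{Z}[G_1]$-module chain complex, $C_2$ a $\mathbb{Z}[G_2]$-module chain complex, $D$ a $\mathbb{Z}[H]$-module chain complex, and $e_1:(i_1)_!D\to C_1$, $e_2:(i_2)_!D\to C_2$ chain maps over $\mathbb{Z}[G_1]$, $\mathbb{Z}[G_2]$; in case (B), an exact sequence of $\mathbb{Z}[G]$-module chain complexes $${\mathcal E}:0\to (j_1i_1)_!D\xrightarrow{1\otimes e_1-t\otimes e_2}(j_1)_!C_1\to C\to 0$$ with $C_1$ a $\mathbb{Z}[G_1]$-module chain complex, $D$ a $\mathbb{Z}[H]$-module chain complex, and $e_1:(i_1)_!D\to C_1$, $e_2:(i_2)_!D\to C_1$ $\mathbb{Z}[G_1]$-module chain maps. The splitting is finite if every chain complex in it ($C$, $D$, $C_1$, and in case (A) $C_2$) is finite f.g. free over its group ring, and infinite otherwise. The canonical infinite Mayer--Vietoris splitting ${\mathcal E}(\infty)$ of $C$ is, in case (A), $0\to k_!k^!C\to(j_1)_!j_1^!C\oplus(j_2)_!j_2^!C\to C\to 0$, with maps $g\otimes x\mapsto(g\otimes x,g\otimes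 x)$ and $(g_1\otimes x_1,g_2\otimes x_2)\mapsto g_1x_1-g_2x_2$; and, in case (B), $0\to k_!k^!C\to(j_1)_!j_1^!C\to C\to 0$, with maps $g\otimes x\mapsto g\otimes x-gt\otimes t^{-1}x$ and $g\otimes x\mapsto gx$. ${\mathcal E}\subset{\mathcal E}(\infty)$ means that $D\subseteq k^!C$ and $C_1\subseteq j_1^!C$ (and $C_2\subseteq j_2^!C$ in case (A)) are subcomplexes over the respective group rings and that the maps of ${\mathcal E}$ are the restrictions of those of ${\mathcal E}(\infty)$, with the identity on $C$. The equality ${\mathcal E}(\infty)=\bigcup{\mathcal E}$ means that each term of ${\mathcal E}(\infty)$ is the union of the corresponding terms of the finite ${\mathcal E}\subset{\mathcal E}(\infty)$. *)

theory Defs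
  imports "HOL-Algebra.Module" "HOL-Algebra.Free_Abelian_Groups"
begin

section \<open>Monoids given by generators and relations\<close>

inductive word_cong :: "('x list \<times> 'x list) set \<Rightarrow> 'x list \<Rightarrow> 'x list \<Rightarrow> bool"
  for Q :: "('x list \<times> 'x list) set" where
  wc_rel: "(u, v) \<in> Q \<Longrightarrow> word_cong Q (p @ u @ s) (p @ v @ s)"
| wc_refl: "word_cong Q u u"
| wc_sym: "word_cong Q u v \<Longrightarrow> word_cong Q v u"
| wc_trans: "word_cong Q u v \<Longrightarrow> word_cong Q v w \<Longrightarrow> word_cong Q u w"

definition word_class :: "'x set \<Rightarrow> ('x list \<times> 'x list) set \<Rightarrow> 'x list \<Rightarrow> 'x list set" where
  "word_class L Q u = {v \<in> lists L. word_cong Q u v}"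

definition presented :: "'x set \<Rightarrow> ('x list \<times> 'x list) set \<Rightarrow> 'x list set monoid" where
  "presented L Q =
     \<lparr>carrier = word_class L Q ` lists L,
      mult = (\<lambda>X Y. \<Union>x\<in>X. \<Union>y\<in>Y. word_class L Q (x @ y)),
      one = word_class L Q []\<rparr>"

definition mult_table :: "('a \<Rightarrow> 'x) \<Rightarrow> ('a, 'z) monoid_scheme \<Rightarrow> ('x list \<times> 'x list) set" where
  "mult_table f A = insert ([f \<one>\<^bsub>A\<^esub>], [])
     {([f a, f b], [f (a \<otimes>\<^bsub>A\<^esub> b)]) | a b. a \<in> carrier A \<and> b \<in> carrier A}"


section \<open>Amalgamated free products and HNN extensions\<close>

record ('h, 'a, 'b, 'g) amalgam =
  am_H :: "'h monoid"
  am_G1 :: "'a monoid"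
  am_G2 :: "'b monoid"
  am_i1 :: "'h \<Rightarrow> 'a"
  am_i2 :: "'h \<Rightarrow> 'b"
  am_G :: "'g monoid"
  am_j1 :: "'a \<Rightarrow> 'g"
  am_j2 :: "'b \<Rightarrow> 'g"

definition am_k :: "('h, 'a, 'b, 'g) amalgam \<Rightarrow> 'h \<Rightarrow> 'g" where
  "am_k A = am_j1 A \<circ> am_i1 A"

definition am_letters :: "('h, 'a, 'b, 'g) amalgam \<Rightarrow> ('a + 'b) set" where
  "am_letters A = carrier (am_G1 A) <+> carrier (am_G2 A)"

definition am_relations :: "('h, 'a, 'b, 'g) amalgam \<Rightarrow> (('a + 'b) list \<times> ('a + 'b) list) set" where
  "am_relations A = mult_table Inl (am_G1 A) \<union> mult_table Inr (am_G2 A) \<union>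
     {([Inl (am_i1 A h)], [Inr (am_i2 A h)]) | h. h \<in> carrier (am_H A)}"

text \<open>The group \<open>G\<close> with \<open>j1\<close>, \<open>j2\<close> is the pushout when it is isomorphic, compatibly
  with the morphisms from \<open>G1\<close> and \<open>G2\<close>, to the explicit pushout (words in \<open>G1\<close> and \<open>G2\<close>
  modulo the multiplication tables and \<open>i1 h = i2 h\<close>). The universal property with respect to
  groups of arbitrary type, which cannot be quantified over in a definition, is proved in
  \<open>pushout_universal\<close> below; likewise \<open>hnn_universal\<close> for HNN extensions.\<close>

definition is_pushout :: "('h, 'a, 'b, 'g) amalgam \<Rightarrow> bool" where
  "is_pushout A \<longleftrightarrow>
     (\<exists>\<phi> \<in> iso (presented (am_letters A) (am_relations A)) (am_G A).
        (\<forall>a \<in> carrier (am_G1 A).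
           \<phi> (word_class (am_letters A) (am_relations A) [Inl a]) = am_j1 A a) \<and>
        (\<forall>b \<in> carrier (am_G2 A).
           \<phi> (word_class (am_letters A) (am_relations A) [Inr b]) = am_j2 A b))"

definition amalgamated_free_product :: "('h, 'a, 'b, 'g) amalgam \<Rightarrow> bool" where
  "amalgamated_free_product A \<longleftrightarrow>
     group (am_H A) \<and> group (am_G1 A) \<and> group (am_G2 A) \<and> group (am_G A) \<and>
     am_i1 A \<in> hom (am_H A) (am_G1 A) \<and> am_i2 A \<in> hom (am_H A) (am_G2 A) \<and>
     is_pushout A"

definition injective_amalgam :: "('h, 'a, 'b, 'g) amalgam \<Rightarrow> bool" where
  "injective_amalgam A \<longleftrightarrow> amalgamated_free_product A \<and>
     inj_on (am_i1 A) (carrier (am_H A)) \<and> inj_on (am_i2 A) (carrier (am_H A))"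

record ('h, 'a, 'g) hnn =
  hn_H :: "'h monoid"
  hn_G1 :: "'a monoid"
  hn_i1 :: "'h \<Rightarrow> 'a"
  hn_i2 :: "'h \<Rightarrow> 'a"
  hn_G :: "'g monoid"
  hn_j1 :: "'a \<Rightarrow> 'g"
  hn_t :: "'g"

definition hn_k :: "('h, 'a, 'g) hnn \<Rightarrow> 'h \<Rightarrow> 'g" where
  "hn_k B = hn_j1 B \<circ> hn_i1 B"

text \<open>The letters \<open>Inr True\<close> and \<open>Inr False\<close> stand for \<open>t\<close> and its inverse.\<close>

definition hn_letters :: "('h, 'a, 'g) hnn \<Rightarrow> ('a + bool) set" where
  "hn_letters B = carrier (hn_G1 B) <+> UNIV"

definition hn_relations :: "('h, 'a, 'g) hnn \<Rightarrow> (('a + bool) list \<times> ('a + bool) list) set" where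
  "hn_relations B = mult_table Inl (hn_G1 B) \<union>
     {([Inr True, Inr False], []), ([Inr False, Inr True], [])} \<union>
     {([Inl (hn_i1 B h), Inr True], [Inr True, Inl (hn_i2 B h)]) | h. h \<in> carrier (hn_H B)}"

definition hnn_extension :: "('h, 'a, 'g) hnn \<Rightarrow> bool" where
  "hnn_extension B \<longleftrightarrow>
     group (hn_H B) \<and> group (hn_G1 B) \<and> group (hn_G B) \<and>
     hn_i1 B \<in> hom (hn_H B) (hn_G1 B) \<and> hn_i2 B \<in> hom (hn_H B) (hn_G1 B) \<and>
     (\<exists>\<phi> \<in> iso (presented (hn_letters B) (hn_relations B)) (hn_G B).
        (\<forall>a \<in> carrier (hn_G1 B).
           \<phi> (word_class (hn_letters B) (hn_relations B) [Inl a]) = hn_j1 B a) \<and>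
        \<phi> (word_class (hn_letters B) (hn_relations B) [Inr True]) = hn_t B)"

definition injective_hnn :: "('h, 'a, 'g) hnn \<Rightarrow> bool" where
  "injective_hnn B \<longleftrightarrow> hnn_extension B \<and>
     inj_on (hn_i1 B) (carrier (hn_H B)) \<and> inj_on (hn_i2 B) (carrier (hn_H B))"


section \<open>Group rings and modules over noncommutative rings\<close>

text \<open>The elements of the group ring are finitely supported functions;
  \<open>frag_of g\<close> is the basis element \<open>g\<close> and \<open>frag_extend\<close> is linear extension.\<close>

definition group_ring :: "('g, 'z) monoid_scheme \<Rightarrow> ('g \<Rightarrow>\<^sub>0 int) ring" (\<open>\<int>[_]\<close>) where
  "\<int>[G] =
     \<lparr>carrier = {x. Poly_Mapping.keys x \<subseteq> carrier G},
      mult = (\<lambda>x y. frag_extend (\<lambda>a. frag_extend (\<lambda>b. frag_of (a \<otimes>\<^bsub>G\<^esub> b)) y) x),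
      one = frag_of \<one>\<^bsub>G\<^esub>,
      ring.zero = 0,
      add = (+)\<rparr>"

definition gr_map :: "('a \<Rightarrow> 'b) \<Rightarrow> ('a \<Rightarrow>\<^sub>0 int) \<Rightarrow> ('b \<Rightarrow>\<^sub>0 int)" where
  "gr_map f = frag_extend (\<lambda>a. frag_of (f a))"

text \<open>The library locale \<open>module\<close> assumes a commutative ring. As there, the fields \<open>mult\<close> and
  \<open>one\<close> of a module record carry no meaning.\<close>

locale left_module = R?: ring R + M?: abelian_group M for R (structure) and M (structure) +
  assumes smult_closed:
      "\<lbrakk>a \<in> carrier R; x \<in> carrier M\<rbrakk> \<Longrightarrow> a \<odot>\<^bsub>M\<^esub> x \<in> carrier M"
    and smult_l_distr:
      "\<lbrakk>a \<in> carrier R; b \<in> carrier R; x \<in> carrier M\<rbrakk> \<Longrightarrow>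
        (a \<oplus>\<^bsub>R\<^esub> b) \<odot>\<^bsub>M\<^esub> x = a \<odot>\<^bsub>M\<^esub> x \<oplus>\<^bsub>M\<^esub> b \<odot>\<^bsub>M\<^esub> x"
    and smult_r_distr:
      "\<lbrakk>a \<in> carrier R; x \<in> carrier M; y \<in> carrier M\<rbrakk> \<Longrightarrow>
        a \<odot>\<^bsub>M\<^esub> (x \<oplus>\<^bsub>M\<^esub> y) = a \<odot>\<^bsub>M\<^esub> x \<oplus>\<^bsub>M\<^esub> a \<odot>\<^bsub>M\<^esub> y"
    and smult_assoc:
      "\<lbrakk>a \<in> carrier R; b \<in> carrier R; x \<in> carrier M\<rbrakk> \<Longrightarrow>
        (a \<otimes>\<^bsub>R\<^esub> b) \<odot>\<^bsub>M\<^esub> x = a \<odot>\<^bsub>M\<^esub> (b \<odot>\<^bsub>M\<^esub> x)"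
    and smult_one:
      "x \<in> carrier M \<Longrightarrow> \<one>\<^bsub>R\<^esub> \<odot>\<^bsub>M\<^esub> x = x"

definition mod_hom :: "'r ring \<Rightarrow> ('r, 'm) module \<Rightarrow> ('r, 'n) module \<Rightarrow> ('m \<Rightarrow> 'n) set" where
  "mod_hom R M N = {f \<in> carrier M \<rightarrow> carrier N.
     (\<forall>x \<in> carrier M. \<forall>y \<in> carrier M. f (x \<oplus>\<^bsub>M\<^esub> y) = f x \<oplus>\<^bsub>N\<^esub> f y) \<and>
     (\<forall>r \<in> carrier R. \<forall>x \<in> carrier M. f (r \<odot>\<^bsub>M\<^esub> x) = r \<odot>\<^bsub>N\<^esub> f x)}"

definition fg_free :: "'r ring \<Rightarrow> ('r, 'm) module \<Rightarrow> bool" where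
  "fg_free R M \<longleftrightarrow> left_module R M \<and>
     (\<exists>B. finite B \<and> B \<subseteq> carrier M \<and>
        (\<forall>x \<in> carrier M. \<exists>!r. r \<in> B \<rightarrow>\<^sub>E carrier R \<and> x = (\<Oplus>\<^bsub>M\<^esub>b\<in>B. r b \<odot>\<^bsub>M\<^esub> b)))"

definition dsum :: "('r, 'm) module \<Rightarrow> ('r, 'n) module \<Rightarrow> ('r, 'm \<times> 'n) module" where
  "dsum M N =
     \<lparr>carrier = carrier M \<times> carrier N,
      mult = undefined, one = undefined,
      ring.zero = (\<zero>\<^bsub>M\<^esub>, \<zero>\<^bsub>N\<^esub>),
      add = (\<lambda>(x, y) (x', y'). (x \<oplus>\<^bsub>M\<^esub> x', y \<oplus>\<^bsub>N\<^esub> y')),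
      smult = (\<lambda>r (x, y). (r \<odot>\<^bsub>M\<^esub> x, r \<odot>\<^bsub>N\<^esub> y))\<rparr>"

definition res_mod :: "('r \<Rightarrow> 's) \<Rightarrow> ('s, 'm) module \<Rightarrow> ('r, 'm) module" where
  "res_mod \<phi> N =
     \<lparr>carrier = carrier N, mult = mult N, one = one N, ring.zero = \<zero>\<^bsub>N\<^esub>, add = add N,
      smult = (\<lambda>r. smult N (\<phi> r))\<rparr>"


section \<open>Extension of scalars\<close>

text \<open>The tensor product of \<open>S\<close> and \<open>M\<close> over \<open>R\<close>, where \<open>S\<close> is a right \<open>R\<close>-module via
  \<open>\<phi>\<close>: the quotient of the free abelian group on pairs by the subgroup \<open>tensor_null\<close>. The action of
  \<open>S\<close> on a coset can be computed on any representative, see \<open>TC_smult\<close> below.\<close>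

type_synonym ('s, 'm) tensor = "(('s \<times> 'm) \<Rightarrow>\<^sub>0 int) set"

definition tensor_free :: "'s ring \<Rightarrow> ('r, 'm) module \<Rightarrow> (('s \<times> 'm) \<Rightarrow>\<^sub>0 int) monoid" where
  "tensor_free S M = free_Abelian_group (carrier S \<times> carrier M)"

definition tensor_relators ::
  "'r ring \<Rightarrow> 's ring \<Rightarrow> ('r \<Rightarrow> 's) \<Rightarrow> ('r, 'm) module \<Rightarrow> (('s \<times> 'm) \<Rightarrow>\<^sub>0 int) set" where
  "tensor_relators R S \<phi> M =
     {frag_of (s \<oplus>\<^bsub>S\<^esub> s', x) - frag_of (s, x) - frag_of (s', x) | s s' x.
        s \<in> carrier S \<and> s' \<in> carrier S \<and> x \<in> carrier M} \<union>
     {frag_of (s, x \<oplus>\<^bsub>M\<^esub> x') - frag_of (s, x) - frag_of (s, x') | s x x'.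
        s \<in> carrier S \<and> x \<in> carrier M \<and> x' \<in> carrier M} \<union>
     {frag_of (s \<otimes>\<^bsub>S\<^esub> \<phi> r, x) - frag_of (s, r \<odot>\<^bsub>M\<^esub> x) | s r x.
        s \<in> carrier S \<and> r \<in> carrier R \<and> x \<in> carrier M}"

definition tensor_null ::
  "'r ring \<Rightarrow> 's ring \<Rightarrow> ('r \<Rightarrow> 's) \<Rightarrow> ('r, 'm) module \<Rightarrow> ('s, 'm) tensor" where
  "tensor_null R S \<phi> M = generate (tensor_free S M) (tensor_relators R S \<phi> M)"

definition tensor_class ::
  "'r ring \<Rightarrow> 's ring \<Rightarrow> ('r \<Rightarrow> 's) \<Rightarrow> ('r, 'm) module \<Rightarrow> (('s \<times> 'm) \<Rightarrow>\<^sub>0 int) \<Rightarrow> ('s, 'm) tensor" where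
  "tensor_class R S \<phi> M c = tensor_null R S \<phi> M #>\<^bsub>tensor_free S M\<^esub> c"

definition pure_tensor ::
  "'r ring \<Rightarrow> 's ring \<Rightarrow> ('r \<Rightarrow> 's) \<Rightarrow> ('r, 'm) module \<Rightarrow> 's \<Rightarrow> 'm \<Rightarrow> ('s, 'm) tensor" where
  "pure_tensor R S \<phi> M s x = tensor_class R S \<phi> M (frag_of (s, x))"

definition ext_mod ::
  "'r ring \<Rightarrow> 's ring \<Rightarrow> ('r \<Rightarrow> 's) \<Rightarrow> ('r, 'm) module \<Rightarrow> ('s, ('s, 'm) tensor) module" where
  "ext_mod R S \<phi> M = (let Q = tensor_free S M Mod tensor_null R S \<phi> M in
     \<lparr>carrier = carrier Q, mult = undefined, one = undefined, ring.zero = one Q, add = mult Q,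
      smult = (\<lambda>s X. \<Union>c\<in>X.
        tensor_class R S \<phi> M (frag_extend (\<lambda>(s', x). frag_of (s \<otimes>\<^bsub>S\<^esub> s', x)) c))\<rparr>)"

text \<open>The additive map to \<open>N\<close> with value \<open>\<beta> s x\<close> on the pure tensor of \<open>s\<close> and \<open>x\<close>.
  The choice of the representative is immaterial when \<open>\<beta>\<close> is biadditive and balanced,
  see \<open>tensor_lift_class\<close> below.\<close>

definition tensor_lift :: "('q, 'n) module \<Rightarrow> ('s \<Rightarrow> 'm \<Rightarrow> 'n) \<Rightarrow> ('s, 'm) tensor \<Rightarrow> 'n" where
  "tensor_lift N \<beta> X = (let c = (SOME c. c \<in> X) in
     \<Oplus>\<^bsub>N\<^esub>p\<in>Poly_Mapping.keys c. [Poly_Mapping.lookup c p] \<cdot>\<^bsub>N\<^esub> \<beta> (fst p) (snd p))"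

definition ext_map ::
  "'r ring \<Rightarrow> 's ring \<Rightarrow> ('r \<Rightarrow> 's) \<Rightarrow> ('r, 'n) module \<Rightarrow> ('m \<Rightarrow> 'n) \<Rightarrow>
    ('s, 'm) tensor \<Rightarrow> ('s, 'n) tensor" where
  "ext_map R S \<phi> N f =
     tensor_lift (ext_mod R S \<phi> N) (\<lambda>s x. pure_tensor R S \<phi> N s (f x))"


section \<open>Chain complexes\<close>

record ('r, 'm) ch_complex =
  cmod :: "int \<Rightarrow> ('r, 'm) module"
  cdiff :: "int \<Rightarrow> 'm \<Rightarrow> 'm"

definition chain_complex :: "'r ring \<Rightarrow> ('r, 'm) ch_complex \<Rightarrow> bool" where
  "chain_complex R C \<longleftrightarrow>
     (\<forall>n. left_module R (cmod C n)) \<and>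
     (\<forall>n. cdiff C n \<in> mod_hom R (cmod C n) (cmod C (n - 1))) \<and>
     (\<forall>n. \<forall>x \<in> carrier (cmod C n). cdiff C (n - 1) (cdiff C n x) = \<zero>\<^bsub>cmod C (n - 1 - 1)\<^esub>)"

definition finite_fg_free :: "'r ring \<Rightarrow> ('r, 'm) ch_complex \<Rightarrow> bool" where
  "finite_fg_free R C \<longleftrightarrow> chain_complex R C \<and>
     finite {n. carrier (cmod C n) \<noteq> {\<zero>\<^bsub>cmod C n\<^esub>}} \<and>
     (\<forall>n. fg_free R (cmod C n))"

definition chain_map ::
  "'r ring \<Rightarrow> ('r, 'm) ch_complex \<Rightarrow> ('r, 'n) ch_complex \<Rightarrow> (int \<Rightarrow> 'm \<Rightarrow> 'n) \<Rightarrow> bool" where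
  "chain_map R C D f \<longleftrightarrow>
     (\<forall>n. f n \<in> mod_hom R (cmod C n) (cmod D n)) \<and>
     (\<forall>n. \<forall>x \<in> carrier (cmod C n). f (n - 1) (cdiff C n x) = cdiff D n (f n x))"

definition short_exact ::
  "'r ring \<Rightarrow> ('r, 'l) ch_complex \<Rightarrow> ('r, 'm) ch_complex \<Rightarrow> ('r, 'n) ch_complex \<Rightarrow>
    (int \<Rightarrow> 'l \<Rightarrow> 'm) \<Rightarrow> (int \<Rightarrow> 'm \<Rightarrow> 'n) \<Rightarrow> bool" where
  "short_exact R K L M f g \<longleftrightarrow>
     chain_complex R K \<and> chain_complex R L \<and> chain_complex R M \<and>
     chain_map R K L f \<and> chain_map R L M g \<and>
     (\<forall>n. inj_on (f n) (carrier (cmod K n)) \<and>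
          f n ` carrier (cmod K n) = {y \<in> carrier (cmod L n). g n y = \<zero>\<^bsub>cmod M n\<^esub>} \<and>
          g n ` carrier (cmod L n) = carrier (cmod M n))"

definition subcomplex :: "'r ring \<Rightarrow> ('r, 'm) ch_complex \<Rightarrow> ('r, 'm) ch_complex \<Rightarrow> bool" where
  "subcomplex R D C \<longleftrightarrow> chain_complex R D \<and> chain_complex R C \<and>
     (\<forall>n. carrier (cmod D n) \<subseteq> carrier (cmod C n) \<and>
          \<zero>\<^bsub>cmod D n\<^esub> = \<zero>\<^bsub>cmod C n\<^esub> \<and>
          (\<forall>x \<in> carrier (cmod D n). \<forall>y \<in> carrier (cmod D n).
             x \<oplus>\<^bsub>cmod D n\<^esub> y = x \<oplus>\<^bsub>cmod C n\<^esub> y) \<and>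
          (\<forall>r \<in> carrier R. \<forall>x \<in> carrier (cmod D n).
             r \<odot>\<^bsub>cmod D n\<^esub> x = r \<odot>\<^bsub>cmod C n\<^esub> x) \<and>
          (\<forall>x \<in> carrier (cmod D n). cdiff D n x = cdiff C n x))"

definition dsum_complex :: "('r, 'm) ch_complex \<Rightarrow> ('r, 'n) ch_complex \<Rightarrow> ('r, 'm \<times> 'n) ch_complex" where
  "dsum_complex C D =
     \<lparr>cmod = (\<lambda>n. dsum (cmod C n) (cmod D n)),
      cdiff = (\<lambda>n. map_prod (cdiff C n) (cdiff D n))\<rparr>"

text \<open>Restriction and induction along a group morphism \<open>i\<close> from \<open>A\<close> to \<open>B\<close>.\<close>

definition res_complex ::
  "('a \<Rightarrow> 'b) \<Rightarrow> ('b \<Rightarrow>\<^sub>0 int, 'm) ch_complex \<Rightarrow> ('a \<Rightarrow>\<^sub>0 int, 'm) ch_complex" where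
  "res_complex i C = \<lparr>cmod = (\<lambda>n. res_mod (gr_map i) (cmod C n)), cdiff = cdiff C\<rparr>"

abbreviation ind_mod ::
  "'a monoid \<Rightarrow> 'b monoid \<Rightarrow> ('a \<Rightarrow> 'b) \<Rightarrow> ('a \<Rightarrow>\<^sub>0 int, 'm) module \<Rightarrow>
    ('b \<Rightarrow>\<^sub>0 int, ('b \<Rightarrow>\<^sub>0 int, 'm) tensor) module" where
  "ind_mod A B i \<equiv> ext_mod \<int>[A] \<int>[B] (gr_map i)"

abbreviation ind_pure ::
  "'a monoid \<Rightarrow> 'b monoid \<Rightarrow> ('a \<Rightarrow> 'b) \<Rightarrow> ('a \<Rightarrow>\<^sub>0 int, 'm) module \<Rightarrow>
    ('b \<Rightarrow>\<^sub>0 int) \<Rightarrow> 'm \<Rightarrow> ('b \<Rightarrow>\<^sub>0 int, 'm) tensor" where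
  "ind_pure A B i \<equiv> pure_tensor \<int>[A] \<int>[B] (gr_map i)"

abbreviation ind_map ::
  "'a monoid \<Rightarrow> 'b monoid \<Rightarrow> ('a \<Rightarrow> 'b) \<Rightarrow> ('a \<Rightarrow>\<^sub>0 int, 'n) module \<Rightarrow> ('m \<Rightarrow> 'n) \<Rightarrow>
    ('b \<Rightarrow>\<^sub>0 int, 'm) tensor \<Rightarrow> ('b \<Rightarrow>\<^sub>0 int, 'n) tensor" where
  "ind_map A B i \<equiv> ext_map \<int>[A] \<int>[B] (gr_map i)"

definition ind_complex ::
  "'a monoid \<Rightarrow> 'b monoid \<Rightarrow> ('a \<Rightarrow> 'b) \<Rightarrow> ('a \<Rightarrow>\<^sub>0 int, 'm) ch_complex \<Rightarrow>
    ('b \<Rightarrow>\<^sub>0 int, ('b \<Rightarrow>\<^sub>0 int, 'm) tensor) ch_complex" where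
  "ind_complex A B i C =
     \<lparr>cmod = (\<lambda>n. ind_mod A B i (cmod C n)),
      cdiff = (\<lambda>n. ind_map A B i (cmod C (n - 1)) (cdiff C n))\<rparr>"


section \<open>Mayer--Vietoris splittings: amalgamated free products\<close>

record ('h, 'a, 'b, 'g, 'd, 'c1, 'c2, 'c) amv =
  amv_D :: "('h \<Rightarrow>\<^sub>0 int, 'd) ch_complex"
  amv_C1 :: "('a \<Rightarrow>\<^sub>0 int, 'c1) ch_complex"
  amv_C2 :: "('b \<Rightarrow>\<^sub>0 int, 'c2) ch_complex"
  amv_e1 :: "int \<Rightarrow> ('a \<Rightarrow>\<^sub>0 int, 'd) tensor \<Rightarrow> 'c1"
  amv_e2 :: "int \<Rightarrow> ('b \<Rightarrow>\<^sub>0 int, 'd) tensor \<Rightarrow> 'c2"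
  amv_proj :: "int \<Rightarrow> ('g \<Rightarrow>\<^sub>0 int, 'c1) tensor \<times> ('g \<Rightarrow>\<^sub>0 int, 'c2) tensor \<Rightarrow> 'c"

definition amv_left ::
  "('h, 'a, 'b, 'g) amalgam \<Rightarrow> ('h, 'a, 'b, 'g, 'd, 'c1, 'c2, 'c) amv \<Rightarrow>
    ('g \<Rightarrow>\<^sub>0 int, ('g \<Rightarrow>\<^sub>0 int, 'd) tensor) ch_complex" where
  "amv_left A E = ind_complex (am_H A) (am_G A) (am_k A) (amv_D E)"

definition amv_mid ::
  "('h, 'a, 'b, 'g) amalgam \<Rightarrow> ('h, 'a, 'b, 'g, 'd, 'c1, 'c2, 'c) amv \<Rightarrow>
    ('g \<Rightarrow>\<^sub>0 int, ('g \<Rightarrow>\<^sub>0 int, 'c1) tensor \<times> ('g \<Rightarrow>\<^sub>0 int, 'c2) tensor) ch_complex" where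
  "amv_mid A E = dsum_complex
     (ind_complex (am_G1 A) (am_G A) (am_j1 A) (amv_C1 E))
     (ind_complex (am_G2 A) (am_G A) (am_j2 A) (amv_C2 E))"

text \<open>Under the identification of \<open>k\<^sub>!D\<close> with the induction of \<open>(i\<^sub>1)\<^sub>!D\<close> along \<open>j\<^sub>1\<close>,
  the map \<open>1 \<otimes> e\<^sub>1\<close> sends \<open>s \<otimes> x\<close> to \<open>s \<otimes> e\<^sub>1 (1 \<otimes> x)\<close>.\<close>

definition amv_inj ::
  "('h, 'a, 'b, 'g) amalgam \<Rightarrow> ('h, 'a, 'b, 'g, 'd, 'c1, 'c2, 'c) amv \<Rightarrow> int \<Rightarrow>
    ('g \<Rightarrow>\<^sub>0 int, 'd) tensor \<Rightarrow> ('g \<Rightarrow>\<^sub>0 int, 'c1) tensor \<times> ('g \<Rightarrow>\<^sub>0 int, 'c2) tensor" where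
  "amv_inj A E n X =
     (tensor_lift (ind_mod (am_G1 A) (am_G A) (am_j1 A) (cmod (amv_C1 E) n))
        (\<lambda>s x. ind_pure (am_G1 A) (am_G A) (am_j1 A) (cmod (amv_C1 E) n) s
           (amv_e1 E n (ind_pure (am_H A) (am_G1 A) (am_i1 A) (cmod (amv_D E) n) \<one>\<^bsub>\<int>[am_G1 A]\<^esub> x))) X,
      tensor_lift (ind_mod (am_G2 A) (am_G A) (am_j2 A) (cmod (amv_C2 E) n))
        (\<lambda>s x. ind_pure (am_G2 A) (am_G A) (am_j2 A) (cmod (amv_C2 E) n) s
           (amv_e2 E n (ind_pure (am_H A) (am_G2 A) (am_i2 A) (cmod (amv_D E) n) \<one>\<^bsub>\<int>[am_G2 A]\<^esub> x))) X)"

definition amv_splitting ::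
  "('h, 'a, 'b, 'g) amalgam \<Rightarrow> ('g \<Rightarrow>\<^sub>0 int, 'c) ch_complex \<Rightarrow>
    ('h, 'a, 'b, 'g, 'd, 'c1, 'c2, 'c) amv \<Rightarrow> bool" where
  "amv_splitting A C E \<longleftrightarrow>
     chain_complex \<int>[am_H A] (amv_D E) \<and>
     chain_complex \<int>[am_G1 A] (amv_C1 E) \<and>
     chain_complex \<int>[am_G2 A] (amv_C2 E) \<and>
     chain_map \<int>[am_G1 A] (ind_complex (am_H A) (am_G1 A) (am_i1 A) (amv_D E)) (amv_C1 E) (amv_e1 E) \<and>
     chain_map \<int>[am_G2 A] (ind_complex (am_H A) (am_G2 A) (am_i2 A) (amv_D E)) (amv_C2 E) (amv_e2 E) \<and>
     short_exact \<int>[am_G A] (amv_left A E) (amv_mid A E) C (amv_inj A E) (amv_proj E)"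

definition amv_finite ::
  "('h, 'a, 'b, 'g) amalgam \<Rightarrow> ('g \<Rightarrow>\<^sub>0 int, 'c) ch_complex \<Rightarrow>
    ('h, 'a, 'b, 'g, 'd, 'c1, 'c2, 'c) amv \<Rightarrow> bool" where
  "amv_finite A C E \<longleftrightarrow> amv_splitting A C E \<and>
     finite_fg_free \<int>[am_G A] C \<and> finite_fg_free \<int>[am_H A] (amv_D E) \<and>
     finite_fg_free \<int>[am_G1 A] (amv_C1 E) \<and> finite_fg_free \<int>[am_G2 A] (amv_C2 E)"

definition amv_canonical ::
  "('h, 'a, 'b, 'g) amalgam \<Rightarrow> ('g \<Rightarrow>\<^sub>0 int, 'c) ch_complex \<Rightarrow>
    ('h, 'a, 'b, 'g, 'c, 'c, 'c, 'c) amv" where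
  "amv_canonical A C =
     \<lparr>amv_D = res_complex (am_k A) C,
      amv_C1 = res_complex (am_j1 A) C,
      amv_C2 = res_complex (am_j2 A) C,
      amv_e1 = (\<lambda>n. tensor_lift (cmod C n) (\<lambda>s x. gr_map (am_j1 A) s \<odot>\<^bsub>cmod C n\<^esub> x)),
      amv_e2 = (\<lambda>n. tensor_lift (cmod C n) (\<lambda>s x. gr_map (am_j2 A) s \<odot>\<^bsub>cmod C n\<^esub> x)),
      amv_proj = (\<lambda>n (X, Y). tensor_lift (cmod C n) (smult (cmod C n)) X \<ominus>\<^bsub>cmod C n\<^esub>
                             tensor_lift (cmod C n) (smult (cmod C n)) Y)\<rparr>"

text \<open>The maps induced by the inclusions of the complexes of \<open>E\<close> into those of \<open>E'\<close>.\<close>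

definition amv_left_incl ::
  "('h, 'a, 'b, 'g) amalgam \<Rightarrow> ('h, 'a, 'b, 'g, 'd, 'c1, 'c2, 'c) amv \<Rightarrow> int \<Rightarrow>
    ('g \<Rightarrow>\<^sub>0 int, 'd) tensor \<Rightarrow> ('g \<Rightarrow>\<^sub>0 int, 'd) tensor" where
  "amv_left_incl A E' n = ind_map (am_H A) (am_G A) (am_k A) (cmod (amv_D E') n) (\<lambda>x. x)"

definition amv_mid_incl ::
  "('h, 'a, 'b, 'g) amalgam \<Rightarrow> ('h, 'a, 'b, 'g, 'd, 'c1, 'c2, 'c) amv \<Rightarrow> int \<Rightarrow>
    ('g \<Rightarrow>\<^sub>0 int, 'c1) tensor \<times> ('g \<Rightarrow>\<^sub>0 int, 'c2) tensor \<Rightarrow>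
    ('g \<Rightarrow>\<^sub>0 int, 'c1) tensor \<times> ('g \<Rightarrow>\<^sub>0 int, 'c2) tensor" where
  "amv_mid_incl A E' n = map_prod
     (ind_map (am_G1 A) (am_G A) (am_j1 A) (cmod (amv_C1 E') n) (\<lambda>x. x))
     (ind_map (am_G2 A) (am_G A) (am_j2 A) (cmod (amv_C2 E') n) (\<lambda>x. x))"

definition amv_sub ::
  "('h, 'a, 'b, 'g) amalgam \<Rightarrow> ('h, 'a, 'b, 'g, 'd, 'c1, 'c2, 'c) amv \<Rightarrow>
    ('h, 'a, 'b, 'g, 'd, 'c1, 'c2, 'c) amv \<Rightarrow> bool" where
  "amv_sub A E E' \<longleftrightarrow>
     subcomplex \<int>[am_H A] (amv_D E) (amv_D E') \<and>
     subcomplex \<int>[am_G1 A] (amv_C1 E) (amv_C1 E') \<and>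
     subcomplex \<int>[am_G2 A] (amv_C2 E) (amv_C2 E') \<and>
     (\<forall>n. \<forall>X \<in> carrier (cmod (amv_left A E) n).
        amv_mid_incl A E' n (amv_inj A E n X) = amv_inj A E' n (amv_left_incl A E' n X)) \<and>
     (\<forall>n. \<forall>Y \<in> carrier (cmod (amv_mid A E) n).
        amv_proj E n Y = amv_proj E' n (amv_mid_incl A E' n Y))"

definition amv_union ::
  "('h, 'a, 'b, 'g) amalgam \<Rightarrow> ('g \<Rightarrow>\<^sub>0 int, 'c) ch_complex \<Rightarrow>
    ('h, 'a, 'b, 'g, 'd, 'c1, 'c2, 'c) amv set \<Rightarrow>
    ('h, 'a, 'b, 'g, 'd, 'c1, 'c2, 'c) amv \<Rightarrow> bool" where
  "amv_union A C \<E> E' \<longleftrightarrow> (\<forall>n.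
     carrier (cmod (amv_D E') n) = (\<Union>E\<in>\<E>. carrier (cmod (amv_D E) n)) \<and>
     carrier (cmod (amv_C1 E') n) = (\<Union>E\<in>\<E>. carrier (cmod (amv_C1 E) n)) \<and>
     carrier (cmod (amv_C2 E') n) = (\<Union>E\<in>\<E>. carrier (cmod (amv_C2 E) n)) \<and>
     carrier (cmod (amv_left A E') n) =
       (\<Union>E\<in>\<E>. amv_left_incl A E' n ` carrier (cmod (amv_left A E) n)) \<and>
     carrier (cmod (amv_mid A E') n) =
       (\<Union>E\<in>\<E>. amv_mid_incl A E' n ` carrier (cmod (amv_mid A E) n)) \<and>
     carrier (cmod C n) = (\<Union>E\<in>\<E>. carrier (cmod C n)))"


section \<open>Mayer--Vietoris splittings: HNN extensions\<close>

record ('h, 'a, 'g, 'd, 'c1, 'c) hmv =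
  hmv_D :: "('h \<Rightarrow>\<^sub>0 int, 'd) ch_complex"
  hmv_C1 :: "('a \<Rightarrow>\<^sub>0 int, 'c1) ch_complex"
  hmv_e1 :: "int \<Rightarrow> ('a \<Rightarrow>\<^sub>0 int, 'd) tensor \<Rightarrow> 'c1"
  hmv_e2 :: "int \<Rightarrow> ('a \<Rightarrow>\<^sub>0 int, 'd) tensor \<Rightarrow> 'c1"
  hmv_proj :: "int \<Rightarrow> ('g \<Rightarrow>\<^sub>0 int, 'c1) tensor \<Rightarrow> 'c"

definition hmv_left ::
  "('h, 'a, 'g) hnn \<Rightarrow> ('h, 'a, 'g, 'd, 'c1, 'c) hmv \<Rightarrow>
    ('g \<Rightarrow>\<^sub>0 int, ('g \<Rightarrow>\<^sub>0 int, 'd) tensor) ch_complex" where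
  "hmv_left B E = ind_complex (hn_H B) (hn_G B) (hn_k B) (hmv_D E)"

definition hmv_mid ::
  "('h, 'a, 'g) hnn \<Rightarrow> ('h, 'a, 'g, 'd, 'c1, 'c) hmv \<Rightarrow>
    ('g \<Rightarrow>\<^sub>0 int, ('g \<Rightarrow>\<^sub>0 int, 'c1) tensor) ch_complex" where
  "hmv_mid B E = ind_complex (hn_G1 B) (hn_G B) (hn_j1 B) (hmv_C1 E)"

text \<open>The map \<open>t \<otimes> e\<^sub>2\<close> sends \<open>s \<otimes> x\<close> to \<open>s t \<otimes> e\<^sub>2 (1 \<otimes> x)\<close>.\<close>

definition hmv_inj ::
  "('h, 'a, 'g) hnn \<Rightarrow> ('h, 'a, 'g, 'd, 'c1, 'c) hmv \<Rightarrow> int \<Rightarrow>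
    ('g \<Rightarrow>\<^sub>0 int, 'd) tensor \<Rightarrow> ('g \<Rightarrow>\<^sub>0 int, 'c1) tensor" where
  "hmv_inj B E n = (let N = ind_mod (hn_G1 B) (hn_G B) (hn_j1 B) (cmod (hmv_C1 E) n) in
     tensor_lift N (\<lambda>s x.
       ind_pure (hn_G1 B) (hn_G B) (hn_j1 B) (cmod (hmv_C1 E) n) s
         (hmv_e1 E n (ind_pure (hn_H B) (hn_G1 B) (hn_i1 B) (cmod (hmv_D E) n) \<one>\<^bsub>\<int>[hn_G1 B]\<^esub> x))
       \<ominus>\<^bsub>N\<^esub>
       ind_pure (hn_G1 B) (hn_G B) (hn_j1 B) (cmod (hmv_C1 E) n) (s \<otimes>\<^bsub>\<int>[hn_G B]\<^esub> frag_of (hn_t B))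
         (hmv_e2 E n (ind_pure (hn_H B) (hn_G1 B) (hn_i2 B) (cmod (hmv_D E) n) \<one>\<^bsub>\<int>[hn_G1 B]\<^esub> x))))"

definition hmv_splitting ::
  "('h, 'a, 'g) hnn \<Rightarrow> ('g \<Rightarrow>\<^sub>0 int, 'c) ch_complex \<Rightarrow> ('h, 'a, 'g, 'd, 'c1, 'c) hmv \<Rightarrow> bool" where
  "hmv_splitting B C E \<longleftrightarrow>
     chain_complex \<int>[hn_H B] (hmv_D E) \<and>
     chain_complex \<int>[hn_G1 B] (hmv_C1 E) \<and>
     chain_map \<int>[hn_G1 B] (ind_complex (hn_H B) (hn_G1 B) (hn_i1 B) (hmv_D E)) (hmv_C1 E) (hmv_e1 E) \<and>
     chain_map \<int>[hn_G1 B] (ind_complex (hn_H B) (hn_G1 B) (hn_i2 B) (hmv_D E)) (hmv_C1 E) (hmv_e2 E) \<and>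
     short_exact \<int>[hn_G B] (hmv_left B E) (hmv_mid B E) C (hmv_inj B E) (hmv_proj E)"

definition hmv_finite ::
  "('h, 'a, 'g) hnn \<Rightarrow> ('g \<Rightarrow>\<^sub>0 int, 'c) ch_complex \<Rightarrow> ('h, 'a, 'g, 'd, 'c1, 'c) hmv \<Rightarrow> bool" where
  "hmv_finite B C E \<longleftrightarrow> hmv_splitting B C E \<and>
     finite_fg_free \<int>[hn_G B] C \<and> finite_fg_free \<int>[hn_H B] (hmv_D E) \<and>
     finite_fg_free \<int>[hn_G1 B] (hmv_C1 E)"

definition hmv_canonical ::
  "('h, 'a, 'g) hnn \<Rightarrow> ('g \<Rightarrow>\<^sub>0 int, 'c) ch_complex \<Rightarrow> ('h, 'a, 'g, 'c, 'c, 'c) hmv" where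
  "hmv_canonical B C =
     \<lparr>hmv_D = res_complex (hn_k B) C,
      hmv_C1 = res_complex (hn_j1 B) C,
      hmv_e1 = (\<lambda>n. tensor_lift (cmod C n) (\<lambda>s x. gr_map (hn_j1 B) s \<odot>\<^bsub>cmod C n\<^esub> x)),
      hmv_e2 = (\<lambda>n. tensor_lift (cmod C n) (\<lambda>s x.
        gr_map (hn_j1 B) s \<odot>\<^bsub>cmod C n\<^esub> (frag_of (inv\<^bsub>hn_G B\<^esub> hn_t B) \<odot>\<^bsub>cmod C n\<^esub> x))),
      hmv_proj = (\<lambda>n. tensor_lift (cmod C n) (smult (cmod C n)))\<rparr>"

definition hmv_left_incl ::
  "('h, 'a, 'g) hnn \<Rightarrow> ('h, 'a, 'g, 'd, 'c1, 'c) hmv \<Rightarrow> int \<Rightarrow>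
    ('g \<Rightarrow>\<^sub>0 int, 'd) tensor \<Rightarrow> ('g \<Rightarrow>\<^sub>0 int, 'd) tensor" where
  "hmv_left_incl B E' n = ind_map (hn_H B) (hn_G B) (hn_k B) (cmod (hmv_D E') n) (\<lambda>x. x)"

definition hmv_mid_incl ::
  "('h, 'a, 'g) hnn \<Rightarrow> ('h, 'a, 'g, 'd, 'c1, 'c) hmv \<Rightarrow> int \<Rightarrow>
    ('g \<Rightarrow>\<^sub>0 int, 'c1) tensor \<Rightarrow> ('g \<Rightarrow>\<^sub>0 int, 'c1) tensor" where
  "hmv_mid_incl B E' n = ind_map (hn_G1 B) (hn_G B) (hn_j1 B) (cmod (hmv_C1 E') n) (\<lambda>x. x)"

definition hmv_sub ::
  "('h, 'a, 'g) hnn \<Rightarrow> ('h, 'a, 'g, 'd, 'c1, 'c) hmv \<Rightarrow> ('h, 'a, 'g, 'd, 'c1, 'c) hmv \<Rightarrow> bool" where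
  "hmv_sub B E E' \<longleftrightarrow>
     subcomplex \<int>[hn_H B] (hmv_D E) (hmv_D E') \<and>
     subcomplex \<int>[hn_G1 B] (hmv_C1 E) (hmv_C1 E') \<and>
     (\<forall>n. \<forall>X \<in> carrier (cmod (hmv_left B E) n).
        hmv_mid_incl B E' n (hmv_inj B E n X) = hmv_inj B E' n (hmv_left_incl B E' n X)) \<and>
     (\<forall>n. \<forall>Y \<in> carrier (cmod (hmv_mid B E) n).
        hmv_proj E n Y = hmv_proj E' n (hmv_mid_incl B E' n Y))"

definition hmv_union ::
  "('h, 'a, 'g) hnn \<Rightarrow> ('g \<Rightarrow>\<^sub>0 int, 'c) ch_complex \<Rightarrow> ('h, 'a, 'g, 'd, 'c1, 'c) hmv set \<Rightarrow>
    ('h, 'a, 'g, 'd, 'c1, 'c) hmv \<Rightarrow> bool" where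
  "hmv_union B C \<E> E' \<longleftrightarrow> (\<forall>n.
     carrier (cmod (hmv_D E') n) = (\<Union>E\<in>\<E>. carrier (cmod (hmv_D E) n)) \<and>
     carrier (cmod (hmv_C1 E') n) = (\<Union>E\<in>\<E>. carrier (cmod (hmv_C1 E) n)) \<and>
     carrier (cmod (hmv_left B E') n) =
       (\<Union>E\<in>\<E>. hmv_left_incl B E' n ` carrier (cmod (hmv_left B E) n)) \<and>
     carrier (cmod (hmv_mid B E') n) =
       (\<Union>E\<in>\<E>. hmv_mid_incl B E' n ` carrier (cmod (hmv_mid B E) n)) \<and>
     carrier (cmod C n) = (\<Union>E\<in>\<E>. carrier (cmod C n)))"


section \<open>Universal properties of the two group constructions\<close>

definition word_val :: "('k, 'z) monoid_scheme \<Rightarrow> ('x \<Rightarrow> 'k) \<Rightarrow> 'x list \<Rightarrow> 'k" where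
  "word_val K f w = foldr (\<lambda>x y. f x \<otimes>\<^bsub>K\<^esub> y) w \<one>\<^bsub>K\<^esub>"

lemma word_class_self: "u \<in> lists L \<Longrightarrow> u \<in> word_class L Q u"
  by (simp add: word_class_def word_cong.wc_refl)

lemma word_class_eqI: "word_cong Q u v \<Longrightarrow> word_class L Q u = word_class L Q v"
  unfolding word_class_def using word_cong.wc_sym word_cong.wc_trans by blast

lemma word_cong_append:
  "word_cong Q u v \<Longrightarrow> word_cong Q (p @ u @ s) (p @ v @ s)"
proof (induction rule: word_cong.induct)
  case (wc_rel u v p' s')
  from word_cong.wc_rel[OF wc_rel, of "p @ p'" "s' @ s"] show ?case by simp
qed (auto intro: word_cong.wc_refl word_cong.wc_sym word_cong.wc_trans)

lemma word_cong_append2: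
  assumes "word_cong Q u u'" "word_cong Q v v'"
  shows "word_cong Q (u @ v) (u' @ v')"
  using word_cong_append[OF assms(1), of "[]" v] word_cong_append[OF assms(2), of u' "[]"]
  by (auto intro: word_cong.wc_trans)

lemma presented_mult:
  assumes "u \<in> lists L" "v \<in> lists L"
  shows "word_class L Q u \<otimes>\<^bsub>presented L Q\<^esub> word_class L Q v = word_class L Q (u @ v)"
proof -
  have "word_class L Q (x @ y) = word_class L Q (u @ v)"
    if "x \<in> word_class L Q u" "y \<in> word_class L Q v" for x y
    using that by (intro word_class_eqI word_cong.wc_sym[OF word_cong_append2])
      (auto simp: word_class_def)
  then have "(\<Union>x\<in>word_class L Q u. \<Union>y\<in>word_class L Q v. word_class L Q (x @ y)) =
      (\<Union>x\<in>word_class L Q u. \<Union>y\<in>word_class L Q v. word_class L Q (u @ v))"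
    by (intro SUP_cong refl) auto
  also have "\<dots> = word_class L Q (u @ v)"
    using word_class_self[OF assms(1), of Q] word_class_self[OF assms(2), of Q] by blast
  finally show ?thesis
    by (simp add: presented_def)
qed

context
  fixes K :: "('k, 'z) monoid_scheme" and f :: "'x \<Rightarrow> 'k" and L :: "'x set"
    and Q :: "('x list \<times> 'x list) set"
  assumes K: "monoid K" and f: "f \<in> L \<rightarrow> carrier K"
    and QL: "Q \<subseteq> lists L \<times> lists L"
    and Qf: "\<And>u v. (u, v) \<in> Q \<Longrightarrow> word_val K f u = word_val K f v"
begin

interpretation monoid K by (rule K)

lemma word_val_closed: "w \<in> lists L \<Longrightarrow> word_val K f w \<in> carrier K"
  by (induction w) (use f in \<open>auto simp: word_val_def\<close>)

lemma word_val_append: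
  "u \<in> lists L \<Longrightarrow> v \<in> lists L \<Longrightarrow> word_val K f (u @ v) = word_val K f u \<otimes>\<^bsub>K\<^esub> word_val K f v"
proof (induction u)
  case Nil
  then show ?case using word_val_closed by (simp add: word_val_def)
next
  case (Cons a u)
  then have "word_val K f u \<in> carrier K" "word_val K f v \<in> carrier K" "f a \<in> carrier K"
    using f word_val_closed by auto
  with Cons show ?case by (simp add: word_val_def m_assoc)
qed

lemma word_val_cong:
  "word_cong Q u v \<Longrightarrow> (u \<in> lists L \<longleftrightarrow> v \<in> lists L) \<and>
     (u \<in> lists L \<longrightarrow> word_val K f u = word_val K f v)"
proof (induction rule: word_cong.induct)
  case (wc_rel u v p s)
  then have "u \<in> lists L" "v \<in> lists L" using QL by auto
  then show ?case using Qf[OF wc_rel] by (auto simp: word_val_append)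
qed auto

lemma presented_universal:
  obtains h where "h \<in> hom (presented L Q) K" "\<And>l. l \<in> L \<Longrightarrow> h (word_class L Q [l]) = f l"
proof
  define h where "h X = word_val K f (SOME w. w \<in> X)" for X
  have h: "h (word_class L Q w) = word_val K f w" if "w \<in> lists L" for w
  proof -
    have "(SOME u. u \<in> word_class L Q w) \<in> word_class L Q w"
      using word_class_self[OF that] by (rule someI)
    then have "word_cong Q w (SOME u. u \<in> word_class L Q w)"
      by (simp add: word_class_def)
    from word_val_cong[OF this] that show ?thesis
      unfolding h_def by simp
  qed
  show "h \<in> hom (presented L Q) K"
  proof (rule homI)
    fix X assume "X \<in> carrier (presented L Q)"
    then obtain w where "w \<in> lists L" "X = word_class L Q w"
      by (auto simp: presented_def)
    then show "h X \<in> carrier K"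
      using h[of w] word_val_closed[of w] by simp
  next
    fix X Y assume "X \<in> carrier (presented L Q)" "Y \<in> carrier (presented L Q)"
    then obtain u v where uv: "u \<in> lists L" "v \<in> lists L" "X = word_class L Q u" "Y = word_class L Q v"
      by (auto simp: presented_def)
    then have "u @ v \<in> lists L" by simp
    with uv show "h (X \<otimes>\<^bsub>presented L Q\<^esub> Y) = h X \<otimes>\<^bsub>K\<^esub> h Y"
      by (simp add: presented_mult h word_val_append)
  qed
  fix l assume l: "l \<in> L"
  then have "f l \<in> carrier K" using f by auto
  with l h[of "[l]"] show "h (word_class L Q [l]) = f l" by (simp add: word_val_def)
qed

end

text \<open>A homomorphism on a group generated by letters is determined by them.\<close>

lemma presented_hom_unique:
  assumes "g \<in> hom (presented L Q) K" "g' \<in> hom (presented L Q) K" "group K"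
    and eq: "\<And>l. l \<in> L \<Longrightarrow> g (word_class L Q [l]) = g' (word_class L Q [l])"
    and X: "X \<in> carrier (presented L Q)"
  shows "g X = g' X"
proof -
  interpret group K by fact
  have ind: "g (word_class L Q w) = g' (word_class L Q w)" if "w \<in> lists L" for w
    using that
  proof (induction w)
    case Nil
    have e: "word_class L Q [] \<in> carrier (presented L Q)" by (auto simp: presented_def)
    have h_one: "h (word_class L Q []) = \<one>\<^bsub>K\<^esub>" if h: "h \<in> hom (presented L Q) K" for h
    proof -
      have "h (word_class L Q []) \<otimes>\<^bsub>K\<^esub> h (word_class L Q []) = h (word_class L Q [])"
        using hom_mult[OF h e e] presented_mult[of "[]" L "[]" Q] by simp
      then show ?thesis using hom_in_carrier[OF h e] by simp
    qed
    show ?case by (simp only: h_one[OF assms(1)] h_one[OF assms(2)])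
  next
    case (Cons a w)
    then have aw: "a \<in> L" "w \<in> lists L" by auto
    have c: "word_class L Q [a] \<in> carrier (presented L Q)" "word_class L Q w \<in> carrier (presented L Q)"
      using aw by (auto simp: presented_def)
    have m: "word_class L Q (a # w) = word_class L Q [a] \<otimes>\<^bsub>presented L Q\<^esub> word_class L Q w"
      using presented_mult[of "[a]" L w Q] aw by simp
    show ?case unfolding m using Cons aw eq c assms(1,2) by (simp add: hom_mult)
  qed
  with X show ?thesis by (auto simp: presented_def)
qed

lemma presented_iso_universal:
  fixes K :: "('k, 'z) monoid_scheme"
  assumes \<phi>: "\<phi> \<in> iso (presented L Q) G" and K: "group K"
    and f: "f \<in> L \<rightarrow> carrier K" and QL: "Q \<subseteq> lists L \<times> lists L"
    and Qf: "\<And>u v. (u, v) \<in> Q \<Longrightarrow> word_val K f u = word_val K f v"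
  obtains g where "g \<in> hom G K" "\<And>l. l \<in> L \<Longrightarrow> g (\<phi> (word_class L Q [l])) = f l"
    "\<And>g' x. g' \<in> hom G K \<Longrightarrow> (\<And>l. l \<in> L \<Longrightarrow> g' (\<phi> (word_class L Q [l])) = f l) \<Longrightarrow>
       x \<in> carrier G \<Longrightarrow> g' x = g x"
proof -
  let ?P = "presented L Q"
  interpret K: group K by fact
  have bij: "bij_betw \<phi> (carrier ?P) (carrier G)" and hom: "\<phi> \<in> hom ?P G"
    using \<phi> by (auto simp: iso_def)
  obtain h where h: "h \<in> hom ?P K" "\<And>l. l \<in> L \<Longrightarrow> h (word_class L Q [l]) = f l"
    using presented_universal[OF K.is_monoid f QL Qf] by blast
  have c: "word_class L Q [l] \<in> carrier ?P" if "l \<in> L" for l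
    using that by (auto simp: presented_def)
  define g where "g x = h (inv_into (carrier ?P) \<phi> x)" for x
  have g\<phi>: "g (\<phi> X) = h X" if "X \<in> carrier ?P" for X
    unfolding g_def using bij that by (simp add: bij_betw_inv_into_left)
  have surj: "\<exists>X \<in> carrier ?P. x = \<phi> X" if "x \<in> carrier G" for x
    using bij that by (auto simp: bij_betw_def)
  have clP: "X \<otimes>\<^bsub>?P\<^esub> Y \<in> carrier ?P" if "X \<in> carrier ?P" "Y \<in> carrier ?P" for X Y
  proof -
    obtain u v where uv: "u \<in> lists L" "v \<in> lists L" "X = word_class L Q u" "Y = word_class L Q v"
      using \<open>X \<in> carrier ?P\<close> \<open>Y \<in> carrier ?P\<close> by (auto simp: presented_def)
    then have "u @ v \<in> lists L" by simp
    with uv show ?thesis by (simp only: presented_mult) (auto simp: presented_def)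
  qed
  have ghom: "g \<in> hom G K"
  proof (rule homI)
    fix x assume "x \<in> carrier G"
    then show "g x \<in> carrier K" using surj g\<phi> hom_in_carrier[OF h(1)] by fastforce
  next
    fix x y assume "x \<in> carrier G" "y \<in> carrier G"
    then obtain X Y where XY: "X \<in> carrier ?P" "Y \<in> carrier ?P" "x = \<phi> X" "y = \<phi> Y"
      using surj by blast
    then have "x \<otimes>\<^bsub>G\<^esub> y = \<phi> (X \<otimes>\<^bsub>?P\<^esub> Y)" using hom by (simp add: hom_mult)
    then show "g (x \<otimes>\<^bsub>G\<^esub> y) = g x \<otimes>\<^bsub>K\<^esub> g y"
      using XY clP[OF XY(1,2)] h(1) by (simp add: g\<phi> hom_mult)
  qed
  have "g' x = g x"
    if g': "g' \<in> hom G K" "\<And>l. l \<in> L \<Longrightarrow> g' (\<phi> (word_class L Q [l])) = f l"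
      and x: "x \<in> carrier G" for g' x
  proof -
    obtain X where X: "X \<in> carrier ?P" "x = \<phi> X" using surj x by blast
    have "g' \<circ> \<phi> \<in> hom ?P K" using hom g'(1) by (rule hom_compose)
    moreover have "(g' \<circ> \<phi>) (word_class L Q [l]) = h (word_class L Q [l])" if "l \<in> L" for l
      using that g'(2) h(2) by simp
    ultimately have "(g' \<circ> \<phi>) X = h X"
      using presented_hom_unique[OF _ h(1) K _ X(1)] by blast
    then show "g' x = g x" using X by (simp add: g\<phi>)
  qed
  then show ?thesis
    using that[OF ghom] by (simp add: g\<phi> c h(2))
qed

lemma pushout_morphisms:
  assumes A: "amalgamated_free_product A"
  shows "am_j1 A \<in> hom (am_G1 A) (am_G A)" "am_j2 A \<in> hom (am_G2 A) (am_G A)"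
    "\<And>h. h \<in> carrier (am_H A) \<Longrightarrow> am_j1 A (am_i1 A h) = am_j2 A (am_i2 A h)"
proof -
  let ?L = "am_letters A" and ?Q = "am_relations A"
  obtain \<phi> where \<phi>: "\<phi> \<in> hom (presented ?L ?Q) (am_G A)"
     and 1: "\<And>a. a \<in> carrier (am_G1 A) \<Longrightarrow> am_j1 A a = \<phi> (word_class ?L ?Q [Inl a])"
     and 2: "\<And>b. b \<in> carrier (am_G2 A) \<Longrightarrow> am_j2 A b = \<phi> (word_class ?L ?Q [Inr b])"
    using A by (fastforce simp: amalgamated_free_product_def is_pushout_def iso_def)
  interpret G1: group "am_G1 A" using A by (simp add: amalgamated_free_product_def)
  interpret G2: group "am_G2 A" using A by (simp add: amalgamated_free_product_def)
  have c: "word_class ?L ?Q [l] \<in> carrier (presented ?L ?Q)" if "l \<in> ?L" for l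
    using that by (auto simp: presented_def)
  have L: "Inl a \<in> ?L \<longleftrightarrow> a \<in> carrier (am_G1 A)" "Inr b \<in> ?L \<longleftrightarrow> b \<in> carrier (am_G2 A)" for a b
    by (auto simp: am_letters_def)
  have eq: "word_class ?L ?Q u = word_class ?L ?Q v" if "(u, v) \<in> ?Q" for u v
    using word_cong.wc_rel[OF that, of "[]" "[]"] by (intro word_class_eqI) simp
  show "am_j1 A \<in> hom (am_G1 A) (am_G A)"
  proof (rule homI)
    fix a b assume ab: "a \<in> carrier (am_G1 A)" "b \<in> carrier (am_G1 A)"
    then have "([Inl a, Inl b], [Inl (a \<otimes>\<^bsub>am_G1 A\<^esub> b)]) \<in> ?Q"
      by (auto simp: am_relations_def mult_table_def)
    from eq[OF this] ab show "am_j1 A (a \<otimes>\<^bsub>am_G1 A\<^esub> b) = am_j1 A a \<otimes>\<^bsub>am_G A\<^esub> am_j1 A b"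
      using presented_mult[of "[Inl a]" ?L "[Inl b]" ?Q]
      by (simp add: 1 L flip: hom_mult[OF \<phi> c c])
  qed (use 1 L hom_in_carrier[OF \<phi> c] in auto)
  show "am_j2 A \<in> hom (am_G2 A) (am_G A)"
  proof (rule homI)
    fix a b assume ab: "a \<in> carrier (am_G2 A)" "b \<in> carrier (am_G2 A)"
    then have "([Inr a, Inr b], [Inr (a \<otimes>\<^bsub>am_G2 A\<^esub> b)]) \<in> ?Q"
      by (auto simp: am_relations_def mult_table_def)
    from eq[OF this] ab show "am_j2 A (a \<otimes>\<^bsub>am_G2 A\<^esub> b) = am_j2 A a \<otimes>\<^bsub>am_G A\<^esub> am_j2 A b"
      using presented_mult[of "[Inr a]" ?L "[Inr b]" ?Q]
      by (simp add: 2 L flip: hom_mult[OF \<phi> c c])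
  qed (use 2 L hom_in_carrier[OF \<phi> c] in auto)
  fix h assume h: "h \<in> carrier (am_H A)"
  then have "am_i1 A h \<in> carrier (am_G1 A)" "am_i2 A h \<in> carrier (am_G2 A)"
    using A by (auto simp: amalgamated_free_product_def hom_def)
  moreover have "([Inl (am_i1 A h)], [Inr (am_i2 A h)]) \<in> ?Q"
    using h by (auto simp: am_relations_def)
  ultimately show "am_j1 A (am_i1 A h) = am_j2 A (am_i2 A h)"
    by (simp add: 1 2 eq)
qed

theorem pushout_universal:
  assumes A: "amalgamated_free_product A" and K: "group K"
    and f1: "f1 \<in> hom (am_G1 A) K" and f2: "f2 \<in> hom (am_G2 A) K"
    and f12: "\<And>h. h \<in> carrier (am_H A) \<Longrightarrow> f1 (am_i1 A h) = f2 (am_i2 A h)"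
  obtains g where "g \<in> hom (am_G A) K"
    "\<And>a. a \<in> carrier (am_G1 A) \<Longrightarrow> g (am_j1 A a) = f1 a"
    "\<And>b. b \<in> carrier (am_G2 A) \<Longrightarrow> g (am_j2 A b) = f2 b"
    "\<And>g' x. g' \<in> hom (am_G A) K \<Longrightarrow>
       (\<And>a. a \<in> carrier (am_G1 A) \<Longrightarrow> g' (am_j1 A a) = f1 a) \<Longrightarrow>
       (\<And>b. b \<in> carrier (am_G2 A) \<Longrightarrow> g' (am_j2 A b) = f2 b) \<Longrightarrow>
       x \<in> carrier (am_G A) \<Longrightarrow> g' x = g x"
proof -
  let ?L = "am_letters A" and ?Q = "am_relations A"
  interpret G1: group "am_G1 A" using A by (simp add: amalgamated_free_product_def)
  interpret G2: group "am_G2 A" using A by (simp add: amalgamated_free_product_def)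
  interpret K: group K by fact
  obtain \<phi> where \<phi>: "\<phi> \<in> iso (presented ?L ?Q) (am_G A)"
     and 1: "\<And>a. a \<in> carrier (am_G1 A) \<Longrightarrow> am_j1 A a = \<phi> (word_class ?L ?Q [Inl a])"
     and 2: "\<And>b. b \<in> carrier (am_G2 A) \<Longrightarrow> am_j2 A b = \<phi> (word_class ?L ?Q [Inr b])"
    using A by (fastforce simp: amalgamated_free_product_def is_pushout_def)
  have i: "am_i1 A h \<in> carrier (am_G1 A)" "am_i2 A h \<in> carrier (am_G2 A)"
    if "h \<in> carrier (am_H A)" for h
    using A that by (auto simp: amalgamated_free_product_def hom_def)
  let ?f = "case_sum f1 f2"
  have f: "?f \<in> ?L \<rightarrow> carrier K" using f1 f2 by (auto simp: am_letters_def hom_def)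
  have QL: "?Q \<subseteq> lists ?L \<times> lists ?L"
    using i by (auto simp: am_relations_def mult_table_def am_letters_def)
  have Qf: "word_val K ?f u = word_val K ?f v" if "(u, v) \<in> ?Q" for u v
    using that f1 f2 f12 i hom_one[OF f1 G1.is_group K] hom_one[OF f2 G2.is_group K]
    by (auto simp: am_relations_def mult_table_def word_val_def hom_mult hom_in_carrier)
  have L: "Inl a \<in> ?L \<longleftrightarrow> a \<in> carrier (am_G1 A)" "Inr b \<in> ?L \<longleftrightarrow> b \<in> carrier (am_G2 A)" for a b
    by (auto simp: am_letters_def)
  obtain g where g: "g \<in> hom (am_G A) K" "\<And>l. l \<in> ?L \<Longrightarrow> g (\<phi> (word_class ?L ?Q [l])) = ?f l"
    and u: "\<And>g' x. g' \<in> hom (am_G A) K \<Longrightarrow>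
      (\<And>l. l \<in> ?L \<Longrightarrow> g' (\<phi> (word_class ?L ?Q [l])) = ?f l) \<Longrightarrow> x \<in> carrier (am_G A) \<Longrightarrow> g' x = g x"
    using presented_iso_universal[OF \<phi> K f QL Qf] by blast
  show ?thesis
  proof (rule that[OF g(1)])
    fix g' x assume g': "g' \<in> hom (am_G A) K"
      and e: "\<And>a. a \<in> carrier (am_G1 A) \<Longrightarrow> g' (am_j1 A a) = f1 a"
             "\<And>b. b \<in> carrier (am_G2 A) \<Longrightarrow> g' (am_j2 A b) = f2 b"
      and x: "x \<in> carrier (am_G A)"
    have "g' (\<phi> (word_class ?L ?Q [l])) = ?f l" if "l \<in> ?L" for l
      using that e 1 2 by (auto simp: am_letters_def)
    from u[OF g' this x] show "g' x = g x" .
  qed (use g(2) L 1 2 in auto)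
qed

lemma hnn_morphisms:
  assumes B: "hnn_extension B"
  shows "hn_j1 B \<in> hom (hn_G1 B) (hn_G B)" "hn_t B \<in> carrier (hn_G B)"
    "\<And>h. h \<in> carrier (hn_H B) \<Longrightarrow>
      hn_j1 B (hn_i1 B h) \<otimes>\<^bsub>hn_G B\<^esub> hn_t B = hn_t B \<otimes>\<^bsub>hn_G B\<^esub> hn_j1 B (hn_i2 B h)"
proof -
  let ?L = "hn_letters B" and ?Q = "hn_relations B"
  obtain \<phi> where \<phi>: "\<phi> \<in> hom (presented ?L ?Q) (hn_G B)"
     and 1: "\<And>a. a \<in> carrier (hn_G1 B) \<Longrightarrow> hn_j1 B a = \<phi> (word_class ?L ?Q [Inl a])"
     and 2: "hn_t B = \<phi> (word_class ?L ?Q [Inr True])"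
    using B by (fastforce simp: hnn_extension_def iso_def)
  interpret G1: group "hn_G1 B" using B by (simp add: hnn_extension_def)
  have c: "word_class ?L ?Q [l] \<in> carrier (presented ?L ?Q)" if "l \<in> ?L" for l
    using that by (auto simp: presented_def)
  have L: "Inl a \<in> ?L \<longleftrightarrow> a \<in> carrier (hn_G1 B)" "Inr b \<in> ?L" for a b
    by (auto simp: hn_letters_def)
  have eq: "word_class ?L ?Q u = word_class ?L ?Q v" if "(u, v) \<in> ?Q" for u v
    using word_cong.wc_rel[OF that, of "[]" "[]"] by (intro word_class_eqI) simp
  show "hn_j1 B \<in> hom (hn_G1 B) (hn_G B)"
  proof (rule homI)
    fix a b assume ab: "a \<in> carrier (hn_G1 B)" "b \<in> carrier (hn_G1 B)"
    then have "([Inl a, Inl b], [Inl (a \<otimes>\<^bsub>hn_G1 B\<^esub> b)]) \<in> ?Q"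
      by (auto simp: hn_relations_def mult_table_def)
    from eq[OF this] ab show "hn_j1 B (a \<otimes>\<^bsub>hn_G1 B\<^esub> b) = hn_j1 B a \<otimes>\<^bsub>hn_G B\<^esub> hn_j1 B b"
      using presented_mult[of "[Inl a]" ?L "[Inl b]" ?Q]
      by (simp add: 1 L flip: hom_mult[OF \<phi> c c])
  qed (use 1 L hom_in_carrier[OF \<phi> c] in auto)
  show "hn_t B \<in> carrier (hn_G B)" using 2 L hom_in_carrier[OF \<phi> c] by auto
  fix h assume h: "h \<in> carrier (hn_H B)"
  then have i: "hn_i1 B h \<in> carrier (hn_G1 B)" "hn_i2 B h \<in> carrier (hn_G1 B)"
    using B by (auto simp: hnn_extension_def hom_def)
  have "([Inl (hn_i1 B h), Inr True], [Inr True, Inl (hn_i2 B h)]) \<in> ?Q"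
    using h by (auto simp: hn_relations_def)
  from eq[OF this] i show "hn_j1 B (hn_i1 B h) \<otimes>\<^bsub>hn_G B\<^esub> hn_t B = hn_t B \<otimes>\<^bsub>hn_G B\<^esub> hn_j1 B (hn_i2 B h)"
    using presented_mult[of "[Inl (hn_i1 B h)]" ?L "[Inr True]" ?Q]
      presented_mult[of "[Inr True]" ?L "[Inl (hn_i2 B h)]" ?Q]
    by (simp add: 1 2 L flip: hom_mult[OF \<phi> c c])
qed

theorem hnn_universal:
  assumes B: "hnn_extension B" and K: "group K"
    and f: "f \<in> hom (hn_G1 B) K" and \<tau>: "\<tau> \<in> carrier K"
    and f\<tau>: "\<And>h. h \<in> carrier (hn_H B) \<Longrightarrow> f (hn_i1 B h) \<otimes>\<^bsub>K\<^esub> \<tau> = \<tau> \<otimes>\<^bsub>K\<^esub> f (hn_i2 B h)"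
  obtains g where "g \<in> hom (hn_G B) K"
    "\<And>a. a \<in> carrier (hn_G1 B) \<Longrightarrow> g (hn_j1 B a) = f a" "g (hn_t B) = \<tau>"
    "\<And>g' x. g' \<in> hom (hn_G B) K \<Longrightarrow>
       (\<And>a. a \<in> carrier (hn_G1 B) \<Longrightarrow> g' (hn_j1 B a) = f a) \<Longrightarrow> g' (hn_t B) = \<tau> \<Longrightarrow>
       x \<in> carrier (hn_G B) \<Longrightarrow> g' x = g x"
proof -
  let ?L = "hn_letters B" and ?Q = "hn_relations B"
  interpret G1: group "hn_G1 B" using B by (simp add: hnn_extension_def)
  interpret G: group "hn_G B" using B by (simp add: hnn_extension_def)
  interpret K: group K by fact
  obtain \<phi> where \<phi>: "\<phi> \<in> iso (presented ?L ?Q) (hn_G B)"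
     and 1: "\<And>a. a \<in> carrier (hn_G1 B) \<Longrightarrow> hn_j1 B a = \<phi> (word_class ?L ?Q [Inl a])"
     and 2: "hn_t B = \<phi> (word_class ?L ?Q [Inr True])"
    using B by (fastforce simp: hnn_extension_def)
  have i: "hn_i1 B h \<in> carrier (hn_G1 B)" "hn_i2 B h \<in> carrier (hn_G1 B)"
    if "h \<in> carrier (hn_H B)" for h
    using B that by (auto simp: hnn_extension_def hom_def)
  let ?f = "case_sum f (\<lambda>b. if b then \<tau> else inv\<^bsub>K\<^esub> \<tau>)"
  have fL: "?f \<in> ?L \<rightarrow> carrier K" using f \<tau> by (auto simp: hn_letters_def hom_def)
  have QL: "?Q \<subseteq> lists ?L \<times> lists ?L"
    using i by (auto simp: hn_relations_def mult_table_def hn_letters_def)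
  have Qf: "word_val K ?f u = word_val K ?f v" if "(u, v) \<in> ?Q" for u v
    using that f \<tau> f\<tau> i hom_one[OF f G1.is_group K]
    by (auto simp: hn_relations_def mult_table_def word_val_def hom_mult hom_in_carrier)
  have L: "Inl a \<in> ?L \<longleftrightarrow> a \<in> carrier (hn_G1 B)" "Inr b \<in> ?L" for a b
    by (auto simp: hn_letters_def)
  obtain g where g: "g \<in> hom (hn_G B) K" "\<And>l. l \<in> ?L \<Longrightarrow> g (\<phi> (word_class ?L ?Q [l])) = ?f l"
    and u: "\<And>g' x. g' \<in> hom (hn_G B) K \<Longrightarrow>
      (\<And>l. l \<in> ?L \<Longrightarrow> g' (\<phi> (word_class ?L ?Q [l])) = ?f l) \<Longrightarrow> x \<in> carrier (hn_G B) \<Longrightarrow> g' x = g x"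
    using presented_iso_universal[OF \<phi> K fL QL Qf] by blast
  let ?s = "\<phi> (word_class ?L ?Q [Inr False])"
  have \<phi>h: "\<phi> \<in> hom (presented ?L ?Q) (hn_G B)" using \<phi> by (simp add: iso_def)
  have c: "word_class ?L ?Q [l] \<in> carrier (presented ?L ?Q)" if "l \<in> ?L" for l
    using that by (auto simp: presented_def)
  have sc: "?s \<in> carrier (hn_G B)" by (rule hom_in_carrier[OF \<phi>h c[OF L(2)]])
  have inv_t: "hom_t \<otimes>\<^bsub>K\<^esub> g' ?s = \<one>\<^bsub>K\<^esub>" if g': "g' \<in> hom (hn_G B) K" "g' (hn_t B) = hom_t" for g' hom_t
  proof -
    have "([Inr True, Inr False], []) \<in> ?Q" by (simp add: hn_relations_def)
    then have "word_class ?L ?Q [Inr True, Inr False] = word_class ?L ?Q []"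
      using word_cong.wc_rel[of "[Inr True, Inr False]" "[]" ?Q "[]" "[]"] by (intro word_class_eqI) simp
    then have m: "word_class ?L ?Q [Inr True] \<otimes>\<^bsub>presented ?L ?Q\<^esub> word_class ?L ?Q [Inr False] = word_class ?L ?Q []"
      using presented_mult[of "[Inr True]" ?L "[Inr False]" ?Q] L by simp
    have e: "word_class ?L ?Q [] \<in> carrier (presented ?L ?Q)" by (auto simp: presented_def)
    let ?e = "\<phi> (word_class ?L ?Q [])"
    have "?e \<otimes>\<^bsub>hn_G B\<^esub> ?e = ?e"
      using hom_mult[OF \<phi>h e e] presented_mult[of "[]" ?L "[]" ?Q] by simp
    then have "?e = \<one>\<^bsub>hn_G B\<^esub>" using hom_in_carrier[OF \<phi>h e] by simp
    then have "hn_t B \<otimes>\<^bsub>hn_G B\<^esub> ?s = \<one>\<^bsub>hn_G B\<^esub>"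
      using hom_mult[OF \<phi>h c[OF L(2)] c[OF L(2)], of True False] m by (simp add: 2)
    then show ?thesis
      using hom_mult[OF g'(1) _ sc, of "hn_t B"] hnn_morphisms(2)[OF B] g'(2)
        hom_one[OF g'(1) G.is_group K] by simp
  qed
  show ?thesis
  proof (rule that[OF g(1)])
    fix g' x assume g': "g' \<in> hom (hn_G B) K"
      and e: "\<And>a. a \<in> carrier (hn_G1 B) \<Longrightarrow> g' (hn_j1 B a) = f a" "g' (hn_t B) = \<tau>"
      and x: "x \<in> carrier (hn_G B)"
    have "g' ?s = inv\<^bsub>K\<^esub> \<tau>"
      using inv_t[OF g' e(2)] \<tau> hom_in_carrier[OF g' sc] K.inv_equality K.inv_comm by metis
    then have "g' (\<phi> (word_class ?L ?Q [l])) = ?f l" if "l \<in> ?L" for l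
      using that e 1 2 by (auto simp: hn_letters_def)
    from u[OF g' this x] show "g' x = g x" .
  qed (use g(2) L 1 2 in auto)
qed


section \<open>Basic facts on extension of scalars\<close>

lemma tensor_free_simps [simp]:
  "x \<in> carrier (tensor_free S M) \<longleftrightarrow> Poly_Mapping.keys x \<subseteq> carrier S \<times> carrier M"
  "x \<otimes>\<^bsub>tensor_free S M\<^esub> y = x + y" "\<one>\<^bsub>tensor_free S M\<^esub> = 0"
  by (simp_all add: tensor_free_def)

lemma comm_group_tensor_free: "comm_group (tensor_free S M)"
  by (simp add: tensor_free_def abelian_free_Abelian_group)

lemma tensor_free_inv [simp]:
  "Poly_Mapping.keys x \<subseteq> carrier S \<times> carrier M \<Longrightarrow> inv\<^bsub>tensor_free S M\<^esub> x = - x"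
  by (simp add: tensor_free_def)

lemma keys_diff_subset:
  "Poly_Mapping.keys x \<subseteq> A \<Longrightarrow> Poly_Mapping.keys y \<subseteq> A \<Longrightarrow> Poly_Mapping.keys (x - y) \<subseteq> A"
  using keys_diff[of x y] by blast

lemma keys_add_subset:
  "Poly_Mapping.keys x \<subseteq> A \<Longrightarrow> Poly_Mapping.keys y \<subseteq> A \<Longrightarrow> Poly_Mapping.keys (x + y) \<subseteq> A"
  using Poly_Mapping.keys_add[of x y] by blast

lemma add_pow_int:
  fixes k l :: int
  assumes N: "abelian_group N" and x: "x \<in> carrier N"
  shows "[k] \<cdot>\<^bsub>N\<^esub> x \<in> carrier N" "[(0::int)] \<cdot>\<^bsub>N\<^esub> x = \<zero>\<^bsub>N\<^esub>" "[(1::int)] \<cdot>\<^bsub>N\<^esub> x = x"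
    "[(k + l)] \<cdot>\<^bsub>N\<^esub> x = [k] \<cdot>\<^bsub>N\<^esub> x \<oplus>\<^bsub>N\<^esub> [l] \<cdot>\<^bsub>N\<^esub> x"
  using group.int_pow_closed[OF abelian_group.a_group[OF N], of x k]
    group.int_pow_1[OF abelian_group.a_group[OF N], of x]
    group.int_pow_mult[OF abelian_group.a_group[OF N], of x k l] x
  by (simp_all add: add_pow_def)

definition frag_sum :: "('q, 'n) module \<Rightarrow> ('s \<Rightarrow> 'm \<Rightarrow> 'n) \<Rightarrow> (('s \<times> 'm) \<Rightarrow>\<^sub>0 int) \<Rightarrow> 'n" where
  "frag_sum N \<beta> c =
     (\<Oplus>\<^bsub>N\<^esub>p\<in>Poly_Mapping.keys c. [Poly_Mapping.lookup c p] \<cdot>\<^bsub>N\<^esub> \<beta> (fst p) (snd p))"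

lemma frag_sum_superset:
  fixes N :: "('q, 'n) module"
  assumes N: "abelian_group N" and \<beta>: "\<And>s x. (s, x) \<in> T \<Longrightarrow> \<beta> s x \<in> carrier N"
    and T: "finite T" "Poly_Mapping.keys c \<subseteq> T"
  shows "frag_sum N \<beta> c = (\<Oplus>\<^bsub>N\<^esub>p\<in>T. [Poly_Mapping.lookup c p] \<cdot>\<^bsub>N\<^esub> \<beta> (fst p) (snd p))"
proof -
  interpret N: abelian_group N by fact
  have cl: "[Poly_Mapping.lookup c p] \<cdot>\<^bsub>N\<^esub> \<beta> (fst p) (snd p) \<in> carrier N" if "p \<in> T" for p
    using \<beta>[of "fst p" "snd p"] that add_pow_int[OF N] by simp
  have z: "[Poly_Mapping.lookup c p] \<cdot>\<^bsub>N\<^esub> \<beta> (fst p) (snd p) = \<zero>\<^bsub>N\<^esub>"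
    if "p \<in> T - Poly_Mapping.keys c" for p
    using that \<beta>[of "fst p" "snd p"] add_pow_int(2)[OF N] by (simp add: in_keys_iff)
  show ?thesis
    unfolding frag_sum_def
    by (rule N.add.finprod_mono_neutral_cong_left) (use T z cl in auto)
qed

lemma frag_sum_hom:
  fixes N :: "('q, 'n) module" and S :: "'s ring" and M :: "('r, 'm) module"
  assumes N: "abelian_group N"
    and \<beta>: "\<And>s x. s \<in> carrier S \<Longrightarrow> x \<in> carrier M \<Longrightarrow> \<beta> s x \<in> carrier N"
  shows "frag_sum N \<beta> \<in> hom (tensor_free S M) (add_monoid N)"
proof (rule homI)
  interpret N: abelian_group N by fact
  let ?v = "\<lambda>(c :: ('s \<times> 'm) \<Rightarrow>\<^sub>0 int) p. [Poly_Mapping.lookup c p] \<cdot>\<^bsub>N\<^esub> \<beta> (fst p) (snd p)"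
  have cl: "?v c p \<in> carrier N" if "p \<in> carrier S \<times> carrier M" for c p
    using add_pow_int(1)[OF N \<beta>[of "fst p" "snd p"]] that by (simp add: mem_Times_iff)
  {
    fix c assume "c \<in> carrier (tensor_free S M)"
    then have "frag_sum N \<beta> c \<in> carrier N"
      unfolding frag_sum_def using cl by (intro N.finsum_closed) auto
    then show "frag_sum N \<beta> c \<in> carrier (add_monoid N)" by simp
  }
  fix c d assume cd: "c \<in> carrier (tensor_free S M)" "d \<in> carrier (tensor_free S M)"
  let ?T = "Poly_Mapping.keys c \<union> Poly_Mapping.keys d"
  have T: "finite ?T" "?T \<subseteq> carrier S \<times> carrier M" "Poly_Mapping.keys (c + d) \<subseteq> ?T"
    using cd Poly_Mapping.keys_add[of c d] by auto
  have \<beta>T: "\<beta> s x \<in> carrier N" if "(s, x) \<in> ?T" for s x using T(2) that \<beta> by auto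
  have "frag_sum N \<beta> (c + d) = (\<Oplus>\<^bsub>N\<^esub>p\<in>?T. ?v (c + d) p)"
    by (rule frag_sum_superset[OF N \<beta>T T(1,3)])
  also have "\<dots> = (\<Oplus>\<^bsub>N\<^esub>p\<in>?T. ?v c p \<oplus>\<^bsub>N\<^esub> ?v d p)"
  proof (rule N.finsum_cong')
    show "?v (c + d) p = ?v c p \<oplus>\<^bsub>N\<^esub> ?v d p" if "p \<in> ?T" for p
      using \<beta>T[of "fst p" "snd p"] that
      by (simp add: add_pow_int(4)[OF N] Poly_Mapping.lookup_add)
    show "(\<lambda>p. ?v c p \<oplus>\<^bsub>N\<^esub> ?v d p) \<in> ?T \<rightarrow> carrier N"
      using cl T(2) by (intro Pi_I N.a_closed) blast+
  qed simp
  also have "\<dots> = (\<Oplus>\<^bsub>N\<^esub>p\<in>?T. ?v c p) \<oplus>\<^bsub>N\<^esub> (\<Oplus>\<^bsub>N\<^esub>p\<in>?T. ?v d p)"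
    using cl T by (intro N.finsum_addf) auto
  also have "(\<Oplus>\<^bsub>N\<^esub>p\<in>?T. ?v c p) = frag_sum N \<beta> c"
    by (rule frag_sum_superset[OF N \<beta>T T(1), symmetric]) auto
  also have "(\<Oplus>\<^bsub>N\<^esub>p\<in>?T. ?v d p) = frag_sum N \<beta> d"
    by (rule frag_sum_superset[OF N \<beta>T T(1), symmetric]) auto
  finally show "frag_sum N \<beta> (c \<otimes>\<^bsub>tensor_free S M\<^esub> d) =
      frag_sum N \<beta> c \<otimes>\<^bsub>add_monoid N\<^esub> frag_sum N \<beta> d"
    by simp
qed

lemma frag_sum_of:
  assumes "abelian_group N" "\<beta> s x \<in> carrier N"
  shows "frag_sum N \<beta> (frag_of (s, x)) = \<beta> s x"
proof -
  interpret N: abelian_group N by fact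
  show ?thesis
    using assms(2) add_pow_int(3)[OF assms(1)] by (simp add: frag_sum_def)
qed

locale base_change = R?: ring R + S?: ring S + M?: left_module R M
  for R :: "'r ring" and S :: "'s ring" and M :: "('r, 'm) module" +
  fixes \<phi> :: "'r \<Rightarrow> 's"
  assumes hom: "\<phi> \<in> ring_hom R S"
begin

abbreviation "TF \<equiv> tensor_free S M"
abbreviation "TK \<equiv> tensor_null R S \<phi> M"
abbreviation "TC \<equiv> tensor_class R S \<phi> M"
abbreviation "TP \<equiv> pure_tensor R S \<phi> M"
abbreviation "TM \<equiv> ext_mod R S \<phi> M"

sublocale TF: comm_group TF by (rule comm_group_tensor_free)

lemma relators_carrier: "tensor_relators R S \<phi> M \<subseteq> carrier TF"
proof
  fix c assume "c \<in> tensor_relators R S \<phi> M"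
  then show "c \<in> carrier TF"
    unfolding tensor_relators_def
    by (elim UnE CollectE exE conjE)
       (simp_all add: keys_diff_subset ring_hom_closed[OF hom] M.smult_closed)
qed

lemma subgroup_null: "subgroup TK TF"
  unfolding tensor_null_def by (intro TF.generate_is_subgroup relators_carrier)

sublocale TK: normal TK TF
  by (rule TF.normal_iff_subgroup[THEN iffD2, OF subgroup_null])

lemma TC_carrier: "carrier TM = TC ` carrier TF"
  by (auto simp: ext_mod_def Let_def FactGroup_def RCOSETS_def tensor_class_def)

lemma TC_add: "c \<in> carrier TF \<Longrightarrow> d \<in> carrier TF \<Longrightarrow> TC c \<oplus>\<^bsub>TM\<^esub> TC d = TC (c + d)"
  using TK.rcos_sum[of c d]
  by (simp add: ext_mod_def Let_def FactGroup_def tensor_class_def)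

lemma TC_zero: "\<zero>\<^bsub>TM\<^esub> = TC 0"
  using TF.coset_mult_one[OF TK.subset]
  by (simp add: ext_mod_def Let_def FactGroup_def tensor_class_def)

lemma TC_self: "c \<in> carrier TF \<Longrightarrow> c \<in> TC c"
  unfolding tensor_class_def by (rule TF.rcos_self[OF _ subgroup_null])

lemma TC_eqI: "c \<in> carrier TF \<Longrightarrow> d \<in> TC c \<Longrightarrow> TC d = TC c"
  unfolding tensor_class_def by (rule TF.repr_independence[OF _ _ subgroup_null, symmetric])

lemma TC_memD:
  assumes "c \<in> carrier TF" "d \<in> TC c" shows "d \<in> carrier TF \<and> d - c \<in> TK"
proof -
  obtain k where k: "k \<in> TK" "d = k + c"
    using assms(2) by (auto simp: tensor_class_def r_coset_def)
  moreover have "k \<in> carrier TF" using k(1) TK.subset by blast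
  ultimately show ?thesis using assms(1) by (simp add: keys_add_subset)
qed

lemma TC_eq_if_diff: 
  assumes "c \<in> carrier TF" "d - c \<in> TK" shows "TC d = TC c"
proof (rule TC_eqI)
  show "d \<in> TC c" unfolding tensor_class_def r_coset_def using assms by force
qed (rule assms)

lemma hom_vanishes_null:
  assumes h: "h \<in> hom TF K" and K: "group K"
    and r: "\<And>c. c \<in> tensor_relators R S \<phi> M \<Longrightarrow> h c = \<one>\<^bsub>K\<^esub>" and c: "c \<in> TK"
  shows "h c = \<one>\<^bsub>K\<^esub>"
proof -
  interpret h: group_hom TF K h
    using h K by (simp add: group_hom_def group_hom_axioms_def)
  have "TK \<subseteq> kernel TF K h"
    unfolding tensor_null_def
    by (rule TF.generate_subgroup_incl[OF _ h.subgroup_kernel])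
       (use r relators_carrier in \<open>unfold kernel_def, blast\<close>)
  with c show ?thesis by (auto simp: kernel_def)
qed

lemma abelian_group_TM: "abelian_group TM"
proof -
  have eq: "add_monoid TM = \<lparr>carrier = carrier (TF Mod TK), mult = mult (TF Mod TK), one = one (TF Mod TK),
      \<dots> = undefined\<rparr>"
    by (simp add: ext_mod_def Let_def)
  have "comm_group \<lparr>carrier = carrier Q, mult = mult Q, one = one Q, \<dots> = u\<rparr>"
    if "comm_group Q" for Q :: "('s, 'm) tensor monoid" and u :: 'z
  proof -
    interpret Q: comm_group Q by fact
    show ?thesis
      by (rule comm_groupI) (simp_all add: Q.m_ac Q.l_inv_ex)
  qed
  from this[OF TF.abelian_FactGroup[OF subgroup_null]] show ?thesis
    by (intro comm_group_abelian_groupI) (simp only: eq)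
qed

sublocale TM: abelian_group TM by (rule abelian_group_TM)

lemma frag_of_in: "s \<in> carrier S \<Longrightarrow> x \<in> carrier M \<Longrightarrow> frag_of (s, x) \<in> carrier TF"
  by simp

lemma TP_closed: "s \<in> carrier S \<Longrightarrow> x \<in> carrier M \<Longrightarrow> TP s x \<in> carrier TM"
  unfolding TC_carrier pure_tensor_def using frag_of_in by blast

lemma TP_add_left:
  assumes "s \<in> carrier S" "s' \<in> carrier S" "x \<in> carrier M"
  shows "TP (s \<oplus>\<^bsub>S\<^esub> s') x = TP s x \<oplus>\<^bsub>TM\<^esub> TP s' x"
proof -
  have "frag_of (s \<oplus>\<^bsub>S\<^esub> s', x) - frag_of (s, x) - frag_of (s', x) \<in> TK"
    unfolding tensor_null_def
    by (rule generate.incl) (use assms in \<open>auto simp: tensor_relators_def\<close>)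
  then show ?thesis
    unfolding pure_tensor_def using assms frag_of_in
    by (subst TC_add) (simp_all add: TC_eq_if_diff keys_add_subset diff_diff_eq)
qed

lemma TP_add_right:
  assumes "s \<in> carrier S" "x \<in> carrier M" "x' \<in> carrier M"
  shows "TP s (x \<oplus>\<^bsub>M\<^esub> x') = TP s x \<oplus>\<^bsub>TM\<^esub> TP s x'"
proof -
  have "frag_of (s, x \<oplus>\<^bsub>M\<^esub> x') - frag_of (s, x) - frag_of (s, x') \<in> TK"
    unfolding tensor_null_def
    by (rule generate.incl) (use assms in \<open>auto simp: tensor_relators_def\<close>)
  then show ?thesis
    unfolding pure_tensor_def using assms frag_of_in
    by (subst TC_add) (simp_all add: TC_eq_if_diff keys_add_subset diff_diff_eq)
qed

lemma TP_balanced: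
  assumes "s \<in> carrier S" "r \<in> carrier R" "x \<in> carrier M"
  shows "TP (s \<otimes>\<^bsub>S\<^esub> \<phi> r) x = TP s (r \<odot>\<^bsub>M\<^esub> x)"
proof -
  have "frag_of (s \<otimes>\<^bsub>S\<^esub> \<phi> r, x) - frag_of (s, r \<odot>\<^bsub>M\<^esub> x) \<in> TK"
    unfolding tensor_null_def
    by (rule generate.incl) (use assms in \<open>auto simp: tensor_relators_def\<close>)
  then show ?thesis
    unfolding pure_tensor_def using assms frag_of_in M.smult_closed by (intro TC_eq_if_diff) auto
qed

lemma frag_act_carrier:
  assumes "s \<in> carrier S" "c \<in> carrier TF"
  shows "frag_extend (\<lambda>(s', x). frag_of (s \<otimes>\<^bsub>S\<^esub> s', x)) c \<in> carrier TF"
  using assms keys_frag_extend[of "\<lambda>(s', x). frag_of (s \<otimes>\<^bsub>S\<^esub> s', x)" c] by fastforce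

lemma TC_smult:
  assumes s: "s \<in> carrier S" and c: "c \<in> carrier TF"
  shows "s \<odot>\<^bsub>TM\<^esub> TC c = TC (frag_extend (\<lambda>(s', x). frag_of (s \<otimes>\<^bsub>S\<^esub> s', x)) c)"
proof -
  let ?a = "frag_extend (\<lambda>(s', x). frag_of (s \<otimes>\<^bsub>S\<^esub> s', x)) :: ('s \<times> 'm \<Rightarrow>\<^sub>0 int) \<Rightarrow> _"
  have null: "?a d \<in> TK" if "d \<in> TK" for d
  proof -
    have "?a r \<in> TK" if "r \<in> tensor_relators R S \<phi> M" for r
    proof -
      have "?a r \<in> tensor_relators R S \<phi> M"
        using that unfolding tensor_relators_def
      proof (elim UnE, goal_cases)
        case 1
        then obtain s' s'' x where "r = frag_of (s' \<oplus>\<^bsub>S\<^esub> s'', x) - frag_of (s', x) - frag_of (s'', x)"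
          "s' \<in> carrier S" "s'' \<in> carrier S" "x \<in> carrier M" by blast
        moreover from this have "?a r = frag_of (s \<otimes>\<^bsub>S\<^esub> s' \<oplus>\<^bsub>S\<^esub> s \<otimes>\<^bsub>S\<^esub> s'', x) -
            frag_of (s \<otimes>\<^bsub>S\<^esub> s', x) - frag_of (s \<otimes>\<^bsub>S\<^esub> s'', x)"
          using s by (simp add: frag_extend_diff S.r_distr)
        ultimately show ?case using s by blast
      next
        case 2
        then obtain s' x x' where "r = frag_of (s', x \<oplus>\<^bsub>M\<^esub> x') - frag_of (s', x) - frag_of (s', x')"
          "s' \<in> carrier S" "x \<in> carrier M" "x' \<in> carrier M" by blast
        moreover from this have "?a r = frag_of (s \<otimes>\<^bsub>S\<^esub> s', x \<oplus>\<^bsub>M\<^esub> x') -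
            frag_of (s \<otimes>\<^bsub>S\<^esub> s', x) - frag_of (s \<otimes>\<^bsub>S\<^esub> s', x')"
          by (simp add: frag_extend_diff)
        ultimately show ?case using s by blast
      next
        case 3
        then obtain s' r' x where "r = frag_of (s' \<otimes>\<^bsub>S\<^esub> \<phi> r', x) - frag_of (s', r' \<odot>\<^bsub>M\<^esub> x)"
          "s' \<in> carrier S" "r' \<in> carrier R" "x \<in> carrier M" by blast
        moreover from this have "?a r = frag_of ((s \<otimes>\<^bsub>S\<^esub> s') \<otimes>\<^bsub>S\<^esub> \<phi> r', x) - frag_of (s \<otimes>\<^bsub>S\<^esub> s', r' \<odot>\<^bsub>M\<^esub> x)"
          using s ring_hom_closed[OF hom] by (simp add: frag_extend_diff S.m_assoc)
        ultimately show ?case using s by blast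
      qed
      then show ?thesis unfolding tensor_null_def by (rule generate.incl)
    qed
    then have "tensor_relators R S \<phi> M \<subseteq> {d \<in> carrier TF. ?a d \<in> TK}"
      using relators_carrier by blast
    moreover have "subgroup {d \<in> carrier TF. ?a d \<in> TK} TF"
    proof (rule TF.subgroupI)
      show "{d \<in> carrier TF. ?a d \<in> TK} \<noteq> {}"
        using TK.one_closed by (auto intro!: exI[of _ 0])
    next
      fix x assume "x \<in> {d \<in> carrier TF. ?a d \<in> TK}"
      moreover from this have "- ?a x \<in> TK"
        using TK.m_inv_closed[of "?a x"] frag_act_carrier[OF s, of x]
        by (metis (no_types, lifting) mem_Collect_eq tensor_free_inv tensor_free_simps(1))
      ultimately show "inv\<^bsub>TF\<^esub> x \<in> {d \<in> carrier TF. ?a d \<in> TK}"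
        by (simp add: frag_extend_minus)
    next
      fix x y assume "x \<in> {d \<in> carrier TF. ?a d \<in> TK}" "y \<in> {d \<in> carrier TF. ?a d \<in> TK}"
      moreover from this have "?a x + ?a y \<in> TK"
        using TK.m_closed[of "?a x" "?a y"] by simp
      ultimately show "x \<otimes>\<^bsub>TF\<^esub> y \<in> {d \<in> carrier TF. ?a d \<in> TK}"
        by (simp add: frag_extend_add keys_add_subset)
    qed auto
    ultimately have "TK \<subseteq> {d \<in> carrier TF. ?a d \<in> TK}"
      unfolding tensor_null_def by (rule TF.generate_subgroup_incl)
    with that show ?thesis by blast
  qed
  have "TC (?a d) = TC (?a c)" if "d \<in> TC c" for d
  proof (rule TC_eq_if_diff)
    show "?a c \<in> carrier TF" using frag_act_carrier s c .
    show "?a d - ?a c \<in> TK"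
      using null TC_memD[OF c that] by (simp flip: frag_extend_diff)
  qed
  then have "(\<Union>d\<in>TC c. TC (?a d)) = (\<Union>d\<in>TC c. TC (?a c))" by (intro SUP_cong refl) auto
  also have "\<dots> = TC (?a c)" using TC_self[OF c] by blast
  finally show ?thesis by (simp add: ext_mod_def Let_def)
qed

lemma TP_smult:
  "s \<in> carrier S \<Longrightarrow> s' \<in> carrier S \<Longrightarrow> x \<in> carrier M \<Longrightarrow> s \<odot>\<^bsub>TM\<^esub> TP s' x = TP (s \<otimes>\<^bsub>S\<^esub> s') x"
  unfolding pure_tensor_def by (subst TC_smult) auto

theorem tensor_lift_class:
  fixes N :: "('q, 'n) module"
  assumes N: "abelian_group N"
    and cl: "\<And>s x. s \<in> carrier S \<Longrightarrow> x \<in> carrier M \<Longrightarrow> \<beta> s x \<in> carrier N"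
    and add_left: "\<And>s s' x. s \<in> carrier S \<Longrightarrow> s' \<in> carrier S \<Longrightarrow> x \<in> carrier M \<Longrightarrow>
      \<beta> (s \<oplus>\<^bsub>S\<^esub> s') x = \<beta> s x \<oplus>\<^bsub>N\<^esub> \<beta> s' x"
    and add_right: "\<And>s x x'. s \<in> carrier S \<Longrightarrow> x \<in> carrier M \<Longrightarrow> x' \<in> carrier M \<Longrightarrow>
      \<beta> s (x \<oplus>\<^bsub>M\<^esub> x') = \<beta> s x \<oplus>\<^bsub>N\<^esub> \<beta> s x'"
    and bal: "\<And>s r x. s \<in> carrier S \<Longrightarrow> r \<in> carrier R \<Longrightarrow> x \<in> carrier M \<Longrightarrow>
      \<beta> (s \<otimes>\<^bsub>S\<^esub> \<phi> r) x = \<beta> s (r \<odot>\<^bsub>M\<^esub> x)"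
    and c: "c \<in> carrier TF"
  shows "tensor_lift N \<beta> (TC c) = frag_sum N \<beta> c"
proof -
  interpret N: abelian_group N by fact
  interpret h: group_hom TF "add_monoid N" "frag_sum N \<beta>"
    using frag_sum_hom[OF N cl] N.a_group by (simp add: group_hom_def group_hom_axioms_def)
  have add: "frag_sum N \<beta> (a + b) = frag_sum N \<beta> a \<oplus>\<^bsub>N\<^esub> frag_sum N \<beta> b"
    if "a \<in> carrier TF" "b \<in> carrier TF" for a b
    using h.hom_mult[OF that] by simp
  have diff: "frag_sum N \<beta> (a - b) = frag_sum N \<beta> a \<ominus>\<^bsub>N\<^esub> frag_sum N \<beta> b"
    if "a \<in> carrier TF" "b \<in> carrier TF" for a b
    using add[OF that(1), of "- b"] that h.hom_inv[OF that(2)] by (simp add: a_minus_def a_inv_def)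
  have of: "frag_sum N \<beta> (frag_of (s, x)) = \<beta> s x" if "s \<in> carrier S" "x \<in> carrier M" for s x
    using N cl[OF that] by (rule frag_sum_of)
  have cancel: "(a \<oplus>\<^bsub>N\<^esub> b) \<ominus>\<^bsub>N\<^esub> a \<ominus>\<^bsub>N\<^esub> b = \<zero>\<^bsub>N\<^esub>" if "a \<in> carrier N" "b \<in> carrier N" for a b
  proof -
    have "(a \<oplus>\<^bsub>N\<^esub> b) \<ominus>\<^bsub>N\<^esub> a \<ominus>\<^bsub>N\<^esub> b = (a \<oplus>\<^bsub>N\<^esub> \<ominus>\<^bsub>N\<^esub> a) \<oplus>\<^bsub>N\<^esub> (b \<oplus>\<^bsub>N\<^esub> \<ominus>\<^bsub>N\<^esub> b)"
      using that by (simp add: N.minus_eq N.a_ac)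
    with that show ?thesis by (simp add: N.r_neg)
  qed
  have rel: "frag_sum N \<beta> d = \<one>\<^bsub>add_monoid N\<^esub>" if "d \<in> tensor_relators R S \<phi> M" for d
    using that unfolding tensor_relators_def
  proof (elim UnE, goal_cases)
    case 1
    then show ?case
      using cl by (auto simp: diff of add_left keys_diff_subset cancel)
  next
    case 2
    then show ?case
      using cl by (auto simp: diff of add_right keys_diff_subset cancel)
  next
    case 3
    then show ?case
      using cl ring_hom_closed[OF hom] M.smult_closed by (auto simp: diff of bal N.minus_eq N.r_neg)
  qed
  have eq: "frag_sum N \<beta> d = frag_sum N \<beta> c" if "d \<in> TC c" for d
  proof -
    have d: "d \<in> carrier TF" "d - c \<in> TK" using TC_memD[OF c that] by auto
    have "frag_sum N \<beta> (d - c) = \<zero>\<^bsub>N\<^esub>"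
      using hom_vanishes_null[OF h.homh N.a_group rel d(2)] by simp
    then have "frag_sum N \<beta> d \<ominus>\<^bsub>N\<^esub> frag_sum N \<beta> c = \<zero>\<^bsub>N\<^esub>"
      using diff[OF d(1) c] by simp
    then show ?thesis
      using h.hom_closed[OF d(1)] h.hom_closed[OF c] N.minus_equality[of "frag_sum N \<beta> d" "\<ominus>\<^bsub>N\<^esub> frag_sum N \<beta> c"]
      by (simp add: N.minus_eq)
  qed
  have "(SOME d. d \<in> TC c) \<in> TC c" using TC_self[OF c] by (rule someI)
  from eq[OF this] show ?thesis by (simp add: tensor_lift_def frag_sum_def Let_def)
qed

lemma TM_induct [consumes 1, case_names pure diff]:
  assumes X: "X \<in> carrier TM"
    and "\<And>s x. s \<in> carrier S \<Longrightarrow> x \<in> carrier M \<Longrightarrow> P (TP s x)"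
    and diff: "\<And>X Y. X \<in> carrier TM \<Longrightarrow> Y \<in> carrier TM \<Longrightarrow> P X \<Longrightarrow> P Y \<Longrightarrow> P (X \<ominus>\<^bsub>TM\<^esub> Y)"
    and zero: "P \<zero>\<^bsub>TM\<^esub>"
  shows "P X"
proof -
  obtain c where c: "Poly_Mapping.keys c \<subseteq> carrier S \<times> carrier M" "X = TC c"
    using X by (auto simp: TC_carrier)
  have TCd: "TC (a - b) = TC a \<ominus>\<^bsub>TM\<^esub> TC b"
    if "a \<in> carrier TF" "b \<in> carrier TF" for a b
  proof -
    have m: "a - b \<in> carrier TF" using that by (simp add: keys_diff_subset)
    have cm: "TC (a - b) \<in> carrier TM" "TC b \<in> carrier TM" using m that by (auto simp: TC_carrier)
    have "TC a = TC (a - b) \<oplus>\<^bsub>TM\<^esub> TC b" using TC_add[OF m that(2)] by simp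
    then show ?thesis using cm by (simp add: TM.minus_eq TM.a_assoc TM.r_neg)
  qed
  have "P (TC c)" using c(1)
  proof (rule free_Abelian_group_induct)
    show "P (TC 0)" using zero by (simp add: TC_zero)
    show "P (TC (a - b))" if "Poly_Mapping.keys a \<subseteq> carrier S \<times> carrier M"
      "Poly_Mapping.keys b \<subseteq> carrier S \<times> carrier M" "P (TC a)" "P (TC b)" for a b
      using that diff[of "TC a" "TC b"] by (auto simp: TCd TC_carrier)
    show "P (TC (frag_of p))" if "p \<in> carrier S \<times> carrier M" for p
      using assms(2)[of "fst p" "snd p"] that by (auto simp: pure_tensor_def)
  qed
  with c show ?thesis by simp
qed

lemma left_module_TM: "left_module S TM"
proof -
  let ?a = "\<lambda>s. frag_extend (\<lambda>(s', x). frag_of (s \<otimes>\<^bsub>S\<^esub> s', x)) :: ('s \<times> 'm \<Rightarrow>\<^sub>0 int) \<Rightarrow> _"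
  have cl: "s \<odot>\<^bsub>TM\<^esub> X \<in> carrier TM" if "s \<in> carrier S" "X \<in> carrier TM" for s X
    using that TC_smult frag_act_carrier by (auto simp: TC_carrier simp del: tensor_free_simps)
  have r: "s \<odot>\<^bsub>TM\<^esub> (X \<oplus>\<^bsub>TM\<^esub> Y) = s \<odot>\<^bsub>TM\<^esub> X \<oplus>\<^bsub>TM\<^esub> s \<odot>\<^bsub>TM\<^esub> Y"
    if s: "s \<in> carrier S" and XY: "X \<in> carrier TM" "Y \<in> carrier TM" for s X Y
  proof -
    obtain c d where c: "c \<in> carrier TF" "X = TC c" and d: "d \<in> carrier TF" "Y = TC d"
      using XY unfolding TC_carrier by blast
    have "c + d \<in> carrier TF" using c d by (simp add: keys_add_subset)
    then show ?thesis
      using s c d frag_act_carrier[OF s c(1)] frag_act_carrier[OF s d(1)]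
      by (simp only: TC_add TC_smult frag_extend_add)
  qed
  have m: "s \<odot>\<^bsub>TM\<^esub> (X \<ominus>\<^bsub>TM\<^esub> Y) = s \<odot>\<^bsub>TM\<^esub> X \<ominus>\<^bsub>TM\<^esub> s \<odot>\<^bsub>TM\<^esub> Y"
    if s: "s \<in> carrier S" and XY: "X \<in> carrier TM" "Y \<in> carrier TM" for s X Y
  proof -
    have "s \<odot>\<^bsub>TM\<^esub> X = s \<odot>\<^bsub>TM\<^esub> (X \<ominus>\<^bsub>TM\<^esub> Y) \<oplus>\<^bsub>TM\<^esub> s \<odot>\<^bsub>TM\<^esub> Y"
      using r[of s "X \<ominus>\<^bsub>TM\<^esub> Y" Y] that by (simp add: TM.minus_eq TM.a_assoc TM.l_neg)
    then show ?thesis using cl that by (simp add: TM.minus_eq TM.a_assoc TM.r_neg)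
  qed
  have z: "s \<odot>\<^bsub>TM\<^esub> \<zero>\<^bsub>TM\<^esub> = \<zero>\<^bsub>TM\<^esub>" if "s \<in> carrier S" for s
    using m[OF that TM.zero_closed TM.zero_closed] cl[OF that TM.zero_closed]
    by (simp add: TM.minus_eq TM.r_neg)
  have l: "(s \<oplus>\<^bsub>S\<^esub> s') \<odot>\<^bsub>TM\<^esub> X = s \<odot>\<^bsub>TM\<^esub> X \<oplus>\<^bsub>TM\<^esub> s' \<odot>\<^bsub>TM\<^esub> X"
    if X: "X \<in> carrier TM" and s: "s \<in> carrier S" "s' \<in> carrier S" for s s' X
    using X
  proof (induction rule: TM_induct)
    case (diff X Y)
    then have "(s \<oplus>\<^bsub>S\<^esub> s') \<odot>\<^bsub>TM\<^esub> (X \<ominus>\<^bsub>TM\<^esub> Y) =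
        (s \<odot>\<^bsub>TM\<^esub> X \<oplus>\<^bsub>TM\<^esub> s' \<odot>\<^bsub>TM\<^esub> X) \<ominus>\<^bsub>TM\<^esub> (s \<odot>\<^bsub>TM\<^esub> Y \<oplus>\<^bsub>TM\<^esub> s' \<odot>\<^bsub>TM\<^esub> Y)"
      using s by (simp add: m)
    also have "\<dots> = (s \<odot>\<^bsub>TM\<^esub> X \<ominus>\<^bsub>TM\<^esub> s \<odot>\<^bsub>TM\<^esub> Y) \<oplus>\<^bsub>TM\<^esub> (s' \<odot>\<^bsub>TM\<^esub> X \<ominus>\<^bsub>TM\<^esub> s' \<odot>\<^bsub>TM\<^esub> Y)"
      using s cl diff by (simp add: TM.minus_eq TM.minus_add TM.a_ac)
    finally show ?case using s diff by (simp add: m)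
  qed (use s z in \<open>simp_all add: TP_smult TP_add_left S.l_distr\<close>)
  have a: "(s \<otimes>\<^bsub>S\<^esub> s') \<odot>\<^bsub>TM\<^esub> X = s \<odot>\<^bsub>TM\<^esub> (s' \<odot>\<^bsub>TM\<^esub> X)"
    if X: "X \<in> carrier TM" and s: "s \<in> carrier S" "s' \<in> carrier S" for s s' X
    using X
  proof (induction rule: TM_induct)
    case (diff X Y)
    then show ?case using s cl by (simp add: m)
  qed (use s z in \<open>simp_all add: TP_smult S.m_assoc\<close>)
  have o: "\<one>\<^bsub>S\<^esub> \<odot>\<^bsub>TM\<^esub> X = X" if X: "X \<in> carrier TM" for X
    using X
  proof (induction rule: TM_induct)
    case (diff X Y)
    then show ?case using cl by (simp add: m)
  qed (use z in \<open>simp_all add: TP_smult\<close>)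
  show ?thesis
    by unfold_locales (use cl r l a o in auto)
qed

lemma tensor_lift_TP:
  fixes N :: "('q, 'n) module"
  assumes N: "abelian_group N"
    and cl: "\<And>s x. s \<in> carrier S \<Longrightarrow> x \<in> carrier M \<Longrightarrow> \<beta> s x \<in> carrier N"
    and "\<And>s s' x. s \<in> carrier S \<Longrightarrow> s' \<in> carrier S \<Longrightarrow> x \<in> carrier M \<Longrightarrow>
      \<beta> (s \<oplus>\<^bsub>S\<^esub> s') x = \<beta> s x \<oplus>\<^bsub>N\<^esub> \<beta> s' x"
    and "\<And>s x x'. s \<in> carrier S \<Longrightarrow> x \<in> carrier M \<Longrightarrow> x' \<in> carrier M \<Longrightarrow>
      \<beta> s (x \<oplus>\<^bsub>M\<^esub> x') = \<beta> s x \<oplus>\<^bsub>N\<^esub> \<beta> s x'"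
    and "\<And>s r x. s \<in> carrier S \<Longrightarrow> r \<in> carrier R \<Longrightarrow> x \<in> carrier M \<Longrightarrow>
      \<beta> (s \<otimes>\<^bsub>S\<^esub> \<phi> r) x = \<beta> s (r \<odot>\<^bsub>M\<^esub> x)"
    and sx: "s \<in> carrier S" "x \<in> carrier M"
  shows "tensor_lift N \<beta> (TP s x) = \<beta> s x"
  unfolding pure_tensor_def
  by (subst tensor_lift_class[of N \<beta>, OF assms(1-5) frag_of_in[OF sx]])
     (assumption | rule frag_sum_of[OF N] cl sx)+

end

lemma frag_extend_plus: "frag_extend (\<lambda>a. f a + g a) x = frag_extend f x + frag_extend g x"
  using subset_UNIV
  by (induction x rule: frag_induction) (auto simp: frag_extend_diff)

lemma frag_extend_frag_extend:
  "frag_extend f (frag_extend g x) = frag_extend (\<lambda>a. frag_extend f (g a)) x"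
  using subset_UNIV
  by (induction x rule: frag_induction) (auto simp: frag_extend_diff)

lemma ring_group_ring:
  assumes "group G" shows "ring \<int>[G]"
proof -
  interpret G: group G by fact
  have cl: "Poly_Mapping.keys (frag_extend (\<lambda>a. frag_extend (\<lambda>b. frag_of (a \<otimes>\<^bsub>G\<^esub> b)) y) x) \<subseteq> carrier G"
    if "Poly_Mapping.keys x \<subseteq> carrier G" "Poly_Mapping.keys y \<subseteq> carrier G" for x y
  proof -
    have "Poly_Mapping.keys (frag_extend (\<lambda>b. frag_of (a \<otimes>\<^bsub>G\<^esub> b)) y) \<subseteq> carrier G" if "a \<in> carrier G" for a
      using keys_frag_extend[of "\<lambda>b. frag_of (a \<otimes>\<^bsub>G\<^esub> b)" y] \<open>Poly_Mapping.keys y \<subseteq> carrier G\<close> that by fastforce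
    then show ?thesis
      using keys_frag_extend[of "\<lambda>a. frag_extend (\<lambda>b. frag_of (a \<otimes>\<^bsub>G\<^esub> b)) y" x] that by blast
  qed
  have "comm_group (add_monoid \<int>[G])"
  proof (rule comm_groupI)
    fix x assume "x \<in> carrier (add_monoid \<int>[G])"
    then show "\<exists>y \<in> carrier (add_monoid \<int>[G]). y \<otimes>\<^bsub>add_monoid \<int>[G]\<^esub> x = \<one>\<^bsub>add_monoid \<int>[G]\<^esub>"
      by (intro bexI[of _ "- x"]) (auto simp: group_ring_def)
  qed (auto simp: group_ring_def keys_add_subset algebra_simps dest: subsetD[OF Poly_Mapping.keys_add])
  then have 1: "abelian_group \<int>[G]" by (rule comm_group_abelian_groupI)
  have id: "frag_extend (\<lambda>a. frag_of (a \<otimes>\<^bsub>G\<^esub> \<one>\<^bsub>G\<^esub>)) x = x" "frag_extend (\<lambda>a. frag_of (\<one>\<^bsub>G\<^esub> \<otimes>\<^bsub>G\<^esub> a)) x = x"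
    if "Poly_Mapping.keys x \<subseteq> carrier G" for x
  proof -
    have "frag_extend (\<lambda>a. frag_of (a \<otimes>\<^bsub>G\<^esub> \<one>\<^bsub>G\<^esub>)) x = frag_extend frag_of x"
      "frag_extend (\<lambda>a. frag_of (\<one>\<^bsub>G\<^esub> \<otimes>\<^bsub>G\<^esub> a)) x = frag_extend frag_of x"
      using that by (auto intro!: frag_extend_eq)
    then show "frag_extend (\<lambda>a. frag_of (a \<otimes>\<^bsub>G\<^esub> \<one>\<^bsub>G\<^esub>)) x = x"
      "frag_extend (\<lambda>a. frag_of (\<one>\<^bsub>G\<^esub> \<otimes>\<^bsub>G\<^esub> a)) x = x"
      by (simp_all flip: frag_expansion)
  qed
  have 2: "monoid \<int>[G]"
  proof (rule monoidI)
    fix x y z assume "x \<in> carrier \<int>[G]" "y \<in> carrier \<int>[G]" "z \<in> carrier \<int>[G]"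
    then show "x \<otimes>\<^bsub>\<int>[G]\<^esub> y \<otimes>\<^bsub>\<int>[G]\<^esub> z = x \<otimes>\<^bsub>\<int>[G]\<^esub> (y \<otimes>\<^bsub>\<int>[G]\<^esub> z)"
      by (auto simp: group_ring_def frag_extend_frag_extend G.m_assoc subset_iff
            intro!: frag_extend_eq)
  qed (use cl id in \<open>auto simp: group_ring_def\<close>)
  show ?thesis
    by (rule ringI[OF 1 2])
       (auto simp: group_ring_def frag_extend_add frag_extend_plus)
qed

lemma gr_map_ring_hom:
  assumes "group A" "group B" "f \<in> hom A B"
  shows "gr_map f \<in> ring_hom \<int>[A] \<int>[B]"
proof (rule ring_hom_memI)
  show "gr_map f x \<in> carrier \<int>[B]" if "x \<in> carrier \<int>[A]" for x
    using that hom_in_carrier[OF assms(3)] keys_frag_extend[of "\<lambda>a. frag_of (f a)" x]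
    by (fastforce simp: group_ring_def gr_map_def)
  show "gr_map f (x \<otimes>\<^bsub>\<int>[A]\<^esub> y) = gr_map f x \<otimes>\<^bsub>\<int>[B]\<^esub> gr_map f y"
    if "x \<in> carrier \<int>[A]" "y \<in> carrier \<int>[A]" for x y
    using that hom_mult[OF assms(3)]
    by (auto simp: group_ring_def gr_map_def frag_extend_frag_extend subset_iff intro!: frag_extend_eq)
qed (use hom_one[OF assms(3,1,2)] in \<open>auto simp: group_ring_def gr_map_def frag_extend_add\<close>)

lemma base_change_group_ring:
  assumes "group A" "group B" "f \<in> hom A B" "left_module \<int>[A] M"
  shows "base_change \<int>[A] \<int>[B] M (gr_map f)"
  using assms by (simp add: base_change_def base_change_axioms_def ring_group_ring gr_map_ring_hom)

lemma left_module_res: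
  assumes "group A" "group B" "f \<in> hom A B" "left_module \<int>[B] M"
  shows "left_module \<int>[A] (res_mod (gr_map f) M)"
proof -
  interpret M: left_module "\<int>[B]" M by fact
  interpret A: ring "\<int>[A]" by (rule ring_group_ring[OF assms(1)])
  note h = gr_map_ring_hom[OF assms(1-3)]
  have "abelian_group (res_mod (gr_map f) M)"
    by (rule abelian_groupI) (auto simp: res_mod_def M.a_ac intro: M.add.l_inv_ex)
  then show ?thesis
    using A.ring_axioms ring_hom_closed[OF h] ring_hom_add[OF h] ring_hom_mult[OF h] ring_hom_one[OF h]
    by (auto simp: left_module_def left_module_axioms_def res_mod_def
        M.smult_closed M.smult_l_distr M.smult_r_distr M.smult_assoc M.smult_one)
qed

text \<open>The maps of the canonical splittings on pure tensors are those of the usual description,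
  see \<open>ind_act_pure\<close>, \<open>amv_canonical_inj_pure\<close> and \<open>hmv_canonical_inj_pure\<close>.\<close>

lemma ind_act_pure:
  assumes G: "group A" "group B" "f \<in> hom A B" and C: "left_module \<int>[B] C"
    and sx: "s \<in> carrier \<int>[B]" "x \<in> carrier C"
  shows "tensor_lift C (smult C) (ind_pure A B f (res_mod (gr_map f) C) s x) = s \<odot>\<^bsub>C\<^esub> x"
proof -
  interpret C: left_module "\<int>[B]" C by fact
  interpret base_change "\<int>[A]" "\<int>[B]" "res_mod (gr_map f) C" "gr_map f"
    by (rule base_change_group_ring[OF G left_module_res[OF G C]])
  have r: "carrier (res_mod (gr_map f) C) = carrier C" "add (res_mod (gr_map f) C) = add C"
    "r \<odot>\<^bsub>res_mod (gr_map f) C\<^esub> y = gr_map f r \<odot>\<^bsub>C\<^esub> y" for r y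
    by (simp_all add: res_mod_def)
  show ?thesis
    by (rule tensor_lift_TP)
       (use sx ring_hom_closed[OF hom] in \<open>auto simp: r C.smult_closed C.smult_l_distr
          C.smult_r_distr C.smult_assoc C.abelian_group_axioms\<close>)
qed

lemma gr_map_twist:
  assumes k: "\<And>h. h \<in> carrier H \<Longrightarrow> k h \<otimes>\<^bsub>B\<^esub> v = v \<otimes>\<^bsub>B\<^esub> j (i h)" and r: "r \<in> carrier \<int>[H]"
  shows "gr_map k r \<otimes>\<^bsub>\<int>[B]\<^esub> frag_of v = frag_of v \<otimes>\<^bsub>\<int>[B]\<^esub> gr_map j (gr_map i r)"
  using k r
  by (auto simp: group_ring_def gr_map_def frag_extend_frag_extend subset_iff intro!: frag_extend_eq)

text \<open>Here \<open>j \<circ> i\<close> and \<open>k\<close> agree up to conjugation: for \<open>v = w = 1\<close> this is the map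
  \<open>s \<otimes> x \<mapsto> s \<otimes> x\<close>, for \<open>v = t\<close> and \<open>w = t\<^sup>-\<^sup>1\<close> the map \<open>s \<otimes> x \<mapsto> s t \<otimes> t\<^sup>-\<^sup>1 x\<close>.\<close>

locale twisted = A?: group A + B?: group B + H?: group H + C?: left_module "\<int>[B]" C
  for A :: "'a monoid" and B :: "'b monoid" and H :: "'h monoid" and C :: "('b \<Rightarrow>\<^sub>0 int, 'm) module" +
  fixes i :: "'h \<Rightarrow> 'a" and j :: "'a \<Rightarrow> 'b" and k :: "'h \<Rightarrow> 'b" and v w :: 'b
  assumes i: "i \<in> hom H A" and j: "j \<in> hom A B" and k: "k \<in> hom H B"
    and v: "v \<in> carrier B" and w: "w \<in> carrier B"
    and kv: "\<And>h. h \<in> carrier H \<Longrightarrow> k h \<otimes>\<^bsub>B\<^esub> v = v \<otimes>\<^bsub>B\<^esub> j (i h)"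
    and jw: "\<And>h. h \<in> carrier H \<Longrightarrow> j (i h) \<otimes>\<^bsub>B\<^esub> w = w \<otimes>\<^bsub>B\<^esub> k h"
begin

lemmas ZB_facts = ring.ring_simprules[OF ring_group_ring[OF B.is_group]]

lemma abelian_C: "abelian_group C"
  by (rule left_module.axioms(2)[OF C.left_module_axioms])

abbreviation "Ck \<equiv> res_mod (gr_map k) C"
abbreviation "Cj \<equiv> res_mod (gr_map j) C"

lemma Ck: "left_module \<int>[H] Ck" and Cj: "left_module \<int>[A] Cj"
  by (rule left_module_res[OF H.is_group B.is_group k C.left_module_axioms],
      rule left_module_res[OF A.is_group B.is_group j C.left_module_axioms])

sublocale K: base_change "\<int>[H]" "\<int>[B]" Ck "gr_map k"
  by (rule base_change_group_ring[OF H.is_group B.is_group k Ck])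

sublocale I: base_change "\<int>[H]" "\<int>[A]" Ck "gr_map i"
  by (rule base_change_group_ring[OF H.is_group A.is_group i Ck])

sublocale J: base_change "\<int>[A]" "\<int>[B]" Cj "gr_map j"
  by (rule base_change_group_ring[OF A.is_group B.is_group j Cj])

lemma res_simps [simp]:
  "carrier Ck = carrier C" "add Ck = add C" "r \<odot>\<^bsub>Ck\<^esub> x = gr_map k r \<odot>\<^bsub>C\<^esub> x"
  "carrier Cj = carrier C" "add Cj = add C" "r' \<odot>\<^bsub>Cj\<^esub> x = gr_map j r' \<odot>\<^bsub>C\<^esub> x"
  by (simp_all add: res_mod_def)

lemma frag_vw: "frag_of v \<in> carrier \<int>[B]" "frag_of w \<in> carrier \<int>[B]"
  using v w by (simp_all add: group_ring_def)

lemma gr_closed: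
  "r \<in> carrier \<int>[H] \<Longrightarrow> gr_map k r \<in> carrier \<int>[B]" "r \<in> carrier \<int>[H] \<Longrightarrow> gr_map i r \<in> carrier \<int>[A]"
  "s \<in> carrier \<int>[A] \<Longrightarrow> gr_map j s \<in> carrier \<int>[B]"
  using ring_hom_closed[OF K.hom] ring_hom_closed[OF I.hom] ring_hom_closed[OF J.hom] by auto

lemma gr_jw:
  assumes "r \<in> carrier \<int>[H]" "x \<in> carrier C"
  shows "gr_map j (gr_map i r) \<odot>\<^bsub>C\<^esub> (frag_of w \<odot>\<^bsub>C\<^esub> x) = frag_of w \<odot>\<^bsub>C\<^esub> (gr_map k r \<odot>\<^bsub>C\<^esub> x)"
proof -
  have "gr_map (j \<circ> i) r \<otimes>\<^bsub>\<int>[B]\<^esub> frag_of w = frag_of w \<otimes>\<^bsub>\<int>[B]\<^esub> gr_map k r"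
    using jw assms(1)
    by (auto simp: group_ring_def gr_map_def frag_extend_frag_extend subset_iff intro!: frag_extend_eq)
  moreover have "gr_map (j \<circ> i) r = gr_map j (gr_map i r)"
    by (simp add: gr_map_def frag_extend_frag_extend)
  ultimately show ?thesis
    using assms frag_vw gr_closed by (simp flip: C.smult_assoc)
qed

lemma e_pure:
  assumes "s \<in> carrier \<int>[A]" "x \<in> carrier C"
  shows "tensor_lift C (\<lambda>s x. gr_map j s \<odot>\<^bsub>C\<^esub> (frag_of w \<odot>\<^bsub>C\<^esub> x)) (ind_pure H A i Ck s x) =
    gr_map j s \<odot>\<^bsub>C\<^esub> (frag_of w \<odot>\<^bsub>C\<^esub> x)"
  by (rule I.tensor_lift_TP)
     (use assms frag_vw gr_closed ring_hom_add[OF J.hom] ring_hom_mult[OF J.hom] gr_jw in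
       \<open>simp_all add: abelian_C C.smult_closed C.smult_l_distr C.smult_r_distr C.smult_assoc\<close>)

lemma \<beta>_facts:
  defines "\<beta> \<equiv> \<lambda>s x. ind_pure A B j Cj (s \<otimes>\<^bsub>\<int>[B]\<^esub> frag_of v) (frag_of w \<odot>\<^bsub>C\<^esub> x)"
  assumes s: "s \<in> carrier \<int>[B]" "s' \<in> carrier \<int>[B]" and x: "x \<in> carrier C" "x' \<in> carrier C"
    and r: "r \<in> carrier \<int>[H]"
  shows "\<beta> s x \<in> carrier J.TM"
    "\<beta> (s \<oplus>\<^bsub>\<int>[B]\<^esub> s') x = \<beta> s x \<oplus>\<^bsub>J.TM\<^esub> \<beta> s' x"
    "\<beta> s (x \<oplus>\<^bsub>C\<^esub> x') = \<beta> s x \<oplus>\<^bsub>J.TM\<^esub> \<beta> s x'"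
    "\<beta> (s \<otimes>\<^bsub>\<int>[B]\<^esub> gr_map k r) x = \<beta> s (gr_map k r \<odot>\<^bsub>C\<^esub> x)"
proof -
  show "\<beta> s x \<in> carrier J.TM"
    unfolding \<beta>_def using s x frag_vw by (intro J.TP_closed) (simp_all add: C.smult_closed)
  show "\<beta> (s \<oplus>\<^bsub>\<int>[B]\<^esub> s') x = \<beta> s x \<oplus>\<^bsub>J.TM\<^esub> \<beta> s' x"
    unfolding \<beta>_def using s x frag_vw by (simp add: J.TP_add_left C.smult_closed ZB_facts)
  show "\<beta> s (x \<oplus>\<^bsub>C\<^esub> x') = \<beta> s x \<oplus>\<^bsub>J.TM\<^esub> \<beta> s x'"
    unfolding \<beta>_def using s x frag_vw J.TP_add_right[of "s \<otimes>\<^bsub>\<int>[B]\<^esub> frag_of v" "frag_of w \<odot>\<^bsub>C\<^esub> x" "frag_of w \<odot>\<^bsub>C\<^esub> x'"]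
    by (simp add: C.smult_closed C.smult_r_distr)
  have "\<beta> (s \<otimes>\<^bsub>\<int>[B]\<^esub> gr_map k r) x =
      ind_pure A B j Cj ((s \<otimes>\<^bsub>\<int>[B]\<^esub> frag_of v) \<otimes>\<^bsub>\<int>[B]\<^esub> gr_map j (gr_map i r)) (frag_of w \<odot>\<^bsub>C\<^esub> x)"
    unfolding \<beta>_def using s r frag_vw gr_closed gr_map_twist[where H = H and k = k and B = B and v = v and j = j and i = i, OF kv r] by (simp add: ZB_facts)
  also have "\<dots> = ind_pure A B j Cj (s \<otimes>\<^bsub>\<int>[B]\<^esub> frag_of v) (gr_map j (gr_map i r) \<odot>\<^bsub>C\<^esub> (frag_of w \<odot>\<^bsub>C\<^esub> x))"
    using J.TP_balanced[of "s \<otimes>\<^bsub>\<int>[B]\<^esub> frag_of v" "gr_map i r" "frag_of w \<odot>\<^bsub>C\<^esub> x"]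
      s x r frag_vw gr_closed by (simp add: C.smult_closed)
  also have "\<dots> = \<beta> s (gr_map k r \<odot>\<^bsub>C\<^esub> x)" unfolding \<beta>_def using r x by (simp add: gr_jw)
  finally show "\<beta> (s \<otimes>\<^bsub>\<int>[B]\<^esub> gr_map k r) x = \<beta> s (gr_map k r \<odot>\<^bsub>C\<^esub> x)" .
qed

lemma gr_map_one: "gr_map j \<one>\<^bsub>\<int>[A]\<^esub> = \<one>\<^bsub>\<int>[B]\<^esub>"
  by (rule ring_hom_one[OF J.hom])

lemma one_ZA: "\<one>\<^bsub>\<int>[A]\<^esub> \<in> carrier \<int>[A]"
  by (simp add: group_ring_def)

lemma e_one:
  assumes "x \<in> carrier C"
  shows "tensor_lift C (\<lambda>s x. gr_map j s \<odot>\<^bsub>C\<^esub> (frag_of w \<odot>\<^bsub>C\<^esub> x)) (ind_pure H A i Ck \<one>\<^bsub>\<int>[A]\<^esub> x) =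
    frag_of w \<odot>\<^bsub>C\<^esub> x"
  using e_pure[OF one_ZA assms] assms frag_vw by (simp add: gr_map_one C.smult_one C.smult_closed)

context
  assumes w1: "w = \<one>\<^bsub>B\<^esub>" and v1: "v = \<one>\<^bsub>B\<^esub>"
begin

lemma one_act: "x \<in> carrier C \<Longrightarrow> frag_of w \<odot>\<^bsub>C\<^esub> x = x"
  using C.smult_one by (simp add: w1 group_ring_def)

lemma e_one':
  assumes "x \<in> carrier C"
  shows "tensor_lift C (\<lambda>s x. gr_map j s \<odot>\<^bsub>C\<^esub> x) (ind_pure H A i Ck \<one>\<^bsub>\<int>[A]\<^esub> x) = x"
proof -
  have "tensor_lift C (\<lambda>s x. gr_map j s \<odot>\<^bsub>C\<^esub> x) (ind_pure H A i Ck \<one>\<^bsub>\<int>[A]\<^esub> x) = gr_map j \<one>\<^bsub>\<int>[A]\<^esub> \<odot>\<^bsub>C\<^esub> x"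
    by (rule I.tensor_lift_TP)
     (use assms frag_vw gr_closed ring_hom_add[OF J.hom] ring_hom_mult[OF J.hom] gr_jw one_act one_ZA in
       \<open>simp_all add: abelian_C C.smult_closed C.smult_l_distr C.smult_r_distr C.smult_assoc\<close>)
  with assms show ?thesis by (simp add: gr_map_one C.smult_one)
qed

lemma one_right: "s \<in> carrier \<int>[B] \<Longrightarrow> s \<otimes>\<^bsub>\<int>[B]\<^esub> frag_of v = s"
  using ZB_facts(11)[of s] monoid.r_one[OF ring.is_monoid[OF ring_group_ring[OF B.is_group]], of s]
  by (simp add: v1 group_ring_def)

lemma inj_one:
  assumes "s \<in> carrier \<int>[B]" "x \<in> carrier C"
  shows "tensor_lift J.TM (\<lambda>s x. ind_pure A B j Cj s
      (tensor_lift C (\<lambda>s x. gr_map j s \<odot>\<^bsub>C\<^esub> x) (ind_pure H A i Ck \<one>\<^bsub>\<int>[A]\<^esub> x)))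
      (ind_pure H B k Ck s x) = ind_pure A B j Cj s x"
proof -
  have r: "ring \<int>[B]" by (rule ring_group_ring[OF B.is_group])
  have z: "0 \<in> carrier \<int>[H]" by (simp add: group_ring_def)
  have "tensor_lift J.TM (\<lambda>s x. ind_pure A B j Cj s
      (tensor_lift C (\<lambda>s x. gr_map j s \<odot>\<^bsub>C\<^esub> x) (ind_pure H A i Ck \<one>\<^bsub>\<int>[A]\<^esub> x)))
      (ind_pure H B k Ck s x) = ind_pure A B j Cj s
      (tensor_lift C (\<lambda>s x. gr_map j s \<odot>\<^bsub>C\<^esub> x) (ind_pure H A i Ck \<one>\<^bsub>\<int>[A]\<^esub> x))"
  proof (rule K.tensor_lift_TP, goal_cases)
    case (2 s x)
    then show ?case using \<beta>_facts(1)[of s s x x, OF _ _ _ _ z] by (simp add: e_one' one_act one_right)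
  next
    case (3 s s' x)
    then show ?case using \<beta>_facts(2)[of s s' x x, OF _ _ _ _ z] ring.ring_simprules(1)[OF r]
      by (simp add: e_one' one_act one_right)
  next
    case (4 s x x')
    then show ?case using \<beta>_facts(3)[of s s x x', OF _ _ _ _ z] abelian_monoid.a_closed[OF abelian_group.axioms(1)[OF abelian_C]]
      by (simp add: e_one' one_act one_right)
  next
    case (5 s r' x)
    then show ?case using \<beta>_facts(4)[of s s x x r'] gr_closed
      by (simp add: e_one' one_act one_right C.smult_closed ring.ring_simprules(5)[OF r])
  qed (use assms J.abelian_group_TM in simp_all)
  with assms show ?thesis by (simp add: e_one')
qed

end

end

theorem amv_canonical_inj_pure:
  fixes C :: "('g \<Rightarrow>\<^sub>0 int, 'c) ch_complex"
  assumes A: "amalgamated_free_product A" and C: "chain_complex \<int>[am_G A] C"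
    and sx: "s \<in> carrier \<int>[am_G A]" "x \<in> carrier (cmod C n)"
  defines "E \<equiv> amv_canonical A C"
  shows "amv_inj A E n (ind_pure (am_H A) (am_G A) (am_k A) (cmod (amv_D E) n) s x) =
    (ind_pure (am_G1 A) (am_G A) (am_j1 A) (cmod (amv_C1 E) n) s x,
     ind_pure (am_G2 A) (am_G A) (am_j2 A) (cmod (amv_C2 E) n) s x)"
proof -
  have g: "group (am_H A)" "group (am_G1 A)" "group (am_G2 A)" "group (am_G A)"
    and i: "am_i1 A \<in> hom (am_H A) (am_G1 A)" "am_i2 A \<in> hom (am_H A) (am_G2 A)"
    using A by (simp_all add: amalgamated_free_product_def)
  note j = pushout_morphisms[OF A]
  have k: "am_k A \<in> hom (am_H A) (am_G A)" unfolding am_k_def by (rule hom_compose[OF i(1) j(1)])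
  have k2: "am_k A h = am_j2 A (am_i2 A h)" if "h \<in> carrier (am_H A)" for h
    using j(3)[OF that] by (simp add: am_k_def)
  interpret G: group "am_G A" by (rule g)
  have m: "left_module \<int>[am_G A] (cmod C n)" using C by (simp add: chain_complex_def)
  have kc: "am_k A h \<in> carrier (am_G A)" if "h \<in> carrier (am_H A)" for h by (rule hom_in_carrier[OF k that])
  interpret T1: twisted "am_G1 A" "am_G A" "am_H A" "cmod C n" "am_i1 A" "am_j1 A" "am_k A" "\<one>\<^bsub>am_G A\<^esub>" "\<one>\<^bsub>am_G A\<^esub>"
    by (intro twisted.intro twisted_axioms.intro g m i j k) (use kc in \<open>simp_all add: am_k_def\<close>)
  interpret T2: twisted "am_G2 A" "am_G A" "am_H A" "cmod C n" "am_i2 A" "am_j2 A" "am_k A" "\<one>\<^bsub>am_G A\<^esub>" "\<one>\<^bsub>am_G A\<^esub>"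
    by (intro twisted.intro twisted_axioms.intro g m i j k) (use kc in \<open>simp_all flip: k2\<close>)
  show ?thesis
    using T1.inj_one[OF refl refl sx] T2.inj_one[OF refl refl sx]
    by (simp add: amv_inj_def E_def amv_canonical_def res_complex_def)
qed

theorem hmv_canonical_inj_pure:
  fixes C :: "('g \<Rightarrow>\<^sub>0 int, 'c) ch_complex"
  assumes B: "hnn_extension B" and C: "chain_complex \<int>[hn_G B] C"
    and sx: "s \<in> carrier \<int>[hn_G B]" "x \<in> carrier (cmod C n)"
  defines "E \<equiv> hmv_canonical B C"
  shows "hmv_inj B E n (ind_pure (hn_H B) (hn_G B) (hn_k B) (cmod (hmv_D E) n) s x) =
    ind_pure (hn_G1 B) (hn_G B) (hn_j1 B) (cmod (hmv_C1 E) n) s x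
    \<ominus>\<^bsub>cmod (hmv_mid B E) n\<^esub>
    ind_pure (hn_G1 B) (hn_G B) (hn_j1 B) (cmod (hmv_C1 E) n)
      (s \<otimes>\<^bsub>\<int>[hn_G B]\<^esub> frag_of (hn_t B)) (frag_of (inv\<^bsub>hn_G B\<^esub> hn_t B) \<odot>\<^bsub>cmod C n\<^esub> x)"
proof -
  have g: "group (hn_H B)" "group (hn_G1 B)" "group (hn_G B)"
    and i: "hn_i1 B \<in> hom (hn_H B) (hn_G1 B)" "hn_i2 B \<in> hom (hn_H B) (hn_G1 B)"
    using B by (simp_all add: hnn_extension_def)
  note j = hnn_morphisms[OF B]
  have k: "hn_k B \<in> hom (hn_H B) (hn_G B)" unfolding hn_k_def by (rule hom_compose[OF i(1) j(1)])
  interpret G: group "hn_G B" by (rule g)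
  have m: "left_module \<int>[hn_G B] (cmod C n)" using C by (simp add: chain_complex_def)
  have kc: "hn_k B h \<in> carrier (hn_G B)" if "h \<in> carrier (hn_H B)" for h by (rule hom_in_carrier[OF k that])
  have kt: "hn_k B h \<otimes>\<^bsub>hn_G B\<^esub> hn_t B = hn_t B \<otimes>\<^bsub>hn_G B\<^esub> hn_j1 B (hn_i2 B h)" if "h \<in> carrier (hn_H B)" for h
    using j(3)[OF that] by (simp add: hn_k_def)
  have ti: "hn_j1 B (hn_i2 B h) \<otimes>\<^bsub>hn_G B\<^esub> inv\<^bsub>hn_G B\<^esub> hn_t B = inv\<^bsub>hn_G B\<^esub> hn_t B \<otimes>\<^bsub>hn_G B\<^esub> hn_k B h"
    if h: "h \<in> carrier (hn_H B)" for h
  proof -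
    have c: "hn_j1 B (hn_i2 B h) \<in> carrier (hn_G B)"
      using hom_in_carrier[OF j(1) hom_in_carrier[OF i(2) h]] .
    have "hn_k B h = hn_t B \<otimes>\<^bsub>hn_G B\<^esub> hn_j1 B (hn_i2 B h) \<otimes>\<^bsub>hn_G B\<^esub> inv\<^bsub>hn_G B\<^esub> hn_t B"
      using kt[OF h] kc[OF h] j(2) c by (metis G.inv_solve_right G.m_closed)
    then show ?thesis using j(2) c by (simp add: G.m_assoc G.inv_solve_left)
  qed
  interpret T1: twisted "hn_G1 B" "hn_G B" "hn_H B" "cmod C n" "hn_i1 B" "hn_j1 B" "hn_k B" "\<one>\<^bsub>hn_G B\<^esub>" "\<one>\<^bsub>hn_G B\<^esub>"
    by (intro twisted.intro twisted_axioms.intro g m i j k) (use kc in \<open>simp_all add: hn_k_def\<close>)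
  interpret T2: twisted "hn_G1 B" "hn_G B" "hn_H B" "cmod C n" "hn_i2 B" "hn_j1 B" "hn_k B" "hn_t B" "inv\<^bsub>hn_G B\<^esub> hn_t B"
    by (intro twisted.intro twisted_axioms.intro g m i j k) (use kt ti j in simp_all)
  have e1: "tensor_lift (cmod C n) (\<lambda>s x. gr_map (hn_j1 B) s \<odot>\<^bsub>cmod C n\<^esub> x)
      (ind_pure (hn_H B) (hn_G1 B) (hn_i1 B) T1.Ck \<one>\<^bsub>\<int>[hn_G1 B]\<^esub> y) = y"
    if "y \<in> carrier (cmod C n)" for y
    by (rule T1.e_one'[OF refl refl that])
  let ?F = "\<lambda>s x. ind_pure (hn_G1 B) (hn_G B) (hn_j1 B) T1.Cj s x"
  let ?t = "frag_of (hn_t B)" and ?u = "frag_of (inv\<^bsub>hn_G B\<^esub> hn_t B)"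
  let ?N = "T1.J.TM"
  let ?\<beta> = "\<lambda>s x. ?F s (tensor_lift (cmod C n) (\<lambda>s x. gr_map (hn_j1 B) s \<odot>\<^bsub>cmod C n\<^esub> x)
        (ind_pure (hn_H B) (hn_G1 B) (hn_i1 B) T1.Ck \<one>\<^bsub>\<int>[hn_G1 B]\<^esub> x)) \<ominus>\<^bsub>?N\<^esub>
      ?F (s \<otimes>\<^bsub>\<int>[hn_G B]\<^esub> ?t) (tensor_lift (cmod C n) (\<lambda>s x. gr_map (hn_j1 B) s \<odot>\<^bsub>cmod C n\<^esub> (?u \<odot>\<^bsub>cmod C n\<^esub> x))
        (ind_pure (hn_H B) (hn_G1 B) (hn_i2 B) T1.Ck \<one>\<^bsub>\<int>[hn_G1 B]\<^esub> x))"
  have \<beta>: "?\<beta> s x = ?F s x \<ominus>\<^bsub>?N\<^esub> ?F (s \<otimes>\<^bsub>\<int>[hn_G B]\<^esub> ?t) (?u \<odot>\<^bsub>cmod C n\<^esub> x)"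
    if "x \<in> carrier (cmod C n)" for s x
    using that e1 T2.e_one by simp
  have f1: "?F s x \<in> carrier ?N" "?F (s \<oplus>\<^bsub>\<int>[hn_G B]\<^esub> s') x = ?F s x \<oplus>\<^bsub>?N\<^esub> ?F s' x"
    "?F s (x \<oplus>\<^bsub>cmod C n\<^esub> x') = ?F s x \<oplus>\<^bsub>?N\<^esub> ?F s x'"
    "r \<in> carrier \<int>[hn_H B] \<Longrightarrow> ?F (s \<otimes>\<^bsub>\<int>[hn_G B]\<^esub> gr_map (hn_k B) r) x = ?F s (gr_map (hn_k B) r \<odot>\<^bsub>cmod C n\<^esub> x)"
    if "s \<in> carrier \<int>[hn_G B]" "s' \<in> carrier \<int>[hn_G B]" "x \<in> carrier (cmod C n)" "x' \<in> carrier (cmod C n)" for s s' x x' r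
  proof -
    show "?F s x \<in> carrier ?N" using that T1.J.TP_closed by simp
    show "?F (s \<oplus>\<^bsub>\<int>[hn_G B]\<^esub> s') x = ?F s x \<oplus>\<^bsub>?N\<^esub> ?F s' x" using that T1.J.TP_add_left by simp
    show "?F s (x \<oplus>\<^bsub>cmod C n\<^esub> x') = ?F s x \<oplus>\<^bsub>?N\<^esub> ?F s x'" using that T1.J.TP_add_right[of s x x'] by simp
    assume r: "r \<in> carrier \<int>[hn_H B]"
    have "?F (s \<otimes>\<^bsub>\<int>[hn_G B]\<^esub> gr_map (hn_k B) r) x = ?F s (gr_map (hn_k B) r \<odot>\<^bsub>cmod C n\<^esub> x)"
      using T1.\<beta>_facts(4)[of s s x x r] that r T1.gr_closed(1)[OF r] T1.C.smult_closed
      by (simp add: T1.one_act[OF refl refl] T1.one_right[OF refl refl]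
           ring.ring_simprules(5)[OF ring_group_ring[OF g(3)]])
    then show "?F (s \<otimes>\<^bsub>\<int>[hn_G B]\<^esub> gr_map (hn_k B) r) x = ?F s (gr_map (hn_k B) r \<odot>\<^bsub>cmod C n\<^esub> x)" .
  qed
  have sub: "(a \<oplus>\<^bsub>?N\<^esub> b) \<ominus>\<^bsub>?N\<^esub> (c \<oplus>\<^bsub>?N\<^esub> d) = (a \<ominus>\<^bsub>?N\<^esub> c) \<oplus>\<^bsub>?N\<^esub> (b \<ominus>\<^bsub>?N\<^esub> d)"
    if "a \<in> carrier ?N" "b \<in> carrier ?N" "c \<in> carrier ?N" "d \<in> carrier ?N" for a b c d
    using that by (simp add: T1.J.TM.minus_eq T1.J.TM.minus_add T1.J.TM.a_ac)
  have z: "0 \<in> carrier \<int>[hn_H B]" by (simp add: group_ring_def)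
  note f2 = T2.\<beta>_facts
  have "tensor_lift ?N ?\<beta> (ind_pure (hn_H B) (hn_G B) (hn_k B) T1.Ck s x) = ?\<beta> s x"
  proof (rule T1.K.tensor_lift_TP, goal_cases)
    case (2 s x)
    then have "x \<in> carrier (cmod C n)" by simp
    with 2 show ?case unfolding \<beta>[OF \<open>x \<in> carrier (cmod C n)\<close>]
      using f1(1) f2(1)[OF _ _ _ _ z] by simp
  next
    case (3 s s' x)
    then have x: "x \<in> carrier (cmod C n)" by simp
    from 3 x show ?case unfolding \<beta>[OF x]
      using f1[of s s' x x] f1[of s' s' x x] f2[of s s' x x, OF _ _ _ _ z] f2[of s' s' x x, OF _ _ _ _ z] by (simp add: sub)
  next
    case (4 s x x')
    then have x: "x \<in> carrier (cmod C n)" "x' \<in> carrier (cmod C n)" "x \<oplus>\<^bsub>T1.Ck\<^esub> x' \<in> carrier (cmod C n)"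
      using abelian_monoid.a_closed[OF abelian_group.axioms(1)[OF T1.abelian_C]] by simp_all
    from 4 x show ?case unfolding \<beta>[OF x(1)] \<beta>[OF x(2)] \<beta>[OF x(3)]
      using f1[of s s x x'] f1[of s s x' x'] f2[of s s x x', OF _ _ _ _ z] f2[of s s x' x', OF _ _ _ _ z] by (simp add: sub)
  next
    case (5 s r x)
    then have x: "x \<in> carrier (cmod C n)" "r \<odot>\<^bsub>T1.Ck\<^esub> x \<in> carrier (cmod C n)"
      using T1.gr_closed(1) T1.C.smult_closed by simp_all
    from 5 x show ?case unfolding \<beta>[OF x(1)] \<beta>[OF x(2)]
      using f1(4)[of s s x x r] f2(4)[of s s x x r] by simp
  qed (use sx T1.J.abelian_group_TM in simp_all)
  with sx show ?thesis
    by (simp add: hmv_inj_def hmv_mid_def ind_complex_def E_def hmv_canonical_def res_complex_def Let_def \<beta>)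
qed

end

theory Submission
  imports Defs
begin

text \<open>Why the theorem holds. Consider the Bass-Serre tree of the decomposition of \<open>G\<close>: the vertices are
  the cosets \<open>xG1\<close> (and \<open>xG2\<close> for an amalgam), the edges are the cosets \<open>xH\<close>. The canonical splitting of \<open>C\<close> is \<open>C\<close> tensored
  with the cellular chain complex of the tree, which is exact because the tree is contractible. Choose a basis of each
  module of \<open>C\<close> and attach to every basis element \<open>b\<close> a finite connected set \<open>Z b\<close> of group elements containing \<open>\<one>\<close>, which
  amounts to a finite subtree. Let \<open>D\<close> consist of the elements of \<open>C\<close> whose \<open>b\<close>-coordinate is supported on \<open>k(H) Z b\<close>, for all
  \<open>b\<close>, and take \<open>G1 Z b\<close> and \<open>G2 Z b\<close> in the same way for \<open>C1\<close> and \<open>C2\<close> (for an HNN extension \<open>G1 (Z b \<union> t\<^sup>-\<^sup>1 Z b)\<close>).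
  In each degree the resulting sequence replaces, over each \<open>g b\<close>, the tree by a finite subtree, which is again contractible.

  Exactness is proved by hand. The left map is injective (\<open>amalgam_piece.tau_injective\<close>, \<open>hnn_piece.delta_injective\<close>)
  since removing an edge separates the tree: there is an integer function on the vertices that changes across this edge
  only (\<open>amalgam_potential\<close>, \<open>hnn_potential\<close>), and weighting a tensor with it extracts the component of the tensor at the
  edge from its image (\<open>induced.eval_separates\<close>, \<open>transfer.eval_tau\<close>). The function comes straight
  from the universal property, by mapping \<open>G\<close> to a semidirect product. In the middle, connectedness of \<open>Z b\<close> moves every generator over \<open>g b\<close> to
  a base point modulo the image of \<open>D\<close>, and the base points form a copy of \<open>C\<close> because \<open>C\<close> is free (\<open>amalgam_piece.kernel\<close>,
  \<open>hnn_piece.kernel\<close>).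

  The modules are finitely generated free over the subgroups since \<open>\<int>[G]\<close> restricted to a subgroup is free on the orbits and
  only finitely many orbits are used (\<open>free_sub.fg_free_span\<close>). The subgroups embed into \<open>G\<close> by explicit permutation
  representations (\<open>amalgam_embeds\<close>, \<open>hnn_embeds\<close>). The modules form subcomplexes if \<open>z g \<in> Z b'\<close> whenever \<open>z \<in> Z b\<close> and
  \<open>g\<close> occurs in the \<open>b'\<close>-coordinate of \<open>d b\<close>; such families are built downwards from the top degree, and any finite set of
  elements of \<open>C\<close> can be thrown into the supports at the start (\<open>connected_family\<close>). That last freedom makes the union
  of the finite splittings everything.\<close>

section \<open>Faithful permutation representations\<close>

definition perm_group :: "('x \<Rightarrow> 'x) monoid" where
  "perm_group = \<lparr>carrier = {f. bij f}, mult = (\<circ>), one = id\<rparr>"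

lemma group_perm_group: "group perm_group"
proof (rule groupI)
  fix f :: "'a \<Rightarrow> 'a" assume "f \<in> carrier perm_group"
  then show "\<exists>g \<in> carrier perm_group. g \<otimes>\<^bsub>perm_group\<^esub> f = \<one>\<^bsub>perm_group\<^esub>"
    by (intro bexI[of _ "Hilbert_Choice.inv f"]) (auto simp: perm_group_def bij_imp_bij_inv bij_is_inj)
qed (auto simp: perm_group_def bij_comp o_assoc)

text \<open>An action on a subset \<open>X\<close> is extended by the identity to a permutation of the whole
  type; this gives every action the same target group, so that the universal properties apply to it.\<close>
lemma perm_group_hom:
  assumes K: "group K"
    and cl: "\<And>a x. a \<in> carrier K \<Longrightarrow> x \<in> X \<Longrightarrow> f a x \<in> X"
    and one: "\<And>x. x \<in> X \<Longrightarrow> f \<one>\<^bsub>K\<^esub> x = x"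
    and mult: "\<And>a b x. a \<in> carrier K \<Longrightarrow> b \<in> carrier K \<Longrightarrow> x \<in> X \<Longrightarrow> f (a \<otimes>\<^bsub>K\<^esub> b) x = f a (f b x)"
  shows "(\<lambda>a x. if x \<in> X then f a x else x) \<in> hom K (perm_group)"
proof (rule homI)
  interpret K: group K by fact
  fix a assume a: "a \<in> carrier K"
  have "bij (\<lambda>x. if x \<in> X then f a x else x)"
    by (rule bij_betw_byWitness[where f' = "\<lambda>x. if x \<in> X then f (inv\<^bsub>K\<^esub> a) x else x"])
      (use a cl one in \<open>auto simp flip: mult\<close>)
  then show "(\<lambda>x. if x \<in> X then f a x else x) \<in> carrier (perm_group)"
    by (simp add: perm_group_def)
  fix b assume b: "b \<in> carrier K"
  show "(\<lambda>x. if x \<in> X then f (a \<otimes>\<^bsub>K\<^esub> b) x else x) =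
      (\<lambda>x. if x \<in> X then f a x else x) \<otimes>\<^bsub>perm_group\<^esub> (\<lambda>x. if x \<in> X then f b x else x)"
    using a b cl mult by (auto simp: perm_group_def)
qed

text \<open>As an \<open>H\<close>-set, \<open>K\<close> is free, hence the product of \<open>H\<close> with a
  transversal, the range of \<open>p\<close>; \<open>c\<close> is the \<open>H\<close>-coordinate,
  normalised to be trivial on the transversal.\<close>
lemma orbit_transversal:
  assumes H: "group H" and K: "group K" and i: "i \<in> hom H K" and inj: "inj_on i (carrier H)"
  obtains c p where "\<And>x. x \<in> carrier K \<Longrightarrow> c x \<in> carrier H" "\<And>x. x \<in> carrier K \<Longrightarrow> p x \<in> carrier K"
    "\<And>x. x \<in> carrier K \<Longrightarrow> i (c x) \<otimes>\<^bsub>K\<^esub> p x = x"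
    "\<And>h x. h \<in> carrier H \<Longrightarrow> x \<in> carrier K \<Longrightarrow> c (i h \<otimes>\<^bsub>K\<^esub> x) = h \<otimes>\<^bsub>H\<^esub> c x"
    "\<And>h x. h \<in> carrier H \<Longrightarrow> x \<in> carrier K \<Longrightarrow> p (i h \<otimes>\<^bsub>K\<^esub> x) = p x"
    "\<And>x. x \<in> carrier K \<Longrightarrow> p (p x) = p x" "\<And>x. x \<in> carrier K \<Longrightarrow> c (p x) = \<one>\<^bsub>H\<^esub>"
proof -
  interpret H: group H by fact
  interpret K: group K by fact
  interpret i: group_hom H K i using i by unfold_locales
  define orb where "orb x = (\<lambda>h. i h \<otimes>\<^bsub>K\<^esub> x) ` carrier H" for x
  define p where "p x = (SOME y. y \<in> orb x)" for x
  define c where "c x = (THE h. h \<in> carrier H \<and> i h \<otimes>\<^bsub>K\<^esub> p x = x)" for x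
  have porb: "p x \<in> orb x" if "x \<in> carrier K" for x
    unfolding p_def by (rule someI[of _ "i \<one>\<^bsub>H\<^esub> \<otimes>\<^bsub>K\<^esub> x"]) (unfold orb_def, blast)
  have pc: "p x \<in> carrier K" if "x \<in> carrier K" for x
    using porb[OF that] that by (auto simp: orb_def)
  have cx: "c x = h" if "h \<in> carrier H" "i h \<otimes>\<^bsub>K\<^esub> p x = x" "x \<in> carrier K" for h x
    unfolding c_def
  proof (rule the_equality)
    fix h' assume h': "h' \<in> carrier H \<and> i h' \<otimes>\<^bsub>K\<^esub> p x = x"
    then have "i h' \<otimes>\<^bsub>K\<^esub> p x = i h \<otimes>\<^bsub>K\<^esub> p x" using that by simp
    then have "i h' = i h" using that h' pc[OF that(3)] by (meson K.right_cancel i.hom_closed)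
    then show "h' = h" using inj h' that by (auto dest: inj_onD)
  qed (use that in simp)
  have ex: "c x \<in> carrier H \<and> i (c x) \<otimes>\<^bsub>K\<^esub> p x = x" if x: "x \<in> carrier K" for x
  proof -
    obtain h where h: "h \<in> carrier H" "p x = i h \<otimes>\<^bsub>K\<^esub> x" using porb[OF x] by (auto simp: orb_def)
    then have "i (inv\<^bsub>H\<^esub> h) \<otimes>\<^bsub>K\<^esub> p x = x" using x by (simp add: K.m_assoc[symmetric])
    with h x cx[of "inv\<^bsub>H\<^esub> h" x] show ?thesis by simp
  qed
  have orb_sub: "orb (i h \<otimes>\<^bsub>K\<^esub> x) \<subseteq> orb x" if "h \<in> carrier H" "x \<in> carrier K" for h x
  proof
    fix y assume "y \<in> orb (i h \<otimes>\<^bsub>K\<^esub> x)"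
    then obtain h' where h': "h' \<in> carrier H" "y = i h' \<otimes>\<^bsub>K\<^esub> (i h \<otimes>\<^bsub>K\<^esub> x)"
      by (auto simp: orb_def)
    then have "y = i (h' \<otimes>\<^bsub>H\<^esub> h) \<otimes>\<^bsub>K\<^esub> x" using that by (simp add: K.m_assoc)
    then show "y \<in> orb x" using that h' unfolding orb_def by blast
  qed
  have orbeq: "orb (i h \<otimes>\<^bsub>K\<^esub> x) = orb x" if "h \<in> carrier H" "x \<in> carrier K" for h x
  proof
    have "i (inv\<^bsub>H\<^esub> h) \<otimes>\<^bsub>K\<^esub> (i h \<otimes>\<^bsub>K\<^esub> x) = x" using that by (simp add: K.m_assoc[symmetric])
    then show "orb x \<subseteq> orb (i h \<otimes>\<^bsub>K\<^esub> x)"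
      using orb_sub[of "inv\<^bsub>H\<^esub> h" "i h \<otimes>\<^bsub>K\<^esub> x"] that by simp
  qed (rule orb_sub[OF that])
  have pi: "p (i h \<otimes>\<^bsub>K\<^esub> x) = p x" if "h \<in> carrier H" "x \<in> carrier K" for h x
    using orbeq[OF that] by (simp add: p_def)
  have ci: "c (i h \<otimes>\<^bsub>K\<^esub> x) = h \<otimes>\<^bsub>H\<^esub> c x" if "h \<in> carrier H" "x \<in> carrier K" for h x
    using that ex[OF that(2)] pc[OF that(2)] by (intro cx) (simp_all add: pi K.m_assoc)
  have px: "p x = i (inv\<^bsub>H\<^esub> c x) \<otimes>\<^bsub>K\<^esub> x" if "x \<in> carrier K" for x
    using ex[OF that] pc[OF that] that by (simp add: K.inv_solve_left)
  show ?thesis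
  proof (rule that[of c p])
    fix x assume x: "x \<in> carrier K"
    show "p (p x) = p x" using pi[of "inv\<^bsub>H\<^esub> c x" x, folded px[OF x]] ex[OF x] x by simp
    show "c (p x) = \<one>\<^bsub>H\<^esub>" using ci[of "inv\<^bsub>H\<^esub> c x" x, folded px[OF x]] ex[OF x] x by simp
  qed (use ex pc pi ci in auto)
qed

text \<open>Let \<open>R1\<close>, \<open>R2\<close> be transversals of the cosets of \<open>H\<close> in the
  factors. As sets with an action of \<open>H\<close>, \<open>G1 \<times> R2\<close> and \<open>R1
  \<times> G2\<close> are both \<open>R1 \<times> H \<times> R2\<close>, so the translation actions of
  \<open>G1\<close> and \<open>G2\<close> on them can be put on one set in such a way that they agree
  on \<open>H\<close>. The universal property extends them to an action of \<open>G\<close>, and both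
  factors act freely, so no nontrivial element of a factor dies in \<open>G\<close>. This avoids the
  normal form theorem.\<close>
lemma amalgam_embeds:
  assumes A: "injective_amalgam A"
  shows "inj_on (am_j1 A) (carrier (am_G1 A))" "inj_on (am_j2 A) (carrier (am_G2 A))"
proof -
  have afp: "amalgamated_free_product A"
    and inj: "inj_on (am_i1 A) (carrier (am_H A))" "inj_on (am_i2 A) (carrier (am_H A))"
    using A by (auto simp: injective_amalgam_def)
  have g: "group (am_H A)" "group (am_G1 A)" "group (am_G2 A)" "group (am_G A)"
    and i: "am_i1 A \<in> hom (am_H A) (am_G1 A)" "am_i2 A \<in> hom (am_H A) (am_G2 A)"
    using afp by (simp_all add: amalgamated_free_product_def)
  interpret H: group "am_H A" by (rule g)
  interpret G1: group "am_G1 A" by (rule g)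
  interpret G2: group "am_G2 A" by (rule g)
  note ic = hom_in_carrier[OF i(1)] hom_in_carrier[OF i(2)]
  obtain c1 p1 where 1: "\<And>x. x \<in> carrier (am_G1 A) \<Longrightarrow> c1 x \<in> carrier (am_H A)"
    "\<And>x. x \<in> carrier (am_G1 A) \<Longrightarrow> p1 x \<in> carrier (am_G1 A)"
    "\<And>x. x \<in> carrier (am_G1 A) \<Longrightarrow> am_i1 A (c1 x) \<otimes>\<^bsub>am_G1 A\<^esub> p1 x = x"
    "\<And>h x. h \<in> carrier (am_H A) \<Longrightarrow> x \<in> carrier (am_G1 A) \<Longrightarrow> c1 (am_i1 A h \<otimes>\<^bsub>am_G1 A\<^esub> x) = h \<otimes>\<^bsub>am_H A\<^esub> c1 x"
    "\<And>h x. h \<in> carrier (am_H A) \<Longrightarrow> x \<in> carrier (am_G1 A) \<Longrightarrow> p1 (am_i1 A h \<otimes>\<^bsub>am_G1 A\<^esub> x) = p1 x"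
    "\<And>x. x \<in> carrier (am_G1 A) \<Longrightarrow> p1 (p1 x) = p1 x" "\<And>x. x \<in> carrier (am_G1 A) \<Longrightarrow> c1 (p1 x) = \<one>\<^bsub>am_H A\<^esub>"
    by (rule orbit_transversal[OF g(1,2) i(1) inj(1)]) blast
  obtain c2 p2 where 2: "\<And>x. x \<in> carrier (am_G2 A) \<Longrightarrow> c2 x \<in> carrier (am_H A)"
    "\<And>x. x \<in> carrier (am_G2 A) \<Longrightarrow> p2 x \<in> carrier (am_G2 A)"
    "\<And>x. x \<in> carrier (am_G2 A) \<Longrightarrow> am_i2 A (c2 x) \<otimes>\<^bsub>am_G2 A\<^esub> p2 x = x"
    "\<And>h x. h \<in> carrier (am_H A) \<Longrightarrow> x \<in> carrier (am_G2 A) \<Longrightarrow> c2 (am_i2 A h \<otimes>\<^bsub>am_G2 A\<^esub> x) = h \<otimes>\<^bsub>am_H A\<^esub> c2 x"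
    "\<And>h x. h \<in> carrier (am_H A) \<Longrightarrow> x \<in> carrier (am_G2 A) \<Longrightarrow> p2 (am_i2 A h \<otimes>\<^bsub>am_G2 A\<^esub> x) = p2 x"
    "\<And>x. x \<in> carrier (am_G2 A) \<Longrightarrow> p2 (p2 x) = p2 x" "\<And>x. x \<in> carrier (am_G2 A) \<Longrightarrow> c2 (p2 x) = \<one>\<^bsub>am_H A\<^esub>"
    by (rule orbit_transversal[OF g(1,3) i(2) inj(2)]) blast
  define X where "X = carrier (am_G1 A) \<times> p2 ` carrier (am_G2 A)"
  define Y where "Y = p1 ` carrier (am_G1 A) \<times> carrier (am_G2 A)"
  define \<beta> where "\<beta> = (\<lambda>(x, r). (p1 x, am_i2 A (c1 x) \<otimes>\<^bsub>am_G2 A\<^esub> r))"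
  define \<gamma> where "\<gamma> = (\<lambda>(r, y). (am_i1 A (c2 y) \<otimes>\<^bsub>am_G1 A\<^esub> r, p2 y))"
  have \<beta>: "\<beta> u \<in> Y" "\<gamma> (\<beta> u) = u" if "u \<in> X" for u
    using that 1 2 ic by (auto simp: X_def Y_def \<beta>_def \<gamma>_def)
  have \<gamma>: "\<gamma> v \<in> X" "\<beta> (\<gamma> v) = v" if "v \<in> Y" for v
    using that 1 2 ic by (auto simp: X_def Y_def \<beta>_def \<gamma>_def)
  define f1 where "f1 a = (\<lambda>(x, r :: 'c). (a \<otimes>\<^bsub>am_G1 A\<^esub> x, r))" for a
  define m2 where "m2 b = (\<lambda>(r :: 'b, y). (r, b \<otimes>\<^bsub>am_G2 A\<^esub> y))" for b
  define f2 where "f2 b u = \<gamma> (m2 b (\<beta> u))" for b u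
  have m2: "m2 b v \<in> Y" if "b \<in> carrier (am_G2 A)" "v \<in> Y" for b v
    using that by (auto simp: m2_def Y_def)
  have r1: "(\<lambda>a u. if u \<in> X then f1 a u else u) \<in> hom (am_G1 A) (perm_group)"
    by (rule perm_group_hom[OF g(2)]) (auto simp: X_def f1_def G1.m_assoc)
  have r2: "(\<lambda>b u. if u \<in> X then f2 b u else u) \<in> hom (am_G2 A) (perm_group)"
  proof (rule perm_group_hom[OF g(3)])
    fix b u assume bu: "b \<in> carrier (am_G2 A)" "u \<in> X"
    then show "f2 b u \<in> X" by (simp add: f2_def \<beta> \<gamma> m2)
    fix b' assume "b' \<in> carrier (am_G2 A)"
    with bu \<beta>(1)[OF bu(2)] have "m2 (b' \<otimes>\<^bsub>am_G2 A\<^esub> b) (\<beta> u) = m2 b' (m2 b (\<beta> u))"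
      by (auto simp: m2_def Y_def G2.m_assoc)
    with bu show "f2 (b' \<otimes>\<^bsub>am_G2 A\<^esub> b) u = f2 b' (f2 b u)"
      by (simp add: f2_def \<beta> \<gamma> m2)
  next
    fix u assume u: "u \<in> X"
    then have "m2 \<one>\<^bsub>am_G2 A\<^esub> (\<beta> u) = \<beta> u" using \<beta>(1)[OF u] by (auto simp: m2_def Y_def)
    then show "f2 \<one>\<^bsub>am_G2 A\<^esub> u = u" by (simp add: f2_def \<beta> u)
  qed
  have "f1 (am_i1 A h) u = f2 (am_i2 A h) u" if "h \<in> carrier (am_H A)" "u \<in> X" for h u
  proof -
    have "\<beta> (f1 (am_i1 A h) u) = m2 (am_i2 A h) (\<beta> u)"
      using that 1 2 i ic by (auto simp: X_def f1_def m2_def \<beta>_def G2.m_assoc hom_mult)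
    moreover have "f1 (am_i1 A h) u \<in> X" using that ic by (auto simp: X_def f1_def)
    ultimately show ?thesis using \<beta>(2)[of "f1 (am_i1 A h) u"] by (simp add: f2_def)
  qed
  then have eq: "(\<lambda>u. if u \<in> X then f1 (am_i1 A h) u else u) = (\<lambda>u. if u \<in> X then f2 (am_i2 A h) u else u)"
    if "h \<in> carrier (am_H A)" for h
    using that by auto
  obtain \<rho> where \<rho>: "\<And>a. a \<in> carrier (am_G1 A) \<Longrightarrow> \<rho> (am_j1 A a) = (\<lambda>u. if u \<in> X then f1 a u else u)"
    "\<And>b. b \<in> carrier (am_G2 A) \<Longrightarrow> \<rho> (am_j2 A b) = (\<lambda>u. if u \<in> X then f2 b u else u)"
  proof (rule pushout_universal[OF afp group_perm_group r1 r2 eq], goal_cases)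
    case (2 g)
    from 2(1)[OF 2(3,4)] show ?case .
  qed
  define u where "u = (\<one>\<^bsub>am_G1 A\<^esub>, p2 \<one>\<^bsub>am_G2 A\<^esub>)"
  have u: "u \<in> X" by (simp add: u_def X_def)
  show "inj_on (am_j1 A) (carrier (am_G1 A))"
  proof (rule inj_onI)
    fix a a' assume "a \<in> carrier (am_G1 A)" "a' \<in> carrier (am_G1 A)" "am_j1 A a = am_j1 A a'"
    with \<rho>(1)[of a] \<rho>(1)[of a'] u have "f1 a u = f1 a' u" by (auto dest: fun_cong[of _ _ u])
    with \<open>a \<in> _\<close> \<open>a' \<in> _\<close> show "a = a'" by (simp add: f1_def u_def)
  qed
  show "inj_on (am_j2 A) (carrier (am_G2 A))"
  proof (rule inj_onI)
    fix b b' assume b: "b \<in> carrier (am_G2 A)" "b' \<in> carrier (am_G2 A)" "am_j2 A b = am_j2 A b'"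
    with \<rho>(2)[of b] \<rho>(2)[of b'] u have "f2 b u = f2 b' u" by (auto dest: fun_cong[of _ _ u])
    then have "m2 b (\<beta> u) = m2 b' (\<beta> u)"
      using \<gamma>(2) m2 b \<beta>(1)[OF u] by (metis f2_def)
    with b \<beta>(1)[OF u] show "b = b'" by (auto simp: m2_def Y_def)
  qed
qed

text \<open>The same idea needs a permutation \<open>\<tau>\<close> for the stable letter that intertwines the
  two actions of \<open>H\<close> on \<open>G1\<close>. The two transversals may differ in size, so
  \<open>G1\<close> is multiplied by two infinite tapes, filled with representatives of the cosets of
  \<open>i1(H)\<close> and of \<open>i2(H)\<close>: \<open>\<tau>\<close> splits off the
  \<open>i2(H)\<close>-representative of its argument, pushes it on the second tape, and completes the
  remaining element of \<open>H\<close>, read through \<open>i1\<close>, with a representative popped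
  from the first tape.\<close>
lemma hnn_embeds:
  assumes B: "injective_hnn B"
  shows "inj_on (hn_j1 B) (carrier (hn_G1 B))"
proof -
  have he: "hnn_extension B"
    and inj: "inj_on (hn_i1 B) (carrier (hn_H B))" "inj_on (hn_i2 B) (carrier (hn_H B))"
    using B by (auto simp: injective_hnn_def)
  have g: "group (hn_H B)" "group (hn_G1 B)" "group (hn_G B)"
    and i: "hn_i1 B \<in> hom (hn_H B) (hn_G1 B)" "hn_i2 B \<in> hom (hn_H B) (hn_G1 B)"
    using he by (simp_all add: hnn_extension_def)
  interpret H: group "hn_H B" by (rule g)
  interpret G1: group "hn_G1 B" by (rule g)
  note ic = hom_in_carrier[OF i(1)] hom_in_carrier[OF i(2)]
  obtain c1 p1 where 1: "\<And>x. x \<in> carrier (hn_G1 B) \<Longrightarrow> c1 x \<in> carrier (hn_H B)"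
    "\<And>x. x \<in> carrier (hn_G1 B) \<Longrightarrow> p1 x \<in> carrier (hn_G1 B)"
    "\<And>x. x \<in> carrier (hn_G1 B) \<Longrightarrow> hn_i1 B (c1 x) \<otimes>\<^bsub>hn_G1 B\<^esub> p1 x = x"
    "\<And>h x. h \<in> carrier (hn_H B) \<Longrightarrow> x \<in> carrier (hn_G1 B) \<Longrightarrow> c1 (hn_i1 B h \<otimes>\<^bsub>hn_G1 B\<^esub> x) = h \<otimes>\<^bsub>hn_H B\<^esub> c1 x"
    "\<And>h x. h \<in> carrier (hn_H B) \<Longrightarrow> x \<in> carrier (hn_G1 B) \<Longrightarrow> p1 (hn_i1 B h \<otimes>\<^bsub>hn_G1 B\<^esub> x) = p1 x"
    "\<And>x. x \<in> carrier (hn_G1 B) \<Longrightarrow> p1 (p1 x) = p1 x" "\<And>x. x \<in> carrier (hn_G1 B) \<Longrightarrow> c1 (p1 x) = \<one>\<^bsub>hn_H B\<^esub>"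
    by (rule orbit_transversal[OF g(1,2) i(1) inj(1)]) blast
  obtain c2 p2 where 2: "\<And>x. x \<in> carrier (hn_G1 B) \<Longrightarrow> c2 x \<in> carrier (hn_H B)"
    "\<And>x. x \<in> carrier (hn_G1 B) \<Longrightarrow> p2 x \<in> carrier (hn_G1 B)"
    "\<And>x. x \<in> carrier (hn_G1 B) \<Longrightarrow> hn_i2 B (c2 x) \<otimes>\<^bsub>hn_G1 B\<^esub> p2 x = x"
    "\<And>h x. h \<in> carrier (hn_H B) \<Longrightarrow> x \<in> carrier (hn_G1 B) \<Longrightarrow> c2 (hn_i2 B h \<otimes>\<^bsub>hn_G1 B\<^esub> x) = h \<otimes>\<^bsub>hn_H B\<^esub> c2 x"
    "\<And>h x. h \<in> carrier (hn_H B) \<Longrightarrow> x \<in> carrier (hn_G1 B) \<Longrightarrow> p2 (hn_i2 B h \<otimes>\<^bsub>hn_G1 B\<^esub> x) = p2 x"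
    "\<And>x. x \<in> carrier (hn_G1 B) \<Longrightarrow> p2 (p2 x) = p2 x" "\<And>x. x \<in> carrier (hn_G1 B) \<Longrightarrow> c2 (p2 x) = \<one>\<^bsub>hn_H B\<^esub>"
    by (rule orbit_transversal[OF g(1,2) i(2) inj(2)]) blast
  define X where "X = {(x, q, r). x \<in> carrier (hn_G1 B) \<and> (\<forall>n :: nat. q n \<in> p1 ` carrier (hn_G1 B)) \<and>
    (\<forall>n :: nat. r n \<in> p2 ` carrier (hn_G1 B))}"
  define \<tau> where "\<tau> = (\<lambda>(x, q, r). (hn_i1 B (c2 x) \<otimes>\<^bsub>hn_G1 B\<^esub> q 0, q \<circ> Suc, case_nat (p2 x) r))"
  define \<tau>' where "\<tau>' = (\<lambda>(x, q, r). (hn_i2 B (c1 x) \<otimes>\<^bsub>hn_G1 B\<^esub> r 0, case_nat (p1 x) q, r \<circ> Suc))"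
  have p_c: "x \<in> carrier (hn_G1 B)" "p1 x = x" "c1 x = \<one>\<^bsub>hn_H B\<^esub>" if "x \<in> p1 ` carrier (hn_G1 B)" for x
    using that 1 by auto
  have p_c': "x \<in> carrier (hn_G1 B)" "p2 x = x" "c2 x = \<one>\<^bsub>hn_H B\<^esub>" if "x \<in> p2 ` carrier (hn_G1 B)" for x
    using that 2 by auto
  have cn: "case_nat (q (0::nat)) (q \<circ> Suc) = q" for q :: "nat \<Rightarrow> 'b"
    by (auto split: nat.split)
  have cs: "case_nat a q \<circ> Suc = q" for a and q :: "nat \<Rightarrow> 'b"
    by auto
  have cp: "case_nat a q n \<in> T" if "a \<in> T" "\<And>n. q n \<in> T" for a and q :: "nat \<Rightarrow> 'b" and n T
    using that by (cases n) auto
  have \<tau>: "\<tau> u \<in> X" "\<tau>' (\<tau> u) = u" if "u \<in> X" for u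
  proof -
    obtain x q r where uxqr: "u = (x, q, r)" by (cases u)
    then have u: "u = (x, q, r)" "x \<in> carrier (hn_G1 B)" "\<And>n. q n \<in> p1 ` carrier (hn_G1 B)"
      "\<And>n. r n \<in> p2 ` carrier (hn_G1 B)"
      using that by (simp_all add: X_def)
    show "\<tau> u \<in> X" "\<tau>' (\<tau> u) = u"
      using u 1 2 ic p_c[OF u(3)] cn[of q]
      by (auto simp: X_def \<tau>_def \<tau>'_def cs intro!: cp)
  qed
  have \<tau>': "\<tau>' u \<in> X" "\<tau> (\<tau>' u) = u" if "u \<in> X" for u
  proof -
    obtain x q r where uxqr: "u = (x, q, r)" by (cases u)
    then have u: "u = (x, q, r)" "x \<in> carrier (hn_G1 B)" "\<And>n. q n \<in> p1 ` carrier (hn_G1 B)"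
      "\<And>n. r n \<in> p2 ` carrier (hn_G1 B)"
      using that by (simp_all add: X_def)
    show "\<tau>' u \<in> X" "\<tau> (\<tau>' u) = u"
      using u 1 2 ic p_c'[OF u(4)] cn[of r]
      by (auto simp: X_def \<tau>_def \<tau>'_def cs intro!: cp)
  qed
  define f where "f a = (\<lambda>(x, q :: nat \<Rightarrow> 'b, r :: nat \<Rightarrow> 'b). (a \<otimes>\<^bsub>hn_G1 B\<^esub> x, q, r))" for a
  have fX: "f a u \<in> X" if "a \<in> carrier (hn_G1 B)" "u \<in> X" for a u
    using that by (auto simp: f_def X_def)
  have r: "(\<lambda>a u. if u \<in> X then f a u else u) \<in> hom (hn_G1 B) (perm_group)"
    by (rule perm_group_hom[OF g(2)]) (auto simp: X_def f_def G1.m_assoc)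
  have "bij (\<lambda>u. if u \<in> X then \<tau> u else u)"
    by (rule bij_betw_byWitness[where f' = "\<lambda>u. if u \<in> X then \<tau>' u else u"]) (use \<tau> \<tau>' in auto)
  then have t: "(\<lambda>u. if u \<in> X then \<tau> u else u) \<in> carrier (perm_group)"
    by (simp add: perm_group_def)
  have eq: "f (hn_i1 B h) (\<tau> u) = \<tau> (f (hn_i2 B h) u)" if "h \<in> carrier (hn_H B)" "u \<in> X" for h u
    using that 1 2 i ic p_c(1) by (auto simp: X_def f_def \<tau>_def hom_mult G1.m_assoc)
  have eq': "(\<lambda>u. if u \<in> X then f (hn_i1 B h) u else u) \<otimes>\<^bsub>perm_group\<^esub> (\<lambda>u. if u \<in> X then \<tau> u else u) =
      (\<lambda>u. if u \<in> X then \<tau> u else u) \<otimes>\<^bsub>perm_group\<^esub> (\<lambda>u. if u \<in> X then f (hn_i2 B h) u else u)"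
    if "h \<in> carrier (hn_H B)" for h
    using eq[OF that] \<tau>(1) fX[OF ic(2)[OF that]] by (auto simp: perm_group_def)
  obtain \<rho> where \<rho>: "\<And>a. a \<in> carrier (hn_G1 B) \<Longrightarrow> \<rho> (hn_j1 B a) = (\<lambda>u. if u \<in> X then f a u else u)"
  proof (rule hnn_universal[OF he group_perm_group r t eq'], goal_cases)
    case (2 g)
    from 2(1)[OF 2(3)] show ?case .
  qed
  define u where "u = (\<one>\<^bsub>hn_G1 B\<^esub>, (\<lambda>_ :: nat. p1 \<one>\<^bsub>hn_G1 B\<^esub>), (\<lambda>_ :: nat. p2 \<one>\<^bsub>hn_G1 B\<^esub>))"
  have u: "u \<in> X" by (simp add: u_def X_def)
  show ?thesis
  proof (rule inj_onI)
    fix a a' assume "a \<in> carrier (hn_G1 B)" "a' \<in> carrier (hn_G1 B)" "hn_j1 B a = hn_j1 B a'"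
    with \<rho>[of a] \<rho>[of a'] u have "f a u = f a' u" by (auto dest: fun_cong[of _ _ u])
    with \<open>a \<in> _\<close> \<open>a' \<in> _\<close> show "a = a'" by (simp add: f_def u_def)
  qed
qed

section \<open>Potentials on the cosets\<close>

text \<open>The semidirect product of the functions \<open>G \<rightarrow> \<int>\<close> by \<open>G\<close>,
  acting by right translation of the argument. A homomorphism \<open>G \<rightarrow> crossed G\<close>
  over the identity of \<open>G\<close> is a 1-cocycle, so a universal property of \<open>G\<close>
  becomes a recipe for cocycles.\<close>
definition crossed :: "'g monoid \<Rightarrow> (('g \<Rightarrow> int) \<times> 'g) monoid" where
  "crossed G = \<lparr>carrier = (carrier G \<rightarrow>\<^sub>E UNIV) \<times> carrier G,
     mult = (\<lambda>(\<phi>, g) (\<psi>, h). (\<lambda>x\<in>carrier G. \<phi> x + \<psi> (x \<otimes>\<^bsub>G\<^esub> g), g \<otimes>\<^bsub>G\<^esub> h)),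
     one = (\<lambda>x\<in>carrier G. 0, \<one>\<^bsub>G\<^esub>)\<rparr>"

lemma group_crossed:
  assumes "group G" shows "group (crossed G)"
proof -
  interpret G: group G by fact
  show ?thesis
  proof (rule groupI)
    fix u assume u: "u \<in> carrier (crossed G)"
    obtain \<phi> g where pg: "u = (\<phi>, g)" by (cases u)
    show "\<exists>v \<in> carrier (crossed G). v \<otimes>\<^bsub>crossed G\<^esub> u = \<one>\<^bsub>crossed G\<^esub>"
      by (rule bexI[of _ "(\<lambda>x\<in>carrier G. - \<phi> (x \<otimes>\<^bsub>G\<^esub> inv\<^bsub>G\<^esub> g), inv\<^bsub>G\<^esub> g)"])
        (use u pg in \<open>auto simp: crossed_def\<close>)
  next
    fix u v w assume "u \<in> carrier (crossed G)" "v \<in> carrier (crossed G)" "w \<in> carrier (crossed G)"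
    then show "u \<otimes>\<^bsub>crossed G\<^esub> v \<otimes>\<^bsub>crossed G\<^esub> w = u \<otimes>\<^bsub>crossed G\<^esub> (v \<otimes>\<^bsub>crossed G\<^esub> w)"
      by (auto simp: crossed_def G.m_assoc intro!: restrict_ext)
  next
    fix u assume "u \<in> carrier (crossed G)"
    then show "\<one>\<^bsub>crossed G\<^esub> \<otimes>\<^bsub>crossed G\<^esub> u = u"
      by (auto simp: crossed_def restrict_def PiE_def extensional_def fun_eq_iff)
  qed (auto simp: crossed_def)
qed

text \<open>Every such cocycle is a coboundary: its value at the identity element is a potential, whose
  increments along right multiplication by \<open>g\<close> are the prescribed function attached to
  \<open>g\<close>.\<close>
lemma crossed_potential:
  assumes G: "group G" and \<rho>: "\<rho> \<in> hom G (crossed G)" and snd: "\<And>g. g \<in> carrier G \<Longrightarrow> snd (\<rho> g) = g"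
    and "x \<in> carrier G" "g \<in> carrier G"
  shows "fst (\<rho> (x \<otimes>\<^bsub>G\<^esub> g)) \<one>\<^bsub>G\<^esub> = fst (\<rho> x) \<one>\<^bsub>G\<^esub> + fst (\<rho> g) x"
proof -
  interpret G: group G by fact
  have "\<rho> (x \<otimes>\<^bsub>G\<^esub> g) = \<rho> x \<otimes>\<^bsub>crossed G\<^esub> \<rho> g" using assms by (simp add: hom_mult)
  then show ?thesis using snd[of x] assms by (simp add: crossed_def case_prod_beta)
qed

lemma snd_crossed_hom: "snd \<in> hom (crossed G) G"
  by (rule homI) (auto simp: crossed_def)

lemma subgroup_mult_right_iff:
  assumes G: "group G" and S: "subgroup S G" and x: "x \<in> carrier G" and y: "y \<in> S"
  shows "x \<otimes>\<^bsub>G\<^esub> y \<in> S \<longleftrightarrow> x \<in> S"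
proof
  interpret G: group G by fact
  have yc: "y \<in> carrier G" using subgroup.mem_carrier[OF S y] .
  assume "x \<otimes>\<^bsub>G\<^esub> y \<in> S"
  then have "(x \<otimes>\<^bsub>G\<^esub> y) \<otimes>\<^bsub>G\<^esub> inv\<^bsub>G\<^esub> y \<in> S"
    using subgroup.m_closed[OF S] subgroup.m_inv_closed[OF S y] by blast
  then show "x \<in> S" using x yc by (simp add: G.m_assoc)
qed (use S y in \<open>simp add: subgroup.m_closed\<close>)

text \<open>In the Bass-Serre tree the cosets \<open>xG1\<close>, \<open>xG2\<close> are the vertices and
  \<open>xH\<close> is the edge between them. The pair \<open>w1\<close>, \<open>w2\<close> is a
  function on the vertices that jumps by one across the edge \<open>H\<close> and across no other
  edge: up to a constant, the indicator of one of the two halves into which that edge cuts the tree.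
  It is found without the tree as the potential of the cocycle that is zero on \<open>G1\<close> and
  the coboundary of the indicator of \<open>H\<close> on \<open>G2\<close>.\<close>
lemma amalgam_potential:
  assumes A: "amalgamated_free_product A"
  obtains w1 w2 :: "'g \<Rightarrow> int" where
    "\<And>x a. x \<in> carrier (am_G A) \<Longrightarrow> a \<in> carrier (am_G1 A) \<Longrightarrow> w1 (x \<otimes>\<^bsub>am_G A\<^esub> am_j1 A a) = w1 x"
    "\<And>x b. x \<in> carrier (am_G A) \<Longrightarrow> b \<in> carrier (am_G2 A) \<Longrightarrow> w2 (x \<otimes>\<^bsub>am_G A\<^esub> am_j2 A b) = w2 x"
    "\<And>x. x \<in> carrier (am_G A) \<Longrightarrow> w1 x - w2 x = of_bool (x \<in> am_k A ` carrier (am_H A))"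
proof -
  let ?G = "am_G A"
  have g: "group (am_H A)" "group (am_G1 A)" "group (am_G2 A)" "group ?G"
    and i: "am_i1 A \<in> hom (am_H A) (am_G1 A)" "am_i2 A \<in> hom (am_H A) (am_G2 A)"
    using A by (simp_all add: amalgamated_free_product_def)
  interpret H: group "am_H A" by (rule g)
  interpret G1: group "am_G1 A" by (rule g)
  interpret G2: group "am_G2 A" by (rule g)
  interpret G: group ?G by (rule g)
  note j = pushout_morphisms[OF A]
  note jc = hom_in_carrier[OF j(1)] hom_in_carrier[OF j(2)]
  have k: "am_k A \<in> hom (am_H A) ?G" unfolding am_k_def by (rule hom_compose[OF i(1) j(1)])
  interpret k: group_hom "am_H A" ?G "am_k A" using k by unfold_locales
  define \<epsilon> :: "'g \<Rightarrow> int" where "\<epsilon> x = of_bool (x \<in> am_k A ` carrier (am_H A))" for x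
  have \<epsilon>: "\<epsilon> (x \<otimes>\<^bsub>?G\<^esub> am_k A h) = \<epsilon> x" if "x \<in> carrier ?G" "h \<in> carrier (am_H A)" for x h
    using subgroup_mult_right_iff[OF G.is_group k.img_is_subgroup that(1)] that(2) by (simp add: \<epsilon>_def)
  define f1 where "f1 a = (\<lambda>x\<in>carrier ?G. 0 :: int, am_j1 A a)" for a
  define f2 where "f2 b = (\<lambda>x\<in>carrier ?G. \<epsilon> (x \<otimes>\<^bsub>?G\<^esub> am_j2 A b) - \<epsilon> x, am_j2 A b)" for b
  have f1: "f1 \<in> hom (am_G1 A) (crossed ?G)"
    by (rule homI) (use j jc in \<open>auto simp: f1_def crossed_def hom_mult intro!: restrict_ext\<close>)
  have f2: "f2 \<in> hom (am_G2 A) (crossed ?G)"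
    by (rule homI) (use j jc in \<open>auto simp: f2_def crossed_def hom_mult G.m_assoc intro!: restrict_ext\<close>)
  have f12: "f1 (am_i1 A h) = f2 (am_i2 A h)" if "h \<in> carrier (am_H A)" for h
    using \<epsilon>[OF _ that] j(3)[OF that] by (auto simp: f1_def f2_def am_k_def intro!: restrict_ext)
  obtain \<rho> where \<rho>: "\<rho> \<in> hom ?G (crossed ?G)"
    "\<And>a. a \<in> carrier (am_G1 A) \<Longrightarrow> \<rho> (am_j1 A a) = f1 a"
    "\<And>b. b \<in> carrier (am_G2 A) \<Longrightarrow> \<rho> (am_j2 A b) = f2 b"
    by (rule pushout_universal[OF A group_crossed[OF g(4)] f1 f2 f12]) blast+
  have snd: "snd (\<rho> x) = x" if x: "x \<in> carrier ?G" for x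
  proof -
    \<comment> \<open>uniqueness in the universal property: \<open>snd \<circ> \<rho>\<close> and the identity agree
      on the generators\<close>
    obtain r where r: "\<And>g' x. g' \<in> hom ?G ?G \<Longrightarrow> (\<And>a. a \<in> carrier (am_G1 A) \<Longrightarrow> g' (am_j1 A a) = am_j1 A a) \<Longrightarrow>
       (\<And>b. b \<in> carrier (am_G2 A) \<Longrightarrow> g' (am_j2 A b) = am_j2 A b) \<Longrightarrow> x \<in> carrier ?G \<Longrightarrow> g' x = r x"
      by (rule pushout_universal[OF A g(4) j]) blast+
    have id_hom: "id \<in> hom ?G ?G" by (simp add: hom_def)
    have "(snd \<circ> \<rho>) x = r x" "id x = r x"
      by (rule r[OF hom_compose[OF \<rho>(1) snd_crossed_hom] _ _ x] r[OF id_hom _ _ x]; simp add: \<rho> f1_def f2_def)+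
    then show ?thesis by simp
  qed
  note w = crossed_potential[OF g(4) \<rho>(1) snd]
  show ?thesis
  proof (rule that[of "\<lambda>x. fst (\<rho> x) \<one>\<^bsub>?G\<^esub>" "\<lambda>x. fst (\<rho> x) \<one>\<^bsub>?G\<^esub> - \<epsilon> x"])
    fix x b assume "x \<in> carrier ?G" "b \<in> carrier (am_G2 A)"
    then show "fst (\<rho> (x \<otimes>\<^bsub>?G\<^esub> am_j2 A b)) \<one>\<^bsub>?G\<^esub> - \<epsilon> (x \<otimes>\<^bsub>?G\<^esub> am_j2 A b) = fst (\<rho> x) \<one>\<^bsub>?G\<^esub> - \<epsilon> x"
      by (simp add: w jc \<rho> f2_def)
  qed (simp_all add: w jc \<rho> f1_def \<epsilon>_def)
qed

text \<open>Here the vertices are the cosets \<open>xG1\<close>, and the edge \<open>xH\<close> joins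
  \<open>xG1\<close> to \<open>xtG1\<close>.\<close>
lemma hnn_potential:
  assumes B: "hnn_extension B"
  obtains w :: "'g \<Rightarrow> int" where
    "\<And>x a. x \<in> carrier (hn_G B) \<Longrightarrow> a \<in> carrier (hn_G1 B) \<Longrightarrow> w (x \<otimes>\<^bsub>hn_G B\<^esub> hn_j1 B a) = w x"
    "\<And>x. x \<in> carrier (hn_G B) \<Longrightarrow> w x - w (x \<otimes>\<^bsub>hn_G B\<^esub> hn_t B) = of_bool (x \<in> hn_k B ` carrier (hn_H B))"
proof -
  let ?G = "hn_G B"
  have g: "group (hn_H B)" "group (hn_G1 B)" "group ?G"
    and i: "hn_i1 B \<in> hom (hn_H B) (hn_G1 B)" "hn_i2 B \<in> hom (hn_H B) (hn_G1 B)"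
    using B by (simp_all add: hnn_extension_def)
  interpret H: group "hn_H B" by (rule g)
  interpret G1: group "hn_G1 B" by (rule g)
  interpret G: group ?G by (rule g)
  note j = hnn_morphisms[OF B]
  note jc = hom_in_carrier[OF j(1)]
  have k: "hn_k B \<in> hom (hn_H B) ?G" unfolding hn_k_def by (rule hom_compose[OF i(1) j(1)])
  interpret k: group_hom "hn_H B" ?G "hn_k B" using k by unfold_locales
  define \<epsilon> :: "'g \<Rightarrow> int" where "\<epsilon> x = of_bool (x \<in> hn_k B ` carrier (hn_H B))" for x
  have \<epsilon>: "\<epsilon> (x \<otimes>\<^bsub>?G\<^esub> hn_k B h) = \<epsilon> x" if "x \<in> carrier ?G" "h \<in> carrier (hn_H B)" for x h
    using subgroup_mult_right_iff[OF G.is_group k.img_is_subgroup that(1)] that(2) by (simp add: \<epsilon>_def)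
  define f where "f a = (\<lambda>x\<in>carrier ?G. 0 :: int, hn_j1 B a)" for a
  define \<tau> where "\<tau> = (\<lambda>x\<in>carrier ?G. - \<epsilon> x, hn_t B)"
  have f: "f \<in> hom (hn_G1 B) (crossed ?G)"
    by (rule homI) (use j jc in \<open>auto simp: f_def crossed_def hom_mult intro!: restrict_ext\<close>)
  have \<tau>: "\<tau> \<in> carrier (crossed ?G)" using j by (simp add: \<tau>_def crossed_def)
  have f\<tau>: "f (hn_i1 B h) \<otimes>\<^bsub>crossed ?G\<^esub> \<tau> = \<tau> \<otimes>\<^bsub>crossed ?G\<^esub> f (hn_i2 B h)" if "h \<in> carrier (hn_H B)" for h
    using \<epsilon>[OF _ that] j(2) j(3)[OF that] k.hom_closed[OF that]
    by (auto simp: f_def \<tau>_def crossed_def hn_k_def intro!: restrict_ext)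
  obtain \<rho> where \<rho>: "\<rho> \<in> hom ?G (crossed ?G)"
    "\<And>a. a \<in> carrier (hn_G1 B) \<Longrightarrow> \<rho> (hn_j1 B a) = f a" "\<rho> (hn_t B) = \<tau>"
    by (rule hnn_universal[OF B group_crossed[OF g(3)] f \<tau> f\<tau>]) blast+
  have snd: "snd (\<rho> x) = x" if x: "x \<in> carrier ?G" for x
  proof -
    obtain r where r: "\<And>g' x. g' \<in> hom ?G ?G \<Longrightarrow> (\<And>a. a \<in> carrier (hn_G1 B) \<Longrightarrow> g' (hn_j1 B a) = hn_j1 B a) \<Longrightarrow>
       g' (hn_t B) = hn_t B \<Longrightarrow> x \<in> carrier ?G \<Longrightarrow> g' x = r x"
      by (rule hnn_universal[OF B g(3) j]) blast+
    have id_hom: "id \<in> hom ?G ?G" by (simp add: hom_def)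
    have "(snd \<circ> \<rho>) x = r x" "id x = r x"
      by (rule r[OF hom_compose[OF \<rho>(1) snd_crossed_hom] _ _ x] r[OF id_hom _ _ x]; simp add: \<rho> f_def \<tau>_def)+
    then show ?thesis by simp
  qed
  note w = crossed_potential[OF g(3) \<rho>(1) snd]
  show ?thesis
    by (rule that[of "\<lambda>x. fst (\<rho> x) \<one>\<^bsub>?G\<^esub>"]) (simp_all add: w jc j \<rho> f_def \<tau>_def \<epsilon>_def)
qed

section \<open>Generation by the factors and finite connected sets\<close>

lemma presented_generated:
  assumes \<phi>: "\<phi> \<in> iso (presented L Q) G" and G: "group G" and x: "x \<in> carrier G"
    and one: "P \<one>\<^bsub>G\<^esub>"
    and step: "\<And>l x. l \<in> L \<Longrightarrow> x \<in> carrier G \<Longrightarrow> P x \<Longrightarrow> P (\<phi> (word_class L Q [l]) \<otimes>\<^bsub>G\<^esub> x)"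
  shows "P x"
proof -
  interpret G: group G by fact
  have hom: "\<phi> \<in> hom (presented L Q) G" using \<phi> by (simp add: iso_def)
  have c: "word_class L Q w \<in> carrier (presented L Q)" if "w \<in> lists L" for w
    using that by (simp add: presented_def)
  have ind: "P (\<phi> (word_class L Q w))" if "w \<in> lists L" for w
    using that
  proof (induction w)
    case Nil
    have "\<phi> (word_class L Q []) \<otimes>\<^bsub>G\<^esub> \<phi> (word_class L Q []) = \<phi> (word_class L Q [])"
      using hom_mult[OF hom c c, of "[]" "[]"] presented_mult[of "[]" L "[]" Q] by simp
    then have "\<phi> (word_class L Q []) = \<one>\<^bsub>G\<^esub>" using hom_in_carrier[OF hom c[of "[]"]] by simp
    then show ?case using one by simp
  next
    case (Cons l w)
    then have lw: "l \<in> L" "w \<in> lists L" by auto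
    then have "\<phi> (word_class L Q (l # w)) = \<phi> (word_class L Q [l]) \<otimes>\<^bsub>G\<^esub> \<phi> (word_class L Q w)"
      using hom_mult[OF hom c c, of "[l]" w] presented_mult[of "[l]" L w Q] by simp
    then show ?case using step[OF lw(1) hom_in_carrier[OF hom c[OF lw(2)]] Cons.IH] by simp
  qed
  have "x \<in> \<phi> ` carrier (presented L Q)" using \<phi> x by (simp add: iso_def bij_betw_def)
  then show ?thesis using ind by (auto simp: presented_def)
qed

lemma amalgam_generated:
  assumes A: "amalgamated_free_product A" and x: "x \<in> carrier (am_G A)" and one: "P \<one>\<^bsub>am_G A\<^esub>"
    and step: "\<And>s x. s \<in> am_j1 A ` carrier (am_G1 A) \<union> am_j2 A ` carrier (am_G2 A) \<Longrightarrow>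
      x \<in> carrier (am_G A) \<Longrightarrow> P x \<Longrightarrow> P (s \<otimes>\<^bsub>am_G A\<^esub> x)"
  shows "P x"
proof -
  obtain \<phi> where \<phi>: "\<phi> \<in> iso (presented (am_letters A) (am_relations A)) (am_G A)"
    "\<And>a. a \<in> carrier (am_G1 A) \<Longrightarrow> \<phi> (word_class (am_letters A) (am_relations A) [Inl a]) = am_j1 A a"
    "\<And>b. b \<in> carrier (am_G2 A) \<Longrightarrow> \<phi> (word_class (am_letters A) (am_relations A) [Inr b]) = am_j2 A b"
    using A by (fastforce simp: amalgamated_free_product_def is_pushout_def)
  have "group (am_G A)" using A by (simp add: amalgamated_free_product_def)
  show ?thesis
  proof (rule presented_generated[where P = P, OF \<phi>(1) \<open>group (am_G A)\<close> x one])
    fix l x assume "l \<in> am_letters A" and x: "x \<in> carrier (am_G A)" "P x"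
    then have "\<phi> (word_class (am_letters A) (am_relations A) [l]) \<in>
        am_j1 A ` carrier (am_G1 A) \<union> am_j2 A ` carrier (am_G2 A)"
      using \<phi>(2,3) by (cases l) (auto simp: am_letters_def)
    from step[OF this x] show "P (\<phi> (word_class (am_letters A) (am_relations A) [l]) \<otimes>\<^bsub>am_G A\<^esub> x)" .
  qed
qed

lemma hnn_generated:
  assumes B: "hnn_extension B" and x: "x \<in> carrier (hn_G B)" and one: "P \<one>\<^bsub>hn_G B\<^esub>"
    and step: "\<And>s x. s \<in> hn_j1 B ` carrier (hn_G1 B) \<union> {hn_t B, inv\<^bsub>hn_G B\<^esub> hn_t B} \<Longrightarrow>
      x \<in> carrier (hn_G B) \<Longrightarrow> P x \<Longrightarrow> P (s \<otimes>\<^bsub>hn_G B\<^esub> x)"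
  shows "P x"
proof -
  let ?L = "hn_letters B" and ?Q = "hn_relations B" and ?G = "hn_G B"
  have G: "group ?G" using B by (simp add: hnn_extension_def)
  interpret G: group ?G by fact
  obtain \<phi> where \<phi>: "\<phi> \<in> iso (presented ?L ?Q) ?G"
    "\<And>a. a \<in> carrier (hn_G1 B) \<Longrightarrow> \<phi> (word_class ?L ?Q [Inl a]) = hn_j1 B a"
    "\<phi> (word_class ?L ?Q [Inr True]) = hn_t B"
    using B by (fastforce simp: hnn_extension_def)
  have hom: "\<phi> \<in> hom (presented ?L ?Q) ?G" using \<phi> by (simp add: iso_def)
  have c: "word_class ?L ?Q w \<in> carrier (presented ?L ?Q)" if "w \<in> lists ?L" for w
    using that by (simp add: presented_def)
  have L: "[Inr b] \<in> lists ?L" for b by (auto simp: hn_letters_def)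
  have "([Inr True, Inr False], []) \<in> ?Q" by (simp add: hn_relations_def)
  then have "word_class ?L ?Q [Inr True, Inr False] = word_class ?L ?Q []"
    using word_cong.wc_rel[of "[Inr True, Inr False]" "[]" ?Q "[]" "[]"] by (intro word_class_eqI) simp
  moreover have "\<phi> (word_class ?L ?Q []) \<otimes>\<^bsub>?G\<^esub> \<phi> (word_class ?L ?Q []) = \<phi> (word_class ?L ?Q [])"
    using hom_mult[OF hom c c, of "[]" "[]"] presented_mult[of "[]" ?L "[]" ?Q] by simp
  then have "\<phi> (word_class ?L ?Q []) = \<one>\<^bsub>?G\<^esub>" using hom_in_carrier[OF hom c[of "[]"]] by simp
  moreover have "\<phi> (word_class ?L ?Q [Inr True, Inr False]) = hn_t B \<otimes>\<^bsub>?G\<^esub> \<phi> (word_class ?L ?Q [Inr False])"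
    using hom_mult[OF hom c[OF L] c[OF L], of True False] presented_mult[OF L[of True] L[of False], of ?Q] \<phi>(3) by simp
  ultimately have "hn_t B \<otimes>\<^bsub>?G\<^esub> \<phi> (word_class ?L ?Q [Inr False]) = \<one>\<^bsub>?G\<^esub>" by simp
  then have "\<phi> (word_class ?L ?Q [Inr False]) = inv\<^bsub>?G\<^esub> hn_t B"
    using hnn_morphisms(2)[OF B] hom_in_carrier[OF hom c[OF L[of False]]]
    by (metis G.inv_equality G.inv_inv G.inv_closed)
  then have "\<phi> (word_class ?L ?Q [l]) \<in> hn_j1 B ` carrier (hn_G1 B) \<union> {hn_t B, inv\<^bsub>?G\<^esub> hn_t B}" if "l \<in> ?L" for l
  proof (cases l)
    case (Inl a)
    with that \<phi>(2) show ?thesis by (auto simp: hn_letters_def)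
  next
    case (Inr b)
    with \<phi>(3) \<open>\<phi> (word_class ?L ?Q [Inr False]) = _\<close> show ?thesis by (cases b) auto
  qed
  then show ?thesis
    using presented_generated[where P = P, OF \<phi>(1) G x one] step by blast
qed

text \<open>A walk from \<open>\<one>\<close> inside \<open>Z\<close>, one letter of \<open>T\<close> at a time.
  With the letters from the factors, consecutive elements \<open>x\<close>, \<open>sx\<close> of the
  walk have \<open>x\<^sup>-\<^sup>1 G\<^sub>i = (sx)\<^sup>-\<^sup>1 G\<^sub>i\<close> for the factor
  \<open>G\<^sub>i\<close> that contains \<open>s\<close>, and a stable letter leads to an adjacent
  coset, so the inverses of the elements of \<open>Z\<close> span a connected part of the tree.\<close>
definition connected_by :: "'g monoid \<Rightarrow> 'g set \<Rightarrow> 'g set \<Rightarrow> bool" where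
  "connected_by G T Z \<longleftrightarrow>
     (\<forall>z \<in> Z. (\<one>\<^bsub>G\<^esub>, z) \<in> {(x, s \<otimes>\<^bsub>G\<^esub> x) | x s. s \<in> T \<and> x \<in> Z \<and> s \<otimes>\<^bsub>G\<^esub> x \<in> Z}\<^sup>*)"

lemma connected_by_Union:
  assumes "\<And>Z. Z \<in> \<Z> \<Longrightarrow> connected_by G T Z" shows "connected_by G T (\<Union>\<Z>)"
  unfolding connected_by_def
proof
  fix z assume "z \<in> \<Union>\<Z>"
  then obtain Z where Z: "Z \<in> \<Z>" "z \<in> Z" by blast
  then have "(\<one>\<^bsub>G\<^esub>, z) \<in> {(x, s \<otimes>\<^bsub>G\<^esub> x) | x s. s \<in> T \<and> x \<in> Z \<and> s \<otimes>\<^bsub>G\<^esub> x \<in> Z}\<^sup>*"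
    using assms by (simp add: connected_by_def)
  moreover have "{(x, s \<otimes>\<^bsub>G\<^esub> x) | x s. s \<in> T \<and> x \<in> Z \<and> s \<otimes>\<^bsub>G\<^esub> x \<in> Z} \<subseteq>
      {(x, s \<otimes>\<^bsub>G\<^esub> x) | x s. s \<in> T \<and> x \<in> \<Union>\<Z> \<and> s \<otimes>\<^bsub>G\<^esub> x \<in> \<Union>\<Z>}"
    using Z by blast
  ultimately show "(\<one>\<^bsub>G\<^esub>, z) \<in> {(x, s \<otimes>\<^bsub>G\<^esub> x) | x s. s \<in> T \<and> x \<in> \<Union>\<Z> \<and> s \<otimes>\<^bsub>G\<^esub> x \<in> \<Union>\<Z>}\<^sup>*"
    using rtrancl_mono by blast
qed

lemma connected_by_insert:
  assumes Z: "connected_by G T Z" and s: "s \<in> T" "x \<in> Z"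
  shows "connected_by G T (insert (s \<otimes>\<^bsub>G\<^esub> x) Z)"
  unfolding connected_by_def
proof
  let ?R = "\<lambda>Z. {(x, s \<otimes>\<^bsub>G\<^esub> x) | x s. s \<in> T \<and> x \<in> Z \<and> s \<otimes>\<^bsub>G\<^esub> x \<in> Z}"
  let ?Z = "insert (s \<otimes>\<^bsub>G\<^esub> x) Z"
  have "?R Z \<subseteq> ?R ?Z" by blast
  then have mono: "(?R Z)\<^sup>* \<subseteq> (?R ?Z)\<^sup>*" by (rule rtrancl_mono)
  have old: "(\<one>\<^bsub>G\<^esub>, z) \<in> (?R ?Z)\<^sup>*" if "z \<in> Z" for z
    using Z that mono unfolding connected_by_def by blast
  have "(x, s \<otimes>\<^bsub>G\<^esub> x) \<in> ?R ?Z" using s by blast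
  with old[OF s(2)] have "(\<one>\<^bsub>G\<^esub>, s \<otimes>\<^bsub>G\<^esub> x) \<in> (?R ?Z)\<^sup>*" by (rule rtrancl_into_rtrancl)
  then show "(\<one>\<^bsub>G\<^esub>, z) \<in> (?R ?Z)\<^sup>*" if "z \<in> ?Z" for z using that old by blast
qed

lemma finite_connected:
  assumes G: "group G" and T: "T \<subseteq> carrier G"
    and gen: "\<And>P x. x \<in> carrier G \<Longrightarrow> P \<one>\<^bsub>G\<^esub> \<Longrightarrow>
      (\<And>s x. s \<in> T \<Longrightarrow> x \<in> carrier G \<Longrightarrow> P x \<Longrightarrow> P (s \<otimes>\<^bsub>G\<^esub> x)) \<Longrightarrow> P x"
    and F: "finite F" "F \<subseteq> carrier G"
  obtains Z where "finite Z" "Z \<subseteq> carrier G" "F \<subseteq> Z" "\<one>\<^bsub>G\<^esub> \<in> Z" "connected_by G T Z"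
proof -
  interpret G: group G by fact
  have "\<exists>Z. finite Z \<and> Z \<subseteq> carrier G \<and> x \<in> Z \<and> connected_by G T Z" if "x \<in> carrier G" for x
    using that
  proof (rule gen[where P = "\<lambda>x. \<exists>Z. finite Z \<and> Z \<subseteq> carrier G \<and> x \<in> Z \<and> connected_by G T Z"])
    show "\<exists>Z. finite Z \<and> Z \<subseteq> carrier G \<and> \<one>\<^bsub>G\<^esub> \<in> Z \<and> connected_by G T Z"
      by (rule exI[of _ "{\<one>\<^bsub>G\<^esub>}"]) (auto simp: connected_by_def)
    fix s x assume s: "s \<in> T" and x: "x \<in> carrier G"
      and "\<exists>Z. finite Z \<and> Z \<subseteq> carrier G \<and> x \<in> Z \<and> connected_by G T Z"
    then obtain Z where "finite Z" "Z \<subseteq> carrier G" "x \<in> Z" "connected_by G T Z" by blast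
    with s x T show "\<exists>Z. finite Z \<and> Z \<subseteq> carrier G \<and> s \<otimes>\<^bsub>G\<^esub> x \<in> Z \<and> connected_by G T Z"
      by (intro exI[of _ "insert (s \<otimes>\<^bsub>G\<^esub> x) Z"]) (auto intro: connected_by_insert)
  qed
  then obtain Z where Z: "\<And>x. x \<in> carrier G \<Longrightarrow> finite (Z x) \<and> Z x \<subseteq> carrier G \<and> x \<in> Z x \<and> connected_by G T (Z x)"
    by metis
  show ?thesis
  proof (rule that[of "\<Union>(Z ` insert \<one>\<^bsub>G\<^esub> F)"])
    show "connected_by G T (\<Union>(Z ` insert \<one>\<^bsub>G\<^esub> F))"
      using Z F by (intro connected_by_Union) auto
    show "\<Union>(Z ` insert \<one>\<^bsub>G\<^esub> F) \<subseteq> carrier G" using Z F G.one_closed by blast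
    show "F \<subseteq> \<Union>(Z ` insert \<one>\<^bsub>G\<^esub> F)" using Z F by blast
    show "\<one>\<^bsub>G\<^esub> \<in> \<Union>(Z ` insert \<one>\<^bsub>G\<^esub> F)" using Z G.one_closed by blast
    show "finite (\<Union>(Z ` insert \<one>\<^bsub>G\<^esub> F))" using Z F G.one_closed by auto
  qed
qed

section \<open>Additive maps and extension of scalars\<close>

context abelian_group
begin

lemma add_minus_cancel:
  assumes "x \<in> carrier G" "y \<in> carrier G"
  shows "x \<oplus> (\<ominus> x \<oplus> y) = y" "\<ominus> x \<oplus> (x \<oplus> y) = y" "x \<oplus> (y \<oplus> \<ominus> x) = y" "\<ominus> x \<oplus> (y \<oplus> x) = y"
proof -
  show "x \<oplus> (\<ominus> x \<oplus> y) = y" "\<ominus> x \<oplus> (x \<oplus> y) = y"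
    using assms by (simp_all add: r_neg l_neg flip: a_assoc)
  then show "x \<oplus> (y \<oplus> \<ominus> x) = y" "\<ominus> x \<oplus> (y \<oplus> x) = y"
    using assms by (simp_all add: a_comm)
qed

lemma minus_minus_minus:
  "\<lbrakk>a \<in> carrier G; b \<in> carrier G; c \<in> carrier G; d \<in> carrier G\<rbrakk> \<Longrightarrow> (a \<ominus> b) \<ominus> (c \<ominus> d) = (a \<ominus> c) \<ominus> (b \<ominus> d)"
  by (simp add: minus_eq minus_add a_ac)

lemma add_minus_add:
  "\<lbrakk>a \<in> carrier G; b \<in> carrier G; c \<in> carrier G; d \<in> carrier G\<rbrakk> \<Longrightarrow> (a \<oplus> b) \<ominus> (c \<oplus> d) = (a \<ominus> c) \<oplus> (b \<ominus> d)"
  by (simp add: minus_eq minus_add a_ac)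

lemma minus_self: "a \<in> carrier G \<Longrightarrow> a \<ominus> a = \<zero>"
  by (simp add: minus_eq r_neg)

lemma minus_minus_cancel: "a \<in> carrier G \<Longrightarrow> b \<in> carrier G \<Longrightarrow> a \<ominus> (a \<ominus> b) = b"
  by (simp add: minus_eq minus_add add_minus_cancel)

lemma minus_plus_cancel: "a \<in> carrier G \<Longrightarrow> b \<in> carrier G \<Longrightarrow> (a \<ominus> b) \<oplus> b = a"
  by (simp add: minus_eq a_assoc l_neg)

lemma minus_minus_left:
  "\<lbrakk>a \<in> carrier G; b \<in> carrier G; d \<in> carrier G\<rbrakk> \<Longrightarrow> (a \<ominus> b) \<ominus> (a \<ominus> d) = d \<ominus> b"
  by (simp add: minus_minus_minus minus_self) (simp add: minus_eq minus_add a_comm)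

lemma minus_add_minus:
  "\<lbrakk>a \<in> carrier G; b \<in> carrier G; d \<in> carrier G\<rbrakk> \<Longrightarrow> (d \<ominus> b) \<oplus> (a \<ominus> d) = a \<ominus> b"
  by (simp add: minus_eq a_ac add_minus_cancel)

lemma minus_right_zero: "a \<in> carrier G \<Longrightarrow> a \<ominus> \<zero> = a"
  using minus_plus_cancel[of a \<zero>] by simp

lemma minus_eq_zeroD: "\<lbrakk>a \<in> carrier G; b \<in> carrier G; a \<ominus> b = \<zero>\<rbrakk> \<Longrightarrow> a = b"
  using minus_plus_cancel[of a b] by simp

end

definition additive :: "('m, 'x) ring_scheme \<Rightarrow> ('n, 'y) ring_scheme \<Rightarrow> ('m \<Rightarrow> 'n) \<Rightarrow> bool" where
  "additive M N f \<longleftrightarrow> (\<forall>x \<in> carrier M. f x \<in> carrier N) \<and>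
     (\<forall>x \<in> carrier M. \<forall>y \<in> carrier M. f (x \<oplus>\<^bsub>M\<^esub> y) = f x \<oplus>\<^bsub>N\<^esub> f y)"

lemma additive_group_hom:
  assumes "additive M N f" "abelian_group M" "abelian_group N"
  shows "group_hom (add_monoid M) (add_monoid N) f"
  using assms
  by (simp add: additive_def group_hom_def group_hom_axioms_def hom_def abelian_group.a_group Pi_iff)

lemma additive_facts:
  assumes f: "additive M N f" "abelian_group M" "abelian_group N"
  shows "\<And>x. x \<in> carrier M \<Longrightarrow> f x \<in> carrier N"
    "\<And>x y. x \<in> carrier M \<Longrightarrow> y \<in> carrier M \<Longrightarrow> f (x \<oplus>\<^bsub>M\<^esub> y) = f x \<oplus>\<^bsub>N\<^esub> f y"
    "f \<zero>\<^bsub>M\<^esub> = \<zero>\<^bsub>N\<^esub>"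
    "\<And>x. x \<in> carrier M \<Longrightarrow> f (\<ominus>\<^bsub>M\<^esub> x) = \<ominus>\<^bsub>N\<^esub> f x"
    "\<And>x y. x \<in> carrier M \<Longrightarrow> y \<in> carrier M \<Longrightarrow> f (x \<ominus>\<^bsub>M\<^esub> y) = f x \<ominus>\<^bsub>N\<^esub> f y"
proof -
  interpret M: abelian_group M by fact
  interpret N: abelian_group N by fact
  interpret h: group_hom "add_monoid M" "add_monoid N" f by (rule additive_group_hom[OF f])
  show c: "f x \<in> carrier N" if "x \<in> carrier M" for x using h.hom_closed that by simp
  show p: "f (x \<oplus>\<^bsub>M\<^esub> y) = f x \<oplus>\<^bsub>N\<^esub> f y" if "x \<in> carrier M" "y \<in> carrier M" for x y
    using h.hom_mult that by simp
  show "f \<zero>\<^bsub>M\<^esub> = \<zero>\<^bsub>N\<^esub>" using h.hom_one by simp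
  show m: "f (\<ominus>\<^bsub>M\<^esub> x) = \<ominus>\<^bsub>N\<^esub> f x" if "x \<in> carrier M" for x
    using h.hom_inv that by (simp add: a_inv_def)
  show "f (x \<ominus>\<^bsub>M\<^esub> y) = f x \<ominus>\<^bsub>N\<^esub> f y" if "x \<in> carrier M" "y \<in> carrier M" for x y
    using that by (simp add: M.minus_eq N.minus_eq p m)
qed

lemma additive_finsum:
  assumes f: "additive M N f" "abelian_group M" "abelian_group N"
    and u: "\<And>i. i \<in> I \<Longrightarrow> u i \<in> carrier M"
  shows "f (\<Oplus>\<^bsub>M\<^esub>i\<in>I. u i) = (\<Oplus>\<^bsub>N\<^esub>i\<in>I. f (u i))"
proof -
  interpret M: abelian_group M by fact
  interpret N: abelian_group N by fact
  note a = additive_facts[OF f]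
  show ?thesis using u
  proof (induction I rule: infinite_finite_induct)
    case (insert i I)
    then show ?case using a(1,2) by (subst M.finsum_insert, simp_all add: Pi_iff)+
  qed (use a in simp_all)
qed

lemma mod_hom_additive: "f \<in> mod_hom R M N \<Longrightarrow> additive M N f"
  by (auto simp: mod_hom_def additive_def)

lemma mod_hom_smult:
  "f \<in> mod_hom R M N \<Longrightarrow> r \<in> carrier R \<Longrightarrow> x \<in> carrier M \<Longrightarrow> f (r \<odot>\<^bsub>M\<^esub> x) = r \<odot>\<^bsub>N\<^esub> f x"
  by (simp add: mod_hom_def)

lemma mod_homI:
  assumes "additive M N f" "\<And>r x. r \<in> carrier R \<Longrightarrow> x \<in> carrier M \<Longrightarrow> f (r \<odot>\<^bsub>M\<^esub> x) = r \<odot>\<^bsub>N\<^esub> f x"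
  shows "f \<in> mod_hom R M N"
  using assms by (auto simp: mod_hom_def additive_def)

lemma left_module_abelian: "left_module R M \<Longrightarrow> abelian_group M"
  by (rule left_module.axioms(2))

lemma (in left_module) smult_zero: "a \<in> carrier R \<Longrightarrow> a \<odot>\<^bsub>M\<^esub> \<zero>\<^bsub>M\<^esub> = \<zero>\<^bsub>M\<^esub>"
  using additive_facts(3)[of M M "smult M a"]
  by (simp add: additive_def smult_closed smult_r_distr M.abelian_group_axioms)

lemma (in left_module) smult_minus:
  "a \<in> carrier R \<Longrightarrow> x \<in> carrier M \<Longrightarrow> y \<in> carrier M \<Longrightarrow> a \<odot>\<^bsub>M\<^esub> (x \<ominus>\<^bsub>M\<^esub> y) = a \<odot>\<^bsub>M\<^esub> x \<ominus>\<^bsub>M\<^esub> a \<odot>\<^bsub>M\<^esub> y"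
  using additive_facts(5)[of M M "smult M a"]
  by (simp add: additive_def smult_closed smult_r_distr M.abelian_group_axioms)

lemma (in left_module) zero_smult:
  assumes "x \<in> carrier M" shows "\<zero>\<^bsub>R\<^esub> \<odot>\<^bsub>M\<^esub> x = \<zero>\<^bsub>M\<^esub>"
proof -
  have "\<zero>\<^bsub>R\<^esub> \<odot>\<^bsub>M\<^esub> x \<oplus>\<^bsub>M\<^esub> \<zero>\<^bsub>R\<^esub> \<odot>\<^bsub>M\<^esub> x = \<zero>\<^bsub>R\<^esub> \<odot>\<^bsub>M\<^esub> x"
    using smult_l_distr[of "\<zero>\<^bsub>R\<^esub>" "\<zero>\<^bsub>R\<^esub>" x] assms by simp
  then show ?thesis using smult_closed[of "\<zero>\<^bsub>R\<^esub>" x] assms by simp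
qed

lemma (in left_module) minus_smult:
  assumes "a \<in> carrier R" "b \<in> carrier R" "x \<in> carrier M"
  shows "(a \<ominus>\<^bsub>R\<^esub> b) \<odot>\<^bsub>M\<^esub> x = a \<odot>\<^bsub>M\<^esub> x \<ominus>\<^bsub>M\<^esub> b \<odot>\<^bsub>M\<^esub> x"
proof -
  have "(a \<ominus>\<^bsub>R\<^esub> b) \<odot>\<^bsub>M\<^esub> x \<oplus>\<^bsub>M\<^esub> b \<odot>\<^bsub>M\<^esub> x = a \<odot>\<^bsub>M\<^esub> x"
    using assms by (simp flip: smult_l_distr add: R.minus_eq R.a_assoc R.l_neg)
  then show ?thesis
    using assms smult_closed[of a x] smult_closed[of b x] smult_closed[of "a \<ominus>\<^bsub>R\<^esub> b" x]
    by (metis M.add.inv_solve_right a_minus_def R.minus_closed a_inv_def M.minus_eq)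
qed

context base_change
begin

definition balanced :: "('q, 'n) module \<Rightarrow> ('s \<Rightarrow> 'm \<Rightarrow> 'n) \<Rightarrow> bool" where
  "balanced N \<beta> \<longleftrightarrow>
     (\<forall>s \<in> carrier S. \<forall>x \<in> carrier M. \<beta> s x \<in> carrier N) \<and>
     (\<forall>s \<in> carrier S. \<forall>s' \<in> carrier S. \<forall>x \<in> carrier M. \<beta> (s \<oplus>\<^bsub>S\<^esub> s') x = \<beta> s x \<oplus>\<^bsub>N\<^esub> \<beta> s' x) \<and>
     (\<forall>s \<in> carrier S. \<forall>x \<in> carrier M. \<forall>x' \<in> carrier M. \<beta> s (x \<oplus>\<^bsub>M\<^esub> x') = \<beta> s x \<oplus>\<^bsub>N\<^esub> \<beta> s x') \<and>
     (\<forall>s \<in> carrier S. \<forall>r \<in> carrier R. \<forall>x \<in> carrier M. \<beta> (s \<otimes>\<^bsub>S\<^esub> \<phi> r) x = \<beta> s (r \<odot>\<^bsub>M\<^esub> x))"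

lemma balancedI:
  assumes "\<And>s x. s \<in> carrier S \<Longrightarrow> x \<in> carrier M \<Longrightarrow> \<beta> s x \<in> carrier N"
    "\<And>s s' x. s \<in> carrier S \<Longrightarrow> s' \<in> carrier S \<Longrightarrow> x \<in> carrier M \<Longrightarrow> \<beta> (s \<oplus>\<^bsub>S\<^esub> s') x = \<beta> s x \<oplus>\<^bsub>N\<^esub> \<beta> s' x"
    "\<And>s x x'. s \<in> carrier S \<Longrightarrow> x \<in> carrier M \<Longrightarrow> x' \<in> carrier M \<Longrightarrow> \<beta> s (x \<oplus>\<^bsub>M\<^esub> x') = \<beta> s x \<oplus>\<^bsub>N\<^esub> \<beta> s x'"
    "\<And>s r x. s \<in> carrier S \<Longrightarrow> r \<in> carrier R \<Longrightarrow> x \<in> carrier M \<Longrightarrow> \<beta> (s \<otimes>\<^bsub>S\<^esub> \<phi> r) x = \<beta> s (r \<odot>\<^bsub>M\<^esub> x)"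
  shows "balanced N \<beta>"
  using assms by (simp add: balanced_def)

lemma lift_TP:
  assumes "abelian_group N" "balanced N \<beta>" "s \<in> carrier S" "x \<in> carrier M"
  shows "tensor_lift N \<beta> (TP s x) = \<beta> s x"
  by (rule tensor_lift_TP[OF assms(1)]) (use assms in \<open>auto simp: balanced_def\<close>)

lemma lift_class:
  assumes "abelian_group N" "balanced N \<beta>" "c \<in> carrier TF"
  shows "tensor_lift N \<beta> (TC c) = frag_sum N \<beta> c"
  by (rule tensor_lift_class[OF assms(1)]) (use assms in \<open>auto simp: balanced_def\<close>)

lemma lift_additive:
  assumes N: "abelian_group N" and \<beta>: "balanced N \<beta>"
  shows "additive TM N (tensor_lift N \<beta>)"
proof -
  have h: "frag_sum N \<beta> \<in> hom TF (add_monoid N)"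
    by (rule frag_sum_hom[OF N]) (use \<beta> in \<open>simp add: balanced_def\<close>)
  show ?thesis
    unfolding additive_def
  proof (intro conjI ballI)
    fix X assume "X \<in> carrier TM"
    then obtain c where c: "c \<in> carrier TF" "X = TC c" unfolding TC_carrier by blast
    then show "tensor_lift N \<beta> X \<in> carrier N"
      using hom_in_carrier[OF h c(1)] by (simp only: lift_class[OF N \<beta>]) simp
    fix Y assume "Y \<in> carrier TM"
    then obtain d where d: "d \<in> carrier TF" "Y = TC d" unfolding TC_carrier by blast
    have cd: "c + d \<in> carrier TF" using c(1) d(1) by (simp add: keys_add_subset)
    have "frag_sum N \<beta> (c + d) = frag_sum N \<beta> c \<oplus>\<^bsub>N\<^esub> frag_sum N \<beta> d"
      using hom_mult[OF h c(1) d(1)] by simp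
    then show "tensor_lift N \<beta> (X \<oplus>\<^bsub>TM\<^esub> Y) = tensor_lift N \<beta> X \<oplus>\<^bsub>N\<^esub> tensor_lift N \<beta> Y"
      unfolding c(2) d(2) TC_add[OF c(1) d(1)] lift_class[OF N \<beta> c(1)] lift_class[OF N \<beta> d(1)] lift_class[OF N \<beta> cd] .
  qed
qed

text \<open>Pure tensors generate the tensor product additively, so no linearity over \<open>S\<close> is asked
  for: the weighted evaluations of induced modules are only additive.\<close>
lemma additive_eqI:
  assumes N: "abelian_group N" and f: "additive TM N f" and g: "additive TM N g"
    and eq: "\<And>s x. s \<in> carrier S \<Longrightarrow> x \<in> carrier M \<Longrightarrow> f (TP s x) = g (TP s x)"
    and X: "X \<in> carrier TM"
  shows "f X = g X"
  using X
  by (induction rule: TM_induct)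
    (simp_all add: eq additive_facts[OF f TM.abelian_group_axioms N] additive_facts[OF g TM.abelian_group_axioms N])

lemma lift_mod_hom:
  assumes N: "left_module S N" and \<beta>: "balanced N \<beta>"
    and lin: "\<And>s s' x. s \<in> carrier S \<Longrightarrow> s' \<in> carrier S \<Longrightarrow> x \<in> carrier M \<Longrightarrow> \<beta> (s \<otimes>\<^bsub>S\<^esub> s') x = s \<odot>\<^bsub>N\<^esub> \<beta> s' x"
  shows "tensor_lift N \<beta> \<in> mod_hom S TM N"
proof (rule mod_homI)
  interpret N: left_module S N by fact
  interpret T: left_module S TM by (rule left_module_TM)
  note aN = N.M.abelian_group_axioms
  show a: "additive TM N (tensor_lift N \<beta>)" by (rule lift_additive[OF aN \<beta>])
  note af = additive_facts[OF a TM.abelian_group_axioms aN]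
  fix s X assume s: "s \<in> carrier S" and X: "X \<in> carrier TM"
  show "tensor_lift N \<beta> (s \<odot>\<^bsub>TM\<^esub> X) = s \<odot>\<^bsub>N\<^esub> tensor_lift N \<beta> X"
  proof (rule additive_eqI[OF aN _ _ _ X, of "\<lambda>X. tensor_lift N \<beta> (s \<odot>\<^bsub>TM\<^esub> X)" "\<lambda>X. s \<odot>\<^bsub>N\<^esub> tensor_lift N \<beta> X"])
    show "additive TM N (\<lambda>X. tensor_lift N \<beta> (s \<odot>\<^bsub>TM\<^esub> X))" "additive TM N (\<lambda>X. s \<odot>\<^bsub>N\<^esub> tensor_lift N \<beta> X)"
      using s by (simp_all add: additive_def af T.smult_closed T.smult_r_distr N.smult_closed N.smult_r_distr)
    fix s' x assume "s' \<in> carrier S" "x \<in> carrier M"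
    then show "tensor_lift N \<beta> (s \<odot>\<^bsub>TM\<^esub> TP s' x) = s \<odot>\<^bsub>N\<^esub> tensor_lift N \<beta> (TP s' x)"
      using s by (simp add: TP_smult lift_TP[OF aN \<beta>] lin)
  qed
qed

lemma lift_cong:
  assumes N: "abelian_group N" and \<beta>: "balanced N \<beta>" and \<beta>': "balanced N \<beta>'"
    and eq: "\<And>s x. s \<in> carrier S \<Longrightarrow> x \<in> carrier M \<Longrightarrow> \<beta> s x = \<beta>' s x" and X: "X \<in> carrier TM"
  shows "tensor_lift N \<beta> X = tensor_lift N \<beta>' X"
  by (rule additive_eqI[OF N lift_additive[OF N \<beta>] lift_additive[OF N \<beta>'] _ X])
    (simp add: lift_TP[OF N] \<beta> \<beta>' eq)

end

lemma ext_map_facts: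
  assumes M: "base_change R S M \<phi>" and N: "base_change R S N \<phi>" and f: "f \<in> mod_hom R M N"
  shows "\<And>s x. s \<in> carrier S \<Longrightarrow> x \<in> carrier M \<Longrightarrow>
      ext_map R S \<phi> N f (pure_tensor R S \<phi> M s x) = pure_tensor R S \<phi> N s (f x)"
    "ext_map R S \<phi> N f \<in> mod_hom S (ext_mod R S \<phi> M) (ext_mod R S \<phi> N)"
proof -
  interpret M: base_change R S M \<phi> by fact
  interpret N: base_change R S N \<phi> by fact
  have fc: "f x \<in> carrier N" if "x \<in> carrier M" for x using f that by (auto simp: mod_hom_def)
  have b: "M.balanced N.TM (\<lambda>s x. pure_tensor R S \<phi> N s (f x))"
    using f fc
    by (intro M.balancedI)
      (simp_all add: mod_hom_def N.TP_closed N.TP_add_left N.TP_add_right N.TP_balanced)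
  show "ext_map R S \<phi> N f (pure_tensor R S \<phi> M s x) = pure_tensor R S \<phi> N s (f x)"
    if "s \<in> carrier S" "x \<in> carrier M" for s x
    unfolding ext_map_def by (rule M.lift_TP[OF N.abelian_group_TM b that])
  show "ext_map R S \<phi> N f \<in> mod_hom S (ext_mod R S \<phi> M) (ext_mod R S \<phi> N)"
    unfolding ext_map_def
    by (rule M.lift_mod_hom[OF N.left_module_TM b]) (simp add: N.TP_smult fc)
qed

lemma ext_map_comp_zero:
  assumes M: "base_change R S M \<phi>" and N: "base_change R S N \<phi>" and P: "base_change R S P \<phi>"
    and f: "f \<in> mod_hom R M N" and g: "g \<in> mod_hom R N P"
    and gf: "\<And>x. x \<in> carrier M \<Longrightarrow> g (f x) = \<zero>\<^bsub>P\<^esub>"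
    and X: "X \<in> carrier (ext_mod R S \<phi> M)"
  shows "ext_map R S \<phi> P g (ext_map R S \<phi> N f X) = \<zero>\<^bsub>ext_mod R S \<phi> P\<^esub>"
proof -
  interpret M: base_change R S M \<phi> by fact
  interpret N: base_change R S N \<phi> by fact
  interpret P: base_change R S P \<phi> by fact
  note ef = ext_map_facts[OF M N f] and eg = ext_map_facts[OF N P g]
  note f1 = additive_facts[OF mod_hom_additive[OF ef(2)] M.abelian_group_TM N.abelian_group_TM]
  note g1 = additive_facts[OF mod_hom_additive[OF eg(2)] N.abelian_group_TM P.abelian_group_TM]
  show ?thesis
  proof (rule M.additive_eqI[OF P.abelian_group_TM _ _ _ X])
    show "additive M.TM P.TM (\<lambda>X. ext_map R S \<phi> P g (ext_map R S \<phi> N f X))"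
      "additive M.TM P.TM (\<lambda>X. \<zero>\<^bsub>P.TM\<^esub>)"
      by (simp_all add: additive_def f1 g1)
    fix s x assume sx: "s \<in> carrier S" "x \<in> carrier M"
    have fx: "f x \<in> carrier N" using f sx by (auto simp: mod_hom_def)
    have "P.TP s \<zero>\<^bsub>P\<^esub> = \<zero>\<^bsub>P.TM\<^esub>"
      using additive_facts(3)[of P P.TM "P.TP s"] sx
      by (simp add: additive_def P.TP_closed P.TP_add_right P.abelian_group_TM P.M.M.abelian_group_axioms)
    then show "ext_map R S \<phi> P g (ext_map R S \<phi> N f (M.TP s x)) = \<zero>\<^bsub>P.TM\<^esub>"
      using sx fx by (simp add: ef(1) eg(1) gf)
  qed
qed

lemma chain_complex_ind:
  assumes G: "group A" "group B" "i \<in> hom A B" and C: "chain_complex \<int>[A] C"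
  shows "chain_complex \<int>[B] (ind_complex A B i C)"
proof -
  have m: "left_module \<int>[A] (cmod C n)" and d: "cdiff C n \<in> mod_hom \<int>[A] (cmod C n) (cmod C (n - 1))"
    and dd: "x \<in> carrier (cmod C n) \<Longrightarrow> cdiff C (n - 1) (cdiff C n x) = \<zero>\<^bsub>cmod C (n - 1 - 1)\<^esub>" for n x
    using C by (auto simp: chain_complex_def)
  have b: "base_change \<int>[A] \<int>[B] (cmod C n) (gr_map i)" for n
    by (rule base_change_group_ring[OF G m])
  show ?thesis
    unfolding chain_complex_def ind_complex_def ch_complex.simps
    by (intro conjI allI ballI base_change.left_module_TM[OF b] ext_map_facts(2)[OF b b d]
        ext_map_comp_zero[OF b b b d d dd])
qed

lemma dsum_simps [simp]:
  "carrier (dsum M N) = carrier M \<times> carrier N" "\<zero>\<^bsub>dsum M N\<^esub> = (\<zero>\<^bsub>M\<^esub>, \<zero>\<^bsub>N\<^esub>)"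
  "(x, y) \<oplus>\<^bsub>dsum M N\<^esub> (x', y') = (x \<oplus>\<^bsub>M\<^esub> x', y \<oplus>\<^bsub>N\<^esub> y')"
  "r \<odot>\<^bsub>dsum M N\<^esub> (x, y) = (r \<odot>\<^bsub>M\<^esub> x, r \<odot>\<^bsub>N\<^esub> y)"
  by (simp_all add: dsum_def)

lemma left_module_dsum:
  assumes "left_module R M" "left_module R N" shows "left_module R (dsum M N)"
proof -
  interpret M: left_module R M by fact
  interpret N: left_module R N by fact
  have "abelian_group (dsum M N)"
  proof (rule abelian_groupI)
    fix u assume u: "u \<in> carrier (dsum M N)"
    then show "\<exists>v \<in> carrier (dsum M N). v \<oplus>\<^bsub>dsum M N\<^esub> u = \<zero>\<^bsub>dsum M N\<^esub>"
      by (intro bexI[of _ "(\<ominus>\<^bsub>M\<^esub> fst u, \<ominus>\<^bsub>N\<^esub> snd u)"]) (auto simp: M.M.l_neg N.M.l_neg)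
  qed (auto simp: M.M.a_ac N.M.a_ac)
  then show ?thesis
    using M.R.ring_axioms
    by (auto simp: left_module_def left_module_axioms_def M.smult_closed N.smult_closed
        M.smult_l_distr N.smult_l_distr M.smult_r_distr N.smult_r_distr M.smult_assoc N.smult_assoc
        M.smult_one N.smult_one)
qed

lemma chain_complex_dsum:
  assumes "chain_complex R C" "chain_complex R D" shows "chain_complex R (dsum_complex C D)"
  using assms
  by (auto simp: chain_complex_def dsum_complex_def mod_hom_def Pi_iff intro!: left_module_dsum)

section \<open>Free modules and their coordinates\<close>

text \<open>Only the carrier is cut down, so the inclusion into the ambient module is literally the identity
  function, as the relation between a splitting and the canonical one demands.\<close>
definition sub_mod :: "('r \<Rightarrow> 's) \<Rightarrow> ('s, 'm) module \<Rightarrow> 'm set \<Rightarrow> ('r, 'm) module" where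
  "sub_mod \<phi> C T = (res_mod \<phi> C)\<lparr>carrier := T\<rparr>"

lemma sub_mod_simps [simp]:
  "carrier (sub_mod \<phi> C T) = T" "\<zero>\<^bsub>sub_mod \<phi> C T\<^esub> = \<zero>\<^bsub>C\<^esub>" "add (sub_mod \<phi> C T) = add C"
  "r \<odot>\<^bsub>sub_mod \<phi> C T\<^esub> x = \<phi> r \<odot>\<^bsub>C\<^esub> x"
  by (simp_all add: sub_mod_def res_mod_def)

lemma sub_mod_carrier: "sub_mod \<phi> C (carrier C) = res_mod \<phi> C"
  by (simp add: sub_mod_def res_mod_def)

definition closed_along :: "'r ring \<Rightarrow> ('r \<Rightarrow> 's) \<Rightarrow> ('s, 'm) module \<Rightarrow> 'm set \<Rightarrow> bool" where
  "closed_along R \<phi> C T \<longleftrightarrow> T \<subseteq> carrier C \<and> \<zero>\<^bsub>C\<^esub> \<in> T \<and> (\<forall>x \<in> T. \<forall>y \<in> T. x \<oplus>\<^bsub>C\<^esub> y \<in> T) \<and>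
     (\<forall>r \<in> carrier R. \<forall>x \<in> T. \<phi> r \<odot>\<^bsub>C\<^esub> x \<in> T)"

lemma left_module_sub_mod:
  assumes R: "ring R" and C: "left_module S C" and \<phi>: "\<phi> \<in> ring_hom R S" and T: "closed_along R \<phi> C T"
  shows "left_module R (sub_mod \<phi> C T)"
proof -
  interpret R: ring R by fact
  interpret C: left_module S C by fact
  have T': "x \<in> carrier C" if "x \<in> T" for x using T that by (auto simp: closed_along_def)
  have "abelian_group (sub_mod \<phi> C T)"
  proof (rule abelian_groupI)
    fix x assume x: "x \<in> carrier (sub_mod \<phi> C T)"
    have "\<phi> (\<ominus>\<^bsub>R\<^esub> \<one>\<^bsub>R\<^esub>) \<odot>\<^bsub>C\<^esub> x \<oplus>\<^bsub>C\<^esub> x = \<phi> (\<ominus>\<^bsub>R\<^esub> \<one>\<^bsub>R\<^esub>) \<odot>\<^bsub>C\<^esub> x \<oplus>\<^bsub>C\<^esub> \<phi> \<one>\<^bsub>R\<^esub> \<odot>\<^bsub>C\<^esub> x"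
      using x T' by (simp add: ring_hom_one[OF \<phi>] C.smult_one)
    also have "\<dots> = \<phi> (\<ominus>\<^bsub>R\<^esub> \<one>\<^bsub>R\<^esub> \<oplus>\<^bsub>R\<^esub> \<one>\<^bsub>R\<^esub>) \<odot>\<^bsub>C\<^esub> x"
      using x T' by (simp add: ring_hom_add[OF \<phi>] ring_hom_closed[OF \<phi>] C.smult_l_distr del: R.l_neg)
    also have "\<dots> = \<zero>\<^bsub>C\<^esub>"
      using x T' by (simp add: ring_hom_zero[OF \<phi> R C.R.ring_axioms] C.zero_smult R.l_neg)
    finally show "\<exists>y \<in> carrier (sub_mod \<phi> C T). y \<oplus>\<^bsub>sub_mod \<phi> C T\<^esub> x = \<zero>\<^bsub>sub_mod \<phi> C T\<^esub>"
      using x T by (intro bexI[of _ "\<phi> (\<ominus>\<^bsub>R\<^esub> \<one>\<^bsub>R\<^esub>) \<odot>\<^bsub>C\<^esub> x"]) (auto simp: closed_along_def)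
  qed (use T T' C.a_ac in \<open>auto simp: closed_along_def\<close>)
  then show ?thesis
    using R T T' ring_hom_closed[OF \<phi>] ring_hom_add[OF \<phi>] ring_hom_mult[OF \<phi>] ring_hom_one[OF \<phi>]
    by (auto simp: left_module_def left_module_axioms_def closed_along_def
        C.smult_l_distr C.smult_r_distr C.smult_assoc C.smult_one)
qed

lemma sub_mod_uminus:
  assumes C: "abelian_group C" and D: "abelian_group (sub_mod \<phi> C T)" and T: "T \<subseteq> carrier C"
    and x: "x \<in> T" "y \<in> T"
  shows "\<ominus>\<^bsub>sub_mod \<phi> C T\<^esub> x = \<ominus>\<^bsub>C\<^esub> x" "x \<ominus>\<^bsub>sub_mod \<phi> C T\<^esub> y = x \<ominus>\<^bsub>C\<^esub> y"
proof -
  have a: "additive (sub_mod \<phi> C T) C (\<lambda>x. x)" using T by (auto simp: additive_def)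
  show "\<ominus>\<^bsub>sub_mod \<phi> C T\<^esub> x = \<ominus>\<^bsub>C\<^esub> x" "x \<ominus>\<^bsub>sub_mod \<phi> C T\<^esub> y = x \<ominus>\<^bsub>C\<^esub> y"
    using additive_facts(4,5)[OF a D C] x by simp_all
qed

text \<open>Functionals dual to the family \<open>e\<close> recover the coefficients of any expansion, which
  gives uniqueness, while \<open>exp\<close> gives existence.\<close>
lemma fg_free_dual_basis:
  assumes M: "left_module R M" and J: "finite J" and e: "\<And>j. j \<in> J \<Longrightarrow> e j \<in> carrier M"
    and \<pi>: "\<And>j. j \<in> J \<Longrightarrow> additive M R (\<pi> j)"
    and \<pi>_smult: "\<And>j r x. j \<in> J \<Longrightarrow> r \<in> carrier R \<Longrightarrow> x \<in> carrier M \<Longrightarrow> \<pi> j (r \<odot>\<^bsub>M\<^esub> x) = r \<otimes>\<^bsub>R\<^esub> \<pi> j x"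
    and \<pi>_e: "\<And>i j. i \<in> J \<Longrightarrow> j \<in> J \<Longrightarrow> \<pi> i (e j) = (if i = j then \<one>\<^bsub>R\<^esub> else \<zero>\<^bsub>R\<^esub>)"
    and exp: "\<And>x. x \<in> carrier M \<Longrightarrow> x = (\<Oplus>\<^bsub>M\<^esub>j\<in>J. \<pi> j x \<odot>\<^bsub>M\<^esub> e j)"
    and nontriv: "\<one>\<^bsub>R\<^esub> \<noteq> \<zero>\<^bsub>R\<^esub>"
  shows "fg_free R M"
proof -
  interpret M: left_module R M by fact
  have inj: "inj_on e J"
    by (rule inj_onI) (metis \<pi>_e nontriv)
  have \<pi>c: "\<pi> j x \<in> carrier R" if "j \<in> J" "x \<in> carrier M" for j x
    using \<pi> that by (auto simp: additive_def)
  have reindex: "(\<Oplus>\<^bsub>M\<^esub>b\<in>e ` J. r b \<odot>\<^bsub>M\<^esub> b) = (\<Oplus>\<^bsub>M\<^esub>j\<in>J. r (e j) \<odot>\<^bsub>M\<^esub> e j)"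
    if "r \<in> e ` J \<rightarrow> carrier R" for r
    using that e by (intro M.add.finprod_reindex[OF _ inj]) (auto intro!: M.smult_closed)
  have "\<exists>!r. r \<in> e ` J \<rightarrow>\<^sub>E carrier R \<and> x = (\<Oplus>\<^bsub>M\<^esub>b\<in>e ` J. r b \<odot>\<^bsub>M\<^esub> b)" if x: "x \<in> carrier M" for x
  proof
    let ?r = "\<lambda>b\<in>e ` J. \<pi> (inv_into J e b) x"
    have r: "?r \<in> e ` J \<rightarrow>\<^sub>E carrier R" using \<pi>c x inj by auto
    have "(\<Oplus>\<^bsub>M\<^esub>b\<in>e ` J. ?r b \<odot>\<^bsub>M\<^esub> b) = (\<Oplus>\<^bsub>M\<^esub>j\<in>J. ?r (e j) \<odot>\<^bsub>M\<^esub> e j)"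
      using r by (intro reindex) auto
    also have "\<dots> = (\<Oplus>\<^bsub>M\<^esub>j\<in>J. \<pi> j x \<odot>\<^bsub>M\<^esub> e j)"
      using inj \<pi>c x e by (intro M.finsum_cong') (auto intro!: M.smult_closed)
    finally show "?r \<in> e ` J \<rightarrow>\<^sub>E carrier R \<and> x = (\<Oplus>\<^bsub>M\<^esub>b\<in>e ` J. ?r b \<odot>\<^bsub>M\<^esub> b)"
      using r exp[OF x] by simp
  next
    fix r assume r: "r \<in> e ` J \<rightarrow>\<^sub>E carrier R \<and> x = (\<Oplus>\<^bsub>M\<^esub>b\<in>e ` J. r b \<odot>\<^bsub>M\<^esub> b)"
    then have rc: "r (e j) \<in> carrier R" if "j \<in> J" for j using that by auto
    have xr: "x = (\<Oplus>\<^bsub>M\<^esub>j\<in>J. r (e j) \<odot>\<^bsub>M\<^esub> e j)" using r reindex[of r] by auto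
    have "\<pi> i x = r (e i)" if i: "i \<in> J" for i
    proof -
      have "\<pi> i x = (\<Oplus>\<^bsub>R\<^esub>j\<in>J. \<pi> i (r (e j) \<odot>\<^bsub>M\<^esub> e j))"
        unfolding xr by (rule additive_finsum[OF \<pi>[OF i] M.M.abelian_group_axioms M.R.abelian_group_axioms])
          (use rc e in \<open>auto intro!: M.smult_closed\<close>)
      also have "\<dots> = (\<Oplus>\<^bsub>R\<^esub>j\<in>J. if i = j then r (e j) else \<zero>\<^bsub>R\<^esub>)"
        using i rc e by (intro M.R.finsum_cong') (auto simp: \<pi>_smult \<pi>_e)
      also have "\<dots> = r (e i)" using i J rc by (intro M.R.finsum_singleton) auto
      finally show ?thesis .
    qed
    then show "r = (\<lambda>b\<in>e ` J. \<pi> (inv_into J e b) x)"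
      using r inj by (intro ext) (auto simp: PiE_def extensional_def)
  qed
  then show ?thesis
    unfolding fg_free_def using M J e by (intro conjI exI[of _ "e ` J"]) auto
qed

locale free_basis = left_module R M for R (structure) and M :: "('r, 'm) module" (structure) +
  fixes B :: "'m set"
  assumes finite_B: "finite B" and B_carrier: "B \<subseteq> carrier M"
    and basis: "\<And>x. x \<in> carrier M \<Longrightarrow> \<exists>!r. r \<in> B \<rightarrow>\<^sub>E carrier R \<and> x = (\<Oplus>\<^bsub>M\<^esub>b\<in>B. r b \<odot>\<^bsub>M\<^esub> b)"
begin

definition coord :: "'m \<Rightarrow> 'm \<Rightarrow> 'r" where
  "coord x = (THE r. r \<in> B \<rightarrow>\<^sub>E carrier R \<and> x = (\<Oplus>\<^bsub>M\<^esub>b\<in>B. r b \<odot>\<^bsub>M\<^esub> b))"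

lemma coord_props:
  assumes "x \<in> carrier M"
  shows "coord x \<in> B \<rightarrow>\<^sub>E carrier R" "x = (\<Oplus>\<^bsub>M\<^esub>b\<in>B. coord x b \<odot>\<^bsub>M\<^esub> b)"
  using theI'[OF basis[OF assms]] by (auto simp: coord_def)

lemma coord_closed: "x \<in> carrier M \<Longrightarrow> b \<in> B \<Longrightarrow> coord x b \<in> carrier R"
  using coord_props(1) by auto

lemma basis_closed: "b \<in> B \<Longrightarrow> b \<in> carrier M"
  using B_carrier by blast

lemma coord_unique:
  assumes "x = (\<Oplus>\<^bsub>M\<^esub>b\<in>B. r b \<odot>\<^bsub>M\<^esub> b)" and r: "\<And>b. b \<in> B \<Longrightarrow> r b \<in> carrier R" and b: "b \<in> B"
  shows "coord x b = r b"
proof -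
  have x: "x \<in> carrier M" unfolding assms(1) using r basis_closed smult_closed by (intro M.finsum_closed) auto
  have "(\<Oplus>\<^bsub>M\<^esub>b\<in>B. restrict r B b \<odot>\<^bsub>M\<^esub> b) = (\<Oplus>\<^bsub>M\<^esub>b\<in>B. r b \<odot>\<^bsub>M\<^esub> b)"
    using r basis_closed by (intro M.finsum_cong') (auto intro!: smult_closed)
  with assms have "restrict r B \<in> B \<rightarrow>\<^sub>E carrier R \<and> x = (\<Oplus>\<^bsub>M\<^esub>b\<in>B. restrict r B b \<odot>\<^bsub>M\<^esub> b)" by auto
  then have "coord x = restrict r B"
    unfolding coord_def by (rule the1_equality[OF basis[OF x]])
  with b show ?thesis by simp
qed

lemma coord_add:
  assumes "x \<in> carrier M" "y \<in> carrier M" "b \<in> B"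
  shows "coord (x \<oplus>\<^bsub>M\<^esub> y) b = coord x b \<oplus> coord y b"
proof (rule coord_unique)
  have "x \<oplus>\<^bsub>M\<^esub> y = (\<Oplus>\<^bsub>M\<^esub>b\<in>B. coord x b \<odot>\<^bsub>M\<^esub> b) \<oplus>\<^bsub>M\<^esub> (\<Oplus>\<^bsub>M\<^esub>b\<in>B. coord y b \<odot>\<^bsub>M\<^esub> b)"
    using coord_props(2) assms by simp
  also have "\<dots> = (\<Oplus>\<^bsub>M\<^esub>b\<in>B. coord x b \<odot>\<^bsub>M\<^esub> b \<oplus>\<^bsub>M\<^esub> coord y b \<odot>\<^bsub>M\<^esub> b)"
    using assms coord_closed basis_closed by (intro M.finsum_addf[symmetric]) (auto intro!: smult_closed)
  also have "\<dots> = (\<Oplus>\<^bsub>M\<^esub>b\<in>B. (coord x b \<oplus> coord y b) \<odot>\<^bsub>M\<^esub> b)"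
    using assms coord_closed basis_closed by (intro M.finsum_cong') (auto simp: smult_l_distr intro!: smult_closed)
  finally show "x \<oplus>\<^bsub>M\<^esub> y = (\<Oplus>\<^bsub>M\<^esub>b\<in>B. (coord x b \<oplus> coord y b) \<odot>\<^bsub>M\<^esub> b)" .
qed (use assms coord_closed in auto)

lemma coord_additive: "b \<in> B \<Longrightarrow> additive M R (\<lambda>x. coord x b)"
  by (simp add: additive_def coord_closed coord_add)

lemmas coord_facts = additive_facts[OF coord_additive M.abelian_group_axioms R.abelian_group_axioms]

lemma coord_smult:
  assumes "r \<in> carrier R" "x \<in> carrier M" "b \<in> B"
  shows "coord (r \<odot>\<^bsub>M\<^esub> x) b = r \<otimes> coord x b"
proof (rule coord_unique)
  have "r \<odot>\<^bsub>M\<^esub> x = r \<odot>\<^bsub>M\<^esub> (\<Oplus>\<^bsub>M\<^esub>b\<in>B. coord x b \<odot>\<^bsub>M\<^esub> b)"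
    using coord_props(2) assms by simp
  also have "\<dots> = (\<Oplus>\<^bsub>M\<^esub>b\<in>B. r \<odot>\<^bsub>M\<^esub> (coord x b \<odot>\<^bsub>M\<^esub> b))"
  proof (rule additive_finsum[OF _ M.abelian_group_axioms M.abelian_group_axioms])
    show "additive M M (smult M r)" using assms by (simp add: additive_def smult_closed smult_r_distr)
  qed (use assms coord_closed basis_closed smult_closed in blast)
  also have "\<dots> = (\<Oplus>\<^bsub>M\<^esub>b\<in>B. (r \<otimes> coord x b) \<odot>\<^bsub>M\<^esub> b)"
    using assms coord_closed basis_closed by (intro M.finsum_cong') (auto simp: smult_assoc intro!: smult_closed)
  finally show "r \<odot>\<^bsub>M\<^esub> x = (\<Oplus>\<^bsub>M\<^esub>b\<in>B. (r \<otimes> coord x b) \<odot>\<^bsub>M\<^esub> b)" .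
qed (use assms coord_closed in auto)

lemma coord_basis:
  assumes "b \<in> B" "b' \<in> B"
  shows "coord b b' = (if b' = b then \<one> else \<zero>)"
proof (rule coord_unique[where r = "\<lambda>b'. if b' = b then \<one> else \<zero>"])
  have "(\<Oplus>\<^bsub>M\<^esub>b'\<in>B. (if b' = b then \<one> else \<zero>) \<odot>\<^bsub>M\<^esub> b') = (\<Oplus>\<^bsub>M\<^esub>b'\<in>B. if b = b' then b' else \<zero>\<^bsub>M\<^esub>)"
    using basis_closed by (intro M.finsum_cong') (auto simp: smult_one zero_smult)
  also have "\<dots> = b" using assms finite_B basis_closed by (intro M.finsum_singleton) auto
  finally show "b = (\<Oplus>\<^bsub>M\<^esub>b'\<in>B. (if b' = b then \<one> else \<zero>) \<odot>\<^bsub>M\<^esub> b')" by simp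
qed (use assms in auto)

end

lemma fg_free_basis:
  assumes "fg_free R M" obtains B where "free_basis R M B"
proof -
  obtain B where "finite B" "B \<subseteq> carrier M"
    "\<forall>x \<in> carrier M. \<exists>!r. r \<in> B \<rightarrow>\<^sub>E carrier R \<and> x = (\<Oplus>\<^bsub>M\<^esub>b\<in>B. r b \<odot>\<^bsub>M\<^esub> b)"
    using assms unfolding fg_free_def by (elim conjE exE)
  then have "free_basis R M B"
    using assms unfolding fg_free_def by (intro free_basis.intro free_basis_axioms.intro) simp_all
  then show ?thesis by (rule that)
qed

section \<open>Submodules given by supports\<close>

lemma group_ring_simps [simp]:
  "\<zero>\<^bsub>\<int>[G]\<^esub> = 0" "x \<oplus>\<^bsub>\<int>[G]\<^esub> y = x + y" "\<one>\<^bsub>\<int>[G]\<^esub> = frag_of \<one>\<^bsub>G\<^esub>"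
  by (simp_all add: group_ring_def)

lemma group_ring_carrier: "x \<in> carrier \<int>[G] \<longleftrightarrow> Poly_Mapping.keys x \<subseteq> carrier G"
  by (simp add: group_ring_def)

lemma frag_of_closed: "g \<in> carrier G \<Longrightarrow> frag_of g \<in> carrier \<int>[G]"
  by (simp add: group_ring_carrier)

lemma frag_of_mult: "frag_of g \<otimes>\<^bsub>\<int>[G]\<^esub> frag_of h = frag_of (g \<otimes>\<^bsub>G\<^esub> h)"
  by (simp add: group_ring_def)

lemma gr_map_of: "gr_map f (frag_of g) = frag_of (f g)"
  by (simp add: gr_map_def)

lemma group_ring_minus:
  assumes "group G" "x \<in> carrier \<int>[G]" "y \<in> carrier \<int>[G]"
  shows "x \<ominus>\<^bsub>\<int>[G]\<^esub> y = x - y"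
proof -
  interpret ring "\<int>[G]" by (rule ring_group_ring[OF assms(1)])
  have "- y \<in> carrier \<int>[G]" using assms by (simp add: group_ring_carrier)
  then have "\<ominus>\<^bsub>\<int>[G]\<^esub> y = - y" using assms by (intro minus_equality) auto
  then show ?thesis by (simp add: a_minus_def)
qed

lemma keys_group_ring_mult:
  "Poly_Mapping.keys (x \<otimes>\<^bsub>\<int>[G]\<^esub> y) \<subseteq> {g \<otimes>\<^bsub>G\<^esub> h | g h. g \<in> Poly_Mapping.keys x \<and> h \<in> Poly_Mapping.keys y}"
proof -
  have "Poly_Mapping.keys (frag_extend (\<lambda>b. frag_of (a \<otimes>\<^bsub>G\<^esub> b)) y) \<subseteq> {a \<otimes>\<^bsub>G\<^esub> h | h. h \<in> Poly_Mapping.keys y}" for a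
    by (rule order_trans[OF keys_frag_extend]) auto
  then have "(\<Union>a\<in>Poly_Mapping.keys x. Poly_Mapping.keys (frag_extend (\<lambda>b. frag_of (a \<otimes>\<^bsub>G\<^esub> b)) y)) \<subseteq>
      {g \<otimes>\<^bsub>G\<^esub> h | g h. g \<in> Poly_Mapping.keys x \<and> h \<in> Poly_Mapping.keys y}"
    by blast
  then show ?thesis
    unfolding group_ring_def by (auto intro!: order_trans[OF keys_frag_extend])
qed

locale free_group_module = G?: group G + F?: free_basis "\<int>[G]" C B
  for G :: "'g monoid" and C :: "('g \<Rightarrow>\<^sub>0 int, 'm) module" and B :: "'m set"
begin

abbreviation act :: "'g \<Rightarrow> 'm \<Rightarrow> 'm" (infixr \<open>\<bullet>\<close> 75) where
  "g \<bullet> x \<equiv> frag_of g \<odot>\<^bsub>C\<^esub> x"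

lemma act_closed: "g \<in> carrier G \<Longrightarrow> x \<in> carrier C \<Longrightarrow> g \<bullet> x \<in> carrier C"
  by (simp add: F.smult_closed frag_of_closed)

lemma act_act: "g \<in> carrier G \<Longrightarrow> h \<in> carrier G \<Longrightarrow> x \<in> carrier C \<Longrightarrow> g \<bullet> h \<bullet> x = (g \<otimes>\<^bsub>G\<^esub> h) \<bullet> x"
  by (simp add: frag_of_closed frag_of_mult flip: F.smult_assoc)

text \<open>The terms of all the finite splittings have this form, with \<open>W b\<close> a union of orbits of
  the subgroup over which the term is a module; additively, this is the span of the elements \<open>g
  b\<close> with \<open>g \<in> W b\<close>.\<close>
definition supported :: "('m \<Rightarrow> 'g set) \<Rightarrow> 'm set" where
  "supported W = {x \<in> carrier C. \<forall>b \<in> B. Poly_Mapping.keys (coord x b) \<subseteq> W b}"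

lemma supported_carrier: "x \<in> supported W \<Longrightarrow> x \<in> carrier C"
  by (simp add: supported_def)

lemma supported_zero: "\<zero>\<^bsub>C\<^esub> \<in> supported W"
  by (simp add: supported_def coord_facts)

lemma supported_add: "x \<in> supported W \<Longrightarrow> y \<in> supported W \<Longrightarrow> x \<oplus>\<^bsub>C\<^esub> y \<in> supported W"
  by (simp add: supported_def coord_add keys_add_subset)

lemma supported_minus: "x \<in> supported W \<Longrightarrow> y \<in> supported W \<Longrightarrow> x \<ominus>\<^bsub>C\<^esub> y \<in> supported W"
  by (simp add: supported_def coord_facts group_ring_minus[OF is_group] coord_closed keys_diff_subset)

lemma supported_smult:
  assumes s: "s \<in> carrier \<int>[G]" and x: "x \<in> supported W"
    and W: "\<And>g b w. g \<in> Poly_Mapping.keys s \<Longrightarrow> b \<in> B \<Longrightarrow> w \<in> W b \<Longrightarrow> g \<otimes>\<^bsub>G\<^esub> w \<in> W' b"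
  shows "s \<odot>\<^bsub>C\<^esub> x \<in> supported W'"
proof -
  have "Poly_Mapping.keys (s \<otimes>\<^bsub>\<int>[G]\<^esub> coord x b) \<subseteq> W' b" if "b \<in> B" for b
  proof
    fix u assume "u \<in> Poly_Mapping.keys (s \<otimes>\<^bsub>\<int>[G]\<^esub> coord x b)"
    then obtain g h where "u = g \<otimes>\<^bsub>G\<^esub> h" "g \<in> Poly_Mapping.keys s" "h \<in> Poly_Mapping.keys (coord x b)"
      using keys_group_ring_mult[of G s "coord x b"] by blast
    with W[OF _ that] x that show "u \<in> W' b" unfolding supported_def by blast
  qed
  then show ?thesis using s x by (simp add: supported_def coord_smult F.smult_closed)
qed

lemma coord_act_basis:
  "g \<in> carrier G \<Longrightarrow> b \<in> B \<Longrightarrow> b' \<in> B \<Longrightarrow> coord (g \<bullet> b) b' = (if b' = b then frag_of g else 0)"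
  using F.R.r_one[OF frag_of_closed] F.R.r_null[OF frag_of_closed]
  by (simp add: coord_smult coord_basis frag_of_closed basis_closed)

lemma act_basis_supported: "g \<in> carrier G \<Longrightarrow> b \<in> B \<Longrightarrow> g \<in> W b \<Longrightarrow> g \<bullet> b \<in> supported W"
  by (simp add: supported_def coord_act_basis act_closed basis_closed)

lemma supported_induct [consumes 1, case_names zero diff act]:
  assumes x: "x \<in> supported W" and zero: "P \<zero>\<^bsub>C\<^esub>"
    and diff: "\<And>x y. x \<in> supported W \<Longrightarrow> y \<in> supported W \<Longrightarrow> P x \<Longrightarrow> P y \<Longrightarrow> P (x \<ominus>\<^bsub>C\<^esub> y)"
    and act: "\<And>g b. g \<in> carrier G \<Longrightarrow> b \<in> B \<Longrightarrow> g \<in> W b \<Longrightarrow> P (g \<bullet> b)"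
  shows "P x"
proof -
  have one: "s \<odot>\<^bsub>C\<^esub> b \<in> supported W \<and> P (s \<odot>\<^bsub>C\<^esub> b)"
    if b: "b \<in> B" and s: "Poly_Mapping.keys s \<subseteq> carrier G \<inter> W b" for s b
    using s
  proof (induction s rule: free_Abelian_group_induct[consumes 1, case_names 1 2 3])
    case 1
    show ?case using F.zero_smult[OF basis_closed[OF b]] zero supported_zero by simp
  next
    case (2 s t)
    then have "s \<in> carrier \<int>[G]" "t \<in> carrier \<int>[G]" by (auto simp: group_ring_carrier)
    then have "(s - t) \<odot>\<^bsub>C\<^esub> b = s \<odot>\<^bsub>C\<^esub> b \<ominus>\<^bsub>C\<^esub> t \<odot>\<^bsub>C\<^esub> b"
      using F.minus_smult[OF _ _ basis_closed[OF b], of s t] by (simp add: group_ring_minus[OF is_group])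
    with 2 show ?case using diff supported_minus by simp
  next
    case (3 g)
    then show ?case using act act_basis_supported b by simp
  qed
  have "(\<Oplus>\<^bsub>C\<^esub>b\<in>T. coord x b \<odot>\<^bsub>C\<^esub> b) \<in> supported W \<and> P (\<Oplus>\<^bsub>C\<^esub>b\<in>T. coord x b \<odot>\<^bsub>C\<^esub> b)"
    if "finite T" "T \<subseteq> B" for T
    using that
  proof (induction T)
    case empty
    then show ?case using zero supported_zero by simp
  next
    case (insert b T)
    let ?y = "\<Oplus>\<^bsub>C\<^esub>b\<in>T. coord x b \<odot>\<^bsub>C\<^esub> b"
    have cl: "coord x b \<odot>\<^bsub>C\<^esub> b \<in> carrier C" if "b \<in> B" for b
      using that x coord_closed basis_closed by (intro F.smult_closed) (auto simp: supported_def)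
    have "Poly_Mapping.keys (coord x b) \<subseteq> carrier G \<inter> W b"
      using x insert.prems coord_closed[of x b] by (auto simp: supported_def group_ring_carrier)
    with insert.prems have b: "coord x b \<odot>\<^bsub>C\<^esub> b \<in> supported W" "P (coord x b \<odot>\<^bsub>C\<^esub> b)"
      using one by auto
    have y: "?y \<in> supported W" "P ?y" using insert by auto
    have "\<zero>\<^bsub>C\<^esub> \<ominus>\<^bsub>C\<^esub> ?y \<in> supported W \<and> P (\<zero>\<^bsub>C\<^esub> \<ominus>\<^bsub>C\<^esub> ?y)"
      using diff[OF supported_zero y(1) zero y(2)] supported_minus[OF supported_zero y(1)] by simp
    then have "coord x b \<odot>\<^bsub>C\<^esub> b \<ominus>\<^bsub>C\<^esub> (\<zero>\<^bsub>C\<^esub> \<ominus>\<^bsub>C\<^esub> ?y) \<in> supported W \<and> P (coord x b \<odot>\<^bsub>C\<^esub> b \<ominus>\<^bsub>C\<^esub> (\<zero>\<^bsub>C\<^esub> \<ominus>\<^bsub>C\<^esub> ?y))"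
      using b diff supported_minus by blast
    moreover have "coord x b \<odot>\<^bsub>C\<^esub> b \<ominus>\<^bsub>C\<^esub> (\<zero>\<^bsub>C\<^esub> \<ominus>\<^bsub>C\<^esub> ?y) = coord x b \<odot>\<^bsub>C\<^esub> b \<oplus>\<^bsub>C\<^esub> ?y"
      using supported_carrier[OF y(1)] supported_carrier[OF b(1)] by (simp add: F.M.minus_eq)
    moreover have "(\<Oplus>\<^bsub>C\<^esub>b\<in>insert b T. coord x b \<odot>\<^bsub>C\<^esub> b) = coord x b \<odot>\<^bsub>C\<^esub> b \<oplus>\<^bsub>C\<^esub> ?y"
      using insert cl by (intro F.M.finsum_insert) auto
    ultimately show ?case by simp
  qed
  from this[OF finite_B order_refl] show ?thesis
    using coord_props(2)[OF supported_carrier[OF x]] by simp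
qed

end

lemma keys_gr_map: "Poly_Mapping.keys (gr_map f s) \<subseteq> f ` Poly_Mapping.keys s"
  unfolding gr_map_def by (rule order_trans[OF keys_frag_extend]) auto

definition translates :: "'k monoid \<Rightarrow> 'g monoid \<Rightarrow> ('k \<Rightarrow> 'g) \<Rightarrow> 'g set \<Rightarrow> 'g set" where
  "translates K G k Z = {k h \<otimes>\<^bsub>G\<^esub> z | h z. h \<in> carrier K \<and> z \<in> Z}"

text \<open>These representatives of the orbits that meet \<open>Z\<close> will index a basis, so they must not
  be redundant.\<close>
lemma translate_transversal:
  assumes K: "group K" and G: "group G" and k: "k \<in> hom K G" and Z: "finite Z" "Z \<subseteq> carrier G"
  obtains R where "R \<subseteq> Z" "Z \<subseteq> translates K G k R"
    "\<And>r r' h. r \<in> R \<Longrightarrow> r' \<in> R \<Longrightarrow> h \<in> carrier K \<Longrightarrow> r = k h \<otimes>\<^bsub>G\<^esub> r' \<Longrightarrow> r = r'"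
proof -
  interpret K: group K by fact
  interpret G: group G by fact
  interpret k: group_hom K G k using k by unfold_locales
  have "\<exists>R \<subseteq> Z. Z \<subseteq> translates K G k R \<and>
    (\<forall>r \<in> R. \<forall>r' \<in> R. \<forall>h \<in> carrier K. r = k h \<otimes>\<^bsub>G\<^esub> r' \<longrightarrow> r = r')"
    using Z
  proof (induction Z)
    case empty
    show ?case by auto
  next
    case (insert z Z)
    then obtain R where R: "R \<subseteq> Z" "Z \<subseteq> translates K G k R"
      "\<And>r r' h. r \<in> R \<Longrightarrow> r' \<in> R \<Longrightarrow> h \<in> carrier K \<Longrightarrow> r = k h \<otimes>\<^bsub>G\<^esub> r' \<Longrightarrow> r = r'"
      by (metis insert_subset)
    show ?case
    proof (cases "z \<in> translates K G k R")
      case True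
      then show ?thesis using R by (intro exI[of _ R]) blast
    next
      case False
      have zc: "z \<in> carrier G" and Rc: "R \<subseteq> carrier G" using insert.prems R by auto
      have "z \<in> translates K G k (insert z R)"
        using zc unfolding translates_def by (intro CollectI exI[of _ "\<one>\<^bsub>K\<^esub>"] exI[of _ z]) auto
      moreover have "translates K G k R \<subseteq> translates K G k (insert z R)"
        by (auto simp: translates_def)
      moreover have n1: "r \<noteq> k h \<otimes>\<^bsub>G\<^esub> z" if "r \<in> R" "h \<in> carrier K" for r h
      proof
        assume "r = k h \<otimes>\<^bsub>G\<^esub> z"
        then have "z = k (inv\<^bsub>K\<^esub> h) \<otimes>\<^bsub>G\<^esub> r" using that zc Rc by (simp add: G.inv_solve_left)
        with that False show False by (auto simp: translates_def)
      qed
      moreover have n2: "z \<noteq> k h \<otimes>\<^bsub>G\<^esub> r" if "r \<in> R" "h \<in> carrier K" for r h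
        using that False by (auto simp: translates_def)
      moreover have "r = r'" if rr: "r \<in> insert z R" "r' \<in> insert z R" "h \<in> carrier K" "r = k h \<otimes>\<^bsub>G\<^esub> r'" for r r' h
      proof (cases "r = z")
        case True
        then show ?thesis using rr n2[of r' h] by auto
      next
        case False
        then show ?thesis using rr n1[of r h] R(3)[of r r' h] by auto
      qed
      ultimately show ?thesis using R
        by (intro exI[of _ "insert z R"]) blast
    qed
  qed
  then show ?thesis using that by blast
qed

text \<open>The \<open>\<int>[K]\<close>-coefficient at \<open>z\<close> of an element of
  \<open>\<int>[G]\<close>, where \<open>\<int>[G]\<close> is seen as the free
  \<open>\<int>[K]\<close>-module on the orbits \<open>k(K)z\<close>.\<close>
definition pull :: "'k monoid \<Rightarrow> 'g monoid \<Rightarrow> ('k \<Rightarrow> 'g) \<Rightarrow> 'g \<Rightarrow> ('g \<Rightarrow>\<^sub>0 int) \<Rightarrow> ('k \<Rightarrow>\<^sub>0 int)" where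
  "pull K G k z = frag_extend (\<lambda>g. if g \<in> translates K G k {z}
     then frag_of (inv_into (carrier K) (\<lambda>h. k h \<otimes>\<^bsub>G\<^esub> z) g) else 0)"

locale free_sub = free_group_module G C B + K: group K
  for G :: "'g monoid" and C :: "('g \<Rightarrow>\<^sub>0 int, 'm) module" and B :: "'m set" and K :: "'k monoid" +
  fixes k :: "'k \<Rightarrow> 'g"
  assumes k: "k \<in> hom K G"
begin

sublocale k: group_hom K G k using k by unfold_locales

abbreviation span :: "('m \<Rightarrow> 'g set) \<Rightarrow> 'm set" where
  "span Z \<equiv> supported (\<lambda>b. translates K G k (Z b))"

lemma translates_self:
  assumes "Z \<subseteq> carrier G" shows "Z \<subseteq> translates K G k Z"
proof
  fix z assume "z \<in> Z"
  with assms have "z \<in> Z" "z \<in> carrier G" by auto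
  then show "z \<in> translates K G k Z"
    unfolding translates_def by (intro CollectI exI[of _ "\<one>\<^bsub>K\<^esub>"] exI[of _ z]) auto
qed

lemma translates_mult:
  assumes "Z \<subseteq> carrier G" "h \<in> carrier K" "g \<in> translates K G k Z"
  shows "k h \<otimes>\<^bsub>G\<^esub> g \<in> translates K G k Z"
proof -
  obtain h' z where "h' \<in> carrier K" "z \<in> Z" "g = k h' \<otimes>\<^bsub>G\<^esub> z" using assms(3) by (auto simp: translates_def)
  moreover from this assms have "k h \<otimes>\<^bsub>G\<^esub> g = k (h \<otimes>\<^bsub>K\<^esub> h') \<otimes>\<^bsub>G\<^esub> z" by (auto simp: G.m_assoc)
  ultimately show ?thesis using assms(2) unfolding translates_def by blast
qed

lemma span_closed:
  assumes Z: "\<And>b. b \<in> B \<Longrightarrow> Z b \<subseteq> carrier G"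
  shows "closed_along \<int>[K] (gr_map k) C (span Z)"
  unfolding closed_along_def
proof (intro conjI ballI)
  fix r x assume r: "r \<in> carrier \<int>[K]" and x: "x \<in> span Z"
  show "gr_map k r \<odot>\<^bsub>C\<^esub> x \<in> span Z"
  proof (rule supported_smult[OF _ x])
    show "gr_map k r \<in> carrier \<int>[G]"
      using ring_hom_closed[OF gr_map_ring_hom[OF K.is_group is_group k] r] .
    fix g b w assume "g \<in> Poly_Mapping.keys (gr_map k r)" "b \<in> B" "w \<in> translates K G k (Z b)"
    moreover from this have "g \<in> k ` carrier K"
      using keys_gr_map[of k r] r by (auto simp: group_ring_carrier)
    ultimately show "g \<otimes>\<^bsub>G\<^esub> w \<in> translates K G k (Z b)" using translates_mult Z by blast
  qed
qed (use supported_zero supported_add supported_carrier in auto)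

lemma left_module_span:
  "(\<And>b. b \<in> B \<Longrightarrow> Z b \<subseteq> carrier G) \<Longrightarrow> left_module \<int>[K] (sub_mod (gr_map k) C (span Z))"
  by (rule left_module_sub_mod[OF ring_group_ring[OF K.is_group] F.left_module_axioms
      gr_map_ring_hom[OF K.is_group is_group k] span_closed])

context
  assumes inj: "inj_on k (carrier K)"
begin

lemma pull_of:
  assumes z: "z \<in> carrier G"
  shows "h \<in> carrier K \<Longrightarrow> pull K G k z (frag_of (k h \<otimes>\<^bsub>G\<^esub> z)) = frag_of h"
    "g \<notin> translates K G k {z} \<Longrightarrow> pull K G k z (frag_of g) = 0"
proof -
  assume h: "h \<in> carrier K"
  have "inj_on (\<lambda>h. k h \<otimes>\<^bsub>G\<^esub> z) (carrier K)"
    using inj z by (auto intro!: inj_onI dest: inj_onD)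
  then have "inv_into (carrier K) (\<lambda>h. k h \<otimes>\<^bsub>G\<^esub> z) (k h \<otimes>\<^bsub>G\<^esub> z) = h" using h by (rule inv_into_f_f)
  moreover have "k h \<otimes>\<^bsub>G\<^esub> z \<in> translates K G k {z}" using h by (auto simp: translates_def)
  ultimately show "pull K G k z (frag_of (k h \<otimes>\<^bsub>G\<^esub> z)) = frag_of h"
    by (simp add: pull_def)
qed (simp add: pull_def)

lemma pull_closed:
  assumes z: "z \<in> carrier G" shows "pull K G k z s \<in> carrier \<int>[K]"
proof -
  have "Poly_Mapping.keys (pull K G k z (frag_of g)) \<subseteq> carrier K" for g
    using pull_of[OF z] by (cases "g \<in> translates K G k {z}") (auto simp: translates_def)
  then have "(\<Union>g\<in>Poly_Mapping.keys s. Poly_Mapping.keys (if g \<in> translates K G k {z}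
     then frag_of (inv_into (carrier K) (\<lambda>h. k h \<otimes>\<^bsub>G\<^esub> z) g) else 0)) \<subseteq> carrier K"
    unfolding pull_def frag_extend_of by blast
  then show ?thesis
    unfolding group_ring_carrier pull_def by (rule order_trans[OF keys_frag_extend])
qed

lemma pull_add: "pull K G k z (s + t) = pull K G k z s + pull K G k z t"
  by (simp add: pull_def frag_extend_add)

lemma pull_smult:
  assumes z: "z \<in> carrier G" and r: "r \<in> carrier \<int>[K]" and s: "s \<in> carrier \<int>[G]"
  shows "pull K G k z (gr_map k r \<otimes>\<^bsub>\<int>[G]\<^esub> s) = r \<otimes>\<^bsub>\<int>[K]\<^esub> pull K G k z s"
proof -
  have of: "pull K G k z (frag_of (k h \<otimes>\<^bsub>G\<^esub> g)) = frag_extend (\<lambda>b. frag_of (h \<otimes>\<^bsub>K\<^esub> b)) (pull K G k z (frag_of g))"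
    if h: "h \<in> carrier K" and g: "g \<in> carrier G" for h g
  proof (cases "g \<in> translates K G k {z}")
    case True
    then obtain h' where h': "h' \<in> carrier K" "g = k h' \<otimes>\<^bsub>G\<^esub> z" by (auto simp: translates_def)
    then have "k h \<otimes>\<^bsub>G\<^esub> g = k (h \<otimes>\<^bsub>K\<^esub> h') \<otimes>\<^bsub>G\<^esub> z" using h z by (simp add: G.m_assoc)
    then show ?thesis using h h' z by (simp only: pull_of K.m_closed) simp
  next
    case False
    have "k h \<otimes>\<^bsub>G\<^esub> g \<notin> translates K G k {z}"
    proof
      assume "k h \<otimes>\<^bsub>G\<^esub> g \<in> translates K G k {z}"
      then have "k (inv\<^bsub>K\<^esub> h) \<otimes>\<^bsub>G\<^esub> (k h \<otimes>\<^bsub>G\<^esub> g) \<in> translates K G k {z}"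
        by (rule translates_mult[rotated 2]) (use h z in auto)
      moreover have "k (inv\<^bsub>K\<^esub> h) \<otimes>\<^bsub>G\<^esub> (k h \<otimes>\<^bsub>G\<^esub> g) = g" using h g by (simp add: G.m_assoc[symmetric])
      ultimately show False using False by simp
    qed
    with False show ?thesis using pull_of(2)[OF z] by simp
  qed
  have "pull K G k z (gr_map k r \<otimes>\<^bsub>\<int>[G]\<^esub> s) =
      frag_extend (\<lambda>h. frag_extend (\<lambda>g. pull K G k z (frag_of (k h \<otimes>\<^bsub>G\<^esub> g))) s) r"
    by (simp add: group_ring_def gr_map_def frag_extend_frag_extend pull_def)
  also have "\<dots> = frag_extend (\<lambda>h. frag_extend (\<lambda>g. frag_extend (\<lambda>b. frag_of (h \<otimes>\<^bsub>K\<^esub> b)) (pull K G k z (frag_of g))) s) r"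
    using r s of by (intro frag_extend_eq) (auto simp: group_ring_carrier intro!: frag_extend_eq)
  also have "\<dots> = r \<otimes>\<^bsub>\<int>[K]\<^esub> pull K G k z s"
    by (simp add: group_ring_def frag_extend_frag_extend pull_def)
  finally show ?thesis .
qed

text \<open>Restricted to a subgroup, the free module on \<open>B\<close> is free on the elements \<open>z
  b\<close>, with \<open>z\<close> in a transversal of the orbits of \<open>K\<close> on
  \<open>G\<close>, and \<open>span Z\<close> uses the finitely many orbits that meet \<open>Z
  b\<close>. The freeness needs \<open>k\<close> to be injective; this is where injectivity of the
  maps into \<open>G\<close> enters.\<close>
lemma fg_free_span:
  assumes Z: "\<And>b. b \<in> B \<Longrightarrow> finite (Z b)" "\<And>b. b \<in> B \<Longrightarrow> Z b \<subseteq> carrier G"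
  shows "fg_free \<int>[K] (sub_mod (gr_map k) C (span Z))"
proof -
  let ?N = "sub_mod (gr_map k) C (span Z)"
  interpret N: left_module "\<int>[K]" ?N by (rule left_module_span[OF Z(2)])
  note hom = gr_map_ring_hom[OF K.is_group is_group k]
  define good where "good b T \<longleftrightarrow> T \<subseteq> Z b \<and> Z b \<subseteq> translates K G k T \<and>
    (\<forall>r \<in> T. \<forall>r' \<in> T. \<forall>h \<in> carrier K. r = k h \<otimes>\<^bsub>G\<^esub> r' \<longrightarrow> r = r')" for b T
  have "\<exists>T. good b T" if "b \<in> B" for b
    by (rule translate_transversal[OF K.is_group is_group k Z[OF that]]) (unfold good_def, blast)
  then obtain R where "\<And>b. b \<in> B \<Longrightarrow> good b (R b)" by metis
  then have R: "\<And>b. b \<in> B \<Longrightarrow> R b \<subseteq> Z b" "\<And>b. b \<in> B \<Longrightarrow> Z b \<subseteq> translates K G k (R b)"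
    "\<And>b r r' h. b \<in> B \<Longrightarrow> r \<in> R b \<Longrightarrow> r' \<in> R b \<Longrightarrow> h \<in> carrier K \<Longrightarrow> r = k h \<otimes>\<^bsub>G\<^esub> r' \<Longrightarrow> r = r'"
    unfolding good_def by blast+
  define J where "J = Sigma B R"
  define e where "e = (\<lambda>(b, z). z \<bullet> b)"
  define \<pi> where "\<pi> = (\<lambda>(b, z) x. pull K G k z (coord x b))"
  have J: "finite J" unfolding J_def
    by (intro finite_SigmaI finite_B finite_subset[OF R(1) Z(1)])
  have RG: "z \<in> carrier G" if "b \<in> B" "z \<in> R b" for b z using that R(1) Z(2) by blast
  have e: "e j \<in> span Z" if jJ: "j \<in> J" for j
  proof -
    obtain b z where j: "j = (b, z)" "b \<in> B" "z \<in> R b" using jJ unfolding J_def by blast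
    have "z \<in> translates K G k (Z b)" using translates_self[OF Z(2)] R(1) j by blast
    then show ?thesis using j RG by (auto simp: e_def intro!: act_basis_supported)
  qed
  have \<pi>c: "\<pi> j x \<in> carrier \<int>[K]" if "j \<in> J" for j x
    using that RG by (auto simp: J_def \<pi>_def intro!: pull_closed)
  have \<pi>: "additive ?N \<int>[K] (\<pi> j)" if "j \<in> J" for j
    using that \<pi>c[OF that] by (auto simp: additive_def J_def \<pi>_def coord_add supported_carrier pull_add)
  have \<pi>_of: "\<pi> (b', z') (frag_of (k h \<otimes>\<^bsub>G\<^esub> z) \<odot>\<^bsub>C\<^esub> b) = (if (b', z') = (b, z) then frag_of h else 0)"
    if bz: "b \<in> B" "z \<in> R b" "b' \<in> B" "z' \<in> R b'" and h: "h \<in> carrier K" for b z b' z' h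
  proof (cases "b' = b")
    case True
    have "k h \<otimes>\<^bsub>G\<^esub> z \<notin> translates K G k {z'}" if "z' \<noteq> z"
    proof
      assume "k h \<otimes>\<^bsub>G\<^esub> z \<in> translates K G k {z'}"
      then obtain h' where h': "h' \<in> carrier K" "k h \<otimes>\<^bsub>G\<^esub> z = k h' \<otimes>\<^bsub>G\<^esub> z'" by (auto simp: translates_def)
      then have zz: "z = k (inv\<^bsub>K\<^esub> h \<otimes>\<^bsub>K\<^esub> h') \<otimes>\<^bsub>G\<^esub> z'"
        using h RG bz by (simp add: G.m_assoc G.inv_solve_left flip: h'(2))
      have "z' \<in> R b" "inv\<^bsub>K\<^esub> h \<otimes>\<^bsub>K\<^esub> h' \<in> carrier K" using bz True h h' by auto
      from R(3)[OF bz(1,2) this zz] that show False by simp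
    qed
    then show ?thesis using bz h RG True pull_of by (simp add: \<pi>_def coord_act_basis)
  next
    case False
    then show ?thesis using bz h RG by (simp add: \<pi>_def coord_act_basis pull_def)
  qed
  have \<pi>_e: "\<pi> i (e j) = (if i = j then \<one>\<^bsub>\<int>[K]\<^esub> else \<zero>\<^bsub>\<int>[K]\<^esub>)" if "i \<in> J" "j \<in> J" for i j
  proof -
    obtain b z b' z' where "j = (b, z)" "b \<in> B" "z \<in> R b" "i = (b', z')" "b' \<in> B" "z' \<in> R b'"
      using \<open>i \<in> J\<close> \<open>j \<in> J\<close> by (auto simp: J_def)
    then show ?thesis using \<pi>_of[of b z b' z' "\<one>\<^bsub>K\<^esub>"] RG by (simp add: e_def)
  qed
  \<comment> \<open>both sides of the expansion \<open>x = E x\<close> are additive, so it is enough to check it on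
    the elements \<open>g b\<close>\<close>
  define E where "E x = (\<Oplus>\<^bsub>?N\<^esub>j\<in>J. \<pi> j x \<odot>\<^bsub>?N\<^esub> e j)" for x
  have Ec: "\<pi> j x \<odot>\<^bsub>?N\<^esub> e j \<in> carrier ?N" if "j \<in> J" for j x
    using N.smult_closed[OF \<pi>c[OF that], of "e j"] e[OF that] by simp
  have E: "additive ?N ?N E"
    unfolding additive_def
  proof (intro conjI ballI)
    fix x assume x: "x \<in> carrier ?N"
    show "E x \<in> carrier ?N" unfolding E_def using Ec by (intro N.M.finsum_closed) blast
    fix y assume y: "y \<in> carrier ?N"
    have "E (x \<oplus>\<^bsub>?N\<^esub> y) = (\<Oplus>\<^bsub>?N\<^esub>j\<in>J. \<pi> j x \<odot>\<^bsub>?N\<^esub> e j \<oplus>\<^bsub>?N\<^esub> \<pi> j y \<odot>\<^bsub>?N\<^esub> e j)"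
      unfolding E_def
    proof (rule N.M.finsum_cong'[OF refl])
      show "(\<lambda>j. \<pi> j x \<odot>\<^bsub>?N\<^esub> e j \<oplus>\<^bsub>?N\<^esub> \<pi> j y \<odot>\<^bsub>?N\<^esub> e j) \<in> J \<rightarrow> carrier ?N"
        using Ec N.M.a_closed by blast
      fix j assume j: "j \<in> J"
      have "\<pi> j (x \<oplus>\<^bsub>?N\<^esub> y) = \<pi> j x \<oplus>\<^bsub>\<int>[K]\<^esub> \<pi> j y" using \<pi>[OF j] x y by (simp add: additive_def)
      then show "\<pi> j (x \<oplus>\<^bsub>?N\<^esub> y) \<odot>\<^bsub>?N\<^esub> e j = \<pi> j x \<odot>\<^bsub>?N\<^esub> e j \<oplus>\<^bsub>?N\<^esub> \<pi> j y \<odot>\<^bsub>?N\<^esub> e j"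
        using N.smult_l_distr[OF \<pi>c[OF j] \<pi>c[OF j], of "e j"] e[OF j] by simp
    qed
    also have "\<dots> = E x \<oplus>\<^bsub>?N\<^esub> E y"
      unfolding E_def using Ec by (intro N.M.finsum_addf) blast+
    finally show "E (x \<oplus>\<^bsub>?N\<^esub> y) = E x \<oplus>\<^bsub>?N\<^esub> E y" .
  qed
  note Ef = additive_facts[OF E N.M.abelian_group_axioms N.M.abelian_group_axioms]
  have "E x = x" if "x \<in> span Z" for x
    using that
  proof (induction rule: supported_induct)
    case zero
    show ?case using Ef(3) by simp
  next
    case (diff x y)
    have mn: "u \<ominus>\<^bsub>?N\<^esub> v = u \<ominus>\<^bsub>C\<^esub> v" if "u \<in> span Z" "v \<in> span Z" for u v
      by (rule sub_mod_uminus(2)[OF F.M.abelian_group_axioms N.M.abelian_group_axioms]) (use that supported_carrier in auto)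
    show ?case using Ef(5)[of x y] diff by (simp add: mn)
  next
    case (act g b)
    then obtain h z0 where "h \<in> carrier K" "z0 \<in> Z b" "g = k h \<otimes>\<^bsub>G\<^esub> z0" by (auto simp: translates_def)
    moreover then obtain h' z where "h' \<in> carrier K" "z \<in> R b" "z0 = k h' \<otimes>\<^bsub>G\<^esub> z"
      using R(2)[OF act(2)] by (auto simp: translates_def)
    ultimately have h: "h \<otimes>\<^bsub>K\<^esub> h' \<in> carrier K" and z: "z \<in> R b" and g: "g = k (h \<otimes>\<^bsub>K\<^esub> h') \<otimes>\<^bsub>G\<^esub> z"
      using RG[OF act(2)] by (auto simp: G.m_assoc)
    have j: "(b, z) \<in> J" using act z by (simp add: J_def)
    have "E (g \<bullet> b) = (\<Oplus>\<^bsub>?N\<^esub>j\<in>J. if (b, z) = j then g \<bullet> b else \<zero>\<^bsub>?N\<^esub>)"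
      unfolding E_def
    proof (rule N.M.finsum_cong'[OF refl])
      show "(\<lambda>j. if (b, z) = j then g \<bullet> b else \<zero>\<^bsub>?N\<^esub>) \<in> J \<rightarrow> carrier ?N"
        using act act_basis_supported supported_zero by auto
      fix j assume j: "j \<in> J"
      obtain b' z' where b': "j = (b', z')" "b' \<in> B" "z' \<in> R b'" using j by (auto simp: J_def)
      have "\<pi> j (g \<bullet> b) = (if (b', z') = (b, z) then frag_of (h \<otimes>\<^bsub>K\<^esub> h') else 0)"
        unfolding b'(1) g by (rule \<pi>_of[OF act(2) z b'(2,3) h])
      moreover have "frag_of (k (h \<otimes>\<^bsub>K\<^esub> h')) \<odot>\<^bsub>C\<^esub> (z \<bullet> b) = g \<bullet> b"
        unfolding g using act z h RG basis_closed by (intro act_act) auto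
      moreover have "gr_map k 0 \<odot>\<^bsub>C\<^esub> e j = \<zero>\<^bsub>C\<^esub>"
        using F.zero_smult[of "e j"] supported_carrier[OF e[OF j]] by (simp add: gr_map_def)
      ultimately show "\<pi> j (g \<bullet> b) \<odot>\<^bsub>?N\<^esub> e j = (if (b, z) = j then g \<bullet> b else \<zero>\<^bsub>?N\<^esub>)"
        using b' by (auto simp: gr_map_of e_def)
    qed
    also have "\<dots> = g \<bullet> b"
      using N.M.finsum_singleton[OF j J, of "\<lambda>_. g \<bullet> b"] act act_basis_supported by simp
    finally show ?case .
  qed
  then have exp: "x = (\<Oplus>\<^bsub>?N\<^esub>j\<in>J. \<pi> j x \<odot>\<^bsub>?N\<^esub> e j)" if "x \<in> carrier ?N" for x
    using that by (simp add: E_def)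
  have \<pi>_smult: "\<pi> j (r \<odot>\<^bsub>?N\<^esub> x) = r \<otimes>\<^bsub>\<int>[K]\<^esub> \<pi> j x"
    if "j \<in> J" "r \<in> carrier \<int>[K]" "x \<in> carrier ?N" for j r x
    using that RG ring_hom_closed[OF hom] supported_carrier
    by (auto simp: \<pi>_def J_def coord_smult coord_closed pull_smult)
  show ?thesis
    by (rule fg_free_dual_basis[OF N.left_module_axioms J _ \<pi> \<pi>_smult \<pi>_e exp]) (use e in auto)
qed

end

end

section \<open>Weighted evaluation of induced modules\<close>

definition weighted :: "('g \<Rightarrow> int) \<Rightarrow> ('g \<Rightarrow>\<^sub>0 int) \<Rightarrow> ('g \<Rightarrow>\<^sub>0 int)" where
  "weighted w = frag_extend (\<lambda>g. frag_cmul (w g) (frag_of g))"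

lemma weighted_closed: "s \<in> carrier \<int>[G] \<Longrightarrow> weighted w s \<in> carrier \<int>[G]"
  unfolding weighted_def group_ring_carrier
  by (rule order_trans[OF keys_frag_extend]) (auto dest: subsetD[OF keys_cmul])

lemma weighted_add: "weighted w (s + t) = weighted w s + weighted w t"
  by (simp add: weighted_def frag_extend_add)

lemma weighted_of: "weighted w (frag_of g) = frag_cmul (w g) (frag_of g)"
  by (simp add: weighted_def)

lemma weighted_one: "weighted (\<lambda>_. 1) s = s"
  by (simp add: weighted_def flip: frag_expansion)

lemma weighted_diff: "weighted (\<lambda>g. w g - w' g) s = weighted w s - weighted w' s"
  using subset_UNIV
  by (induction s rule: frag_induction)
    (simp_all add: weighted_def frag_extend_diff frag_cmul_diff_distrib)

lemma weighted_cong: "s \<in> carrier \<int>[G] \<Longrightarrow> (\<And>g. g \<in> carrier G \<Longrightarrow> w g = w' g) \<Longrightarrow> weighted w s = weighted w' s"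
  unfolding weighted_def by (intro frag_extend_eq) (auto simp: group_ring_carrier)

lemma frag_extend_cmul_of: "frag_extend f (frag_cmul c (frag_of g)) = frag_cmul c (f g)"
  by (simp add: frag_extend_cmul)

lemma frag_cmul_diff_distrib2: "frag_cmul c (a - b) = frag_cmul c a - frag_cmul c b"
  by (rule poly_mapping_eqI) (simp add: lookup_minus right_diff_distrib)

lemma weighted_mult:
  assumes w: "\<And>g h. g \<in> carrier G \<Longrightarrow> h \<in> Poly_Mapping.keys r \<Longrightarrow> w (g \<otimes>\<^bsub>G\<^esub> h) = w' g"
    and s: "s \<in> carrier \<int>[G]"
  shows "weighted w (s \<otimes>\<^bsub>\<int>[G]\<^esub> r) = weighted w' s \<otimes>\<^bsub>\<int>[G]\<^esub> r"
proof -
  have "frag_extend (\<lambda>h. frag_cmul (w (g \<otimes>\<^bsub>G\<^esub> h)) (frag_of (g \<otimes>\<^bsub>G\<^esub> h))) r =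
      frag_cmul (w' g) (frag_extend (\<lambda>h. frag_of (g \<otimes>\<^bsub>G\<^esub> h)) r)" if "g \<in> carrier G" for g
  proof -
    have "frag_extend (\<lambda>h. frag_cmul (w (g \<otimes>\<^bsub>G\<^esub> h)) (frag_of (g \<otimes>\<^bsub>G\<^esub> h))) r =
        frag_extend (\<lambda>h. frag_cmul (w' g) (frag_of (g \<otimes>\<^bsub>G\<^esub> h))) r"
      using w[OF that] by (intro frag_extend_eq) auto
    also have "\<dots> = frag_cmul (w' g) (frag_extend (\<lambda>h. frag_of (g \<otimes>\<^bsub>G\<^esub> h)) r)"
      using subset_UNIV
      by (induction r rule: frag_induction) (simp_all add: frag_extend_diff frag_cmul_diff_distrib2)
    finally show ?thesis .
  qed
  then show ?thesis
    using s unfolding weighted_def group_ring_def monoid.simps partial_object.simps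
    by (simp add: frag_extend_frag_extend frag_extend_cmul_of)
      (intro frag_extend_eq, auto)
qed

text \<open>The module induced from a \<open>\<int>[K]\<close>-submodule \<open>T\<close> of the restriction of
  \<open>C\<close>; the left and middle terms of a splitting inside the canonical one are of this
  kind, up to direct sums.\<close>
locale induced = G?: group G + C?: left_module "\<int>[G]" C + K: group K
  for G :: "'g monoid" and C :: "('g \<Rightarrow>\<^sub>0 int, 'm) module" and K :: "'k monoid" +
  fixes k :: "'k \<Rightarrow> 'g" and T :: "'m set"
  assumes k: "k \<in> hom K G" and T: "closed_along \<int>[K] (gr_map k) C T"
begin

abbreviation "sub \<equiv> sub_mod (gr_map k) C T"

sublocale k: group_hom K G k using k by unfold_locales

lemma gr_hom: "gr_map k \<in> ring_hom \<int>[K] \<int>[G]"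
  by (rule gr_map_ring_hom[OF K.is_group G.is_group k])

lemma left_module_sub: "left_module \<int>[K] sub"
  by (rule left_module_sub_mod[OF ring_group_ring[OF K.is_group] C.left_module_axioms gr_hom T])

sublocale b: base_change "\<int>[K]" "\<int>[G]" sub "gr_map k"
  by (rule base_change_group_ring[OF K.is_group G.is_group k left_module_sub])

lemma T_facts:
  "x \<in> T \<Longrightarrow> x \<in> carrier C" "\<zero>\<^bsub>C\<^esub> \<in> T" "x \<in> T \<Longrightarrow> y \<in> T \<Longrightarrow> x \<oplus>\<^bsub>C\<^esub> y \<in> T"
  "r \<in> carrier \<int>[K] \<Longrightarrow> x \<in> T \<Longrightarrow> gr_map k r \<odot>\<^bsub>C\<^esub> x \<in> T"
  using T by (auto simp: closed_along_def)

lemma T_minus: "x \<in> T \<Longrightarrow> y \<in> T \<Longrightarrow> x \<ominus>\<^bsub>C\<^esub> y \<in> T"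
  using b.M.minus_closed[of x y]
    sub_mod_uminus(2)[OF C.M.abelian_group_axioms left_module_abelian[OF left_module_sub], of x y]
  by (simp add: T_facts subset_iff)

lemma TP_frag_facts:
  "x \<in> T \<Longrightarrow> additive \<int>[G] b.TM (\<lambda>s. b.TP s x)" "s \<in> carrier \<int>[G] \<Longrightarrow> additive sub b.TM (b.TP s)"
  using b.TP_add_left[of _ _ x] b.TP_add_right[of s] by (simp_all add: additive_def b.TP_closed)

text \<open>Signs and multiplicities are absorbed by \<open>x\<close>, so group elements suffice on the left of
  the tensor sign.\<close>
lemma TM_group_induct [consumes 1, case_names zero add]:
  assumes X: "X \<in> carrier b.TM" and zero: "P \<zero>\<^bsub>b.TM\<^esub>"
    and add: "\<And>X g x. X \<in> carrier b.TM \<Longrightarrow> P X \<Longrightarrow> g \<in> carrier G \<Longrightarrow> x \<in> T \<Longrightarrow>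
      P (X \<oplus>\<^bsub>b.TM\<^esub> b.TP (frag_of g) x)"
  shows "P X"
proof -
  \<comment> \<open>\<open>P\<close> is only known to survive the addition of a generator, while tensors are built by
    differences\<close>
  define Q where "Q X \<longleftrightarrow> X \<in> carrier b.TM \<and>
    (\<forall>Y \<in> carrier b.TM. P Y \<longrightarrow> P (Y \<oplus>\<^bsub>b.TM\<^esub> X) \<and> P (Y \<ominus>\<^bsub>b.TM\<^esub> X))" for X
  have Q_diff: "Q (X \<ominus>\<^bsub>b.TM\<^esub> X')" if "Q X" "Q X'" for X X'
    unfolding Q_def
  proof (intro conjI ballI impI)
    have c: "X \<in> carrier b.TM" "X' \<in> carrier b.TM" using that by (simp_all add: Q_def)
    then show "X \<ominus>\<^bsub>b.TM\<^esub> X' \<in> carrier b.TM" by simp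
    fix Y assume Y: "Y \<in> carrier b.TM" "P Y"
    have "P ((Y \<oplus>\<^bsub>b.TM\<^esub> X) \<ominus>\<^bsub>b.TM\<^esub> X')" "P ((Y \<ominus>\<^bsub>b.TM\<^esub> X) \<oplus>\<^bsub>b.TM\<^esub> X')"
      using Y c that by (simp_all add: Q_def)
    then show "P (Y \<oplus>\<^bsub>b.TM\<^esub> (X \<ominus>\<^bsub>b.TM\<^esub> X'))" "P (Y \<ominus>\<^bsub>b.TM\<^esub> (X \<ominus>\<^bsub>b.TM\<^esub> X'))"
      using Y c by (simp_all add: b.TM.minus_eq b.TM.a_assoc b.TM.minus_add)
  qed
  have "\<ominus>\<^bsub>b.TM\<^esub> \<zero>\<^bsub>b.TM\<^esub> = \<zero>\<^bsub>b.TM\<^esub>"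
    using b.TM.l_zero[OF b.TM.a_inv_closed[OF b.TM.zero_closed]] b.TM.r_neg[OF b.TM.zero_closed] by metis
  then have "Y \<ominus>\<^bsub>b.TM\<^esub> \<zero>\<^bsub>b.TM\<^esub> = Y" if "Y \<in> carrier b.TM" for Y
    using b.TM.r_zero[OF that] unfolding a_minus_def by metis
  then have Q_zero: "Q \<zero>\<^bsub>b.TM\<^esub>" by (simp add: Q_def)
  note rr = ring.is_abelian_group[OF ring_group_ring[OF G.is_group]]
  have Q_TP: "Q (b.TP s x)" if s: "s \<in> carrier \<int>[G]" and x: "x \<in> T" for s x
    using s[unfolded group_ring_carrier]
  proof (induction s rule: free_Abelian_group_induct[consumes 1, case_names 1 2 3])
    case 1
    show ?case using Q_zero additive_facts(3)[OF TP_frag_facts(1)[OF x] _ b.abelian_group_TM] rr by simp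
  next
    case (2 s t)
    then have st: "s \<in> carrier \<int>[G]" "t \<in> carrier \<int>[G]" by (auto simp: group_ring_carrier)
    have "b.TP (s - t) x = b.TP s x \<ominus>\<^bsub>b.TM\<^esub> b.TP t x"
      using additive_facts(5)[OF TP_frag_facts(1)[OF x] _ b.abelian_group_TM st] rr
      by (simp add: group_ring_minus[OF G.is_group st])
    with 2 Q_diff show ?case by simp
  next
    case (3 g)
    have gc: "frag_of g \<in> carrier \<int>[G]" using 3 by (rule frag_of_closed)
    have "P (Y \<ominus>\<^bsub>b.TM\<^esub> b.TP (frag_of g) x)" if "Y \<in> carrier b.TM" "P Y" for Y
    proof -
      have mx: "\<ominus>\<^bsub>sub\<^esub> x \<in> T" using b.M.a_inv_closed[of x] x by simp
      have "b.TP (frag_of g) (\<ominus>\<^bsub>sub\<^esub> x) = \<ominus>\<^bsub>b.TM\<^esub> b.TP (frag_of g) x"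
        using additive_facts(4)[OF TP_frag_facts(2)[OF gc] b.M.M.abelian_group_axioms b.abelian_group_TM] x by simp
      with add[OF that 3 mx] show ?thesis by (simp add: b.TM.minus_eq)
    qed
    then show ?case using add 3 x gc by (simp add: Q_def b.TP_closed)
  qed
  have "Q X" using X
    by (induction rule: b.TM_induct) (use Q_TP Q_diff Q_zero in simp_all)
  then have "P (\<zero>\<^bsub>b.TM\<^esub> \<oplus>\<^bsub>b.TM\<^esub> X)" using zero b.TM.zero_closed unfolding Q_def by blast
  then show ?thesis using X by simp
qed

text \<open>Weights on the left cosets of \<open>K\<close>: exactly those for which the evaluation below
  respects the relation \<open>gk(h) \<otimes> x = g \<otimes> hx\<close>.\<close>
definition invariant :: "('g \<Rightarrow> int) \<Rightarrow> bool" where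
  "invariant w \<longleftrightarrow> (\<forall>g \<in> carrier G. \<forall>h \<in> carrier K. w (g \<otimes>\<^bsub>G\<^esub> k h) = w g)"

text \<open>The map \<open>g \<otimes> x \<mapsto> w(g) gx\<close>. The weight \<open>1\<close> gives the
  projection of the canonical splitting, and the indicator of a coset gives the component at that
  coset.\<close>
definition eval :: "('g \<Rightarrow> int) \<Rightarrow> ('g \<Rightarrow>\<^sub>0 int, 'm) tensor \<Rightarrow> 'm" where
  "eval w = tensor_lift C (\<lambda>s x. weighted w s \<odot>\<^bsub>C\<^esub> x)"

lemma eval_balanced:
  assumes w: "invariant w" shows "b.balanced C (\<lambda>s x. weighted w s \<odot>\<^bsub>C\<^esub> x)"
proof (rule b.balancedI)
  fix s r x assume s: "s \<in> carrier \<int>[G]" and r: "r \<in> carrier \<int>[K]" and x: "x \<in> carrier sub"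
  have "weighted w (s \<otimes>\<^bsub>\<int>[G]\<^esub> gr_map k r) = weighted w s \<otimes>\<^bsub>\<int>[G]\<^esub> gr_map k r"
    by (rule weighted_mult[OF _ s])
      (use w r in \<open>auto simp: invariant_def group_ring_carrier dest!: subsetD[OF keys_gr_map]\<close>)
  then show "weighted w (s \<otimes>\<^bsub>\<int>[G]\<^esub> gr_map k r) \<odot>\<^bsub>C\<^esub> x = weighted w s \<odot>\<^bsub>C\<^esub> (r \<odot>\<^bsub>sub\<^esub> x)"
    using s r x ring_hom_closed[OF gr_hom] by (simp add: C.smult_assoc weighted_closed T_facts)
qed (auto simp: weighted_closed C.smult_closed T_facts weighted_add C.smult_r_distr
    C.smult_l_distr[of "weighted w _" "weighted w _", simplified])

lemma eval_TP: "invariant w \<Longrightarrow> s \<in> carrier \<int>[G] \<Longrightarrow> x \<in> T \<Longrightarrow> eval w (b.TP s x) = weighted w s \<odot>\<^bsub>C\<^esub> x"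
  unfolding eval_def by (rule b.lift_TP[OF C.M.abelian_group_axioms eval_balanced]) auto

lemma eval_additive: "invariant w \<Longrightarrow> additive b.TM C (eval w)"
  unfolding eval_def by (rule b.lift_additive[OF C.M.abelian_group_axioms eval_balanced])

lemmas eval_facts = additive_facts[OF eval_additive b.abelian_group_TM C.M.abelian_group_axioms]

lemma eval_one: "tensor_lift C (smult C) = eval (\<lambda>_. 1)"
  by (simp add: eval_def weighted_one)

lemma eval_diff:
  assumes w: "invariant w" "invariant w'" and X: "X \<in> carrier b.TM"
  shows "eval (\<lambda>g. w g - w' g) X = eval w X \<ominus>\<^bsub>C\<^esub> eval w' X"
proof (rule b.additive_eqI[OF C.M.abelian_group_axioms _ _ _ X, of "eval (\<lambda>g. w g - w' g)" "\<lambda>X. eval w X \<ominus>\<^bsub>C\<^esub> eval w' X"])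
  have i: "invariant (\<lambda>g. w g - w' g)" using w by (simp add: invariant_def)
  show "additive b.TM C (eval (\<lambda>g. w g - w' g))" by (rule eval_additive[OF i])
  show "additive b.TM C (\<lambda>X. eval w X \<ominus>\<^bsub>C\<^esub> eval w' X)"
    using w by (auto simp: additive_def eval_facts C.M.minus_eq C.M.minus_add C.M.a_ac)
  fix s x assume "s \<in> carrier \<int>[G]" "x \<in> carrier sub"
  then show "eval (\<lambda>g. w g - w' g) (b.TP s x) = eval w (b.TP s x) \<ominus>\<^bsub>C\<^esub> eval w' (b.TP s x)"
    using w i C.minus_smult[of "weighted w s" "weighted w' s" x]
    by (simp add: eval_TP weighted_diff weighted_closed T_facts group_ring_minus[OF G.is_group])
qed

definition coset_weight :: "'g \<Rightarrow> 'g \<Rightarrow> int" where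
  "coset_weight u g = of_bool (inv\<^bsub>G\<^esub> u \<otimes>\<^bsub>G\<^esub> g \<in> k ` carrier K)"

lemma coset_weight_invariant: "u \<in> carrier G \<Longrightarrow> invariant (coset_weight u)"
  unfolding invariant_def coset_weight_def
  using subgroup_mult_right_iff[OF G.is_group k.img_is_subgroup]
  by (simp add: G.m_assoc[symmetric])

text \<open>The existence half of the fact that the induced module is the direct sum of the pieces \<open>u
  \<otimes> T\<close>, one for each left coset of \<open>K\<close>; the uniqueness half comes out of
  \<open>eval_separates\<close>.\<close>
lemma coset_decomposition:
  assumes X: "X \<in> carrier b.TM"
  obtains U x where "finite U" "U \<subseteq> carrier G" "\<And>u. u \<in> U \<Longrightarrow> x u \<in> T"
    "\<And>u v. u \<in> U \<Longrightarrow> v \<in> U \<Longrightarrow> inv\<^bsub>G\<^esub> u \<otimes>\<^bsub>G\<^esub> v \<in> k ` carrier K \<Longrightarrow> u = v"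
    "X = (\<Oplus>\<^bsub>b.TM\<^esub>u\<in>U. b.TP (frag_of u) (x u))"
proof -
  define rep where "rep g = (SOME u. u \<in> (\<lambda>h. g \<otimes>\<^bsub>G\<^esub> k h) ` carrier K)" for g
  have rep_ex: "\<exists>h \<in> carrier K. rep g = g \<otimes>\<^bsub>G\<^esub> k h" for g
    using someI_ex[of "\<lambda>u. u \<in> (\<lambda>h. g \<otimes>\<^bsub>G\<^esub> k h) ` carrier K"] K.one_closed unfolding rep_def by blast
  have rep_sub: "(\<lambda>h. (g \<otimes>\<^bsub>G\<^esub> k h') \<otimes>\<^bsub>G\<^esub> k h) ` carrier K \<subseteq> (\<lambda>h. g \<otimes>\<^bsub>G\<^esub> k h) ` carrier K"
    if "g \<in> carrier G" "h' \<in> carrier K" for g h'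
  proof
    fix u assume "u \<in> (\<lambda>h. (g \<otimes>\<^bsub>G\<^esub> k h') \<otimes>\<^bsub>G\<^esub> k h) ` carrier K"
    then obtain h where h: "h \<in> carrier K" "u = (g \<otimes>\<^bsub>G\<^esub> k h') \<otimes>\<^bsub>G\<^esub> k h" by blast
    then have "u = g \<otimes>\<^bsub>G\<^esub> k (h' \<otimes>\<^bsub>K\<^esub> h)" "h' \<otimes>\<^bsub>K\<^esub> h \<in> carrier K"
      using that by (simp_all add: G.m_assoc)
    then show "u \<in> (\<lambda>h. g \<otimes>\<^bsub>G\<^esub> k h) ` carrier K" using that by blast
  qed
  have rep_mult: "rep (g \<otimes>\<^bsub>G\<^esub> k h') = rep g" if "g \<in> carrier G" "h' \<in> carrier K" for g h'
  proof -
    have "(g \<otimes>\<^bsub>G\<^esub> k h') \<otimes>\<^bsub>G\<^esub> k (inv\<^bsub>K\<^esub> h') = g" using that by (simp add: G.m_assoc)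
    then have "(\<lambda>h. (g \<otimes>\<^bsub>G\<^esub> k h') \<otimes>\<^bsub>G\<^esub> k h) ` carrier K = (\<lambda>h. g \<otimes>\<^bsub>G\<^esub> k h) ` carrier K"
      using rep_sub[OF that] rep_sub[of "g \<otimes>\<^bsub>G\<^esub> k h'" "inv\<^bsub>K\<^esub> h'"] that by auto
    then show ?thesis by (simp add: rep_def)
  qed
  have rep_idem: "rep (rep g) = rep g" if g: "g \<in> carrier G" for g
    using rep_ex[of g] rep_mult[OF g] by auto
  have rep_c: "rep g \<in> carrier G" if g: "g \<in> carrier G" for g
    using rep_ex[of g] g by auto
  define dec where "dec X \<longleftrightarrow> (\<exists>U x. finite U \<and> U \<subseteq> rep ` carrier G \<and> x \<in> U \<rightarrow> T \<and>
    X = (\<Oplus>\<^bsub>b.TM\<^esub>u\<in>U. b.TP (frag_of u) (x u)))" for X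
  have "dec X" using X
  proof (induction rule: TM_group_induct)
    case zero
    show ?case unfolding dec_def by (intro exI[of _ "{}"]) simp
  next
    case (add X g y)
    obtain U x where U: "finite U" "U \<subseteq> rep ` carrier G" "x \<in> U \<rightarrow> T"
      and Xeq: "X = (\<Oplus>\<^bsub>b.TM\<^esub>u\<in>U. b.TP (frag_of u) (x u))"
      using add.IH unfolding dec_def by blast
    have UG: "U \<subseteq> carrier G" using U rep_c by blast
    have cl: "b.TP (frag_of u) (x u) \<in> carrier b.TM" if "u \<in> U" for u
      using that UG U(3) by (intro b.TP_closed frag_of_closed) auto
    let ?u = "rep g"
    obtain h where h: "h \<in> carrier K" "?u = g \<otimes>\<^bsub>G\<^esub> k h" using rep_ex by blast
    then have g: "g = ?u \<otimes>\<^bsub>G\<^esub> k (inv\<^bsub>K\<^esub> h)" using add.hyps(2) by (simp add: G.m_assoc)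
    let ?y = "gr_map k (frag_of (inv\<^bsub>K\<^esub> h)) \<odot>\<^bsub>C\<^esub> y"
    have y: "?y \<in> T" using h add.hyps(3) by (intro T_facts frag_of_closed) auto
    have uc: "frag_of ?u \<in> carrier \<int>[G]" using rep_c[OF add.hyps(2)] by (rule frag_of_closed)
    have "b.TP (frag_of g) y = b.TP (frag_of ?u \<otimes>\<^bsub>\<int>[G]\<^esub> gr_map k (frag_of (inv\<^bsub>K\<^esub> h))) y"
      using g by (simp add: gr_map_of frag_of_mult)
    also have "\<dots> = b.TP (frag_of ?u) ?y"
      using b.TP_balanced[OF uc frag_of_closed[of "inv\<^bsub>K\<^esub> h" K], of y] h add.hyps(3) by simp
    finally have gy: "b.TP (frag_of g) y = b.TP (frag_of ?u) ?y" .
    define x0 where "x0 = (if ?u \<in> U then x ?u else \<zero>\<^bsub>C\<^esub>)"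
    have x0: "x0 \<in> T" using U(3) T_facts(2) by (auto simp: x0_def)
    let ?S = "\<Oplus>\<^bsub>b.TM\<^esub>u\<in>U - {?u}. b.TP (frag_of u) (x u)"
    have S: "?S \<in> carrier b.TM" using cl by (intro b.TM.finsum_closed) auto
    have TP0: "b.TP (frag_of ?u) \<zero>\<^bsub>C\<^esub> = \<zero>\<^bsub>b.TM\<^esub>"
      using additive_facts(3)[OF TP_frag_facts(2)[OF uc] b.M.M.abelian_group_axioms b.abelian_group_TM] by simp
    have X0: "X = b.TP (frag_of ?u) x0 \<oplus>\<^bsub>b.TM\<^esub> ?S"
    proof (cases "?u \<in> U")
      case True
      then have "X = (\<Oplus>\<^bsub>b.TM\<^esub>u\<in>insert ?u (U - {?u}). b.TP (frag_of u) (x u))"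
        unfolding Xeq by (simp add: insert_absorb)
      also have "\<dots> = b.TP (frag_of ?u) (x ?u) \<oplus>\<^bsub>b.TM\<^esub> ?S"
        using U(1) cl True by (intro b.TM.finsum_insert) auto
      finally show ?thesis using True by (simp add: x0_def)
    next
      case False
      then have "X = ?S" unfolding Xeq by simp
      then show ?thesis using False TP0 S by (simp add: x0_def)
    qed
    have "X \<oplus>\<^bsub>b.TM\<^esub> b.TP (frag_of g) y = b.TP (frag_of ?u) (x0 \<oplus>\<^bsub>C\<^esub> ?y) \<oplus>\<^bsub>b.TM\<^esub> ?S"
      unfolding X0 gy using b.TP_add_right[OF uc, of x0 ?y] x0 y S b.TP_closed[OF uc]
      by (simp add: b.TM.a_ac)
    also have "\<dots> = (\<Oplus>\<^bsub>b.TM\<^esub>u\<in>insert ?u (U - {?u}). b.TP (frag_of u) ((x(?u := x0 \<oplus>\<^bsub>C\<^esub> ?y)) u))"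
    proof -
      have "(\<Oplus>\<^bsub>b.TM\<^esub>u\<in>U - {?u}. b.TP (frag_of u) ((x(?u := x0 \<oplus>\<^bsub>C\<^esub> ?y)) u)) = ?S"
        using cl by (intro b.TM.finsum_cong') auto
      then show ?thesis
        using U(1) cl x0 y T_facts(3) b.TP_closed[OF uc] by (subst b.TM.finsum_insert) auto
    qed
    finally show ?case unfolding dec_def
      using U x0 y T_facts(3) add.hyps(2)
      by (intro exI[of _ "insert ?u (U - {?u})"] exI[of _ "x(?u := x0 \<oplus>\<^bsub>C\<^esub> ?y)"]) auto
  qed
  then obtain U x where U: "finite U" "U \<subseteq> rep ` carrier G" "x \<in> U \<rightarrow> T"
    "X = (\<Oplus>\<^bsub>b.TM\<^esub>u\<in>U. b.TP (frag_of u) (x u))"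
    unfolding dec_def by blast
  show ?thesis
  proof (rule that[OF U(1) _ _ _ U(4)])
    show UG: "U \<subseteq> carrier G" using U(2) rep_c by blast
    fix u v assume uv: "u \<in> U" "v \<in> U" "inv\<^bsub>G\<^esub> u \<otimes>\<^bsub>G\<^esub> v \<in> k ` carrier K"
    then obtain h where h: "h \<in> carrier K" "inv\<^bsub>G\<^esub> u \<otimes>\<^bsub>G\<^esub> v = k h" by auto
    then have "v = u \<otimes>\<^bsub>G\<^esub> k h" using uv UG by (metis G.inv_solve_left k.hom_closed subsetD)
    then have "rep v = rep u" using h uv UG by (simp add: rep_mult subset_iff)
    moreover have "rep v = v" "rep u = u" using uv U(2) rep_idem by auto
    ultimately show "u = v" by simp
  qed (use U in auto)
qed

text \<open>Evaluation with the weight of the coset of \<open>u\<close> turns a tensor into \<open>u x\<close>,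
  where \<open>u \<otimes> x\<close> is its component there; since \<open>u\<close> acts invertibly,
  the components can be tested inside \<open>C\<close>.\<close>
lemma eval_separates:
  assumes X: "X \<in> carrier b.TM" and zero: "\<And>u. u \<in> carrier G \<Longrightarrow> eval (coset_weight u) X = \<zero>\<^bsub>C\<^esub>"
  shows "X = \<zero>\<^bsub>b.TM\<^esub>"
proof -
  obtain U x where U: "finite U" "U \<subseteq> carrier G" "\<And>u. u \<in> U \<Longrightarrow> x u \<in> T"
    "\<And>u v. u \<in> U \<Longrightarrow> v \<in> U \<Longrightarrow> inv\<^bsub>G\<^esub> u \<otimes>\<^bsub>G\<^esub> v \<in> k ` carrier K \<Longrightarrow> u = v"
    and Xeq: "X = (\<Oplus>\<^bsub>b.TM\<^esub>u\<in>U. b.TP (frag_of u) (x u))"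
    using coset_decomposition[OF X] by blast
  have cl: "b.TP (frag_of u) (x u) \<in> carrier b.TM" if "u \<in> U" for u
    using that U by (intro b.TP_closed frag_of_closed) auto
  have "x u = \<zero>\<^bsub>C\<^esub>" if u: "u \<in> U" for u
  proof -
    have uG: "u \<in> carrier G" and xc: "x u \<in> carrier C" using u U T_facts by auto
    note inv = coset_weight_invariant[OF uG]
    have one: "\<one>\<^bsub>G\<^esub> \<in> k ` carrier K" using k.hom_one K.one_closed by (metis imageI)
    have "eval (coset_weight u) X = (\<Oplus>\<^bsub>C\<^esub>v\<in>U. eval (coset_weight u) (b.TP (frag_of v) (x v)))"
      unfolding Xeq by (rule additive_finsum[OF eval_additive[OF inv] b.abelian_group_TM C.M.abelian_group_axioms cl])
    also have "\<dots> = (\<Oplus>\<^bsub>C\<^esub>v\<in>U. if u = v then frag_of v \<odot>\<^bsub>C\<^esub> x v else \<zero>\<^bsub>C\<^esub>)"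
    proof (rule C.M.finsum_cong'[OF refl])
      show "(\<lambda>v. if u = v then frag_of v \<odot>\<^bsub>C\<^esub> x v else \<zero>\<^bsub>C\<^esub>) \<in> U \<rightarrow> carrier C"
        using U T_facts by (auto intro!: C.smult_closed frag_of_closed)
      fix v assume v: "v \<in> U"
      have "coset_weight u v = of_bool (u = v)"
        using U(4)[OF u v] uG one by (auto simp: coset_weight_def)
      moreover have "0 \<odot>\<^bsub>C\<^esub> x v = \<zero>\<^bsub>C\<^esub>" using C.zero_smult[of "x v"] U(3)[OF v] T_facts by simp
      ultimately show "eval (coset_weight u) (b.TP (frag_of v) (x v)) = (if u = v then frag_of v \<odot>\<^bsub>C\<^esub> x v else \<zero>\<^bsub>C\<^esub>)"
        using U v by (simp add: eval_TP[OF inv] frag_of_closed subset_iff weighted_of)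
    qed
    also have "\<dots> = frag_of u \<odot>\<^bsub>C\<^esub> x u"
      using u U T_facts by (intro C.M.finsum_singleton) (auto intro!: C.smult_closed frag_of_closed)
    finally have "frag_of u \<odot>\<^bsub>C\<^esub> x u = \<zero>\<^bsub>C\<^esub>" using zero[OF uG] by simp
    then have "frag_of (inv\<^bsub>G\<^esub> u) \<odot>\<^bsub>C\<^esub> (frag_of u \<odot>\<^bsub>C\<^esub> x u) = \<zero>\<^bsub>C\<^esub>"
      using uG by (simp add: C.smult_zero frag_of_closed)
    then show ?thesis
      using uG xc C.smult_one[OF xc] by (simp flip: C.smult_assoc add: frag_of_closed frag_of_mult)
  qed
  then have "X = (\<Oplus>\<^bsub>b.TM\<^esub>u\<in>U. b.TP (frag_of u) \<zero>\<^bsub>C\<^esub>)"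
    unfolding Xeq using cl by (intro b.TM.finsum_cong') auto
  also have "\<dots> = (\<Oplus>\<^bsub>b.TM\<^esub>u\<in>U. \<zero>\<^bsub>b.TM\<^esub>)"
    using additive_facts(3)[OF TP_frag_facts(2) b.M.M.abelian_group_axioms b.abelian_group_TM] U(2)
    by (intro b.TM.finsum_cong') (auto simp: frag_of_closed subset_iff)
  finally show ?thesis by (simp add: b.TM.finsum_zero)
qed

end

section \<open>The maps between induced modules\<close>

lemma (in base_change) balanced_cong:
  assumes \<beta>: "balanced N \<beta>" and eq: "\<And>s x. s \<in> carrier S \<Longrightarrow> x \<in> carrier M \<Longrightarrow> \<beta>' s x = \<beta> s x"
  shows "balanced N \<beta>'"
  using \<beta> ring_hom_closed[OF hom] by (simp add: balanced_def eq M.smult_closed)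

lemma (in base_change) lift_diff:
  assumes N: "abelian_group N" and \<beta>: "balanced N \<beta>" "balanced N \<beta>'" and X: "X \<in> carrier TM"
  shows "tensor_lift N (\<lambda>s x. \<beta> s x \<ominus>\<^bsub>N\<^esub> \<beta>' s x) X = tensor_lift N \<beta> X \<ominus>\<^bsub>N\<^esub> tensor_lift N \<beta>' X"
proof -
  interpret N: abelian_group N by fact
  have "balanced N (\<lambda>s x. \<beta> s x \<ominus>\<^bsub>N\<^esub> \<beta>' s x)"
    using \<beta> by (auto simp: balanced_def N.add_minus_add)
  moreover note a = lift_additive[OF N \<beta>(1)] lift_additive[OF N \<beta>(2)]
  note f = additive_facts[OF a(1) TM.abelian_group_axioms N] additive_facts[OF a(2) TM.abelian_group_axioms N]
  ultimately show ?thesis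
    by (intro additive_eqI[OF N lift_additive[OF N] _ _ X, of "\<lambda>s x. \<beta> s x \<ominus>\<^bsub>N\<^esub> \<beta>' s x"
          "\<lambda>X. tensor_lift N \<beta> X \<ominus>\<^bsub>N\<^esub> tensor_lift N \<beta>' X"])
      (auto simp: additive_def f N.add_minus_add lift_TP[OF N] \<beta>)
qed

lemma mod_hom_cong:
  assumes "f \<in> mod_hom R M N" "left_module R M" "\<And>x. x \<in> carrier M \<Longrightarrow> g x = f x"
  shows "g \<in> mod_hom R M N"
proof -
  interpret left_module R M by fact
  show ?thesis using assms(1,3) by (auto simp: mod_hom_def smult_closed)
qed

text \<open>The maps of both kinds of splitting have the shape \<open>s \<otimes> x \<mapsto> sv \<otimes>
  v\<^sup>-\<^sup>1 x\<close>: for an amalgam \<open>v = \<one>\<close> in both components, for an HNN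
  extension \<open>v = \<one>\<close> and \<open>v = t\<close>. The relation \<open>kv\<close> makes
  this compatible with the two tensor products.\<close>
locale transfer = D: induced G C K k T + E: induced G C L j U
  for G :: "'g monoid" and C :: "('g \<Rightarrow>\<^sub>0 int, 'm) module" and K :: "'k monoid" and k :: "'k \<Rightarrow> 'g"
    and T :: "'m set" and L :: "'l monoid" and j :: "'l \<Rightarrow> 'g" and U :: "'m set" +
  fixes i :: "'k \<Rightarrow> 'l" and v :: 'g
  assumes i: "i \<in> hom K L" and v: "v \<in> carrier G"
    and kv: "\<And>h. h \<in> carrier K \<Longrightarrow> k h \<otimes>\<^bsub>G\<^esub> v = v \<otimes>\<^bsub>G\<^esub> j (i h)"
    and TU: "\<And>x. x \<in> T \<Longrightarrow> frag_of (inv\<^bsub>G\<^esub> v) \<odot>\<^bsub>C\<^esub> x \<in> U"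
begin

sublocale I: base_change "\<int>[K]" "\<int>[L]" D.sub "gr_map i"
  by (rule base_change_group_ring[OF D.K.is_group E.K.is_group i D.left_module_sub])

abbreviation v_inv where "v_inv \<equiv> frag_of (inv\<^bsub>G\<^esub> v) :: 'g \<Rightarrow>\<^sub>0 int"

lemma v_closed: "frag_of v \<in> carrier \<int>[G]" "v_inv \<in> carrier \<int>[G]"
  using v by (simp_all add: frag_of_closed)

lemma gr_i: "r \<in> carrier \<int>[K] \<Longrightarrow> gr_map i r \<in> carrier \<int>[L]"
  by (rule ring_hom_closed[OF I.hom])

lemmas gr_closed = ring_hom_closed[OF D.gr_hom] ring_hom_closed[OF E.gr_hom]

lemma v_inv_linear:
  assumes r: "r \<in> carrier \<int>[K]" and x: "x \<in> T"
  shows "v_inv \<odot>\<^bsub>C\<^esub> (gr_map k r \<odot>\<^bsub>C\<^esub> x) = gr_map j (gr_map i r) \<odot>\<^bsub>C\<^esub> (v_inv \<odot>\<^bsub>C\<^esub> x)"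
proof -
  have j: "inv\<^bsub>G\<^esub> v \<otimes>\<^bsub>G\<^esub> k h = j (i h) \<otimes>\<^bsub>G\<^esub> inv\<^bsub>G\<^esub> v" if h: "h \<in> carrier K" for h
  proof -
    have c: "j (i h) \<in> carrier G" using h hom_in_carrier[OF i] by simp
    have "inv\<^bsub>G\<^esub> v \<otimes>\<^bsub>G\<^esub> k h = inv\<^bsub>G\<^esub> v \<otimes>\<^bsub>G\<^esub> (k h \<otimes>\<^bsub>G\<^esub> v) \<otimes>\<^bsub>G\<^esub> inv\<^bsub>G\<^esub> v"
      using h v by (simp add: D.G.m_assoc)
    also have "\<dots> = (inv\<^bsub>G\<^esub> v \<otimes>\<^bsub>G\<^esub> v) \<otimes>\<^bsub>G\<^esub> j (i h) \<otimes>\<^bsub>G\<^esub> inv\<^bsub>G\<^esub> v"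
      unfolding kv[OF h] using c v by (simp only: D.G.m_assoc D.G.inv_closed D.G.m_closed)
    also have "\<dots> = j (i h) \<otimes>\<^bsub>G\<^esub> inv\<^bsub>G\<^esub> v" using c v by simp
    finally show ?thesis .
  qed
  have "v_inv \<otimes>\<^bsub>\<int>[G]\<^esub> gr_map k r = gr_map j (gr_map i r) \<otimes>\<^bsub>\<int>[G]\<^esub> v_inv"
    using j r
    by (auto simp: group_ring_def gr_map_def frag_extend_frag_extend subset_iff intro!: frag_extend_eq)
  then show ?thesis
    using r x v_closed gr_closed gr_i D.T_facts by (simp flip: D.C.smult_assoc)
qed

definition tau :: "('g \<Rightarrow>\<^sub>0 int, 'm) tensor \<Rightarrow> ('g \<Rightarrow>\<^sub>0 int, 'm) tensor" where
  "tau = tensor_lift E.b.TM (\<lambda>s x. E.b.TP (s \<otimes>\<^bsub>\<int>[G]\<^esub> frag_of v) (v_inv \<odot>\<^bsub>C\<^esub> x))"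

lemma tau_balanced: "D.b.balanced E.b.TM (\<lambda>s x. E.b.TP (s \<otimes>\<^bsub>\<int>[G]\<^esub> frag_of v) (v_inv \<odot>\<^bsub>C\<^esub> x))"
proof (rule D.b.balancedI)
  fix s x assume s: "s \<in> carrier \<int>[G]" and x: "x \<in> carrier D.sub"
  show "E.b.TP (s \<otimes>\<^bsub>\<int>[G]\<^esub> frag_of v) (v_inv \<odot>\<^bsub>C\<^esub> x) \<in> carrier E.b.TM"
    using s x v_closed TU by (intro E.b.TP_closed) auto
  fix s' assume s': "s' \<in> carrier \<int>[G]"
  show "E.b.TP ((s \<oplus>\<^bsub>\<int>[G]\<^esub> s') \<otimes>\<^bsub>\<int>[G]\<^esub> frag_of v) (v_inv \<odot>\<^bsub>C\<^esub> x) =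
      E.b.TP (s \<otimes>\<^bsub>\<int>[G]\<^esub> frag_of v) (v_inv \<odot>\<^bsub>C\<^esub> x) \<oplus>\<^bsub>E.b.TM\<^esub> E.b.TP (s' \<otimes>\<^bsub>\<int>[G]\<^esub> frag_of v) (v_inv \<odot>\<^bsub>C\<^esub> x)"
    using s s' x v_closed TU
    by (simp del: group_ring_simps add: D.C.R.l_distr E.b.TP_add_left)
next
  fix s x x' assume s: "s \<in> carrier \<int>[G]" and x: "x \<in> carrier D.sub" "x' \<in> carrier D.sub"
  show "E.b.TP (s \<otimes>\<^bsub>\<int>[G]\<^esub> frag_of v) (v_inv \<odot>\<^bsub>C\<^esub> (x \<oplus>\<^bsub>D.sub\<^esub> x')) =
      E.b.TP (s \<otimes>\<^bsub>\<int>[G]\<^esub> frag_of v) (v_inv \<odot>\<^bsub>C\<^esub> x) \<oplus>\<^bsub>E.b.TM\<^esub> E.b.TP (s \<otimes>\<^bsub>\<int>[G]\<^esub> frag_of v) (v_inv \<odot>\<^bsub>C\<^esub> x')"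
    using s x v_closed TU D.T_facts E.b.TP_add_right[of "s \<otimes>\<^bsub>\<int>[G]\<^esub> frag_of v" "v_inv \<odot>\<^bsub>C\<^esub> x" "v_inv \<odot>\<^bsub>C\<^esub> x'"]
    by (simp add: D.C.smult_r_distr)
next
  fix s r x assume s: "s \<in> carrier \<int>[G]" and r: "r \<in> carrier \<int>[K]" and x: "x \<in> carrier D.sub"
  have "(s \<otimes>\<^bsub>\<int>[G]\<^esub> gr_map k r) \<otimes>\<^bsub>\<int>[G]\<^esub> frag_of v = s \<otimes>\<^bsub>\<int>[G]\<^esub> frag_of v \<otimes>\<^bsub>\<int>[G]\<^esub> gr_map j (gr_map i r)"
    using s r v_closed gr_closed gr_i gr_map_twist[where H = K and k = k and B = G and v = v and j = j and i = i, OF kv r]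
    by (simp add: D.C.R.m_assoc)
  then show "E.b.TP ((s \<otimes>\<^bsub>\<int>[G]\<^esub> gr_map k r) \<otimes>\<^bsub>\<int>[G]\<^esub> frag_of v) (v_inv \<odot>\<^bsub>C\<^esub> x) =
      E.b.TP (s \<otimes>\<^bsub>\<int>[G]\<^esub> frag_of v) (v_inv \<odot>\<^bsub>C\<^esub> (r \<odot>\<^bsub>D.sub\<^esub> x))"
    using E.b.TP_balanced[of "s \<otimes>\<^bsub>\<int>[G]\<^esub> frag_of v" "gr_map i r" "v_inv \<odot>\<^bsub>C\<^esub> x"] s r x v_closed gr_i TU
    by (simp add: v_inv_linear)
qed

lemma tau_TP:
  "s \<in> carrier \<int>[G] \<Longrightarrow> x \<in> T \<Longrightarrow> tau (D.b.TP s x) = E.b.TP (s \<otimes>\<^bsub>\<int>[G]\<^esub> frag_of v) (v_inv \<odot>\<^bsub>C\<^esub> x)"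
  unfolding tau_def by (rule D.b.lift_TP[OF E.b.abelian_group_TM tau_balanced]) auto

lemma tau_hom: "tau \<in> mod_hom \<int>[G] D.b.TM E.b.TM"
  unfolding tau_def
  by (rule D.b.lift_mod_hom[OF E.b.left_module_TM tau_balanced])
    (use v_closed TU in \<open>simp add: E.b.TP_smult D.C.R.m_assoc\<close>)

lemmas tau_facts = additive_facts[OF mod_hom_additive[OF tau_hom] D.b.abelian_group_TM E.b.abelian_group_TM]

text \<open>The factors \<open>v\<close> and \<open>v\<^sup>-\<^sup>1\<close> cancel in \<open>C\<close>, but
  the weight sees \<open>gv\<close>. Therefore an evaluation of a difference of two transfers is an
  evaluation with a difference of weights, and a potential can turn it into a component.\<close>
lemma eval_tau:
  assumes w: "E.invariant w" and X: "X \<in> carrier D.b.TM"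
  shows "E.eval w (tau X) = D.eval (\<lambda>g. w (g \<otimes>\<^bsub>G\<^esub> v)) X"
proof -
  have w': "D.invariant (\<lambda>g. w (g \<otimes>\<^bsub>G\<^esub> v))"
    unfolding D.invariant_def
  proof (intro ballI)
    fix g h assume g: "g \<in> carrier G" and h: "h \<in> carrier K"
    have ih: "i h \<in> carrier L" using h hom_in_carrier[OF i] by simp
    have "g \<otimes>\<^bsub>G\<^esub> k h \<otimes>\<^bsub>G\<^esub> v = (g \<otimes>\<^bsub>G\<^esub> v) \<otimes>\<^bsub>G\<^esub> j (i h)"
      using g h v kv[OF h] ih by (simp add: D.G.m_assoc)
    then show "w (g \<otimes>\<^bsub>G\<^esub> k h \<otimes>\<^bsub>G\<^esub> v) = w (g \<otimes>\<^bsub>G\<^esub> v)"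
      using w g v ih by (simp add: E.invariant_def)
  qed
  show ?thesis
  proof (rule D.b.additive_eqI[OF D.C.M.abelian_group_axioms _ D.eval_additive[OF w'] _ X, of "\<lambda>X. E.eval w (tau X)"])
    show "additive D.b.TM C (\<lambda>X. E.eval w (tau X))"
      by (auto simp: additive_def tau_facts E.eval_facts[OF w])
    fix s x assume s: "s \<in> carrier \<int>[G]" and x: "x \<in> carrier D.sub"
    have "weighted w (s \<otimes>\<^bsub>\<int>[G]\<^esub> frag_of v) = weighted (\<lambda>g. w (g \<otimes>\<^bsub>G\<^esub> v)) s \<otimes>\<^bsub>\<int>[G]\<^esub> frag_of v"
      by (rule weighted_mult[OF _ s]) simp
    then have "E.eval w (tau (D.b.TP s x)) =
        (weighted (\<lambda>g. w (g \<otimes>\<^bsub>G\<^esub> v)) s \<otimes>\<^bsub>\<int>[G]\<^esub> frag_of v) \<odot>\<^bsub>C\<^esub> (v_inv \<odot>\<^bsub>C\<^esub> x)"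
      using s x v_closed TU by (simp add: tau_TP E.eval_TP[OF w])
    also have "\<dots> = weighted (\<lambda>g. w (g \<otimes>\<^bsub>G\<^esub> v)) s \<odot>\<^bsub>C\<^esub> ((frag_of v \<otimes>\<^bsub>\<int>[G]\<^esub> v_inv) \<odot>\<^bsub>C\<^esub> x)"
      using s x v_closed by (simp add: D.C.smult_assoc weighted_closed D.T_facts D.C.smult_closed)
    also have "\<dots> = weighted (\<lambda>g. w (g \<otimes>\<^bsub>G\<^esub> v)) s \<odot>\<^bsub>C\<^esub> x"
      using x v D.C.smult_one[of x] D.T_facts by (simp add: frag_of_mult)
    also have "\<dots> = D.eval (\<lambda>g. w (g \<otimes>\<^bsub>G\<^esub> v)) (D.b.TP s x)"
      using s x by (simp add: D.eval_TP[OF w'])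
    finally show "E.eval w (tau (D.b.TP s x)) = D.eval (\<lambda>g. w (g \<otimes>\<^bsub>G\<^esub> v)) (D.b.TP s x)" .
  qed
qed

text \<open>The map \<open>e\<close> of a splitting, from the module induced to the intermediate group
  \<open>L\<close>; \<open>tau\<close> sends \<open>s \<otimes> x\<close> to \<open>sv \<otimes> e(1
  \<otimes> x)\<close>.\<close>
definition restriction :: "('l \<Rightarrow>\<^sub>0 int, 'm) tensor \<Rightarrow> 'm" where
  "restriction = tensor_lift C (\<lambda>s x. gr_map j s \<odot>\<^bsub>C\<^esub> (v_inv \<odot>\<^bsub>C\<^esub> x))"

lemma restriction_balanced: "I.balanced C (\<lambda>s x. gr_map j s \<odot>\<^bsub>C\<^esub> (v_inv \<odot>\<^bsub>C\<^esub> x))"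
proof (rule I.balancedI)
  fix s s' x assume "s \<in> carrier \<int>[L]" "s' \<in> carrier \<int>[L]" "x \<in> carrier D.sub"
  then show "gr_map j (s \<oplus>\<^bsub>\<int>[L]\<^esub> s') \<odot>\<^bsub>C\<^esub> (v_inv \<odot>\<^bsub>C\<^esub> x) =
      gr_map j s \<odot>\<^bsub>C\<^esub> (v_inv \<odot>\<^bsub>C\<^esub> x) \<oplus>\<^bsub>C\<^esub> gr_map j s' \<odot>\<^bsub>C\<^esub> (v_inv \<odot>\<^bsub>C\<^esub> x)"
    using gr_closed v_closed
    by (simp del: group_ring_simps add: ring_hom_add[OF E.gr_hom] D.C.smult_l_distr D.C.smult_closed D.T_facts)
qed (use v_closed gr_closed gr_i in \<open>simp_all add: D.C.smult_closed D.C.smult_r_distr D.T_facts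
    v_inv_linear ring_hom_mult[OF E.gr_hom] D.C.smult_assoc\<close>)

lemma restriction_TP:
  "s \<in> carrier \<int>[L] \<Longrightarrow> x \<in> T \<Longrightarrow> restriction (I.TP s x) = gr_map j s \<odot>\<^bsub>C\<^esub> (v_inv \<odot>\<^bsub>C\<^esub> x)"
  unfolding restriction_def by (rule I.lift_TP[OF D.C.M.abelian_group_axioms restriction_balanced]) auto

lemma restriction_one: "x \<in> T \<Longrightarrow> restriction (I.TP \<one>\<^bsub>\<int>[L]\<^esub> x) = v_inv \<odot>\<^bsub>C\<^esub> x"
  using restriction_TP[of "\<one>\<^bsub>\<int>[L]\<^esub>" x] D.C.smult_one[of "v_inv \<odot>\<^bsub>C\<^esub> x"] v_closed
  by (simp add: frag_of_closed gr_map_of D.C.smult_closed D.T_facts)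

lemma restriction_additive: "additive I.TM C restriction"
  unfolding restriction_def by (rule I.lift_additive[OF D.C.M.abelian_group_axioms restriction_balanced])

lemmas restriction_facts = additive_facts[OF restriction_additive I.abelian_group_TM D.C.M.abelian_group_axioms]

lemma restriction_in: "X \<in> carrier I.TM \<Longrightarrow> restriction X \<in> U"
proof (induction rule: I.TM_induct)
  case (pure s x)
  then show ?case using E.T_facts(4)[of s "v_inv \<odot>\<^bsub>C\<^esub> x"] TU by (simp add: restriction_TP)
qed (simp_all add: restriction_facts E.T_facts E.T_minus)

lemma restriction_hom: "restriction \<in> mod_hom \<int>[L] I.TM E.sub"
proof (rule mod_homI)
  show "additive I.TM E.sub restriction"
    using restriction_facts restriction_in by (simp add: additive_def)
  interpret IL: left_module "\<int>[L]" I.TM by (rule I.left_module_TM)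
  fix r X assume r: "r \<in> carrier \<int>[L]" and X: "X \<in> carrier I.TM"
  have "restriction (r \<odot>\<^bsub>I.TM\<^esub> X) = gr_map j r \<odot>\<^bsub>C\<^esub> restriction X"
  proof (rule I.additive_eqI[OF D.C.M.abelian_group_axioms _ _ _ X, of "\<lambda>X. restriction (r \<odot>\<^bsub>I.TM\<^esub> X)" "\<lambda>X. gr_map j r \<odot>\<^bsub>C\<^esub> restriction X"])
    show "additive I.TM C (\<lambda>X. restriction (r \<odot>\<^bsub>I.TM\<^esub> X))" "additive I.TM C (\<lambda>X. gr_map j r \<odot>\<^bsub>C\<^esub> restriction X)"
      using r gr_closed
      by (simp_all add: additive_def restriction_facts IL.smult_closed IL.smult_r_distr D.C.smult_closed D.C.smult_r_distr)
    fix s x assume "s \<in> carrier \<int>[L]" "x \<in> carrier D.sub"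
    then show "restriction (r \<odot>\<^bsub>I.TM\<^esub> I.TP s x) = gr_map j r \<odot>\<^bsub>C\<^esub> restriction (I.TP s x)"
      using r gr_closed v_closed
      by (simp add: I.TP_smult restriction_TP ring_hom_mult[OF E.gr_hom] D.C.smult_assoc D.C.smult_closed D.T_facts)
  qed
  then show "restriction (r \<odot>\<^bsub>I.TM\<^esub> X) = r \<odot>\<^bsub>E.sub\<^esub> restriction X" by simp
qed

lemma tau_eq:
  assumes f: "\<And>x. x \<in> T \<Longrightarrow> f x = v_inv \<odot>\<^bsub>C\<^esub> x" and V: "\<And>s. s \<in> carrier \<int>[G] \<Longrightarrow> V s = s \<otimes>\<^bsub>\<int>[G]\<^esub> frag_of v"
    and X: "X \<in> carrier D.b.TM"
  shows "tensor_lift E.b.TM (\<lambda>s x. E.b.TP (V s) (f x)) X = tau X"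
  unfolding tau_def
  by (rule D.b.lift_cong[OF E.b.abelian_group_TM D.b.balanced_cong[OF tau_balanced] tau_balanced _ X])
    (use f V in simp_all)

lemma restriction_eq:
  assumes v1: "v = \<one>\<^bsub>G\<^esub>" and X: "X \<in> carrier I.TM"
  shows "tensor_lift C (\<lambda>s x. gr_map j s \<odot>\<^bsub>C\<^esub> x) X = restriction X"
  unfolding restriction_def
  by (rule I.lift_cong[OF D.C.M.abelian_group_axioms I.balanced_cong[OF restriction_balanced] restriction_balanced _ X])
    (use D.C.smult_one v1 D.T_facts in simp_all)

end

text \<open>Naturality serves twice: with \<open>d\<close> a differential it makes the maps of a splitting chain maps, and with \<open>d\<close> the
  identity, for growing submodules, it compares a splitting with the canonical one.\<close>

context
  fixes G :: "'g monoid" and C C' :: "('g \<Rightarrow>\<^sub>0 int, 'm) module" and K :: "'k monoid" and k :: "'k \<Rightarrow> 'g"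
    and T T' U U' :: "'m set" and L :: "'l monoid" and j :: "'l \<Rightarrow> 'g" and i v d
  assumes t: "transfer G C K k T L j U i v" and t': "transfer G C' K k T' L j U' i v"
    and d: "d \<in> mod_hom \<int>[G] C C'" and dT: "d ` T \<subseteq> T'" and dU: "d ` U \<subseteq> U'"
begin

interpretation t: transfer G C K k T L j U i v by (rule t)
interpretation t': transfer G C' K k T' L j U' i v by (rule t')

lemma sub_hom: "d \<in> mod_hom \<int>[K] t.D.sub t'.D.sub" "d \<in> mod_hom \<int>[L] t.E.sub t'.E.sub"
  using d dT dU t.D.T_facts t.E.T_facts t.gr_closed by (auto simp: mod_hom_def)

lemma d_v: "x \<in> T \<Longrightarrow> d (t.v_inv \<odot>\<^bsub>C\<^esub> x) = t.v_inv \<odot>\<^bsub>C'\<^esub> d x"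
  using mod_hom_smult[OF d] t.v_closed t.D.T_facts by simp

lemmas eK = ext_map_facts[OF t.D.b.base_change_axioms t'.D.b.base_change_axioms sub_hom(1)]
lemmas eL = ext_map_facts[OF t.E.b.base_change_axioms t'.E.b.base_change_axioms sub_hom(2)]
lemmas eI = ext_map_facts[OF t.I.base_change_axioms t'.I.base_change_axioms sub_hom(1)]

lemma tau_natural:
  assumes X: "X \<in> carrier t.D.b.TM"
  shows "t'.tau (ind_map K G k t'.D.sub d X) = ind_map L G j t'.E.sub d (t.tau X)"
proof (rule t.D.b.additive_eqI[OF t'.E.b.abelian_group_TM _ _ _ X,
      of "\<lambda>X. t'.tau (ind_map K G k t'.D.sub d X)" "\<lambda>X. ind_map L G j t'.E.sub d (t.tau X)"])
  note aK = additive_facts[OF mod_hom_additive[OF eK(2)] t.D.b.abelian_group_TM t'.D.b.abelian_group_TM]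
  note aL = additive_facts[OF mod_hom_additive[OF eL(2)] t.E.b.abelian_group_TM t'.E.b.abelian_group_TM]
  show "additive t.D.b.TM t'.E.b.TM (\<lambda>X. t'.tau (ind_map K G k t'.D.sub d X))"
    "additive t.D.b.TM t'.E.b.TM (\<lambda>X. ind_map L G j t'.E.sub d (t.tau X))"
    by (simp_all add: additive_def t.tau_facts t'.tau_facts aK aL)
  fix s x assume "s \<in> carrier \<int>[G]" "x \<in> carrier t.D.sub"
  then show "t'.tau (ind_map K G k t'.D.sub d (t.D.b.TP s x)) = ind_map L G j t'.E.sub d (t.tau (t.D.b.TP s x))"
    using dT t.v_closed t.TU by (simp add: eK(1) eL(1) t.tau_TP t'.tau_TP d_v image_subset_iff)
qed

lemma restriction_natural:
  assumes X: "X \<in> carrier t.I.TM"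
  shows "t'.restriction (ind_map K L i t'.D.sub d X) = d (t.restriction X)"
proof (rule t.I.additive_eqI[OF t'.D.C.M.abelian_group_axioms _ _ _ X,
      of "\<lambda>X. t'.restriction (ind_map K L i t'.D.sub d X)" "\<lambda>X. d (t.restriction X)"])
  note aI = additive_facts[OF mod_hom_additive[OF eI(2)] t.I.abelian_group_TM t'.I.abelian_group_TM]
  note ad = additive_facts[OF mod_hom_additive[OF d] t.D.C.M.abelian_group_axioms t'.D.C.M.abelian_group_axioms]
  show "additive t.I.TM C' (\<lambda>X. t'.restriction (ind_map K L i t'.D.sub d X))"
    "additive t.I.TM C' (\<lambda>X. d (t.restriction X))"
    by (simp_all add: additive_def t.restriction_facts t'.restriction_facts aI ad)
  fix s x assume "s \<in> carrier \<int>[L]" "x \<in> carrier t.D.sub"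
  then show "t'.restriction (ind_map K L i t'.D.sub d (t.I.TP s x)) = d (t.restriction (t.I.TP s x))"
    using dT t.v_closed t.gr_closed t.D.T_facts
    by (simp add: eI(1) t.restriction_TP t'.restriction_TP d_v image_subset_iff mod_hom_smult[OF d] t.D.C.smult_closed)
qed

end

lemma eval_one_natural:
  assumes "induced G C K k T" "induced G C' K k T'"
    and d: "d \<in> mod_hom \<int>[G] C C'" and dT: "d ` T \<subseteq> T'"
    and X: "X \<in> carrier (ind_mod K G k (sub_mod (gr_map k) C T))"
  shows "tensor_lift C' (smult C') (ind_map K G k (sub_mod (gr_map k) C' T') d X) = d (tensor_lift C (smult C) X)"
proof -
  interpret a: induced G C K k T by fact
  interpret b: induced G C' K k T' by fact
  have h: "d \<in> mod_hom \<int>[K] a.sub b.sub"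
    using d dT a.T_facts b.T_facts ring_hom_closed[OF a.gr_hom] by (auto simp: mod_hom_def)
  note e = ext_map_facts[OF a.b.base_change_axioms b.b.base_change_axioms h]
  note ae = additive_facts[OF mod_hom_additive[OF e(2)] a.b.abelian_group_TM b.b.abelian_group_TM]
  note ad = additive_facts[OF mod_hom_additive[OF d] a.C.M.abelian_group_axioms b.C.M.abelian_group_axioms]
  have ia: "a.invariant (\<lambda>_. 1)" and ib: "b.invariant (\<lambda>_. 1)" by (simp_all add: a.invariant_def b.invariant_def)
  show ?thesis
    unfolding a.eval_one b.eval_one
  proof (rule a.b.additive_eqI[OF b.C.M.abelian_group_axioms _ _ _ X,
      of "\<lambda>X. b.eval (\<lambda>_. 1) (ind_map K G k b.sub d X)" "\<lambda>X. d (a.eval (\<lambda>_. 1) X)"])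
    show "additive a.b.TM C' (\<lambda>X. b.eval (\<lambda>_. 1) (ind_map K G k b.sub d X))"
      "additive a.b.TM C' (\<lambda>X. d (a.eval (\<lambda>_. 1) X))"
      by (simp_all add: additive_def a.eval_facts[OF ia] b.eval_facts[OF ib] ae ad)
    fix s x assume "s \<in> carrier \<int>[G]" "x \<in> carrier a.sub"
    then show "b.eval (\<lambda>_. 1) (ind_map K G k b.sub d (a.b.TP s x)) = d (a.eval (\<lambda>_. 1) (a.b.TP s x))"
      using dT a.T_facts by (simp add: e(1) a.eval_TP[OF ia] b.eval_TP[OF ib] weighted_one image_subset_iff mod_hom_smult[OF d])
  qed
qed

section \<open>Generators of an induced module and a section of the projection\<close>

lemma (in induced) eval_cong:
  assumes w: "invariant w" "invariant w'" and eq: "\<And>g. g \<in> carrier G \<Longrightarrow> w g = w' g"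
    and X: "X \<in> carrier b.TM"
  shows "eval w X = eval w' X"
proof -
  have "weighted w s = weighted w' s" if "s \<in> carrier \<int>[G]" for s
    using that eq by (rule weighted_cong)
  then show ?thesis unfolding eval_def
    by (intro b.lift_cong[OF C.M.abelian_group_axioms eval_balanced[OF w(1)] eval_balanced[OF w(2)] _ X]) simp
qed

locale span_ind = free_sub G C B K k
  for G :: "'g monoid" and C :: "('g \<Rightarrow>\<^sub>0 int, 'm) module" and B :: "'m set" and K :: "'k monoid"
    and k :: "'k \<Rightarrow> 'g" +
  fixes Z :: "'m \<Rightarrow> 'g set"
  assumes Z: "\<And>b. b \<in> B \<Longrightarrow> Z b \<subseteq> carrier G"
begin

sublocale n: induced G C K k "span Z"
  by (intro induced.intro induced_axioms.intro is_group F.left_module_axioms K.is_group k span_closed Z)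

text \<open>A generator lying over \<open>y b\<close>. As \<open>z\<close> runs through \<open>Z b\<close> it
  picks various cosets \<open>yz\<^sup>-\<^sup>1 K\<close>, hence various places of the tree, for the
  same element of \<open>C\<close>.\<close>
definition pt :: "'g \<Rightarrow> 'g \<Rightarrow> 'm \<Rightarrow> ('g \<Rightarrow>\<^sub>0 int, 'm) tensor" where
  "pt y z b = n.b.TP (frag_of (y \<otimes>\<^bsub>G\<^esub> inv\<^bsub>G\<^esub> z)) (z \<bullet> b)"

lemma Z_span: "b \<in> B \<Longrightarrow> z \<in> Z b \<Longrightarrow> z \<in> carrier G" "b \<in> B \<Longrightarrow> z \<in> Z b \<Longrightarrow> z \<bullet> b \<in> span Z"
proof -
  show c: "z \<in> carrier G" if "b \<in> B" "z \<in> Z b" using Z[OF that(1)] that(2) by (rule subsetD)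
  show "z \<bullet> b \<in> span Z" if "b \<in> B" "z \<in> Z b"
    using c[OF that] that translates_self[OF Z[OF that(1)]] by (intro act_basis_supported) auto
qed

lemma pt_closed: "y \<in> carrier G \<Longrightarrow> b \<in> B \<Longrightarrow> z \<in> Z b \<Longrightarrow> pt y z b \<in> carrier n.b.TM"
  unfolding pt_def using Z_span by (intro n.b.TP_closed frag_of_closed) auto

lemma invariant_one: "n.invariant (\<lambda>_. 1)"
  by (simp add: n.invariant_def)

lemmas eval_one_facts = n.eval_facts[OF invariant_one]

lemma eval_pt:
  assumes "y \<in> carrier G" "b \<in> B" "z \<in> Z b"
  shows "n.eval (\<lambda>_. 1) (pt y z b) = y \<bullet> b"
proof -
  have z: "z \<in> carrier G" using Z_span(1)[OF assms(2,3)] .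
  have "n.eval (\<lambda>_. 1) (pt y z b) = (y \<otimes>\<^bsub>G\<^esub> inv\<^bsub>G\<^esub> z) \<bullet> z \<bullet> b"
    unfolding pt_def using assms z Z_span
    by (simp add: n.eval_TP[OF invariant_one] frag_of_closed weighted_one)
  also have "\<dots> = y \<bullet> b" using assms z basis_closed by (simp add: act_act G.m_assoc)
  finally show ?thesis .
qed

text \<open>Only the orbit of \<open>z\<close> counts: the factor \<open>k(a)\<close> moves across the tensor
  sign.\<close>
lemma pt_translate:
  assumes "y \<in> carrier G" "b \<in> B" "z \<in> Z b" "a \<in> carrier K"
  shows "pt y (k a \<otimes>\<^bsub>G\<^esub> z) b = pt y z b"
proof -
  have z: "z \<in> carrier G" using Z_span(1)[OF assms(2,3)] .
  let ?g = "y \<otimes>\<^bsub>G\<^esub> inv\<^bsub>G\<^esub> (k a \<otimes>\<^bsub>G\<^esub> z)"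
  have g: "?g \<in> carrier G" "?g \<otimes>\<^bsub>G\<^esub> k a = y \<otimes>\<^bsub>G\<^esub> inv\<^bsub>G\<^esub> z"
    using assms z by (simp_all add: inv_mult_group G.m_assoc)
  have "pt y (k a \<otimes>\<^bsub>G\<^esub> z) b = n.b.TP (frag_of ?g) (gr_map k (frag_of a) \<odot>\<^bsub>C\<^esub> (z \<bullet> b))"
    unfolding pt_def using assms z basis_closed by (simp add: gr_map_of act_act)
  also have "\<dots> = n.b.TP (frag_of ?g \<otimes>\<^bsub>\<int>[G]\<^esub> gr_map k (frag_of a)) (z \<bullet> b)"
    using n.b.TP_balanced[OF frag_of_closed[OF g(1)] frag_of_closed[OF assms(4)], of "z \<bullet> b"] assms Z_span by simp
  also have "\<dots> = pt y z b" unfolding pt_def using g by (simp add: gr_map_of frag_of_mult)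
  finally show ?thesis .
qed

lemma ind_span_induct [consumes 1, case_names zero diff pt]:
  assumes X: "X \<in> carrier n.b.TM" and zero: "P \<zero>\<^bsub>n.b.TM\<^esub>"
    and diff: "\<And>X Y. X \<in> carrier n.b.TM \<Longrightarrow> Y \<in> carrier n.b.TM \<Longrightarrow> P X \<Longrightarrow> P Y \<Longrightarrow> P (X \<ominus>\<^bsub>n.b.TM\<^esub> Y)"
    and pt: "\<And>y b z. y \<in> carrier G \<Longrightarrow> b \<in> B \<Longrightarrow> z \<in> Z b \<Longrightarrow> P (pt y z b)"
  shows "P X"
proof -
  have gen: "n.b.TP (frag_of g) x \<in> carrier n.b.TM \<and> P (n.b.TP (frag_of g) x)" if g: "g \<in> carrier G" and x: "x \<in> span Z" for g x
    using x
  proof (induction rule: supported_induct)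
    note tp = additive_facts[OF n.TP_frag_facts(2)[OF frag_of_closed[OF g]] n.b.M.M.abelian_group_axioms n.b.abelian_group_TM]
    {
      case zero
      show ?case using tp(3) \<open>P \<zero>\<^bsub>n.b.TM\<^esub>\<close> by simp
    next
      case (diff x y)
      have "x \<ominus>\<^bsub>n.sub\<^esub> y = x \<ominus>\<^bsub>C\<^esub> y"
        by (rule sub_mod_uminus(2)[OF F.M.abelian_group_axioms n.b.M.M.abelian_group_axioms]) (use diff supported_carrier in auto)
      then have "n.b.TP (frag_of g) (x \<ominus>\<^bsub>C\<^esub> y) = n.b.TP (frag_of g) x \<ominus>\<^bsub>n.b.TM\<^esub> n.b.TP (frag_of g) y"
        using tp(5)[of x y] diff by simp
      then show ?case using diff assms(3) by simp
    next
      case (act c b)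
      then obtain a z where az: "a \<in> carrier K" "z \<in> Z b" "c = k a \<otimes>\<^bsub>G\<^esub> z" by (auto simp: translates_def)
      have z: "z \<in> carrier G" using Z_span(1)[OF act(2) az(2)] .
      let ?y = "g \<otimes>\<^bsub>G\<^esub> c"
      have y: "?y \<in> carrier G" using g act by simp
      have "n.b.TP (frag_of g) (c \<bullet> b) = pt ?y c b"
        using g act by (simp add: pt_def G.m_assoc)
      also have "\<dots> = pt ?y z b" unfolding az(3) by (rule pt_translate) (use y act az in auto)
      finally show ?case using assms(4)[OF y act(2) az(2)] pt_closed[OF y act(2) az(2)] by simp
    }
  qed
  show ?thesis using X
  proof (induction rule: n.TM_group_induct)
    case zero
    show ?case by fact
  next
    case (add X g x)
    let ?Y = "n.b.TP (frag_of g) x"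
    have Y: "?Y \<in> carrier n.b.TM" "P ?Y" using gen add by auto
    have "P (\<zero>\<^bsub>n.b.TM\<^esub> \<ominus>\<^bsub>n.b.TM\<^esub> ?Y)" using diff Y zero by simp
    then have "P (X \<ominus>\<^bsub>n.b.TM\<^esub> (\<zero>\<^bsub>n.b.TM\<^esub> \<ominus>\<^bsub>n.b.TM\<^esub> ?Y))" using diff Y add by simp
    then show ?case using Y add by (simp add: n.b.TM.minus_eq)
  qed
qed

text \<open>Freeness of \<open>C\<close> splits the projection: every \<open>y b\<close> is lifted to the place
  \<open>z = \<one>\<close>, which is the reason for putting \<open>\<one>\<close> into every \<open>Z
  b\<close>.\<close>
definition sigma :: "'m \<Rightarrow> ('g \<Rightarrow>\<^sub>0 int, 'm) tensor" where
  "sigma x = (\<Oplus>\<^bsub>n.b.TM\<^esub>b\<in>B. n.b.TP (coord x b) b)"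

context
  assumes one: "\<And>b. b \<in> B \<Longrightarrow> \<one>\<^bsub>G\<^esub> \<in> Z b"
begin

lemma basis_span: "b \<in> B \<Longrightarrow> b \<in> span Z"
  using Z_span(2)[of b "\<one>\<^bsub>G\<^esub>"] one F.smult_one[OF basis_closed, of b] by simp

lemma sigma_closed: "x \<in> carrier C \<Longrightarrow> b \<in> B \<Longrightarrow> n.b.TP (coord x b) b \<in> carrier n.b.TM"
  using basis_span coord_closed by (intro n.b.TP_closed) auto

lemma sigma_additive: "additive C n.b.TM sigma"
  unfolding additive_def
proof (intro conjI ballI)
  fix x y assume x: "x \<in> carrier C" and y: "y \<in> carrier C"
  show "sigma x \<in> carrier n.b.TM" unfolding sigma_def using sigma_closed[OF x] by (intro n.b.TM.finsum_closed) auto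
  have "sigma (x \<oplus>\<^bsub>C\<^esub> y) = (\<Oplus>\<^bsub>n.b.TM\<^esub>b\<in>B. n.b.TP (coord x b) b \<oplus>\<^bsub>n.b.TM\<^esub> n.b.TP (coord y b) b)"
    unfolding sigma_def using sigma_closed[OF x] sigma_closed[OF y] coord_closed[OF x] coord_closed[OF y] basis_span
    by (intro n.b.TM.finsum_cong') (simp_all del: group_ring_simps add: coord_add x y n.b.TP_add_left)
  also have "\<dots> = sigma x \<oplus>\<^bsub>n.b.TM\<^esub> sigma y"
    unfolding sigma_def using sigma_closed[OF x] sigma_closed[OF y] by (intro n.b.TM.finsum_addf) auto
  finally show "sigma (x \<oplus>\<^bsub>C\<^esub> y) = sigma x \<oplus>\<^bsub>n.b.TM\<^esub> sigma y" .
qed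

lemmas sigma_facts = additive_facts[OF sigma_additive F.M.abelian_group_axioms n.b.abelian_group_TM]

lemma sigma_act:
  assumes y: "y \<in> carrier G" and b: "b \<in> B" shows "sigma (y \<bullet> b) = pt y \<one>\<^bsub>G\<^esub> b"
proof -
  have TP0: "n.b.TP 0 b' = \<zero>\<^bsub>n.b.TM\<^esub>" if "b' \<in> B" for b'
    using additive_facts(3)[OF n.TP_frag_facts(1)[OF basis_span[OF that]] F.R.abelian_group_axioms n.b.abelian_group_TM] by simp
  have yb: "n.b.TP (frag_of y) b \<in> carrier n.b.TM" using y b basis_span by (intro n.b.TP_closed frag_of_closed) auto
  have "sigma (y \<bullet> b) = (\<Oplus>\<^bsub>n.b.TM\<^esub>b'\<in>B. if b = b' then n.b.TP (frag_of y) b else \<zero>\<^bsub>n.b.TM\<^esub>)"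
    unfolding sigma_def using y b TP0 yb
    by (intro n.b.TM.finsum_cong') (auto simp: coord_act_basis)
  also have "\<dots> = n.b.TP (frag_of y) b"
    using n.b.TM.finsum_singleton[OF b finite_B, of "\<lambda>_. n.b.TP (frag_of y) b"] yb by simp
  also have "\<dots> = pt y \<one>\<^bsub>G\<^esub> b"
    using y b F.smult_one[OF basis_closed[OF b]] by (simp add: pt_def)
  finally show ?thesis .
qed

lemma eval_sigma:
  assumes x: "x \<in> carrier C" shows "n.eval (\<lambda>_. 1) (sigma x) = x"
proof -
  have "n.eval (\<lambda>_. 1) (sigma x) = (\<Oplus>\<^bsub>C\<^esub>b\<in>B. n.eval (\<lambda>_. 1) (n.b.TP (coord x b) b))"
    unfolding sigma_def
    by (rule additive_finsum[OF n.eval_additive[OF invariant_one] n.b.abelian_group_TM F.M.abelian_group_axioms sigma_closed[OF x]])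
  also have "\<dots> = (\<Oplus>\<^bsub>C\<^esub>b\<in>B. coord x b \<odot>\<^bsub>C\<^esub> b)"
    using coord_closed[OF x] basis_span basis_closed
    by (intro F.M.finsum_cong') (auto simp: n.eval_TP[OF invariant_one] weighted_one intro!: F.smult_closed)
  also have "\<dots> = x" using coord_props(2)[OF x] by simp
  finally show ?thesis .
qed

end

end

text \<open>A transfer between modules given by supports; the condition \<open>ZZ'\<close> is what is needed for
  \<open>v\<^sup>-\<^sup>1\<close> to carry one support into the other.\<close>
locale span_transfer = D: span_ind G C B K k Z + E: span_ind G C B L j Z'
  for G :: "'g monoid" and C :: "('g \<Rightarrow>\<^sub>0 int, 'm) module" and B :: "'m set" and K :: "'k monoid"
    and k :: "'k \<Rightarrow> 'g" and Z :: "'m \<Rightarrow> 'g set" and L :: "'l monoid" and j :: "'l \<Rightarrow> 'g" and Z' :: "'m \<Rightarrow> 'g set" +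
  fixes i :: "'k \<Rightarrow> 'l" and v :: 'g
  assumes i: "i \<in> hom K L" and v: "v \<in> carrier G"
    and kv: "\<And>h. h \<in> carrier K \<Longrightarrow> k h \<otimes>\<^bsub>G\<^esub> v = v \<otimes>\<^bsub>G\<^esub> j (i h)"
    and ZZ': "\<And>b z. b \<in> B \<Longrightarrow> z \<in> Z b \<Longrightarrow> inv\<^bsub>G\<^esub> v \<otimes>\<^bsub>G\<^esub> z \<in> Z' b"
begin

lemma span_mono: "x \<in> D.span Z \<Longrightarrow> frag_of (inv\<^bsub>G\<^esub> v) \<odot>\<^bsub>C\<^esub> x \<in> E.span Z'"
proof (rule D.supported_smult)
  show "frag_of (inv\<^bsub>G\<^esub> v) \<in> carrier \<int>[G]" using v by (simp add: frag_of_closed)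
  fix g b w assume g: "g \<in> Poly_Mapping.keys (frag_of (inv\<^bsub>G\<^esub> v))" and b: "b \<in> B" and w: "w \<in> translates K G k (Z b)"
  obtain h z where hz: "h \<in> carrier K" "z \<in> Z b" "w = k h \<otimes>\<^bsub>G\<^esub> z" using w by (auto simp: translates_def)
  have z: "z \<in> carrier G" using D.Z_span(1)[OF b hz(2)] .
  have ih: "i h \<in> carrier L" using hz(1) hom_in_carrier[OF i] by simp
  have "v \<otimes>\<^bsub>G\<^esub> (j (i h) \<otimes>\<^bsub>G\<^esub> (inv\<^bsub>G\<^esub> v \<otimes>\<^bsub>G\<^esub> z)) = (v \<otimes>\<^bsub>G\<^esub> j (i h)) \<otimes>\<^bsub>G\<^esub> (inv\<^bsub>G\<^esub> v \<otimes>\<^bsub>G\<^esub> z)"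
    using v z ih by (simp add: D.G.m_assoc)
  also have "\<dots> = k h \<otimes>\<^bsub>G\<^esub> (v \<otimes>\<^bsub>G\<^esub> inv\<^bsub>G\<^esub> v) \<otimes>\<^bsub>G\<^esub> z"
    unfolding kv[OF hz(1), symmetric] using hz(1) v z by (simp only: D.G.m_assoc D.k.hom_closed D.G.m_closed D.G.inv_closed)
  also have "\<dots> = w" using hz v z by simp
  finally have "inv\<^bsub>G\<^esub> v \<otimes>\<^bsub>G\<^esub> w = j (i h) \<otimes>\<^bsub>G\<^esub> (inv\<^bsub>G\<^esub> v \<otimes>\<^bsub>G\<^esub> z)"
    using v z ih by (metis D.G.inv_solve_left D.G.m_closed D.G.inv_closed E.k.hom_closed)
  then show "g \<otimes>\<^bsub>G\<^esub> w \<in> translates L G j (Z' b)"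
    using g ih ZZ'[OF b hz(2)] by (auto simp: translates_def)
qed

sublocale t: transfer G C K k "D.span Z" L j "E.span Z'" i v
  by unfold_locales (use i v kv span_mono in auto)

lemma tau_pt:
  assumes y: "y \<in> carrier G" and b: "b \<in> B" and z: "z \<in> Z b"
  shows "t.tau (D.pt y z b) = E.pt y (inv\<^bsub>G\<^esub> v \<otimes>\<^bsub>G\<^esub> z) b"
proof -
  have zc: "z \<in> carrier G" using D.Z_span(1)[OF b z] .
  have "inv\<^bsub>G\<^esub> (inv\<^bsub>G\<^esub> v \<otimes>\<^bsub>G\<^esub> z) = inv\<^bsub>G\<^esub> z \<otimes>\<^bsub>G\<^esub> v" using v zc by (simp add: D.G.inv_mult_group)
  then show ?thesis
    unfolding D.pt_def E.pt_def using y b z zc v D.Z_span(2)[OF b z] D.basis_closed[OF b]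
    by (simp add: t.tau_TP frag_of_closed frag_of_mult D.act_act D.G.m_assoc)
qed

end

section \<open>Exactness for amalgams\<close>

text \<open>One degree of the splitting. The set \<open>Z b\<close> stands for a finite subtree attached to the
  basis element \<open>b\<close>; its edges go into \<open>D\<close> and its vertices into
  \<open>C1\<close> and \<open>C2\<close>.\<close>
locale amalgam_piece =
  fixes A :: "('h, 'a, 'b, 'g) amalgam" and C :: "('g \<Rightarrow>\<^sub>0 int, 'm) module" and B :: "'m set"
    and Z :: "'m \<Rightarrow> 'g set"
  assumes A: "amalgamated_free_product A" and free: "free_group_module (am_G A) C B"
    and Z: "\<And>b. b \<in> B \<Longrightarrow> Z b \<subseteq> carrier (am_G A)" and one: "\<And>b. b \<in> B \<Longrightarrow> \<one>\<^bsub>am_G A\<^esub> \<in> Z b"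
    and conn: "\<And>b. b \<in> B \<Longrightarrow>
      connected_by (am_G A) (am_j1 A ` carrier (am_G1 A) \<union> am_j2 A ` carrier (am_G2 A)) (Z b)"
begin

abbreviation "G \<equiv> am_G A"

lemma groups: "group (am_H A)" "group (am_G1 A)" "group (am_G2 A)" "group G"
    and homs: "am_i1 A \<in> hom (am_H A) (am_G1 A)" "am_i2 A \<in> hom (am_H A) (am_G2 A)"
  using A by (simp_all add: amalgamated_free_product_def)

lemmas j = pushout_morphisms[OF A]

lemma k: "am_k A \<in> hom (am_H A) G"
  unfolding am_k_def by (rule hom_compose[OF homs(1) j(1)])

lemma free_sub: "free_sub G C B (am_H A) (am_k A)" "free_sub G C B (am_G1 A) (am_j1 A)"
  "free_sub G C B (am_G2 A) (am_j2 A)"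
  by (intro free_sub.intro free_sub_axioms.intro free groups j k)+

sublocale G: group G by (rule groups)

sublocale F: free_basis "\<int>[G]" C B using free by (rule free_group_module.axioms)

sublocale D: span_ind G C B "am_H A" "am_k A" Z
  by (intro span_ind.intro span_ind_axioms.intro free_sub Z)

sublocale E1: span_ind G C B "am_G1 A" "am_j1 A" Z
  by (intro span_ind.intro span_ind_axioms.intro free_sub Z)

sublocale E2: span_ind G C B "am_G2 A" "am_j2 A" Z
  by (intro span_ind.intro span_ind_axioms.intro free_sub Z)

lemma kv: "h \<in> carrier (am_H A) \<Longrightarrow> am_k A h \<otimes>\<^bsub>G\<^esub> \<one>\<^bsub>G\<^esub> = \<one>\<^bsub>G\<^esub> \<otimes>\<^bsub>G\<^esub> am_j1 A (am_i1 A h)"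
  "h \<in> carrier (am_H A) \<Longrightarrow> am_k A h \<otimes>\<^bsub>G\<^esub> \<one>\<^bsub>G\<^esub> = \<one>\<^bsub>G\<^esub> \<otimes>\<^bsub>G\<^esub> am_j2 A (am_i2 A h)"
  using j(3)[of h] hom_in_carrier[OF k, of h] by (simp_all add: am_k_def)

lemma ZZ: "b \<in> B \<Longrightarrow> z \<in> Z b \<Longrightarrow> inv\<^bsub>G\<^esub> \<one>\<^bsub>G\<^esub> \<otimes>\<^bsub>G\<^esub> z \<in> Z b"
  using Z[of b] by (auto simp: subset_iff)

sublocale T1: span_transfer G C B "am_H A" "am_k A" Z "am_G1 A" "am_j1 A" Z "am_i1 A" "\<one>\<^bsub>G\<^esub>"
  by (intro span_transfer.intro span_transfer_axioms.intro D.span_ind_axioms E1.span_ind_axioms homs G.one_closed kv ZZ)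

sublocale T2: span_transfer G C B "am_H A" "am_k A" Z "am_G2 A" "am_j2 A" Z "am_i2 A" "\<one>\<^bsub>G\<^esub>"
  by (intro span_transfer.intro span_transfer_axioms.intro D.span_ind_axioms E2.span_ind_axioms homs G.one_closed kv ZZ)

lemma eval_tau1: "E1.n.invariant w \<Longrightarrow> D.n.invariant w \<Longrightarrow> X \<in> carrier D.n.b.TM \<Longrightarrow> E1.n.eval w (T1.t.tau X) = D.n.eval w X"
  and eval_tau2: "E2.n.invariant w' \<Longrightarrow> D.n.invariant w' \<Longrightarrow> X \<in> carrier D.n.b.TM \<Longrightarrow> E2.n.eval w' (T2.t.tau X) = D.n.eval w' X"
  by (simp only: T1.t.eval_tau, rule D.n.eval_cong; simp add: D.n.invariant_def)
    (simp only: T2.t.eval_tau, rule D.n.eval_cong; simp add: D.n.invariant_def)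

lemma composite:
  assumes X: "X \<in> carrier D.n.b.TM"
  shows "E1.n.eval (\<lambda>_. 1) (T1.t.tau X) = E2.n.eval (\<lambda>_. 1) (T2.t.tau X)"
  by (simp add: eval_tau1 eval_tau2 X E1.invariant_one E2.invariant_one D.invariant_one)

text \<open>The component of \<open>X\<close> at the edge \<open>uH\<close> is the evaluation with the indicator
  of that edge. This indicator is the difference \<open>w1 - w2\<close> of the potential translated by
  \<open>u\<close>, and evaluating \<open>X\<close> with \<open>w1\<close> and \<open>w2\<close>
  factors through the two images of \<open>X\<close>.\<close>
lemma tau_injective:
  assumes X: "X \<in> carrier D.n.b.TM" and z: "T1.t.tau X = \<zero>\<^bsub>E1.n.b.TM\<^esub>" "T2.t.tau X = \<zero>\<^bsub>E2.n.b.TM\<^esub>"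
  shows "X = \<zero>\<^bsub>D.n.b.TM\<^esub>"
proof (rule D.n.eval_separates[OF X])
  fix u assume u: "u \<in> carrier G"
  obtain w1 w2 :: "'g \<Rightarrow> int" where w:
    "\<And>x a. x \<in> carrier G \<Longrightarrow> a \<in> carrier (am_G1 A) \<Longrightarrow> w1 (x \<otimes>\<^bsub>G\<^esub> am_j1 A a) = w1 x"
    "\<And>x b. x \<in> carrier G \<Longrightarrow> b \<in> carrier (am_G2 A) \<Longrightarrow> w2 (x \<otimes>\<^bsub>G\<^esub> am_j2 A b) = w2 x"
    "\<And>x. x \<in> carrier G \<Longrightarrow> w1 x - w2 x = of_bool (x \<in> am_k A ` carrier (am_H A))"
    using amalgam_potential[OF A] by blast
  define w1' where "w1' g = w1 (inv\<^bsub>G\<^esub> u \<otimes>\<^bsub>G\<^esub> g)" for g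
  define w2' where "w2' g = w2 (inv\<^bsub>G\<^esub> u \<otimes>\<^bsub>G\<^esub> g)" for g
  have inv: "E1.n.invariant w1'" "E2.n.invariant w2'"
    using u w by (simp_all add: E1.n.invariant_def E2.n.invariant_def w1'_def w2'_def flip: G.m_assoc)
  have k2: "am_k A h = am_j2 A (am_i2 A h)" if "h \<in> carrier (am_H A)" for h
    using j(3)[OF that] by (simp add: am_k_def)
  have "D.n.invariant w1'"
    using inv(1) hom_in_carrier[OF homs(1)] unfolding D.n.invariant_def E1.n.invariant_def by (simp add: am_k_def)
  moreover have "D.n.invariant w2'"
    using inv(2) hom_in_carrier[OF homs(2)] unfolding D.n.invariant_def E2.n.invariant_def by (simp add: k2)
  ultimately have invD: "D.n.invariant w1'" "D.n.invariant w2'" .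
  have "D.n.eval (D.n.coset_weight u) X = D.n.eval (\<lambda>g. w1' g - w2' g) X"
  proof (rule D.n.eval_cong[OF D.n.coset_weight_invariant[OF u] _ _ X])
    show "D.n.invariant (\<lambda>g. w1' g - w2' g)" using invD by (simp add: D.n.invariant_def)
    show "D.n.coset_weight u g = w1' g - w2' g" if "g \<in> carrier G" for g
      using u that by (simp add: D.n.coset_weight_def w1'_def w2'_def w(3))
  qed
  also have "\<dots> = D.n.eval w1' X \<ominus>\<^bsub>C\<^esub> D.n.eval w2' X" by (rule D.n.eval_diff[OF invD X])
  also have "\<dots> = E1.n.eval w1' (T1.t.tau X) \<ominus>\<^bsub>C\<^esub> E2.n.eval w2' (T2.t.tau X)"
    by (simp add: eval_tau1 eval_tau2 inv invD X)
  also have "\<dots> = \<zero>\<^bsub>C\<^esub> \<ominus>\<^bsub>C\<^esub> \<zero>\<^bsub>C\<^esub>"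
    unfolding z using E1.n.eval_facts(3)[OF inv(1)] E2.n.eval_facts(3)[OF inv(2)] by simp
  also have "\<dots> = \<zero>\<^bsub>C\<^esub>" by (simp add: F.M.minus_self)
  finally show "D.n.eval (D.n.coset_weight u) X = \<zero>\<^bsub>C\<^esub>" .
qed

text \<open>\<open>R1\<close> and \<open>R2\<close> say that \<open>(Y, 0)\<close> and \<open>(0, Y)\<close>,
  respectively, can be moved to the place \<open>\<one>\<close> of the first summand by adding an
  element of the image of \<open>D\<close>.\<close>
definition R1 :: "('g \<Rightarrow>\<^sub>0 int, 'm) tensor \<Rightarrow> bool" where
  "R1 Y \<longleftrightarrow> (\<exists>X \<in> carrier D.n.b.TM. T1.t.tau X = Y \<ominus>\<^bsub>E1.n.b.TM\<^esub> E1.sigma (E1.n.eval (\<lambda>_. 1) Y) \<and>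
     T2.t.tau X = \<zero>\<^bsub>E2.n.b.TM\<^esub>)"

definition R2 :: "('g \<Rightarrow>\<^sub>0 int, 'm) tensor \<Rightarrow> bool" where
  "R2 Y \<longleftrightarrow> (\<exists>X \<in> carrier D.n.b.TM. T1.t.tau X = E1.sigma (E2.n.eval (\<lambda>_. 1) Y) \<and> T2.t.tau X = Y)"

lemmas sigma_facts = E1.sigma_facts[OF one]

text \<open>The edge \<open>yz\<^sup>-\<^sup>1 H\<close> contributes a generator of \<open>D\<close> whose image
  is the pair of the generators at its two end points.\<close>
lemma R1_R2_pt:
  assumes y: "y \<in> carrier G" and b: "b \<in> B" and z: "z \<in> Z b"
  shows "R1 (E1.pt y z b) \<longleftrightarrow> R2 (E2.pt y z b)"
proof -
  let ?d = "D.pt y z b" and ?e1 = "E1.pt y z b" and ?e2 = "E2.pt y z b" and ?o = "E1.pt y \<one>\<^bsub>G\<^esub> b"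
  have zc: "z \<in> carrier G" using Z b z by auto
  have s1: "E1.sigma (E1.n.eval (\<lambda>_. 1) ?e1) = ?o" "E1.sigma (E2.n.eval (\<lambda>_. 1) ?e2) = ?o"
    using E1.sigma_act[OF one y b] by (simp_all add: E1.eval_pt E2.eval_pt y b z)
  have c: "?d \<in> carrier D.n.b.TM" "?e1 \<in> carrier E1.n.b.TM" "?e2 \<in> carrier E2.n.b.TM" "?o \<in> carrier E1.n.b.TM"
    using y b z one by (auto intro: D.pt_closed E1.pt_closed E2.pt_closed)
  have t: "T1.t.tau ?d = ?e1" "T2.t.tau ?d = ?e2"
    using T1.tau_pt[OF y b z] T2.tau_pt[OF y b z] zc by simp_all
  note tf = T1.t.tau_facts(5)[OF c(1)] T2.t.tau_facts(5)[OF c(1)]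
  show ?thesis
  proof
    assume "R1 ?e1"
    then obtain X where X: "X \<in> carrier D.n.b.TM" "T1.t.tau X = ?e1 \<ominus>\<^bsub>E1.n.b.TM\<^esub> ?o" "T2.t.tau X = \<zero>\<^bsub>E2.n.b.TM\<^esub>"
      unfolding R1_def s1 by blast
    then show "R2 ?e2" unfolding R2_def s1
      using c by (intro bexI[of _ "?d \<ominus>\<^bsub>D.n.b.TM\<^esub> X"]) (simp_all add: tf t E1.n.b.TM.minus_minus_cancel E2.n.b.TM.minus_right_zero)
  next
    assume "R2 ?e2"
    then obtain X where X: "X \<in> carrier D.n.b.TM" "T1.t.tau X = ?o" "T2.t.tau X = ?e2"
      unfolding R2_def s1 by blast
    then show "R1 ?e1" unfolding R1_def s1
      using c by (intro bexI[of _ "?d \<ominus>\<^bsub>D.n.b.TM\<^esub> X"]) (simp_all add: tf t E2.n.b.TM.minus_self)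
  qed
qed

text \<open>Following the walk from \<open>\<one>\<close> to \<open>z\<close>: a letter of \<open>G1\<close>
  does not change the place in the first summand, and a letter of \<open>G2\<close> does not change
  the place in the second one.\<close>
lemma R1_pt:
  assumes y: "y \<in> carrier G" and b: "b \<in> B" and z: "z \<in> Z b"
  shows "R1 (E1.pt y z b)"
proof -
  have "(\<one>\<^bsub>G\<^esub>, z) \<in> {(x, s \<otimes>\<^bsub>G\<^esub> x) | x s. s \<in> am_j1 A ` carrier (am_G1 A) \<union> am_j2 A ` carrier (am_G2 A) \<and>
      x \<in> Z b \<and> s \<otimes>\<^bsub>G\<^esub> x \<in> Z b}\<^sup>*"
    using conn[OF b] z by (simp add: connected_by_def)
  then show ?thesis
  proof (induction rule: rtrancl_induct)
    case base
    have o: "E1.pt y \<one>\<^bsub>G\<^esub> b \<in> carrier E1.n.b.TM" using y b one by (intro E1.pt_closed)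
    then show ?case unfolding R1_def
      using E1.sigma_act[OF one y b] E1.eval_pt[OF y b one[OF b]]
      by (intro bexI[of _ "\<zero>\<^bsub>D.n.b.TM\<^esub>"]) (simp_all add: T1.t.tau_facts(3) T2.t.tau_facts(3) E1.n.b.TM.minus_self)
  next
    case (step x x')
    then obtain s where s: "x' = s \<otimes>\<^bsub>G\<^esub> x" "s \<in> am_j1 A ` carrier (am_G1 A) \<union> am_j2 A ` carrier (am_G2 A)"
      and x: "x \<in> Z b" "x' \<in> Z b" by blast
    from s(2) show ?case
    proof
      assume "s \<in> am_j1 A ` carrier (am_G1 A)"
      then have "E1.pt y x' b = E1.pt y x b" using E1.pt_translate[OF y b x(1)] s(1) by auto
      with step show ?case by simp
    next
      assume "s \<in> am_j2 A ` carrier (am_G2 A)"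
      then have "E2.pt y x' b = E2.pt y x b" using E2.pt_translate[OF y b x(1)] s(1) by auto
      with step show ?case using R1_R2_pt[OF y b x(1)] R1_R2_pt[OF y b x(2)] by simp
    qed
  qed
qed

lemma R1: "Y \<in> carrier E1.n.b.TM \<Longrightarrow> R1 Y"
proof (induction rule: E1.ind_span_induct)
  case zero
  show ?case unfolding R1_def
    by (intro bexI[of _ "\<zero>\<^bsub>D.n.b.TM\<^esub>"])
      (simp_all add: E1.n.b.TM.minus_self T1.t.tau_facts(3) T2.t.tau_facts(3) E1.eval_one_facts(3) sigma_facts(3))
next
  case (diff Y Y')
  let ?s = "\<lambda>Y. E1.sigma (E1.n.eval (\<lambda>_. 1) Y)"
  have c: "?s Y \<in> carrier E1.n.b.TM" if "Y \<in> carrier E1.n.b.TM" for Y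
    using that by (simp add: sigma_facts(1) E1.eval_one_facts(1))
  obtain X X' where X: "X \<in> carrier D.n.b.TM" "T1.t.tau X = Y \<ominus>\<^bsub>E1.n.b.TM\<^esub> ?s Y" "T2.t.tau X = \<zero>\<^bsub>E2.n.b.TM\<^esub>"
    and X': "X' \<in> carrier D.n.b.TM" "T1.t.tau X' = Y' \<ominus>\<^bsub>E1.n.b.TM\<^esub> ?s Y'" "T2.t.tau X' = \<zero>\<^bsub>E2.n.b.TM\<^esub>"
    using diff.IH unfolding R1_def by blast
  have "T1.t.tau (X \<ominus>\<^bsub>D.n.b.TM\<^esub> X') = (Y \<ominus>\<^bsub>E1.n.b.TM\<^esub> Y') \<ominus>\<^bsub>E1.n.b.TM\<^esub> ?s (Y \<ominus>\<^bsub>E1.n.b.TM\<^esub> Y')"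
    using X X' diff.hyps c by (simp add: T1.t.tau_facts(5) E1.n.b.TM.minus_minus_minus sigma_facts(5) E1.eval_one_facts(1,5))
  moreover have "T2.t.tau (X \<ominus>\<^bsub>D.n.b.TM\<^esub> X') = \<zero>\<^bsub>E2.n.b.TM\<^esub>"
    using X X' by (simp add: T2.t.tau_facts(5) E2.n.b.TM.minus_self)
  ultimately show ?case unfolding R1_def using X(1) X'(1) D.n.b.TM.minus_closed by blast
qed (rule R1_pt)

lemma R2: "Y \<in> carrier E2.n.b.TM \<Longrightarrow> R2 Y"
proof (induction rule: E2.ind_span_induct)
  case zero
  show ?case unfolding R2_def
    by (intro bexI[of _ "\<zero>\<^bsub>D.n.b.TM\<^esub>"])
      (simp_all add: T1.t.tau_facts(3) T2.t.tau_facts(3) E2.eval_one_facts(3) sigma_facts(3))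
next
  case (diff Y Y')
  obtain X X' where X: "X \<in> carrier D.n.b.TM" "T1.t.tau X = E1.sigma (E2.n.eval (\<lambda>_. 1) Y)" "T2.t.tau X = Y"
    and X': "X' \<in> carrier D.n.b.TM" "T1.t.tau X' = E1.sigma (E2.n.eval (\<lambda>_. 1) Y')" "T2.t.tau X' = Y'"
    using diff.IH unfolding R2_def by blast
  then show ?case unfolding R2_def
    using diff.hyps by (intro bexI[of _ "X \<ominus>\<^bsub>D.n.b.TM\<^esub> X'"])
      (simp_all add: T1.t.tau_facts(5) T2.t.tau_facts(5) sigma_facts(5) E2.eval_one_facts(1,5))
qed (use R1_pt R1_R2_pt in blast)

text \<open>Moving both components to the place \<open>\<one>\<close> of the first summand, they meet there: a
  lift along \<open>sigma\<close> of the common value.\<close>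
lemma kernel:
  assumes Y: "Y1 \<in> carrier E1.n.b.TM" "Y2 \<in> carrier E2.n.b.TM"
    and eq: "E1.n.eval (\<lambda>_. 1) Y1 = E2.n.eval (\<lambda>_. 1) Y2"
  obtains X where "X \<in> carrier D.n.b.TM" "T1.t.tau X = Y1" "T2.t.tau X = Y2"
proof -
  let ?s = "E1.sigma (E2.n.eval (\<lambda>_. 1) Y2)"
  have s: "?s \<in> carrier E1.n.b.TM" using Y by (simp add: sigma_facts(1) E2.eval_one_facts(1))
  obtain X where X: "X \<in> carrier D.n.b.TM" "T1.t.tau X = Y1 \<ominus>\<^bsub>E1.n.b.TM\<^esub> ?s" "T2.t.tau X = \<zero>\<^bsub>E2.n.b.TM\<^esub>"
    using R1[OF Y(1)] unfolding R1_def eq by blast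
  obtain X' where X': "X' \<in> carrier D.n.b.TM" "T1.t.tau X' = ?s" "T2.t.tau X' = Y2"
    using R2[OF Y(2)] unfolding R2_def by blast
  show ?thesis
  proof (rule that[of "X \<oplus>\<^bsub>D.n.b.TM\<^esub> X'"])
    show "T1.t.tau (X \<oplus>\<^bsub>D.n.b.TM\<^esub> X') = Y1"
      using X X' Y s by (simp add: T1.t.tau_facts(2) E1.n.b.TM.minus_plus_cancel)
    show "T2.t.tau (X \<oplus>\<^bsub>D.n.b.TM\<^esub> X') = Y2"
      using X X' Y by (simp add: T2.t.tau_facts(2))
  qed (use X X' in simp)
qed

end

section \<open>Exactness for HNN extensions\<close>

text \<open>An edge \<open>yz\<^sup>-\<^sup>1 H\<close> has the end points \<open>yz\<^sup>-\<^sup>1 G1\<close>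
  and \<open>yz\<^sup>-\<^sup>1 tG1\<close>. The second one belongs to \<open>t\<^sup>-\<^sup>1
  z\<close>, so the module of the vertices has to use the larger sets \<open>Z' b\<close>.\<close>
locale hnn_piece =
  fixes A :: "('h, 'a, 'g) hnn" and C :: "('g \<Rightarrow>\<^sub>0 int, 'm) module" and B :: "'m set"
    and Z :: "'m \<Rightarrow> 'g set"
  assumes A: "hnn_extension A" and free: "free_group_module (hn_G A) C B"
    and Z: "\<And>b. b \<in> B \<Longrightarrow> Z b \<subseteq> carrier (hn_G A)" and one: "\<And>b. b \<in> B \<Longrightarrow> \<one>\<^bsub>hn_G A\<^esub> \<in> Z b"
    and conn: "\<And>b. b \<in> B \<Longrightarrow>
      connected_by (hn_G A) (hn_j1 A ` carrier (hn_G1 A) \<union> {hn_t A, inv\<^bsub>hn_G A\<^esub> hn_t A}) (Z b)"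
begin

abbreviation "G \<equiv> hn_G A"
abbreviation "t \<equiv> hn_t A"
abbreviation "Z' \<equiv> \<lambda>b. Z b \<union> (\<lambda>z. inv\<^bsub>G\<^esub> t \<otimes>\<^bsub>G\<^esub> z) ` Z b"

lemma groups: "group (hn_H A)" "group (hn_G1 A)" "group G"
    and homs: "hn_i1 A \<in> hom (hn_H A) (hn_G1 A)" "hn_i2 A \<in> hom (hn_H A) (hn_G1 A)"
  using A by (simp_all add: hnn_extension_def)

lemmas j = hnn_morphisms[OF A]

lemma k: "hn_k A \<in> hom (hn_H A) G"
  unfolding hn_k_def by (rule hom_compose[OF homs(1) j(1)])

lemma free_sub: "free_sub G C B (hn_H A) (hn_k A)" "free_sub G C B (hn_G1 A) (hn_j1 A)"
  by (intro free_sub.intro free_sub_axioms.intro free groups j k)+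

sublocale G: group G by (rule groups)

sublocale F: free_basis "\<int>[G]" C B using free by (rule free_group_module.axioms)

lemma Z': "b \<in> B \<Longrightarrow> Z' b \<subseteq> carrier G"
  using Z[of b] j(2) by auto

lemma one': "b \<in> B \<Longrightarrow> \<one>\<^bsub>G\<^esub> \<in> Z' b"
  using one by simp

sublocale D: span_ind G C B "hn_H A" "hn_k A" Z
  by (intro span_ind.intro span_ind_axioms.intro free_sub Z)

sublocale E: span_ind G C B "hn_G1 A" "hn_j1 A" Z'
  by (intro span_ind.intro span_ind_axioms.intro free_sub Z')

lemma kv: "h \<in> carrier (hn_H A) \<Longrightarrow> hn_k A h \<otimes>\<^bsub>G\<^esub> \<one>\<^bsub>G\<^esub> = \<one>\<^bsub>G\<^esub> \<otimes>\<^bsub>G\<^esub> hn_j1 A (hn_i1 A h)"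
  "h \<in> carrier (hn_H A) \<Longrightarrow> hn_k A h \<otimes>\<^bsub>G\<^esub> t = t \<otimes>\<^bsub>G\<^esub> hn_j1 A (hn_i2 A h)"
  using j(3)[of h] hom_in_carrier[OF k, of h] by (simp_all add: hn_k_def)

lemma ZZ: "b \<in> B \<Longrightarrow> z \<in> Z b \<Longrightarrow> inv\<^bsub>G\<^esub> \<one>\<^bsub>G\<^esub> \<otimes>\<^bsub>G\<^esub> z \<in> Z' b"
  "b \<in> B \<Longrightarrow> z \<in> Z b \<Longrightarrow> inv\<^bsub>G\<^esub> t \<otimes>\<^bsub>G\<^esub> z \<in> Z' b"
  using Z[of b] by (auto simp: subset_iff)

sublocale T1: span_transfer G C B "hn_H A" "hn_k A" Z "hn_G1 A" "hn_j1 A" Z' "hn_i1 A" "\<one>\<^bsub>G\<^esub>"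
  by (intro span_transfer.intro span_transfer_axioms.intro D.span_ind_axioms E.span_ind_axioms homs G.one_closed kv ZZ)

sublocale T2: span_transfer G C B "hn_H A" "hn_k A" Z "hn_G1 A" "hn_j1 A" Z' "hn_i2 A" t
  by (intro span_transfer.intro span_transfer_axioms.intro D.span_ind_axioms E.span_ind_axioms homs j kv ZZ)

definition delta :: "('g \<Rightarrow>\<^sub>0 int, 'm) tensor \<Rightarrow> ('g \<Rightarrow>\<^sub>0 int, 'm) tensor" where
  "delta X = T1.t.tau X \<ominus>\<^bsub>E.n.b.TM\<^esub> T2.t.tau X"


lemma delta_hom: "delta \<in> mod_hom \<int>[G] D.n.b.TM E.n.b.TM"
proof (rule mod_homI)
  interpret N: left_module "\<int>[G]" E.n.b.TM by (rule E.n.b.left_module_TM)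
  show "additive D.n.b.TM E.n.b.TM delta"
    unfolding additive_def delta_def
    by (simp add: T1.t.tau_facts(1,2) T2.t.tau_facts(1,2) E.n.b.TM.add_minus_add)
  fix r X assume "r \<in> carrier \<int>[G]" "X \<in> carrier D.n.b.TM"
  then show "delta (r \<odot>\<^bsub>D.n.b.TM\<^esub> X) = r \<odot>\<^bsub>E.n.b.TM\<^esub> delta X"
    by (simp add: delta_def mod_hom_smult[OF T1.t.tau_hom] mod_hom_smult[OF T2.t.tau_hom]
        T1.t.tau_facts(1) T2.t.tau_facts(1) N.smult_minus)
qed

lemmas delta_facts = additive_facts[OF mod_hom_additive[OF delta_hom] D.n.b.abelian_group_TM E.n.b.abelian_group_TM]

lemma eval_delta:
  assumes w: "E.n.invariant w" "D.n.invariant w" "D.n.invariant (\<lambda>g. w (g \<otimes>\<^bsub>G\<^esub> t))"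
    and X: "X \<in> carrier D.n.b.TM"
  shows "E.n.eval w (delta X) = D.n.eval (\<lambda>g. w g - w (g \<otimes>\<^bsub>G\<^esub> t)) X"
proof -
  have "E.n.eval w (T1.t.tau X) = D.n.eval w X"
    unfolding T1.t.eval_tau[OF w(1) X] by (rule D.n.eval_cong[OF _ w(2) _ X]) (use w(2) in \<open>simp_all add: D.n.invariant_def\<close>)
  then show ?thesis
    using X by (simp add: delta_def E.n.eval_facts(5)[OF w(1)] T1.t.tau_facts(1) T2.t.tau_facts(1)
      T2.t.eval_tau[OF w(1)] D.n.eval_diff[OF w(2,3)])
qed

lemma composite:
  assumes X: "X \<in> carrier D.n.b.TM"
  shows "E.n.eval (\<lambda>_. 1) (delta X) = \<zero>\<^bsub>C\<^esub>"
  using X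
  by (simp add: F.M.minus_self delta_def E.eval_one_facts(5) T1.t.tau_facts(1) T2.t.tau_facts(1)
      T1.t.eval_tau[OF E.invariant_one] T2.t.eval_tau[OF E.invariant_one] D.eval_one_facts(1))

text \<open>The indicator of the edge \<open>uH\<close> is \<open>w(g) - w(gt)\<close> for the translated
  potential, and \<open>eval_delta\<close> shows that this evaluation factors through
  \<open>delta\<close>.\<close>
lemma delta_injective:
  assumes X: "X \<in> carrier D.n.b.TM" and z: "delta X = \<zero>\<^bsub>E.n.b.TM\<^esub>"
  shows "X = \<zero>\<^bsub>D.n.b.TM\<^esub>"
proof (rule D.n.eval_separates[OF X])
  fix u assume u: "u \<in> carrier G"
  obtain w :: "'g \<Rightarrow> int" where w:
    "\<And>x a. x \<in> carrier G \<Longrightarrow> a \<in> carrier (hn_G1 A) \<Longrightarrow> w (x \<otimes>\<^bsub>G\<^esub> hn_j1 A a) = w x"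
    "\<And>x. x \<in> carrier G \<Longrightarrow> w x - w (x \<otimes>\<^bsub>G\<^esub> t) = of_bool (x \<in> hn_k A ` carrier (hn_H A))"
    using hnn_potential[OF A] by blast
  define w' where "w' g = w (inv\<^bsub>G\<^esub> u \<otimes>\<^bsub>G\<^esub> g)" for g
  have inv: "E.n.invariant w'"
    using u w by (simp add: E.n.invariant_def w'_def flip: G.m_assoc)
  have invD: "D.n.invariant w'"
    using inv hom_in_carrier[OF homs(1)] unfolding D.n.invariant_def E.n.invariant_def by (simp add: hn_k_def)
  have cw: "D.n.coset_weight u g = w' g - w' (g \<otimes>\<^bsub>G\<^esub> t)" if "g \<in> carrier G" for g
    using u that w(2)[of "inv\<^bsub>G\<^esub> u \<otimes>\<^bsub>G\<^esub> g"] j(2) by (simp add: D.n.coset_weight_def w'_def G.m_assoc)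
  have ic: "D.n.invariant (D.n.coset_weight u)" by (rule D.n.coset_weight_invariant[OF u])
  have invt: "D.n.invariant (\<lambda>g. w' (g \<otimes>\<^bsub>G\<^esub> t))"
    unfolding D.n.invariant_def
  proof (intro ballI)
    fix g h assume g: "g \<in> carrier G" and h: "h \<in> carrier (hn_H A)"
    have gh: "g \<otimes>\<^bsub>G\<^esub> hn_k A h \<in> carrier G" using g h by simp
    have "w' (g \<otimes>\<^bsub>G\<^esub> hn_k A h) = w' g" "D.n.coset_weight u (g \<otimes>\<^bsub>G\<^esub> hn_k A h) = D.n.coset_weight u g"
      using g h invD ic by (simp_all add: D.n.invariant_def)
    with cw[OF g] cw[OF gh] show "w' (g \<otimes>\<^bsub>G\<^esub> hn_k A h \<otimes>\<^bsub>G\<^esub> t) = w' (g \<otimes>\<^bsub>G\<^esub> t)" by linarith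
  qed
  have "D.n.eval (D.n.coset_weight u) X = D.n.eval (\<lambda>g. w' g - w' (g \<otimes>\<^bsub>G\<^esub> t)) X"
    by (rule D.n.eval_cong[OF ic _ cw X]) (use invD invt in \<open>simp_all add: D.n.invariant_def\<close>)
  also have "\<dots> = E.n.eval w' (delta X)" by (rule eval_delta[OF inv invD invt X, symmetric])
  also have "\<dots> = \<zero>\<^bsub>C\<^esub>" unfolding z by (rule E.n.eval_facts(3)[OF inv])
  finally show "D.n.eval (D.n.coset_weight u) X = \<zero>\<^bsub>C\<^esub>" .
qed

definition R :: "('g \<Rightarrow>\<^sub>0 int, 'm) tensor \<Rightarrow> bool" where
  "R Y \<longleftrightarrow> (\<exists>X \<in> carrier D.n.b.TM. delta X = Y \<ominus>\<^bsub>E.n.b.TM\<^esub> E.sigma (E.n.eval (\<lambda>_. 1) Y))"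

lemmas sigma_facts = E.sigma_facts[OF one']

lemma R_pt_iff:
  assumes y: "y \<in> carrier G" and b: "b \<in> B" and z: "z \<in> Z' b"
  shows "R (E.pt y z b) \<longleftrightarrow> (\<exists>X \<in> carrier D.n.b.TM. delta X = E.pt y z b \<ominus>\<^bsub>E.n.b.TM\<^esub> E.pt y \<one>\<^bsub>G\<^esub> b)"
  using E.sigma_act[OF one' y b] E.eval_pt[OF y b z] by (simp add: R_def)

text \<open>The generator of \<open>D\<close> at an edge is mapped to the difference of the generators at its
  end points.\<close>
lemma R_pt_ends:
  assumes y: "y \<in> carrier G" and b: "b \<in> B" and z: "z \<in> Z b"
  shows "R (E.pt y z b) \<longleftrightarrow> R (E.pt y (inv\<^bsub>G\<^esub> t \<otimes>\<^bsub>G\<^esub> z) b)"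
proof -
  let ?d = "D.pt y z b" and ?e = "E.pt y z b" and ?e' = "E.pt y (inv\<^bsub>G\<^esub> t \<otimes>\<^bsub>G\<^esub> z) b" and ?o = "E.pt y \<one>\<^bsub>G\<^esub> b"
  have zc: "z \<in> carrier G" using Z b z by auto
  have z': "z \<in> Z' b" "inv\<^bsub>G\<^esub> t \<otimes>\<^bsub>G\<^esub> z \<in> Z' b" using z by auto
  have c: "?d \<in> carrier D.n.b.TM" "?e \<in> carrier E.n.b.TM" "?e' \<in> carrier E.n.b.TM" "?o \<in> carrier E.n.b.TM"
    using y b z z' one'[OF b] by (intro D.pt_closed E.pt_closed; simp)+
  have d: "delta ?d = ?e \<ominus>\<^bsub>E.n.b.TM\<^esub> ?e'"
    using T1.tau_pt[OF y b z] T2.tau_pt[OF y b z] zc by (simp add: delta_def)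
  show ?thesis
    unfolding R_pt_iff[OF y b z'(1)] R_pt_iff[OF y b z'(2)]
  proof
    assume "\<exists>X \<in> carrier D.n.b.TM. delta X = ?e \<ominus>\<^bsub>E.n.b.TM\<^esub> ?o"
    then obtain X where "X \<in> carrier D.n.b.TM" "delta X = ?e \<ominus>\<^bsub>E.n.b.TM\<^esub> ?o" by blast
    then show "\<exists>X \<in> carrier D.n.b.TM. delta X = ?e' \<ominus>\<^bsub>E.n.b.TM\<^esub> ?o"
      using c by (intro bexI[of _ "X \<ominus>\<^bsub>D.n.b.TM\<^esub> ?d"]) (simp_all add: delta_facts(5) d E.n.b.TM.minus_minus_left)
  next
    assume "\<exists>X \<in> carrier D.n.b.TM. delta X = ?e' \<ominus>\<^bsub>E.n.b.TM\<^esub> ?o"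
    then obtain X where "X \<in> carrier D.n.b.TM" "delta X = ?e' \<ominus>\<^bsub>E.n.b.TM\<^esub> ?o" by blast
    then show "\<exists>X \<in> carrier D.n.b.TM. delta X = ?e \<ominus>\<^bsub>E.n.b.TM\<^esub> ?o"
      using c by (intro bexI[of _ "X \<oplus>\<^bsub>D.n.b.TM\<^esub> ?d"]) (simp_all add: delta_facts(2) d E.n.b.TM.minus_add_minus)
  qed
qed

lemma R_pt_Z:
  assumes y: "y \<in> carrier G" and b: "b \<in> B" and z: "z \<in> Z b"
  shows "R (E.pt y z b)"
proof -
  have "(\<one>\<^bsub>G\<^esub>, z) \<in> {(x, s \<otimes>\<^bsub>G\<^esub> x) | x s. s \<in> hn_j1 A ` carrier (hn_G1 A) \<union> {t, inv\<^bsub>G\<^esub> t} \<and>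
      x \<in> Z b \<and> s \<otimes>\<^bsub>G\<^esub> x \<in> Z b}\<^sup>*"
    using conn[OF b] z by (simp add: connected_by_def)
  then show ?thesis
  proof (induction rule: rtrancl_induct)
    case base
    have o: "E.pt y \<one>\<^bsub>G\<^esub> b \<in> carrier E.n.b.TM" using y b one' by (intro E.pt_closed)
    then show ?case unfolding R_pt_iff[OF y b one'[OF b]]
      by (intro bexI[of _ "\<zero>\<^bsub>D.n.b.TM\<^esub>"]) (simp_all add: delta_facts(3) E.n.b.TM.minus_self)
  next
    case (step x x')
    then obtain s where s: "x' = s \<otimes>\<^bsub>G\<^esub> x" "s \<in> hn_j1 A ` carrier (hn_G1 A) \<union> {t, inv\<^bsub>G\<^esub> t}"
      and x: "x \<in> Z b" "x' \<in> Z b" by blast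
    have xc: "x \<in> carrier G" using Z[OF b] x by auto
    consider "s \<in> hn_j1 A ` carrier (hn_G1 A)" | "s = t" | "s = inv\<^bsub>G\<^esub> t" using s(2) by blast
    then show ?case
    proof cases
      case 1
      then have "E.pt y x' b = E.pt y x b" using E.pt_translate[OF y b, of x] x s(1) by auto
      with step show ?thesis by simp
    next
      case 2
      then have "inv\<^bsub>G\<^esub> t \<otimes>\<^bsub>G\<^esub> x' = x" using s(1) xc j(2) by (simp add: G.m_assoc[symmetric])
      with step R_pt_ends[OF y b x(2)] show ?thesis by simp
    next
      case 3
      with step R_pt_ends[OF y b x(1)] s(1) show ?thesis by simp
    qed
  qed
qed

lemma R: "Y \<in> carrier E.n.b.TM \<Longrightarrow> R Y"
proof (induction rule: E.ind_span_induct)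
  case zero
  show ?case unfolding R_def
    by (intro bexI[of _ "\<zero>\<^bsub>D.n.b.TM\<^esub>"])
      (simp_all add: E.n.b.TM.minus_self delta_facts(3) E.eval_one_facts(3) sigma_facts(3))
next
  case (diff Y Y')
  let ?s = "\<lambda>Y. E.sigma (E.n.eval (\<lambda>_. 1) Y)"
  have c: "?s Y \<in> carrier E.n.b.TM" if "Y \<in> carrier E.n.b.TM" for Y
    using that by (simp add: sigma_facts(1) E.eval_one_facts(1))
  obtain X X' where X: "X \<in> carrier D.n.b.TM" "delta X = Y \<ominus>\<^bsub>E.n.b.TM\<^esub> ?s Y"
    and X': "X' \<in> carrier D.n.b.TM" "delta X' = Y' \<ominus>\<^bsub>E.n.b.TM\<^esub> ?s Y'"
    using diff.IH unfolding R_def by blast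
  have "delta (X \<ominus>\<^bsub>D.n.b.TM\<^esub> X') = (Y \<ominus>\<^bsub>E.n.b.TM\<^esub> Y') \<ominus>\<^bsub>E.n.b.TM\<^esub> ?s (Y \<ominus>\<^bsub>E.n.b.TM\<^esub> Y')"
    using X X' diff.hyps c by (simp add: delta_facts(5) E.n.b.TM.minus_minus_minus sigma_facts(5) E.eval_one_facts(1,5))
  then show ?case unfolding R_def using X(1) X'(1) D.n.b.TM.minus_closed by blast
next
  case (pt y b z)
  then show ?case using R_pt_Z R_pt_ends by blast
qed

lemma kernel:
  assumes Y: "Y \<in> carrier E.n.b.TM" and eq: "E.n.eval (\<lambda>_. 1) Y = \<zero>\<^bsub>C\<^esub>"
  obtains X where "X \<in> carrier D.n.b.TM" "delta X = Y"
  using R[OF Y] that E.n.b.TM.minus_right_zero[OF Y]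
  unfolding R_def eq by (auto simp: sigma_facts(3))

end

section \<open>Subcomplexes given by supports\<close>

definition sub_complex ::
  "('k \<Rightarrow> 'g) \<Rightarrow> ('g \<Rightarrow>\<^sub>0 int, 'm) ch_complex \<Rightarrow> (int \<Rightarrow> 'm set) \<Rightarrow> ('k \<Rightarrow>\<^sub>0 int, 'm) ch_complex" where
  "sub_complex k C T = \<lparr>cmod = (\<lambda>n. sub_mod (gr_map k) (cmod C n) (T n)), cdiff = cdiff C\<rparr>"

lemma sub_complex_simps [simp]:
  "cmod (sub_complex k C T) n = sub_mod (gr_map k) (cmod C n) (T n)" "cdiff (sub_complex k C T) = cdiff C"
  by (simp_all add: sub_complex_def)

lemma sub_complex_carrier: "sub_complex k C (\<lambda>n. carrier (cmod C n)) = res_complex k C"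
  by (simp add: sub_complex_def res_complex_def sub_mod_carrier)

definition closed_family ::
  "'k monoid \<Rightarrow> ('k \<Rightarrow> 'g) \<Rightarrow> ('g \<Rightarrow>\<^sub>0 int, 'm) ch_complex \<Rightarrow> (int \<Rightarrow> 'm set) \<Rightarrow> bool" where
  "closed_family K k C T \<longleftrightarrow> (\<forall>n. closed_along \<int>[K] (gr_map k) (cmod C n) (T n)) \<and>
     (\<forall>n. cdiff C n ` T n \<subseteq> T (n - 1))"

lemma closed_family_subset: "closed_family K k C T \<Longrightarrow> T n \<subseteq> carrier (cmod C n)"
  by (auto simp: closed_family_def closed_along_def)

lemma chain_complex_dest:
  assumes "chain_complex R C"
  shows "left_module R (cmod C n)" "cdiff C n \<in> mod_hom R (cmod C n) (cmod C (n - 1))"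
    "x \<in> carrier (cmod C n) \<Longrightarrow> cdiff C (n - 1) (cdiff C n x) = \<zero>\<^bsub>cmod C (n - 1 - 1)\<^esub>"
  using assms unfolding chain_complex_def by blast+

lemma closed_family_carrier:
  assumes G: "group K" "group G" "k \<in> hom K G" and C: "chain_complex \<int>[G] C"
  shows "closed_family K k C (\<lambda>n. carrier (cmod C n))"
  unfolding closed_family_def
proof (intro conjI allI)
  fix n
  interpret M: left_module "\<int>[G]" "cmod C n" by (rule chain_complex_dest[OF C])
  show "closed_along \<int>[K] (gr_map k) (cmod C n) (carrier (cmod C n))"
    using ring_hom_closed[OF gr_map_ring_hom[OF G]] by (simp add: closed_along_def M.smult_closed)
  show "cdiff C n ` carrier (cmod C n) \<subseteq> carrier (cmod C (n - 1))"
    using chain_complex_dest(2)[OF C, of n] by (auto simp: mod_hom_def)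
qed

lemma chain_complex_sub:
  assumes G: "group K" "group G" "k \<in> hom K G" and C: "chain_complex \<int>[G] C" and T: "closed_family K k C T"
  shows "chain_complex \<int>[K] (sub_complex k C T)"
proof -
  have cl: "closed_along \<int>[K] (gr_map k) (cmod C n) (T n)" and d: "x \<in> T n \<Longrightarrow> cdiff C n x \<in> T (n - 1)" for n x
    using T by (auto simp: closed_family_def)
  have Tc: "x \<in> carrier (cmod C n)" if "x \<in> T n" for x n
    using cl[of n] that by (auto simp: closed_along_def)
  note c = chain_complex_dest[OF C]
  have "cdiff C n \<in> mod_hom \<int>[K] (sub_mod (gr_map k) (cmod C n) (T n)) (sub_mod (gr_map k) (cmod C (n - 1)) (T (n - 1)))" for n
    using c(2)[of n] d Tc ring_hom_closed[OF gr_map_ring_hom[OF G]] by (auto simp: mod_hom_def)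
  then show ?thesis
    unfolding chain_complex_def sub_complex_simps sub_mod_simps
    using c(3) Tc left_module_sub_mod[OF ring_group_ring[OF G(1)] c(1) gr_map_ring_hom[OF G] cl] by blast
qed

lemma subcomplex_sub:
  assumes G: "group K" "group G" "k \<in> hom K G" and C: "chain_complex \<int>[G] C" and T: "closed_family K k C T"
  shows "subcomplex \<int>[K] (sub_complex k C T) (res_complex k C)"
proof -
  have "T n \<subseteq> carrier (cmod C n)" for n using T by (auto simp: closed_family_def closed_along_def)
  then show ?thesis
    using chain_complex_sub[OF G C T] chain_complex_sub[OF G C closed_family_carrier[OF G C]]
    unfolding sub_complex_carrier[symmetric] by (simp add: subcomplex_def)
qed

lemma finite_fg_free_sub:
  assumes G: "group K" "group G" "k \<in> hom K G" and C: "finite_fg_free \<int>[G] C" and T: "closed_family K k C T"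
    and free: "\<And>n. fg_free \<int>[K] (sub_mod (gr_map k) (cmod C n) (T n))"
  shows "finite_fg_free \<int>[K] (sub_complex k C T)"
proof -
  have "T n = {\<zero>\<^bsub>cmod C n\<^esub>}" if "carrier (cmod C n) = {\<zero>\<^bsub>cmod C n\<^esub>}" for n
  proof -
    have "T n \<subseteq> carrier (cmod C n)" "\<zero>\<^bsub>cmod C n\<^esub> \<in> T n"
      using T by (auto simp: closed_family_def closed_along_def)
    with that show ?thesis by auto
  qed
  then have "{n. T n \<noteq> {\<zero>\<^bsub>cmod C n\<^esub>}} \<subseteq> {n. carrier (cmod C n) \<noteq> {\<zero>\<^bsub>cmod C n\<^esub>}}" by blast
  then have "finite {n. T n \<noteq> {\<zero>\<^bsub>cmod C n\<^esub>}}" using C by (auto simp: finite_fg_free_def intro: finite_subset)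
  then show ?thesis
    using chain_complex_sub[OF G _ T] C free by (simp add: finite_fg_free_def)
qed

text \<open>Since \<open>d(gb) = g d(b)\<close>, only the group elements that occur in the matrix of the
  differential matter, and left translation by \<open>K\<close> commutes with right multiplication by
  them.\<close>
lemma closed_family_span:
  assumes fs: "\<And>n. free_sub G (cmod C n) (Bas n) K k" and C: "chain_complex \<int>[G] C"
    and Z: "\<And>n b. b \<in> Bas n \<Longrightarrow> Z n b \<subseteq> carrier G"
    and step: "\<And>n b b' z g. b \<in> Bas n \<Longrightarrow> b' \<in> Bas (n - 1) \<Longrightarrow> z \<in> Z n b \<Longrightarrow>
      g \<in> Poly_Mapping.keys (free_basis.coord \<int>[G] (cmod C (n - 1)) (Bas (n - 1)) (cdiff C n b) b') \<Longrightarrow>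
      z \<otimes>\<^bsub>G\<^esub> g \<in> Z (n - 1) b'"
  shows "closed_family K k C (\<lambda>n. free_group_module.supported G (cmod C n) (Bas n) (\<lambda>b. translates K G k (Z n b)))"
  unfolding closed_family_def
proof (intro conjI allI)
  fix n
  interpret M: free_sub G "cmod C n" "Bas n" K k by (rule fs)
  interpret M': free_sub G "cmod C (n - 1)" "Bas (n - 1)" K k by (rule fs)
  show "closed_along \<int>[K] (gr_map k) (cmod C n) (M.span (Z n))" by (rule M.span_closed[OF Z])
  note d = chain_complex_dest(2)[OF C, of n]
  note ad = additive_facts[OF mod_hom_additive[OF d] M.F.M.abelian_group_axioms M'.F.M.abelian_group_axioms]
  have "cdiff C n x \<in> M'.span (Z (n - 1))" if "x \<in> M.span (Z n)" for x
    using that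
  proof (induction rule: M.supported_induct)
    case zero
    show ?case by (simp add: ad M'.supported_zero)
  next
    case (diff x y)
    then show ?case by (simp add: ad M.supported_carrier M'.supported_minus)
  next
    case (act g b)
    have db: "cdiff C n b \<in> carrier (cmod C (n - 1))" using ad(1) M.basis_closed[OF act(2)] .
    have gc: "frag_of g \<in> carrier \<int>[G]" using act(1) by (rule frag_of_closed)
    have "frag_of g \<odot>\<^bsub>cmod C (n - 1)\<^esub> cdiff C n b \<in> M'.span (Z (n - 1))"
    proof (rule M'.supported_smult[OF gc])
      let ?W = "\<lambda>b'. Poly_Mapping.keys (free_basis.coord \<int>[G] (cmod C (n - 1)) (Bas (n - 1)) (cdiff C n b) b')"
      show "cdiff C n b \<in> M'.supported ?W" using db by (simp add: M'.supported_def)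
      fix g' b' w assume g': "g' \<in> Poly_Mapping.keys (frag_of g)" and b': "b' \<in> Bas (n - 1)" and w: "w \<in> ?W b'"
      obtain h z where h: "h \<in> carrier K" "z \<in> Z n b" "g = k h \<otimes>\<^bsub>G\<^esub> z"
        using act(3) by (auto simp: translates_def)
      have "w \<in> carrier G" using M'.coord_closed[OF db b'] w by (auto simp: group_ring_carrier)
      moreover have "z \<in> carrier G" using Z[OF act(2)] h by auto
      ultimately have "g' \<otimes>\<^bsub>G\<^esub> w = k h \<otimes>\<^bsub>G\<^esub> (z \<otimes>\<^bsub>G\<^esub> w)" using g' h by (simp add: M.G.m_assoc)
      then show "g' \<otimes>\<^bsub>G\<^esub> w \<in> translates K G k (Z (n - 1) b')"
        using h(1) step[OF act(2) b' h(2) w] unfolding translates_def by blast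
    qed
    then show ?case using mod_hom_smult[OF d gc M.basis_closed[OF act(2)]] by simp
  qed
  then show "cdiff C n ` M.span (Z n) \<subseteq> M'.span (Z (n - 1))" by blast
qed

text \<open>The sets are chosen by descending induction on the degree, starting above the top degree of
  \<open>C\<close>: in degree \<open>n - 1\<close> the differential forces finitely many elements, and
  any finite set can be enlarged so that \<open>P\<close> holds. Boundedness of \<open>C\<close> is
  what lets the induction start.\<close>
lemma connected_family:
  fixes C :: "('g \<Rightarrow>\<^sub>0 int, 'm) ch_complex"
  assumes G: "group G" and C: "finite_fg_free \<int>[G] C"
    and Bas: "\<And>n. free_basis \<int>[G] (cmod C n) (Bas n)"
    and cl: "\<And>F. finite F \<Longrightarrow> F \<subseteq> carrier G \<Longrightarrow>
      \<exists>Z. finite Z \<and> Z \<subseteq> carrier G \<and> F \<subseteq> Z \<and> \<one>\<^bsub>G\<^esub> \<in> Z \<and> P Z"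
    and F0: "finite F0" "F0 \<subseteq> carrier (cmod C n0)"
  obtains Z where "\<And>n b. b \<in> Bas n \<Longrightarrow> finite (Z n b)" "\<And>n b. b \<in> Bas n \<Longrightarrow> Z n b \<subseteq> carrier G"
    "\<And>n b. b \<in> Bas n \<Longrightarrow> \<one>\<^bsub>G\<^esub> \<in> Z n b" "\<And>n b. b \<in> Bas n \<Longrightarrow> P (Z n b)"
    "\<And>n b b' z g. b \<in> Bas n \<Longrightarrow> b' \<in> Bas (n - 1) \<Longrightarrow> z \<in> Z n b \<Longrightarrow>
      g \<in> Poly_Mapping.keys (free_basis.coord \<int>[G] (cmod C (n - 1)) (Bas (n - 1)) (cdiff C n b) b') \<Longrightarrow>
      z \<otimes>\<^bsub>G\<^esub> g \<in> Z (n - 1) b'"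
    "\<And>x b. x \<in> F0 \<Longrightarrow> b \<in> Bas n0 \<Longrightarrow>
      Poly_Mapping.keys (free_basis.coord \<int>[G] (cmod C n0) (Bas n0) x b) \<subseteq> Z n0 b"
proof -
  interpret G: group G by fact
  have cc: "chain_complex \<int>[G] C" using C by (simp add: finite_fg_free_def)
  define coord where "coord n = free_basis.coord \<int>[G] (cmod C n) (Bas n)" for n
  have coord_keys: "Poly_Mapping.keys (coord n x b) \<subseteq> carrier G" if "x \<in> carrier (cmod C n)" "b \<in> Bas n" for n x b
    using free_basis.coord_closed[OF Bas that] by (simp add: coord_def group_ring_carrier)
  have d: "cdiff C n b \<in> carrier (cmod C (n - 1))" if "b \<in> Bas n" for n b
    using chain_complex_dest(2)[OF cc, of n] free_basis.basis_closed[OF Bas that] by (auto simp: mod_hom_def)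
  define S where "S = {n. carrier (cmod C n) \<noteq> {\<zero>\<^bsub>cmod C n\<^esub>}}"
  have S: "finite S" using C by (simp add: finite_fg_free_def S_def)
  define N where "N = Max (insert 0 S)"
  have empty: "Bas n = {}" if "N < n" for n
  proof (rule equals0I)
    fix b assume b: "b \<in> Bas n"
    interpret M: free_basis "\<int>[G]" "cmod C n" "Bas n" by (rule Bas)
    have "n \<notin> S" using that S unfolding N_def by (metis Max_ge finite_insert insertCI not_less)
    then have "b = \<zero>\<^bsub>cmod C n\<^esub>" using M.basis_closed[OF b] by (auto simp: S_def)
    then have "M.coord b b = 0" using M.coord_facts(3)[OF b] by simp
    then show False using M.coord_basis[OF b b] by simp
  qed
  define hull where "hull F = (SOME Z. finite Z \<and> Z \<subseteq> carrier G \<and> F \<subseteq> Z \<and> \<one>\<^bsub>G\<^esub> \<in> Z \<and> P Z)" for F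
  have hull: "finite (hull F) \<and> hull F \<subseteq> carrier G \<and> F \<subseteq> hull F \<and> \<one>\<^bsub>G\<^esub> \<in> hull F \<and> P (hull F)"
    if "finite F" "F \<subseteq> carrier G" for F
    unfolding hull_def using cl[OF that] by (rule someI_ex)
  define F where "F n b = (if n = n0 then \<Union>x\<in>F0. Poly_Mapping.keys (coord n0 x b) else {})" for n b
  have F: "finite (F n b)" "F n b \<subseteq> carrier G" if "b \<in> Bas n" for n b
    using F0 that coord_keys[of _ n0 b] by (auto simp: F_def subset_iff)
  define needed where "needed n z b' = F (n - 1) b' \<union>
    (\<Union>b\<in>Bas n. \<Union>g\<in>Poly_Mapping.keys (coord (n - 1) (cdiff C n b) b'). (\<lambda>x. x \<otimes>\<^bsub>G\<^esub> g) ` z b)" for n z b'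
  define z where "z = rec_nat (\<lambda>b. hull (F N b)) (\<lambda>m zm b'. hull (needed (N - int m) zm b'))"
  have z0: "z 0 b = hull (F N b)" and zS: "z (Suc m) b = hull (needed (N - int m) (z m) b)" for m b
    by (simp_all add: z_def)
  define good where "good Z \<longleftrightarrow> finite Z \<and> Z \<subseteq> carrier G \<and> \<one>\<^bsub>G\<^esub> \<in> Z \<and> P Z" for Z
  have needed: "finite (needed (N - int m) (z m) b')" "needed (N - int m) (z m) b' \<subseteq> carrier G"
    if b': "b' \<in> Bas (N - int m - 1)" and IH: "\<And>b. b \<in> Bas (N - int m) \<Longrightarrow> good (z m b)" for m b'
    using F[OF b'] IH free_basis.finite_B[OF Bas] coord_keys[OF d b'] unfolding needed_def good_def
    by (auto simp: subset_iff)
  have good_z: "good (z m b)" if "b \<in> Bas (N - int m)" for m b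
    using that
  proof (induction m arbitrary: b)
    case 0
    then show ?case using hull[OF F[of b N]] by (simp add: z0 good_def)
  next
    case (Suc m)
    have "b \<in> Bas (N - int m - 1)" using Suc.prems by (simp add: algebra_simps)
    from hull[OF needed[OF this Suc.IH]] show ?case by (simp add: zS good_def)
  qed
  define Z where "Z n = z (nat (N - n))" for n
  have nle: "n \<le> N" if "b \<in> Bas n" for n b using that empty[of n] by fastforce
  have good_Z: "good (Z n b)" if "b \<in> Bas n" for n b
    using good_z[of b "nat (N - n)"] nle[OF that] that by (simp add: Z_def)
  have FZ: "F n b \<subseteq> Z n b" if b: "b \<in> Bas n" for n b
  proof (cases "nat (N - n)")
    case 0
    then have "n = N" using nle[OF b] by simp
    then show ?thesis using hull[OF F[OF b]] by (simp add: Z_def z0)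
  next
    case (Suc m)
    then have n: "n = N - int m - 1" by simp
    have bm: "b \<in> Bas (N - int m - 1)" using b n by simp
    have "F n b \<subseteq> needed (N - int m) (z m) b" unfolding n needed_def by blast
    also have "\<dots> \<subseteq> z (Suc m) b" unfolding zS using hull[OF needed[OF bm good_z]] by blast
    finally show ?thesis unfolding Z_def Suc .
  qed
  have step: "x \<otimes>\<^bsub>G\<^esub> g \<in> Z (n - 1) b'"
    if b: "b \<in> Bas n" and b': "b' \<in> Bas (n - 1)" and x: "x \<in> Z n b"
      and g: "g \<in> Poly_Mapping.keys (coord (n - 1) (cdiff C n b) b')" for n b b' x g
  proof -
    define m where "m = nat (N - n)"
    have n: "n = N - int m" using nle[OF b] by (simp add: m_def)
    have "x \<otimes>\<^bsub>G\<^esub> g \<in> needed (N - int m) (z m) b'"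
      using b x g unfolding needed_def n Z_def by fastforce
    also have "\<dots> \<subseteq> z (Suc m) b'" unfolding zS using hull[OF needed[OF _ good_z]] b' n by blast
    also have "z (Suc m) = Z (n - 1)" using n by (simp add: Z_def nat_add_distrib)
    finally show ?thesis .
  qed
  show ?thesis
  proof (rule that[of Z])
    fix x b assume "x \<in> F0" and b: "b \<in> Bas n0"
    then have "Poly_Mapping.keys (coord n0 x b) \<subseteq> F n0 b" by (auto simp: F_def)
    also have "\<dots> \<subseteq> Z n0 b" by (rule FZ[OF b])
    finally show "Poly_Mapping.keys (free_basis.coord \<int>[G] (cmod C n0) (Bas n0) x b) \<subseteq> Z n0 b"
      by (simp add: coord_def)
  qed (use good_Z step in \<open>auto simp: good_def coord_def\<close>)
qed

section \<open>Inclusions of subcomplexes\<close>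

lemma subcomplex_hom:
  assumes "subcomplex R D D'" shows "(\<lambda>x. x) \<in> mod_hom R (cmod D n) (cmod D' n)"
  using assms by (auto simp: subcomplex_def mod_hom_def)

lemma ind_incl_closed:
  assumes G: "group K" "group G" "k \<in> hom K G" and D: "subcomplex \<int>[K] D D'"
  shows "ind_map K G k (cmod D' n) (\<lambda>x. x) ` carrier (ind_mod K G k (cmod D n)) \<subseteq>
    carrier (ind_mod K G k (cmod D' n))"
proof -
  have b: "base_change \<int>[K] \<int>[G] (cmod D n) (gr_map k)" "base_change \<int>[K] \<int>[G] (cmod D' n) (gr_map k)"
    by (rule base_change_group_ring[OF G]; use D in \<open>simp add: subcomplex_def chain_complex_def\<close>)+
  show ?thesis using ext_map_facts(2)[OF b subcomplex_hom[OF D]] by (auto simp: mod_hom_def)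
qed

text \<open>A tensor is a finite sum of pure tensors, so it comes from any submodule that contains the finitely
  many elements involved.\<close>
lemma ind_finite_support:
  assumes G: "group K" "group G" "k \<in> hom K G" and M: "left_module \<int>[K] M"
    and X: "X \<in> carrier (ind_mod K G k M)"
  obtains F where "finite F" "F \<subseteq> carrier M"
    "\<And>N. left_module \<int>[K] N \<Longrightarrow> (\<lambda>x. x) \<in> mod_hom \<int>[K] N M \<Longrightarrow> F \<subseteq> carrier N \<Longrightarrow>
      X \<in> ind_map K G k M (\<lambda>x. x) ` carrier (ind_mod K G k N)"
proof -
  interpret b: base_change "\<int>[K]" "\<int>[G]" M "gr_map k" by (rule base_change_group_ring[OF G M])
  have "\<exists>F. finite F \<and> F \<subseteq> carrier M \<and> (\<forall>N. left_module \<int>[K] N \<longrightarrow> (\<lambda>x. x) \<in> mod_hom \<int>[K] N M \<longrightarrow>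
      F \<subseteq> carrier N \<longrightarrow> X \<in> ind_map K G k M (\<lambda>x. x) ` carrier (ind_mod K G k N))"
    using X
  proof (induction rule: b.TM_induct[consumes 1, case_names pure diff zero])
    case (pure s x)
    show ?case
    proof (intro exI[of _ "{x}"] conjI allI impI)
      fix N assume N: "left_module \<int>[K] N" "(\<lambda>x. x) \<in> mod_hom \<int>[K] N M" "{x} \<subseteq> carrier N"
      interpret n: base_change "\<int>[K]" "\<int>[G]" N "gr_map k" by (rule base_change_group_ring[OF G N(1)])
      have "ind_map K G k M (\<lambda>x. x) (n.TP s x) = b.TP s x"
        using ext_map_facts(1)[OF n.base_change_axioms b.base_change_axioms N(2)] pure N(3) by simp
      then show "b.TP s x \<in> ind_map K G k M (\<lambda>x. x) ` carrier n.TM"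
        using n.TP_closed[of s x] pure N(3) by (metis image_eqI insert_subset)
    qed (use pure in auto)
  next
    case (diff X Y)
    then obtain F F' where F: "finite F" "F \<subseteq> carrier M" "\<And>N. left_module \<int>[K] N \<Longrightarrow> (\<lambda>x. x) \<in> mod_hom \<int>[K] N M \<Longrightarrow>
      F \<subseteq> carrier N \<Longrightarrow> X \<in> ind_map K G k M (\<lambda>x. x) ` carrier (ind_mod K G k N)"
      and F': "finite F'" "F' \<subseteq> carrier M" "\<And>N. left_module \<int>[K] N \<Longrightarrow> (\<lambda>x. x) \<in> mod_hom \<int>[K] N M \<Longrightarrow>
      F' \<subseteq> carrier N \<Longrightarrow> Y \<in> ind_map K G k M (\<lambda>x. x) ` carrier (ind_mod K G k N)"
      by blast
    show ?case
    proof (intro exI[of _ "F \<union> F'"] conjI allI impI)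
      fix N assume N: "left_module \<int>[K] N" "(\<lambda>x. x) \<in> mod_hom \<int>[K] N M" "F \<union> F' \<subseteq> carrier N"
      interpret n: base_change "\<int>[K]" "\<int>[G]" N "gr_map k" by (rule base_change_group_ring[OF G N(1)])
      obtain X' Y' where X': "X' \<in> carrier n.TM" "X = ind_map K G k M (\<lambda>x. x) X'"
        and Y': "Y' \<in> carrier n.TM" "Y = ind_map K G k M (\<lambda>x. x) Y'"
        using F(3)[OF N(1,2)] F'(3)[OF N(1,2)] N(3) by blast
      have "ind_map K G k M (\<lambda>x. x) (X' \<ominus>\<^bsub>n.TM\<^esub> Y') = X \<ominus>\<^bsub>b.TM\<^esub> Y"
        using additive_facts(5)[OF mod_hom_additive[OF ext_map_facts(2)[OF n.base_change_axioms b.base_change_axioms N(2)]]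
          n.abelian_group_TM b.abelian_group_TM X'(1) Y'(1)] X'(2) Y'(2) by simp
      then show "X \<ominus>\<^bsub>b.TM\<^esub> Y \<in> ind_map K G k M (\<lambda>x. x) ` carrier n.TM"
        using n.TM.minus_closed[OF X'(1) Y'(1)] by (metis image_eqI)
    qed (use F F' in auto)
  next
    case zero
    show ?case
    proof (intro exI[of _ "{}"] conjI allI impI)
      fix N assume N: "left_module \<int>[K] N" "(\<lambda>x. x) \<in> mod_hom \<int>[K] N M"
      interpret n: base_change "\<int>[K]" "\<int>[G]" N "gr_map k" by (rule base_change_group_ring[OF G N(1)])
      have "ind_map K G k M (\<lambda>x. x) \<zero>\<^bsub>n.TM\<^esub> = \<zero>\<^bsub>b.TM\<^esub>"
        using additive_facts(3)[OF mod_hom_additive[OF ext_map_facts(2)[OF n.base_change_axioms b.base_change_axioms N(2)]]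
          n.abelian_group_TM b.abelian_group_TM] .
      then show "\<zero>\<^bsub>b.TM\<^esub> \<in> ind_map K G k M (\<lambda>x. x) ` carrier n.TM"
        using n.TM.zero_closed by (metis image_eqI)
    qed auto
  qed
  then show ?thesis using that by blast
qed

lemma eval_one_hom:
  assumes "induced G C K k T"
  shows "tensor_lift C (smult C) \<in> mod_hom \<int>[G] (ind_mod K G k (sub_mod (gr_map k) C T)) C"
proof -
  interpret induced G C K k T by fact
  have "invariant (\<lambda>_. 1)" by (simp add: invariant_def)
  from eval_balanced[OF this] have "b.balanced C (smult C)" by (simp add: weighted_one)
  then show ?thesis
    by (rule b.lift_mod_hom[OF C.left_module_axioms]) (use T_facts in \<open>simp add: C.smult_assoc\<close>)
qed

section \<open>Splittings for amalgams\<close>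

text \<open>All maps are those of the canonical splitting: the inclusions are the identity on elements, so the
  same formulas describe the restricted maps.\<close>
definition amv_of ::
  "('h, 'a, 'b, 'g) amalgam \<Rightarrow> ('g \<Rightarrow>\<^sub>0 int, 'c) ch_complex \<Rightarrow> (int \<Rightarrow> 'c set) \<Rightarrow> (int \<Rightarrow> 'c set) \<Rightarrow>
    (int \<Rightarrow> 'c set) \<Rightarrow> ('h, 'a, 'b, 'g, 'c, 'c, 'c, 'c) amv" where
  "amv_of A C TD T1 T2 = (amv_canonical A C)\<lparr>amv_D := sub_complex (am_k A) C TD,
     amv_C1 := sub_complex (am_j1 A) C T1, amv_C2 := sub_complex (am_j2 A) C T2\<rparr>"

lemma amv_of_simps [simp]:
  "amv_D (amv_of A C TD T1 T2) = sub_complex (am_k A) C TD"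
  "amv_C1 (amv_of A C TD T1 T2) = sub_complex (am_j1 A) C T1"
  "amv_C2 (amv_of A C TD T1 T2) = sub_complex (am_j2 A) C T2"
  "amv_e1 (amv_of A C TD T1 T2) n = tensor_lift (cmod C n) (\<lambda>s x. gr_map (am_j1 A) s \<odot>\<^bsub>cmod C n\<^esub> x)"
  "amv_e2 (amv_of A C TD T1 T2) n = tensor_lift (cmod C n) (\<lambda>s x. gr_map (am_j2 A) s \<odot>\<^bsub>cmod C n\<^esub> x)"
  "amv_proj (amv_of A C TD T1 T2) n (X, Y) = tensor_lift (cmod C n) (smult (cmod C n)) X \<ominus>\<^bsub>cmod C n\<^esub>
     tensor_lift (cmod C n) (smult (cmod C n)) Y"
  by (simp_all add: amv_of_def amv_canonical_def)

lemma amv_canonical_of: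
  "amv_canonical A C = amv_of A C (\<lambda>n. carrier (cmod C n)) (\<lambda>n. carrier (cmod C n)) (\<lambda>n. carrier (cmod C n))"
  unfolding amv_of_def sub_complex_carrier by (simp add: amv_canonical_def)

locale amv_family =
  fixes A :: "('h, 'a, 'b, 'g) amalgam" and C :: "('g \<Rightarrow>\<^sub>0 int, 'm) ch_complex"
    and TD T1 T2 :: "int \<Rightarrow> 'm set"
  assumes A: "amalgamated_free_product A" and C: "chain_complex \<int>[am_G A] C"
    and TD: "closed_family (am_H A) (am_k A) C TD"
    and T1: "closed_family (am_G1 A) (am_j1 A) C T1"
    and T2: "closed_family (am_G2 A) (am_j2 A) C T2"
    and sub: "\<And>n. TD n \<subseteq> T1 n" "\<And>n. TD n \<subseteq> T2 n"
begin

abbreviation "G \<equiv> am_G A"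
abbreviation "E \<equiv> amv_of A C TD T1 T2"

lemma groups: "group (am_H A)" "group (am_G1 A)" "group (am_G2 A)" "group G"
    and homs: "am_i1 A \<in> hom (am_H A) (am_G1 A)" "am_i2 A \<in> hom (am_H A) (am_G2 A)"
  using A by (simp_all add: amalgamated_free_product_def)

lemmas j = pushout_morphisms[OF A]

lemma k: "am_k A \<in> hom (am_H A) G"
  unfolding am_k_def by (rule hom_compose[OF homs(1) j(1)])

lemmas cm = chain_complex_dest[OF C]

lemma induced: "induced G (cmod C n) (am_H A) (am_k A) (TD n)"
    "induced G (cmod C n) (am_G1 A) (am_j1 A) (T1 n)"
    "induced G (cmod C n) (am_G2 A) (am_j2 A) (T2 n)"
  using TD T1 T2
  by (auto simp: closed_family_def intro!: induced.intro induced_axioms.intro groups cm k j)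

lemma transfer: "transfer G (cmod C n) (am_H A) (am_k A) (TD n) (am_G1 A) (am_j1 A) (T1 n) (am_i1 A) \<one>\<^bsub>G\<^esub>"
    "transfer G (cmod C n) (am_H A) (am_k A) (TD n) (am_G2 A) (am_j2 A) (T2 n) (am_i2 A) \<one>\<^bsub>G\<^esub>"
proof -
  interpret G: group G by (rule groups)
  interpret M: left_module "\<int>[G]" "cmod C n" by (rule cm)
  have one: "frag_of (inv\<^bsub>G\<^esub> \<one>\<^bsub>G\<^esub>) \<odot>\<^bsub>cmod C n\<^esub> x = x" if "x \<in> TD n" for x
    using that closed_family_subset[OF TD] M.smult_one[of x] by auto
  have kv: "am_k A h \<otimes>\<^bsub>G\<^esub> \<one>\<^bsub>G\<^esub> = \<one>\<^bsub>G\<^esub> \<otimes>\<^bsub>G\<^esub> am_j1 A (am_i1 A h)"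
    "am_k A h \<otimes>\<^bsub>G\<^esub> \<one>\<^bsub>G\<^esub> = \<one>\<^bsub>G\<^esub> \<otimes>\<^bsub>G\<^esub> am_j2 A (am_i2 A h)" if "h \<in> carrier (am_H A)" for h
    using j(3)[OF that] hom_in_carrier[OF k that] by (simp_all add: am_k_def)
  show "transfer G (cmod C n) (am_H A) (am_k A) (TD n) (am_G1 A) (am_j1 A) (T1 n) (am_i1 A) \<one>\<^bsub>G\<^esub>"
    by (intro transfer.intro transfer_axioms.intro induced homs G.one_closed kv) (use one sub[THEN subsetD] in auto)
  show "transfer G (cmod C n) (am_H A) (am_k A) (TD n) (am_G2 A) (am_j2 A) (T2 n) (am_i2 A) \<one>\<^bsub>G\<^esub>"
    by (intro transfer.intro transfer_axioms.intro induced homs G.one_closed kv) (use one sub[THEN subsetD] in auto)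
qed

abbreviation "tau1 n \<equiv> transfer.tau G (cmod C n) (am_G1 A) (am_j1 A) (T1 n) \<one>\<^bsub>G\<^esub>"
abbreviation "tau2 n \<equiv> transfer.tau G (cmod C n) (am_G2 A) (am_j2 A) (T2 n) \<one>\<^bsub>G\<^esub>"
abbreviation "ev n \<equiv> tensor_lift (cmod C n) (smult (cmod C n))"

lemma d_sub: "cdiff C n ` TD n \<subseteq> TD (n - 1)" "cdiff C n ` T1 n \<subseteq> T1 (n - 1)" "cdiff C n ` T2 n \<subseteq> T2 (n - 1)"
  using TD T1 T2 by (auto simp: closed_family_def)

lemma chain_complexes:
  "chain_complex \<int>[am_H A] (amv_D E)" "chain_complex \<int>[am_G1 A] (amv_C1 E)" "chain_complex \<int>[am_G2 A] (amv_C2 E)"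
  unfolding amv_of_simps
  by (rule chain_complex_sub[OF groups(1,4) k C TD] chain_complex_sub[OF groups(2,4) j(1) C T1]
      chain_complex_sub[OF groups(3,4) j(2) C T2])+

lemma left_mid: "chain_complex \<int>[G] (amv_left A E)" "chain_complex \<int>[G] (amv_mid A E)"
  unfolding amv_left_def amv_mid_def
  by (intro chain_complex_dsum chain_complex_ind groups k j chain_complexes)+

lemma chain_map_e:
  "chain_map \<int>[am_G1 A] (ind_complex (am_H A) (am_G1 A) (am_i1 A) (amv_D E)) (amv_C1 E) (amv_e1 E)"
  "chain_map \<int>[am_G2 A] (ind_complex (am_H A) (am_G2 A) (am_i2 A) (amv_D E)) (amv_C2 E) (amv_e2 E)"
proof -
  have i: "chain_complex \<int>[am_G1 A] (ind_complex (am_H A) (am_G1 A) (am_i1 A) (amv_D E))"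
    "chain_complex \<int>[am_G2 A] (ind_complex (am_H A) (am_G2 A) (am_i2 A) (amv_D E))"
    by (intro chain_complex_ind groups homs chain_complexes)+
  show "chain_map \<int>[am_G1 A] (ind_complex (am_H A) (am_G1 A) (am_i1 A) (amv_D E)) (amv_C1 E) (amv_e1 E)"
    unfolding chain_map_def
  proof (intro conjI allI ballI)
    fix n
    note t = transfer(1)[of n] and t' = transfer(1)[of "n - 1"]
    note e = transfer.restriction_eq[OF t refl] and e' = transfer.restriction_eq[OF t' refl]
    show "amv_e1 E n \<in> mod_hom \<int>[am_G1 A] (cmod (ind_complex (am_H A) (am_G1 A) (am_i1 A) (amv_D E)) n) (cmod (amv_C1 E) n)"
      using mod_hom_cong[OF transfer.restriction_hom[OF t] chain_complex_dest(1)[OF i(1), of n, simplified ind_complex_def ch_complex.simps amv_of_simps sub_complex_simps] e]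
      by (simp add: ind_complex_def)
    fix X assume "X \<in> carrier (cmod (ind_complex (am_H A) (am_G1 A) (am_i1 A) (amv_D E)) n)"
    then have X: "X \<in> carrier (ind_mod (am_H A) (am_G1 A) (am_i1 A) (sub_mod (gr_map (am_k A)) (cmod C n) (TD n)))"
      by (simp add: ind_complex_def)
    have dX: "ind_map (am_H A) (am_G1 A) (am_i1 A) (sub_mod (gr_map (am_k A)) (cmod C (n - 1)) (TD (n - 1))) (cdiff C n) X
        \<in> carrier (ind_mod (am_H A) (am_G1 A) (am_i1 A) (sub_mod (gr_map (am_k A)) (cmod C (n - 1)) (TD (n - 1))))"
      using chain_complex_dest(2)[OF i(1), of n] X by (auto simp: ind_complex_def mod_hom_def)
    show "amv_e1 E (n - 1) (cdiff (ind_complex (am_H A) (am_G1 A) (am_i1 A) (amv_D E)) n X) = cdiff (amv_C1 E) n (amv_e1 E n X)"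
      using restriction_natural[OF t t' cm(2) d_sub(1,2) X] e[OF X] e'[OF dX]
      by (simp add: ind_complex_def)
  qed
  show "chain_map \<int>[am_G2 A] (ind_complex (am_H A) (am_G2 A) (am_i2 A) (amv_D E)) (amv_C2 E) (amv_e2 E)"
    unfolding chain_map_def
  proof (intro conjI allI ballI)
    fix n
    note t = transfer(2)[of n] and t' = transfer(2)[of "n - 1"]
    note e = transfer.restriction_eq[OF t refl] and e' = transfer.restriction_eq[OF t' refl]
    show "amv_e2 E n \<in> mod_hom \<int>[am_G2 A] (cmod (ind_complex (am_H A) (am_G2 A) (am_i2 A) (amv_D E)) n) (cmod (amv_C2 E) n)"
      using mod_hom_cong[OF transfer.restriction_hom[OF t] chain_complex_dest(1)[OF i(2), of n, simplified ind_complex_def ch_complex.simps amv_of_simps sub_complex_simps] e]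
      by (simp add: ind_complex_def)
    fix X assume "X \<in> carrier (cmod (ind_complex (am_H A) (am_G2 A) (am_i2 A) (amv_D E)) n)"
    then have X: "X \<in> carrier (ind_mod (am_H A) (am_G2 A) (am_i2 A) (sub_mod (gr_map (am_k A)) (cmod C n) (TD n)))"
      by (simp add: ind_complex_def)
    have dX: "ind_map (am_H A) (am_G2 A) (am_i2 A) (sub_mod (gr_map (am_k A)) (cmod C (n - 1)) (TD (n - 1))) (cdiff C n) X
        \<in> carrier (ind_mod (am_H A) (am_G2 A) (am_i2 A) (sub_mod (gr_map (am_k A)) (cmod C (n - 1)) (TD (n - 1))))"
      using chain_complex_dest(2)[OF i(2), of n] X by (auto simp: ind_complex_def mod_hom_def)
    show "amv_e2 E (n - 1) (cdiff (ind_complex (am_H A) (am_G2 A) (am_i2 A) (amv_D E)) n X) = cdiff (amv_C2 E) n (amv_e2 E n X)"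
      using restriction_natural[OF t t' cm(2) d_sub(1,3) X] e[OF X] e'[OF dX]
      by (simp add: ind_complex_def)
  qed
qed

lemma left_carrier: "cmod (amv_left A E) n = ind_mod (am_H A) G (am_k A) (sub_mod (gr_map (am_k A)) (cmod C n) (TD n))"
  and mid_carrier: "cmod (amv_mid A E) n = dsum
     (ind_mod (am_G1 A) G (am_j1 A) (sub_mod (gr_map (am_j1 A)) (cmod C n) (T1 n)))
     (ind_mod (am_G2 A) G (am_j2 A) (sub_mod (gr_map (am_j2 A)) (cmod C n) (T2 n)))"
  by (simp_all add: amv_left_def amv_mid_def ind_complex_def dsum_complex_def)

text \<open>The definition of the map passes through the group ring of the intermediate group; the composite is
  the transfer.\<close>
lemma inj_eq:
  assumes X: "X \<in> carrier (cmod (amv_left A E) n)"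
  shows "amv_inj A E n X = (tau1 n X, tau2 n X)"
proof -
  interpret t1: transfer G "cmod C n" "am_H A" "am_k A" "TD n" "am_G1 A" "am_j1 A" "T1 n" "am_i1 A" "\<one>\<^bsub>G\<^esub>"
    by (rule transfer)
  interpret t2: transfer G "cmod C n" "am_H A" "am_k A" "TD n" "am_G2 A" "am_j2 A" "T2 n" "am_i2 A" "\<one>\<^bsub>G\<^esub>"
    by (rule transfer)
  have one1: "\<one>\<^bsub>\<int>[am_G1 A]\<^esub> \<in> carrier \<int>[am_G1 A]" and one2: "\<one>\<^bsub>\<int>[am_G2 A]\<^esub> \<in> carrier \<int>[am_G2 A]"
    using t1.E.K.one_closed t2.E.K.one_closed by (simp_all add: frag_of_closed)
  have f1: "amv_e1 E n (t1.I.TP \<one>\<^bsub>\<int>[am_G1 A]\<^esub> x) = t1.v_inv \<odot>\<^bsub>cmod C n\<^esub> x"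
    and f2: "amv_e2 E n (t2.I.TP \<one>\<^bsub>\<int>[am_G2 A]\<^esub> x) = t1.v_inv \<odot>\<^bsub>cmod C n\<^esub> x" if "x \<in> TD n" for x
    using t1.restriction_eq[OF refl t1.I.TP_closed[OF one1, of x]] t1.restriction_one[OF that]
      t2.restriction_eq[OF refl t2.I.TP_closed[OF one2, of x]] t2.restriction_one[OF that] that by simp_all
  have V: "s = s \<otimes>\<^bsub>\<int>[G]\<^esub> frag_of \<one>\<^bsub>G\<^esub>" if "s \<in> carrier \<int>[G]" for s
    using t1.D.C.R.r_one[OF that] by simp
  have X': "X \<in> carrier t1.D.b.TM" using X by (simp add: left_carrier)
  have "tensor_lift t1.E.b.TM (\<lambda>s x. t1.E.b.TP s (amv_e1 E n (t1.I.TP \<one>\<^bsub>\<int>[am_G1 A]\<^esub> x))) X = tau1 n X"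
    by (rule t1.tau_eq[OF f1 V X'])
  moreover have "tensor_lift t2.E.b.TM (\<lambda>s x. t2.E.b.TP s (amv_e2 E n (t2.I.TP \<one>\<^bsub>\<int>[am_G2 A]\<^esub> x))) X = tau2 n X"
    by (rule t2.tau_eq[OF f2 V X'])
  ultimately show ?thesis unfolding amv_inj_def amv_of_simps(1,2,3) sub_complex_simps by simp
qed

lemma chain_map_inj: "chain_map \<int>[G] (amv_left A E) (amv_mid A E) (amv_inj A E)"
  unfolding chain_map_def
proof (intro conjI allI ballI)
  fix n
  note t1 = transfer(1)[of n] and t2 = transfer(2)[of n]
  note t1' = transfer(1)[of "n - 1"] and t2' = transfer(2)[of "n - 1"]
  have "(\<lambda>X. (tau1 n X, tau2 n X)) \<in> mod_hom \<int>[G] (cmod (amv_left A E) n) (cmod (amv_mid A E) n)"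
    using transfer.tau_hom[OF t1] transfer.tau_hom[OF t2]
    unfolding left_carrier mid_carrier by (auto simp: mod_hom_def)
  then show "amv_inj A E n \<in> mod_hom \<int>[G] (cmod (amv_left A E) n) (cmod (amv_mid A E) n)"
    by (rule mod_hom_cong[OF _ chain_complex_dest(1)[OF left_mid(1)] inj_eq])
  fix X assume X: "X \<in> carrier (cmod (amv_left A E) n)"
  have dX: "cdiff (amv_left A E) n X \<in> carrier (cmod (amv_left A E) (n - 1))"
    using chain_complex_dest(2)[OF left_mid(1), of n] X by (auto simp: mod_hom_def)
  show "amv_inj A E (n - 1) (cdiff (amv_left A E) n X) = cdiff (amv_mid A E) n (amv_inj A E n X)"
    unfolding inj_eq[OF X] inj_eq[OF dX]
    using tau_natural[OF t1 t1' cm(2) d_sub(1,2), of X] tau_natural[OF t2 t2' cm(2) d_sub(1,3), of X] X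
    unfolding left_carrier
    by (simp add: amv_left_def amv_mid_def ind_complex_def dsum_complex_def)
qed

lemma ev_hom:
  "ev n \<in> mod_hom \<int>[G] (ind_mod (am_G1 A) G (am_j1 A) (sub_mod (gr_map (am_j1 A)) (cmod C n) (T1 n))) (cmod C n)"
  "ev n \<in> mod_hom \<int>[G] (ind_mod (am_G2 A) G (am_j2 A) (sub_mod (gr_map (am_j2 A)) (cmod C n) (T2 n))) (cmod C n)"
  by (rule eval_one_hom[OF induced(2)], rule eval_one_hom[OF induced(3)])

lemma chain_map_proj: "chain_map \<int>[G] (amv_mid A E) C (amv_proj E)"
  unfolding chain_map_def
proof (intro conjI allI ballI)
  fix n
  interpret M: left_module "\<int>[G]" "cmod C n" by (rule cm)
  interpret M': left_module "\<int>[G]" "cmod C (n - 1)" by (rule cm)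
  have evc: "Y \<in> carrier (ind_mod (am_G1 A) G (am_j1 A) (sub_mod (gr_map (am_j1 A)) (cmod C n) (T1 n))) \<Longrightarrow> ev n Y \<in> carrier (cmod C n)"
    "Y \<in> carrier (ind_mod (am_G2 A) G (am_j2 A) (sub_mod (gr_map (am_j2 A)) (cmod C n) (T2 n))) \<Longrightarrow> ev n Y \<in> carrier (cmod C n)" for Y
    using ev_hom[of n] by (auto simp: mod_hom_def)
  show "amv_proj E n \<in> mod_hom \<int>[G] (cmod (amv_mid A E) n) (cmod C n)"
    using ev_hom[of n] evc unfolding mid_carrier
    by (auto simp: mod_hom_def M.M.add_minus_add M.smult_minus)
  fix Y assume "Y \<in> carrier (cmod (amv_mid A E) n)"
  then obtain Y1 Y2 where Y: "Y = (Y1, Y2)"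
    "Y1 \<in> carrier (ind_mod (am_G1 A) G (am_j1 A) (sub_mod (gr_map (am_j1 A)) (cmod C n) (T1 n)))"
    "Y2 \<in> carrier (ind_mod (am_G2 A) G (am_j2 A) (sub_mod (gr_map (am_j2 A)) (cmod C n) (T2 n)))"
    unfolding mid_carrier by auto
  note ad = additive_facts(5)[OF mod_hom_additive[OF cm(2)] M.M.abelian_group_axioms M'.M.abelian_group_axioms]
  show "amv_proj E (n - 1) (cdiff (amv_mid A E) n Y) = cdiff C n (amv_proj E n Y)"
    using eval_one_natural[OF induced(2) induced(2) cm(2) d_sub(2) Y(2)]
      eval_one_natural[OF induced(3) induced(3) cm(2) d_sub(3) Y(3)] evc Y
    by (simp add: amv_mid_def ind_complex_def dsum_complex_def ad)
qed

lemma splitting: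
  assumes inj: "\<And>n X. X \<in> carrier (cmod (amv_left A E) n) \<Longrightarrow>
      tau1 n X = \<zero>\<^bsub>ind_mod (am_G1 A) G (am_j1 A) (sub_mod (gr_map (am_j1 A)) (cmod C n) (T1 n))\<^esub> \<Longrightarrow>
      tau2 n X = \<zero>\<^bsub>ind_mod (am_G2 A) G (am_j2 A) (sub_mod (gr_map (am_j2 A)) (cmod C n) (T2 n))\<^esub> \<Longrightarrow>
      X = \<zero>\<^bsub>cmod (amv_left A E) n\<^esub>"
    and comp: "\<And>n X. X \<in> carrier (cmod (amv_left A E) n) \<Longrightarrow> ev n (tau1 n X) = ev n (tau2 n X)"
    and ker: "\<And>n Y1 Y2.
      Y1 \<in> carrier (ind_mod (am_G1 A) G (am_j1 A) (sub_mod (gr_map (am_j1 A)) (cmod C n) (T1 n))) \<Longrightarrow>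
      Y2 \<in> carrier (ind_mod (am_G2 A) G (am_j2 A) (sub_mod (gr_map (am_j2 A)) (cmod C n) (T2 n))) \<Longrightarrow>
      ev n Y1 = ev n Y2 \<Longrightarrow> \<exists>X \<in> carrier (cmod (amv_left A E) n). tau1 n X = Y1 \<and> tau2 n X = Y2"
    and surj: "\<And>n x. x \<in> carrier (cmod C n) \<Longrightarrow>
      \<exists>Y \<in> carrier (ind_mod (am_G1 A) G (am_j1 A) (sub_mod (gr_map (am_j1 A)) (cmod C n) (T1 n))). ev n Y = x"
  shows "amv_splitting A C E"
proof -
  have "inj_on (amv_inj A E n) (carrier (cmod (amv_left A E) n)) \<and>
      amv_inj A E n ` carrier (cmod (amv_left A E) n) = {y \<in> carrier (cmod (amv_mid A E) n). amv_proj E n y = \<zero>\<^bsub>cmod C n\<^esub>} \<and>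
      amv_proj E n ` carrier (cmod (amv_mid A E) n) = carrier (cmod C n)" for n
  proof (intro conjI)
    interpret M: left_module "\<int>[G]" "cmod C n" by (rule cm)
    interpret L: left_module "\<int>[G]" "cmod (amv_left A E) n" by (rule chain_complex_dest(1)[OF left_mid(1)])
    interpret N: left_module "\<int>[G]" "cmod (amv_mid A E) n" by (rule chain_complex_dest(1)[OF left_mid(2)])
    let ?N1 = "ind_mod (am_G1 A) G (am_j1 A) (sub_mod (gr_map (am_j1 A)) (cmod C n) (T1 n))"
    let ?N2 = "ind_mod (am_G2 A) G (am_j2 A) (sub_mod (gr_map (am_j2 A)) (cmod C n) (T2 n))"
    have ih: "amv_inj A E n \<in> mod_hom \<int>[G] (cmod (amv_left A E) n) (cmod (amv_mid A E) n)"
      and ph: "amv_proj E n \<in> mod_hom \<int>[G] (cmod (amv_mid A E) n) (cmod C n)"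
      using chain_map_inj chain_map_proj by (simp_all add: chain_map_def)
    note fi = additive_facts[OF mod_hom_additive[OF ih] L.M.abelian_group_axioms N.M.abelian_group_axioms]
    note fp = additive_facts[OF mod_hom_additive[OF ph] N.M.abelian_group_axioms M.M.abelian_group_axioms]
    have evc: "Y \<in> carrier ?N1 \<Longrightarrow> ev n Y \<in> carrier (cmod C n)" "Y \<in> carrier ?N2 \<Longrightarrow> ev n Y \<in> carrier (cmod C n)" for Y
      using ev_hom[of n] by (auto simp: mod_hom_def)
    show "inj_on (amv_inj A E n) (carrier (cmod (amv_left A E) n))"
    proof (rule inj_onI)
      fix X X' assume X: "X \<in> carrier (cmod (amv_left A E) n)" "X' \<in> carrier (cmod (amv_left A E) n)"
        and eq: "amv_inj A E n X = amv_inj A E n X'"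
      have D: "X \<ominus>\<^bsub>cmod (amv_left A E) n\<^esub> X' \<in> carrier (cmod (amv_left A E) n)" using X by simp
      have "amv_inj A E n (X \<ominus>\<^bsub>cmod (amv_left A E) n\<^esub> X') = \<zero>\<^bsub>cmod (amv_mid A E) n\<^esub>"
        using X eq by (simp add: fi N.M.minus_self)
      then have "X \<ominus>\<^bsub>cmod (amv_left A E) n\<^esub> X' = \<zero>\<^bsub>cmod (amv_left A E) n\<^esub>"
        unfolding inj_eq[OF D] mid_carrier by (intro inj[OF D]) auto
      then show "X = X'" using X L.M.minus_eq_zeroD by blast
    qed
    show "amv_inj A E n ` carrier (cmod (amv_left A E) n) = {y \<in> carrier (cmod (amv_mid A E) n). amv_proj E n y = \<zero>\<^bsub>cmod C n\<^esub>}"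
    proof (intro equalityI subsetI)
      fix y assume "y \<in> amv_inj A E n ` carrier (cmod (amv_left A E) n)"
      then obtain X where X: "X \<in> carrier (cmod (amv_left A E) n)" "y = amv_inj A E n X" by blast
      have y: "y \<in> carrier (cmod (amv_mid A E) n)" using X fi(1) by simp
      then have "tau1 n X \<in> carrier ?N1" "tau2 n X \<in> carrier ?N2"
        using X inj_eq[OF X(1)] unfolding mid_carrier by auto
      then have "amv_proj E n y = \<zero>\<^bsub>cmod C n\<^esub>"
        unfolding X(2) inj_eq[OF X(1)] using comp[OF X(1)] evc by (simp add: M.M.minus_self)
      with y show "y \<in> {y \<in> carrier (cmod (amv_mid A E) n). amv_proj E n y = \<zero>\<^bsub>cmod C n\<^esub>}" by simp
    next
      fix y assume y: "y \<in> {y \<in> carrier (cmod (amv_mid A E) n). amv_proj E n y = \<zero>\<^bsub>cmod C n\<^esub>}"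
      then obtain Y1 Y2 where Y: "y = (Y1, Y2)" "Y1 \<in> carrier ?N1" "Y2 \<in> carrier ?N2"
        unfolding mid_carrier by auto
      then have "ev n Y1 = ev n Y2" using y evc M.M.minus_eq_zeroD by simp
      from ker[OF Y(2,3) this] obtain X where X: "X \<in> carrier (cmod (amv_left A E) n)" "tau1 n X = Y1" "tau2 n X = Y2"
        by blast
      then have "y = amv_inj A E n X" using inj_eq[OF X(1)] Y(1) by simp
      then show "y \<in> amv_inj A E n ` carrier (cmod (amv_left A E) n)" using X(1) by blast
    qed
    show "amv_proj E n ` carrier (cmod (amv_mid A E) n) = carrier (cmod C n)"
    proof (intro equalityI subsetI)
      fix x assume "x \<in> carrier (cmod C n)"
      then obtain Y where Y: "Y \<in> carrier ?N1" "ev n Y = x" using surj by blast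
      interpret i2: induced G "cmod C n" "am_G2 A" "am_j2 A" "T2 n" by (rule induced)
      have "ev n \<zero>\<^bsub>?N2\<^esub> = \<zero>\<^bsub>cmod C n\<^esub>"
        by (rule additive_facts(3)[OF mod_hom_additive[OF ev_hom(2)] i2.b.abelian_group_TM M.M.abelian_group_axioms])
      then have "amv_proj E n (Y, \<zero>\<^bsub>?N2\<^esub>) = x" using Y M.M.minus_right_zero[OF \<open>x \<in> carrier (cmod C n)\<close>] by simp
      moreover have "(Y, \<zero>\<^bsub>?N2\<^esub>) \<in> carrier (cmod (amv_mid A E) n)"
        unfolding mid_carrier using Y i2.b.TM.zero_closed by simp
      ultimately show "x \<in> amv_proj E n ` carrier (cmod (amv_mid A E) n)" by (metis image_eqI)
    qed (use fp(1) in auto)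
  qed
  then show ?thesis
    unfolding amv_splitting_def short_exact_def
    using chain_complexes chain_map_e left_mid chain_map_inj chain_map_proj C by blast
qed

end

lemma amv_family_canonical:
  assumes A: "amalgamated_free_product A" and C: "chain_complex \<int>[am_G A] C"
  shows "amv_family A C (\<lambda>n. carrier (cmod C n)) (\<lambda>n. carrier (cmod C n)) (\<lambda>n. carrier (cmod C n))"
proof -
  have g: "group (am_H A)" "group (am_G1 A)" "group (am_G2 A)" "group (am_G A)"
    and i: "am_i1 A \<in> hom (am_H A) (am_G1 A)"
    using A by (simp_all add: amalgamated_free_product_def)
  note j = pushout_morphisms[OF A]
  have k: "am_k A \<in> hom (am_H A) (am_G A)" unfolding am_k_def by (rule hom_compose[OF i j(1)])
  show ?thesis
    by (intro amv_family.intro A C order_refl closed_family_carrier[OF g(1,4) k C]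
      closed_family_carrier[OF g(2,4) j(1) C] closed_family_carrier[OF g(3,4) j(2) C])
qed

lemma id_mod_hom: "(\<lambda>x. x) \<in> mod_hom R M M"
  by (simp add: mod_hom_def)

context amv_family
begin

text \<open>The canonical splitting is the case in which all supports are full, so naturality for the identity
  of \<open>C\<close> compares the two.\<close>
lemma sub_canonical: "amv_sub A E (amv_canonical A C)"
proof -
  let ?c = "\<lambda>n. carrier (cmod C n)"
  let ?E = "amv_of A C ?c ?c ?c"
  interpret c: amv_family A C ?c ?c ?c by (rule amv_family_canonical[OF A C])
  have le: "(\<lambda>x. x) ` TD n \<subseteq> ?c n" "(\<lambda>x. x) ` T1 n \<subseteq> ?c n" "(\<lambda>x. x) ` T2 n \<subseteq> ?c n" for n
    using closed_family_subset[OF TD] closed_family_subset[OF T1] closed_family_subset[OF T2] by auto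
  have s: "subcomplex \<int>[am_H A] (amv_D E) (amv_D ?E)" "subcomplex \<int>[am_G1 A] (amv_C1 E) (amv_C1 ?E)"
    "subcomplex \<int>[am_G2 A] (amv_C2 E) (amv_C2 ?E)"
    unfolding amv_of_simps sub_complex_carrier
    by (rule subcomplex_sub[OF groups(1,4) k C TD] subcomplex_sub[OF groups(2,4) j(1) C T1]
        subcomplex_sub[OF groups(3,4) j(2) C T2])+
  have "amv_mid_incl A ?E n (amv_inj A E n X) = amv_inj A ?E n (amv_left_incl A ?E n X)"
    if X: "X \<in> carrier (cmod (amv_left A E) n)" for n X
  proof -
    have X': "X \<in> carrier (ind_mod (am_H A) G (am_k A) (sub_mod (gr_map (am_k A)) (cmod C n) (TD n)))"
      using X by (simp add: left_carrier)
    have L: "amv_left_incl A ?E n X \<in> carrier (cmod (amv_left A ?E) n)"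
      using ind_incl_closed[OF groups(1,4) k s(1), of n] X' by (auto simp: c.left_carrier amv_left_incl_def)
    then show ?thesis
      unfolding inj_eq[OF X] c.inj_eq[OF L]
      using tau_natural[OF transfer(1) c.transfer(1) id_mod_hom le(1,2) X']
        tau_natural[OF transfer(2) c.transfer(2) id_mod_hom le(1,3) X']
      by (simp add: amv_mid_incl_def amv_left_incl_def)
  qed
  moreover have "amv_proj E n Y = amv_proj ?E n (amv_mid_incl A ?E n Y)"
    if Yin: "Y \<in> carrier (cmod (amv_mid A E) n)" for n Y
  proof -
    obtain Y1 Y2 where Y: "Y = (Y1, Y2)"
      "Y1 \<in> carrier (ind_mod (am_G1 A) G (am_j1 A) (sub_mod (gr_map (am_j1 A)) (cmod C n) (T1 n)))"
      "Y2 \<in> carrier (ind_mod (am_G2 A) G (am_j2 A) (sub_mod (gr_map (am_j2 A)) (cmod C n) (T2 n)))"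
      using Yin unfolding mid_carrier by auto
    show ?thesis
      using eval_one_natural[OF induced(2) c.induced(2) id_mod_hom le(2) Y(2)]
        eval_one_natural[OF induced(3) c.induced(3) id_mod_hom le(3) Y(3)] Y
      by (simp add: amv_mid_incl_def)
  qed
  ultimately show ?thesis
    unfolding amv_sub_def amv_canonical_of using s by blast
qed

end

text \<open>Finite splittings exist with prescribed elements in every term, because the finite connected sets
  may be started from any finite set of group elements, in particular from the coefficients of
  \<open>F\<close>.\<close>
theorem amalgam_finite_splittings:
  fixes A :: "('h, 'a, 'b, 'g) amalgam" and C :: "('g \<Rightarrow>\<^sub>0 int, 'm) ch_complex"
  assumes A: "injective_amalgam A" and C: "finite_fg_free \<int>[am_G A] C"
    and F: "finite F" "F \<subseteq> carrier (cmod C m)"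
  obtains E :: "('h, 'a, 'b, 'g, 'm, 'm, 'm, 'm) amv"
  where "amv_finite A C E" "amv_sub A E (amv_canonical A C)"
    "F \<subseteq> carrier (cmod (amv_D E) m)" "F \<subseteq> carrier (cmod (amv_C1 E) m)" "F \<subseteq> carrier (cmod (amv_C2 E) m)"
proof -
  let ?G = "am_G A"
  let ?S = "am_j1 A ` carrier (am_G1 A) \<union> am_j2 A ` carrier (am_G2 A)"
  have afp: "amalgamated_free_product A" and inj: "inj_on (am_i1 A) (carrier (am_H A))"
    using A by (auto simp: injective_amalgam_def)
  have g: "group (am_H A)" "group (am_G1 A)" "group (am_G2 A)" "group ?G"
    and i: "am_i1 A \<in> hom (am_H A) (am_G1 A)"
    using afp by (simp_all add: amalgamated_free_product_def)
  note j = pushout_morphisms[OF afp]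
  have k: "am_k A \<in> hom (am_H A) ?G" unfolding am_k_def by (rule hom_compose[OF i j(1)])
  have injk: "inj_on (am_k A) (carrier (am_H A))"
    unfolding am_k_def
    by (rule comp_inj_on[OF inj inj_on_subset[OF amalgam_embeds(1)[OF A]]]) (use hom_in_carrier[OF i] in auto)
  interpret G: group ?G by (rule g)
  have cc: "chain_complex \<int>[?G] C" using C by (simp add: finite_fg_free_def)
  have "\<exists>B. free_basis \<int>[?G] (cmod C n) B" for n
    using C fg_free_basis unfolding finite_fg_free_def by metis
  then obtain Bas where Bas: "\<And>n. free_basis \<int>[?G] (cmod C n) (Bas n)" by metis
  have free: "free_group_module ?G (cmod C n) (Bas n)" for n
    by (intro free_group_module.intro g Bas)
  have S: "?S \<subseteq> carrier ?G" using hom_in_carrier[OF j(1)] hom_in_carrier[OF j(2)] by auto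
  have cl: "\<exists>Z. finite Z \<and> Z \<subseteq> carrier ?G \<and> F \<subseteq> Z \<and> \<one>\<^bsub>?G\<^esub> \<in> Z \<and> connected_by ?G ?S Z"
    if "finite F" "F \<subseteq> carrier ?G" for F
  proof (rule finite_connected[OF g(4) S _ that])
    fix P x assume "x \<in> carrier ?G" "P \<one>\<^bsub>?G\<^esub>"
      and "\<And>s x. s \<in> ?S \<Longrightarrow> x \<in> carrier ?G \<Longrightarrow> P x \<Longrightarrow> P (s \<otimes>\<^bsub>?G\<^esub> x)"
    then show "P x" by (rule amalgam_generated[where P = P, OF afp])
  qed blast
  obtain Z where Z: "\<And>n b. b \<in> Bas n \<Longrightarrow> finite (Z n b)" "\<And>n b. b \<in> Bas n \<Longrightarrow> Z n b \<subseteq> carrier ?G"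
    "\<And>n b. b \<in> Bas n \<Longrightarrow> \<one>\<^bsub>?G\<^esub> \<in> Z n b" "\<And>n b. b \<in> Bas n \<Longrightarrow> connected_by ?G ?S (Z n b)"
    and step: "\<And>n b b' z g. b \<in> Bas n \<Longrightarrow> b' \<in> Bas (n - 1) \<Longrightarrow> z \<in> Z n b \<Longrightarrow>
      g \<in> Poly_Mapping.keys (free_basis.coord \<int>[?G] (cmod C (n - 1)) (Bas (n - 1)) (cdiff C n b) b') \<Longrightarrow>
      z \<otimes>\<^bsub>?G\<^esub> g \<in> Z (n - 1) b'"
    and FZ: "\<And>x b. x \<in> F \<Longrightarrow> b \<in> Bas m \<Longrightarrow>
      Poly_Mapping.keys (free_basis.coord \<int>[?G] (cmod C m) (Bas m) x b) \<subseteq> Z m b"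
    by (rule connected_family[OF g(4) C Bas cl F]) blast+
  have piece: "amalgam_piece A (cmod C n) (Bas n) (Z n)" for n
    by (intro amalgam_piece.intro afp free Z)
  define TD where "TD n = free_group_module.supported ?G (cmod C n) (Bas n) (\<lambda>b. translates (am_H A) ?G (am_k A) (Z n b))" for n
  define T1 where "T1 n = free_group_module.supported ?G (cmod C n) (Bas n) (\<lambda>b. translates (am_G1 A) ?G (am_j1 A) (Z n b))" for n
  define T2 where "T2 n = free_group_module.supported ?G (cmod C n) (Bas n) (\<lambda>b. translates (am_G2 A) ?G (am_j2 A) (Z n b))" for n
  have "closed_family (am_H A) (am_k A) C TD" unfolding TD_def
    by (rule closed_family_span[where Z = Z and Bas = Bas], rule amalgam_piece.free_sub(1)[OF piece], rule cc,
        erule Z(2), erule (3) step)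
  moreover have "closed_family (am_G1 A) (am_j1 A) C T1" unfolding T1_def
    by (rule closed_family_span[where Z = Z and Bas = Bas], rule amalgam_piece.free_sub(2)[OF piece], rule cc,
        erule Z(2), erule (3) step)
  moreover have "closed_family (am_G2 A) (am_j2 A) C T2" unfolding T2_def
    by (rule closed_family_span[where Z = Z and Bas = Bas], rule amalgam_piece.free_sub(3)[OF piece], rule cc,
        erule Z(2), erule (3) step)
  ultimately have cf: "closed_family (am_H A) (am_k A) C TD" "closed_family (am_G1 A) (am_j1 A) C T1"
    "closed_family (am_G2 A) (am_j2 A) C T2" .
  have sub: "TD n \<subseteq> T1 n" "TD n \<subseteq> T2 n" and free_sub: "fg_free \<int>[am_H A] (sub_mod (gr_map (am_k A)) (cmod C n) (TD n))"
    "fg_free \<int>[am_G1 A] (sub_mod (gr_map (am_j1 A)) (cmod C n) (T1 n))"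
    "fg_free \<int>[am_G2 A] (sub_mod (gr_map (am_j2 A)) (cmod C n) (T2 n))" for n
  proof -
    interpret p: amalgam_piece A "cmod C n" "Bas n" "Z n" by (rule piece)
    have one: "frag_of (inv\<^bsub>?G\<^esub> \<one>\<^bsub>?G\<^esub>) \<odot>\<^bsub>cmod C n\<^esub> x = x" if "x \<in> carrier (cmod C n)" for x
      using p.F.smult_one[OF that] by simp
    {
      fix x assume "x \<in> TD n"
      then have "x \<in> p.D.span (Z n)" by (simp add: TD_def)
      from p.T1.span_mono[OF this] p.T2.span_mono[OF this] one[OF p.D.supported_carrier[OF this]]
      have "x \<in> T1 n \<and> x \<in> T2 n" by (simp add: T1_def T2_def)
    }
    then show "TD n \<subseteq> T1 n" "TD n \<subseteq> T2 n" by blast+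
    show "fg_free \<int>[am_H A] (sub_mod (gr_map (am_k A)) (cmod C n) (TD n))"
      unfolding TD_def by (rule p.D.fg_free_span[OF injk Z(1,2)])
    show "fg_free \<int>[am_G1 A] (sub_mod (gr_map (am_j1 A)) (cmod C n) (T1 n))"
      unfolding T1_def by (rule p.E1.fg_free_span[OF amalgam_embeds(1)[OF A] Z(1,2)])
    show "fg_free \<int>[am_G2 A] (sub_mod (gr_map (am_j2 A)) (cmod C n) (T2 n))"
      unfolding T2_def by (rule p.E2.fg_free_span[OF amalgam_embeds(2)[OF A] Z(1,2)])
  qed
  interpret f: amv_family A C TD T1 T2
    by (intro amv_family.intro afp cc cf sub)
  have ev: "tensor_lift (cmod C n) (smult (cmod C n)) = induced.eval (cmod C n) (\<lambda>_. 1)" for n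
    by (rule induced.eval_one[OF f.induced(1)])
  have "amv_splitting A C f.E"
  proof (rule f.splitting)
    fix n
    interpret p: amalgam_piece A "cmod C n" "Bas n" "Z n" by (rule piece)
    show "X = \<zero>\<^bsub>cmod (amv_left A f.E) n\<^esub>" if "X \<in> carrier (cmod (amv_left A f.E) n)"
      "f.tau1 n X = \<zero>\<^bsub>ind_mod (am_G1 A) ?G (am_j1 A) (sub_mod (gr_map (am_j1 A)) (cmod C n) (T1 n))\<^esub>"
      "f.tau2 n X = \<zero>\<^bsub>ind_mod (am_G2 A) ?G (am_j2 A) (sub_mod (gr_map (am_j2 A)) (cmod C n) (T2 n))\<^esub>" for X
      using p.tau_injective that unfolding f.left_carrier TD_def T1_def T2_def .
    show "f.ev n (f.tau1 n X) = f.ev n (f.tau2 n X)" if "X \<in> carrier (cmod (amv_left A f.E) n)" for X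
      using p.composite that unfolding f.left_carrier ev TD_def T1_def T2_def .
    show "\<exists>X \<in> carrier (cmod (amv_left A f.E) n). f.tau1 n X = Y1 \<and> f.tau2 n X = Y2"
      if Y: "Y1 \<in> carrier (ind_mod (am_G1 A) ?G (am_j1 A) (sub_mod (gr_map (am_j1 A)) (cmod C n) (T1 n)))"
      "Y2 \<in> carrier (ind_mod (am_G2 A) ?G (am_j2 A) (sub_mod (gr_map (am_j2 A)) (cmod C n) (T2 n)))"
      "f.ev n Y1 = f.ev n Y2" for Y1 Y2
      by (rule p.kernel[OF Y[unfolded ev T1_def T2_def]]) (unfold f.left_carrier TD_def T1_def T2_def, blast)
    show "\<exists>Y \<in> carrier (ind_mod (am_G1 A) ?G (am_j1 A) (sub_mod (gr_map (am_j1 A)) (cmod C n) (T1 n))). f.ev n Y = x"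
      if "x \<in> carrier (cmod C n)" for x
      unfolding ev T1_def
      by (rule bexI[of _ "p.E1.sigma x"]) (use p.E1.eval_sigma[OF p.one] p.sigma_facts(1)[of x] that in simp_all)
  qed
  then have "amv_finite A C f.E"
    unfolding amv_finite_def
    using C finite_fg_free_sub[OF g(1,4) k C cf(1) free_sub(1)] finite_fg_free_sub[OF g(2,4) j(1) C cf(2) free_sub(2)]
      finite_fg_free_sub[OF g(3,4) j(2) C cf(3) free_sub(3)] by simp
  moreover have "F \<subseteq> TD m"
  proof
    fix x assume x: "x \<in> F"
    interpret p: amalgam_piece A "cmod C m" "Bas m" "Z m" by (rule piece)
    have "Poly_Mapping.keys (p.F.coord x b) \<subseteq> translates (am_H A) ?G (am_k A) (Z m b)" if "b \<in> Bas m" for b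
      using FZ[OF x that] p.D.translates_self[OF Z(2)[OF that]] by blast
    then show "x \<in> TD m" unfolding TD_def p.D.supported_def using x F by auto
  qed
  ultimately show ?thesis
    using sub[of m] f.sub_canonical by (intro that[of f.E]) auto
qed

text \<open>An element of a term of the canonical splitting involves finitely many elements of \<open>C\<close>,
  also after induction, and a single finite splitting contains them all.\<close>
theorem amalgam_union:
  fixes A :: "('h, 'a, 'b, 'g) amalgam" and C :: "('g \<Rightarrow>\<^sub>0 int, 'm) ch_complex"
  assumes A: "injective_amalgam A" and C: "finite_fg_free \<int>[am_G A] C"
  shows "amv_union A C {E. amv_finite A C E \<and> amv_sub A E (amv_canonical A C)} (amv_canonical A C)"
proof -
  let ?E = "amv_canonical A C"
  let ?\<E> = "{E. amv_finite A C E \<and> amv_sub A E ?E}"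
  have afp: "amalgamated_free_product A" using A by (simp add: injective_amalgam_def)
  have cc: "chain_complex \<int>[am_G A] C" using C by (simp add: finite_fg_free_def)
  interpret c: amv_family A C "\<lambda>n. carrier (cmod C n)" "\<lambda>n. carrier (cmod C n)" "\<lambda>n. carrier (cmod C n)"
    by (rule amv_family_canonical[OF afp cc])
  have s: "subcomplex \<int>[am_H A] (amv_D E) (amv_D ?E)" "subcomplex \<int>[am_G1 A] (amv_C1 E) (amv_C1 ?E)"
    "subcomplex \<int>[am_G2 A] (amv_C2 E) (amv_C2 ?E)" if "E \<in> ?\<E>" for E
    using that by (simp_all add: amv_sub_def)
  have big: "\<exists>E \<in> ?\<E>. F \<subseteq> carrier (cmod (amv_D E) n) \<and> F \<subseteq> carrier (cmod (amv_C1 E) n) \<and> F \<subseteq> carrier (cmod (amv_C2 E) n)"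
    if "finite F" "F \<subseteq> carrier (cmod C n)" for F n
    using amalgam_finite_splittings[OF A C that] by (metis (mono_tags, lifting) mem_Collect_eq)
  have can: "carrier (cmod (amv_D ?E) n) = carrier (cmod C n)" "carrier (cmod (amv_C1 ?E) n) = carrier (cmod C n)"
    "carrier (cmod (amv_C2 ?E) n) = carrier (cmod C n)" for n
    by (simp_all add: amv_canonical_of)
  have lm: "left_module \<int>[am_H A] (cmod (amv_D E) n)" "left_module \<int>[am_G1 A] (cmod (amv_C1 E) n)"
    "left_module \<int>[am_G2 A] (cmod (amv_C2 E) n)" if "E \<in> ?\<E>" for E n
    using s[OF that] by (auto simp: subcomplex_def chain_complex_def)
  have lmc: "left_module \<int>[am_H A] (cmod (amv_D ?E) n)" "left_module \<int>[am_G1 A] (cmod (amv_C1 ?E) n)"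
    "left_module \<int>[am_G2 A] (cmod (amv_C2 ?E) n)" for n
    using chain_complex_dest(1)[OF c.chain_complexes(1)] chain_complex_dest(1)[OF c.chain_complexes(2)]
      chain_complex_dest(1)[OF c.chain_complexes(3)] by (simp_all add: amv_canonical_of)
  note hom = subcomplex_hom[OF s(1)] subcomplex_hom[OF s(2)] subcomplex_hom[OF s(3)]
  have left: "carrier (cmod (amv_left A E) n) = carrier (ind_mod (am_H A) (am_G A) (am_k A) (cmod (amv_D E) n))"
    and mid: "carrier (cmod (amv_mid A E) n) = carrier (ind_mod (am_G1 A) (am_G A) (am_j1 A) (cmod (amv_C1 E) n)) \<times>
      carrier (ind_mod (am_G2 A) (am_G A) (am_j2 A) (cmod (amv_C2 E) n))"
    for E :: "('h, 'a, 'b, 'g, 'm, 'm, 'm, 'm) amv" and n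
    by (simp_all add: amv_left_def amv_mid_def ind_complex_def dsum_complex_def)
  note incl1 = ind_incl_closed[OF c.groups(1,4) c.k s(1)] and incl2 = ind_incl_closed[OF c.groups(2,4) c.j(1) s(2)]
    and incl3 = ind_incl_closed[OF c.groups(3,4) c.j(2) s(3)]
  show ?thesis
    unfolding amv_union_def
  proof (intro allI conjI equalityI)
    fix n
    show "carrier (cmod (amv_D ?E) n) \<subseteq> (\<Union>E\<in>?\<E>. carrier (cmod (amv_D E) n))"
      "carrier (cmod (amv_C1 ?E) n) \<subseteq> (\<Union>E\<in>?\<E>. carrier (cmod (amv_C1 E) n))"
      "carrier (cmod (amv_C2 ?E) n) \<subseteq> (\<Union>E\<in>?\<E>. carrier (cmod (amv_C2 E) n))"
    proof (safe, goal_cases)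
      case (1 x)
      then show ?case using big[of "{x}" n] unfolding can by auto
    next
      case (2 x)
      then show ?case using big[of "{x}" n] unfolding can by auto
    next
      case (3 x)
      then show ?case using big[of "{x}" n] unfolding can by auto
    qed
    show "(\<Union>E\<in>?\<E>. carrier (cmod (amv_D E) n)) \<subseteq> carrier (cmod (amv_D ?E) n)"
      "(\<Union>E\<in>?\<E>. carrier (cmod (amv_C1 E) n)) \<subseteq> carrier (cmod (amv_C1 ?E) n)"
      "(\<Union>E\<in>?\<E>. carrier (cmod (amv_C2 E) n)) \<subseteq> carrier (cmod (amv_C2 ?E) n)"
      by (rule UN_least, use s in \<open>simp add: subcomplex_def\<close>)+
    show "carrier (cmod C n) \<subseteq> (\<Union>E\<in>?\<E>. carrier (cmod C n))" using big[of "{}" n] by auto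
    show "(\<Union>E\<in>?\<E>. carrier (cmod C n)) \<subseteq> carrier (cmod C n)" by blast
    show "(\<Union>E\<in>?\<E>. amv_left_incl A ?E n ` carrier (cmod (amv_left A E) n)) \<subseteq> carrier (cmod (amv_left A ?E) n)"
      unfolding left amv_left_incl_def by (rule UN_least) (rule incl1)
    show "(\<Union>E\<in>?\<E>. amv_mid_incl A ?E n ` carrier (cmod (amv_mid A E) n)) \<subseteq> carrier (cmod (amv_mid A ?E) n)"
      unfolding mid amv_mid_incl_def
    proof (rule UN_least)
      fix E assume "E \<in> ?\<E>"
      from incl2[OF this, of n] incl3[OF this, of n]
      show "map_prod (ind_map (am_G1 A) (am_G A) (am_j1 A) (cmod (amv_C1 ?E) n) (\<lambda>x. x))
          (ind_map (am_G2 A) (am_G A) (am_j2 A) (cmod (amv_C2 ?E) n) (\<lambda>x. x)) `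
          (carrier (ind_mod (am_G1 A) (am_G A) (am_j1 A) (cmod (amv_C1 E) n)) \<times>
           carrier (ind_mod (am_G2 A) (am_G A) (am_j2 A) (cmod (amv_C2 E) n))) \<subseteq>
          carrier (ind_mod (am_G1 A) (am_G A) (am_j1 A) (cmod (amv_C1 ?E) n)) \<times>
          carrier (ind_mod (am_G2 A) (am_G A) (am_j2 A) (cmod (amv_C2 ?E) n))"
        by (auto simp: image_subset_iff)
    qed
    show "carrier (cmod (amv_left A ?E) n) \<subseteq> (\<Union>E\<in>?\<E>. amv_left_incl A ?E n ` carrier (cmod (amv_left A E) n))"
      unfolding left amv_left_incl_def
    proof
      fix X assume "X \<in> carrier (ind_mod (am_H A) (am_G A) (am_k A) (cmod (amv_D ?E) n))"
      from ind_finite_support[OF c.groups(1,4) c.k lmc(1) this] obtain F where F: "finite F"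
        "F \<subseteq> carrier (cmod (amv_D ?E) n)"
        "\<And>N. left_module \<int>[am_H A] N \<Longrightarrow> (\<lambda>x. x) \<in> mod_hom \<int>[am_H A] N (cmod (amv_D ?E) n) \<Longrightarrow> F \<subseteq> carrier N \<Longrightarrow>
          X \<in> ind_map (am_H A) (am_G A) (am_k A) (cmod (amv_D ?E) n) (\<lambda>x. x) ` carrier (ind_mod (am_H A) (am_G A) (am_k A) N)"
        by blast
      obtain E where "E \<in> ?\<E>" "F \<subseteq> carrier (cmod (amv_D E) n)" using big[OF F(1) F(2)[unfolded can]] by blast
      with F(3)[OF lm(1) hom(1)] show "X \<in> (\<Union>E\<in>?\<E>. ind_map (am_H A) (am_G A) (am_k A) (cmod (amv_D ?E) n) (\<lambda>x. x) `
          carrier (ind_mod (am_H A) (am_G A) (am_k A) (cmod (amv_D E) n)))" by blast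
    qed
    show "carrier (cmod (amv_mid A ?E) n) \<subseteq> (\<Union>E\<in>?\<E>. amv_mid_incl A ?E n ` carrier (cmod (amv_mid A E) n))"
      unfolding mid amv_mid_incl_def
    proof
      fix Y assume "Y \<in> carrier (ind_mod (am_G1 A) (am_G A) (am_j1 A) (cmod (amv_C1 ?E) n)) \<times>
        carrier (ind_mod (am_G2 A) (am_G A) (am_j2 A) (cmod (amv_C2 ?E) n))"
      then obtain Y1 Y2 where Y: "Y = (Y1, Y2)" "Y1 \<in> carrier (ind_mod (am_G1 A) (am_G A) (am_j1 A) (cmod (amv_C1 ?E) n))"
        "Y2 \<in> carrier (ind_mod (am_G2 A) (am_G A) (am_j2 A) (cmod (amv_C2 ?E) n))" by blast
      from ind_finite_support[OF c.groups(2,4) c.j(1) lmc(2) Y(2)] obtain F1 where F1: "finite F1"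
        "F1 \<subseteq> carrier (cmod (amv_C1 ?E) n)"
        "\<And>N. left_module \<int>[am_G1 A] N \<Longrightarrow> (\<lambda>x. x) \<in> mod_hom \<int>[am_G1 A] N (cmod (amv_C1 ?E) n) \<Longrightarrow> F1 \<subseteq> carrier N \<Longrightarrow>
          Y1 \<in> ind_map (am_G1 A) (am_G A) (am_j1 A) (cmod (amv_C1 ?E) n) (\<lambda>x. x) ` carrier (ind_mod (am_G1 A) (am_G A) (am_j1 A) N)"
        by blast
      from ind_finite_support[OF c.groups(3,4) c.j(2) lmc(3) Y(3)] obtain F2 where F2: "finite F2"
        "F2 \<subseteq> carrier (cmod (amv_C2 ?E) n)"
        "\<And>N. left_module \<int>[am_G2 A] N \<Longrightarrow> (\<lambda>x. x) \<in> mod_hom \<int>[am_G2 A] N (cmod (amv_C2 ?E) n) \<Longrightarrow> F2 \<subseteq> carrier N \<Longrightarrow>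
          Y2 \<in> ind_map (am_G2 A) (am_G A) (am_j2 A) (cmod (amv_C2 ?E) n) (\<lambda>x. x) ` carrier (ind_mod (am_G2 A) (am_G A) (am_j2 A) N)"
        by blast
      have "finite (F1 \<union> F2)" "F1 \<union> F2 \<subseteq> carrier (cmod C n)" using F1 F2 by (auto simp: can)
      from big[OF this] obtain E where E: "E \<in> ?\<E>" "F1 \<subseteq> carrier (cmod (amv_C1 E) n)" "F2 \<subseteq> carrier (cmod (amv_C2 E) n)"
        by blast
      have "Y \<in> map_prod (ind_map (am_G1 A) (am_G A) (am_j1 A) (cmod (amv_C1 ?E) n) (\<lambda>x. x))
          (ind_map (am_G2 A) (am_G A) (am_j2 A) (cmod (amv_C2 ?E) n) (\<lambda>x. x)) `
          (carrier (ind_mod (am_G1 A) (am_G A) (am_j1 A) (cmod (amv_C1 E) n)) \<times>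
           carrier (ind_mod (am_G2 A) (am_G A) (am_j2 A) (cmod (amv_C2 E) n)))"
        using F1(3)[OF lm(2)[OF E(1)] hom(2)[OF E(1)] E(2)] F2(3)[OF lm(3)[OF E(1)] hom(3)[OF E(1)] E(3)]
        unfolding Y(1) by (auto simp: map_prod_def image_iff)
      with E(1) show "Y \<in> (\<Union>E\<in>?\<E>. map_prod (ind_map (am_G1 A) (am_G A) (am_j1 A) (cmod (amv_C1 ?E) n) (\<lambda>x. x))
          (ind_map (am_G2 A) (am_G A) (am_j2 A) (cmod (amv_C2 ?E) n) (\<lambda>x. x)) `
          (carrier (ind_mod (am_G1 A) (am_G A) (am_j1 A) (cmod (amv_C1 E) n)) \<times>
           carrier (ind_mod (am_G2 A) (am_G A) (am_j2 A) (cmod (amv_C2 E) n))))" by blast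
    qed
  qed
qed

section \<open>Splittings for HNN extensions\<close>

definition hmv_of ::
  "('h, 'a, 'g) hnn \<Rightarrow> ('g \<Rightarrow>\<^sub>0 int, 'c) ch_complex \<Rightarrow> (int \<Rightarrow> 'c set) \<Rightarrow> (int \<Rightarrow> 'c set) \<Rightarrow>
    ('h, 'a, 'g, 'c, 'c, 'c) hmv" where
  "hmv_of B C TD T1 = (hmv_canonical B C)\<lparr>hmv_D := sub_complex (hn_k B) C TD,
     hmv_C1 := sub_complex (hn_j1 B) C T1\<rparr>"

lemma hmv_of_simps [simp]:
  "hmv_D (hmv_of B C TD T1) = sub_complex (hn_k B) C TD"
  "hmv_C1 (hmv_of B C TD T1) = sub_complex (hn_j1 B) C T1"
  "hmv_e1 (hmv_of B C TD T1) n = tensor_lift (cmod C n) (\<lambda>s x. gr_map (hn_j1 B) s \<odot>\<^bsub>cmod C n\<^esub> x)"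
  "hmv_e2 (hmv_of B C TD T1) n = tensor_lift (cmod C n) (\<lambda>s x.
     gr_map (hn_j1 B) s \<odot>\<^bsub>cmod C n\<^esub> (frag_of (inv\<^bsub>hn_G B\<^esub> hn_t B) \<odot>\<^bsub>cmod C n\<^esub> x))"
  "hmv_proj (hmv_of B C TD T1) n = tensor_lift (cmod C n) (smult (cmod C n))"
  by (simp_all add: hmv_of_def hmv_canonical_def)

lemma hmv_canonical_of:
  "hmv_canonical B C = hmv_of B C (\<lambda>n. carrier (cmod C n)) (\<lambda>n. carrier (cmod C n))"
  unfolding hmv_of_def sub_complex_carrier by (simp add: hmv_canonical_def)

text \<open>The second map sends \<open>x\<close> to \<open>t\<^sup>-\<^sup>1 x\<close> in \<open>C1\<close>,
  hence the second condition in \<open>sub\<close>.\<close>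
locale hmv_family =
  fixes A :: "('h, 'a, 'g) hnn" and C :: "('g \<Rightarrow>\<^sub>0 int, 'm) ch_complex"
    and TD T1 :: "int \<Rightarrow> 'm set"
  assumes A: "hnn_extension A" and C: "chain_complex \<int>[hn_G A] C"
    and TD: "closed_family (hn_H A) (hn_k A) C TD"
    and T1: "closed_family (hn_G1 A) (hn_j1 A) C T1"
    and sub: "\<And>n. TD n \<subseteq> T1 n"
    and sub_t: "\<And>n x. x \<in> TD n \<Longrightarrow> frag_of (inv\<^bsub>hn_G A\<^esub> hn_t A) \<odot>\<^bsub>cmod C n\<^esub> x \<in> T1 n"
begin

abbreviation "G \<equiv> hn_G A"
abbreviation "t \<equiv> hn_t A"
abbreviation "E \<equiv> hmv_of A C TD T1"

lemma groups: "group (hn_H A)" "group (hn_G1 A)" "group G"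
    and homs: "hn_i1 A \<in> hom (hn_H A) (hn_G1 A)" "hn_i2 A \<in> hom (hn_H A) (hn_G1 A)"
  using A by (simp_all add: hnn_extension_def)

lemmas j = hnn_morphisms[OF A]

lemma k: "hn_k A \<in> hom (hn_H A) G"
  unfolding hn_k_def by (rule hom_compose[OF homs(1) j(1)])

lemmas cm = chain_complex_dest[OF C]

lemma induced: "induced G (cmod C n) (hn_H A) (hn_k A) (TD n)"
    "induced G (cmod C n) (hn_G1 A) (hn_j1 A) (T1 n)"
  using TD T1
  by (auto simp: closed_family_def intro!: induced.intro induced_axioms.intro groups cm k j)

lemma transfer: "transfer G (cmod C n) (hn_H A) (hn_k A) (TD n) (hn_G1 A) (hn_j1 A) (T1 n) (hn_i1 A) \<one>\<^bsub>G\<^esub>"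
    "transfer G (cmod C n) (hn_H A) (hn_k A) (TD n) (hn_G1 A) (hn_j1 A) (T1 n) (hn_i2 A) t"
proof -
  interpret G: group G by (rule groups)
  interpret M: left_module "\<int>[G]" "cmod C n" by (rule cm)
  have one: "frag_of (inv\<^bsub>G\<^esub> \<one>\<^bsub>G\<^esub>) \<odot>\<^bsub>cmod C n\<^esub> x = x" if "x \<in> TD n" for x
    using that closed_family_subset[OF TD] M.smult_one[of x] by auto
  have kv: "hn_k A h \<otimes>\<^bsub>G\<^esub> \<one>\<^bsub>G\<^esub> = \<one>\<^bsub>G\<^esub> \<otimes>\<^bsub>G\<^esub> hn_j1 A (hn_i1 A h)"
    "hn_k A h \<otimes>\<^bsub>G\<^esub> t = t \<otimes>\<^bsub>G\<^esub> hn_j1 A (hn_i2 A h)" if "h \<in> carrier (hn_H A)" for h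
    using j(3)[OF that] hom_in_carrier[OF k that] by (simp_all add: hn_k_def)
  show "transfer G (cmod C n) (hn_H A) (hn_k A) (TD n) (hn_G1 A) (hn_j1 A) (T1 n) (hn_i1 A) \<one>\<^bsub>G\<^esub>"
    by (intro transfer.intro transfer_axioms.intro induced homs G.one_closed kv) (use one sub[THEN subsetD] in auto)
  show "transfer G (cmod C n) (hn_H A) (hn_k A) (TD n) (hn_G1 A) (hn_j1 A) (T1 n) (hn_i2 A) t"
    by (intro transfer.intro transfer_axioms.intro induced homs j(2) kv sub_t)
qed

abbreviation "N1 n \<equiv> ind_mod (hn_G1 A) G (hn_j1 A) (sub_mod (gr_map (hn_j1 A)) (cmod C n) (T1 n))"
abbreviation "tau1 n \<equiv> transfer.tau G (cmod C n) (hn_G1 A) (hn_j1 A) (T1 n) \<one>\<^bsub>G\<^esub>"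
abbreviation "tau2 n \<equiv> transfer.tau G (cmod C n) (hn_G1 A) (hn_j1 A) (T1 n) t"
abbreviation "ev n \<equiv> tensor_lift (cmod C n) (smult (cmod C n))"

lemma d_sub: "cdiff C n ` TD n \<subseteq> TD (n - 1)" "cdiff C n ` T1 n \<subseteq> T1 (n - 1)"
  using TD T1 by (auto simp: closed_family_def)

lemma chain_complexes: "chain_complex \<int>[hn_H A] (hmv_D E)" "chain_complex \<int>[hn_G1 A] (hmv_C1 E)"
  unfolding hmv_of_simps
  by (rule chain_complex_sub[OF groups(1,3) k C TD] chain_complex_sub[OF groups(2,3) j(1) C T1])+

lemma left_mid: "chain_complex \<int>[G] (hmv_left A E)" "chain_complex \<int>[G] (hmv_mid A E)"
  unfolding hmv_left_def hmv_mid_def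
  by (intro chain_complex_ind groups k j chain_complexes)+

lemma chain_map_e:
  "chain_map \<int>[hn_G1 A] (ind_complex (hn_H A) (hn_G1 A) (hn_i1 A) (hmv_D E)) (hmv_C1 E) (hmv_e1 E)"
  "chain_map \<int>[hn_G1 A] (ind_complex (hn_H A) (hn_G1 A) (hn_i2 A) (hmv_D E)) (hmv_C1 E) (hmv_e2 E)"
proof -
  have i: "chain_complex \<int>[hn_G1 A] (ind_complex (hn_H A) (hn_G1 A) (hn_i1 A) (hmv_D E))"
    by (intro chain_complex_ind groups homs chain_complexes)+
  show "chain_map \<int>[hn_G1 A] (ind_complex (hn_H A) (hn_G1 A) (hn_i1 A) (hmv_D E)) (hmv_C1 E) (hmv_e1 E)"
    unfolding chain_map_def
  proof (intro conjI allI ballI)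
    fix n
    note t = transfer(1)[of n] and t' = transfer(1)[of "n - 1"]
    note e = transfer.restriction_eq[OF t refl] and e' = transfer.restriction_eq[OF t' refl]
    show "hmv_e1 E n \<in> mod_hom \<int>[hn_G1 A] (cmod (ind_complex (hn_H A) (hn_G1 A) (hn_i1 A) (hmv_D E)) n) (cmod (hmv_C1 E) n)"
      using mod_hom_cong[OF transfer.restriction_hom[OF t] chain_complex_dest(1)[OF i, of n, simplified ind_complex_def ch_complex.simps hmv_of_simps sub_complex_simps] e]
      by (simp add: ind_complex_def)
    fix X assume "X \<in> carrier (cmod (ind_complex (hn_H A) (hn_G1 A) (hn_i1 A) (hmv_D E)) n)"
    then have X: "X \<in> carrier (ind_mod (hn_H A) (hn_G1 A) (hn_i1 A) (sub_mod (gr_map (hn_k A)) (cmod C n) (TD n)))"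
      by (simp add: ind_complex_def)
    have dX: "ind_map (hn_H A) (hn_G1 A) (hn_i1 A) (sub_mod (gr_map (hn_k A)) (cmod C (n - 1)) (TD (n - 1))) (cdiff C n) X
        \<in> carrier (ind_mod (hn_H A) (hn_G1 A) (hn_i1 A) (sub_mod (gr_map (hn_k A)) (cmod C (n - 1)) (TD (n - 1))))"
      using chain_complex_dest(2)[OF i, of n] X by (auto simp: ind_complex_def mod_hom_def)
    show "hmv_e1 E (n - 1) (cdiff (ind_complex (hn_H A) (hn_G1 A) (hn_i1 A) (hmv_D E)) n X) = cdiff (hmv_C1 E) n (hmv_e1 E n X)"
      using restriction_natural[OF t t' cm(2) d_sub(1,2) X] e[OF X] e'[OF dX]
      by (simp add: ind_complex_def)
  qed
  show "chain_map \<int>[hn_G1 A] (ind_complex (hn_H A) (hn_G1 A) (hn_i2 A) (hmv_D E)) (hmv_C1 E) (hmv_e2 E)"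
    unfolding chain_map_def
  proof (intro conjI allI ballI)
    fix n
    note t = transfer(2)[of n] and t' = transfer(2)[of "n - 1"]
    note e = transfer.restriction_def[OF t] and e' = transfer.restriction_def[OF t']
    show "hmv_e2 E n \<in> mod_hom \<int>[hn_G1 A] (cmod (ind_complex (hn_H A) (hn_G1 A) (hn_i2 A) (hmv_D E)) n) (cmod (hmv_C1 E) n)"
      using transfer.restriction_hom[OF t] by (simp add: e ind_complex_def)
    fix X assume "X \<in> carrier (cmod (ind_complex (hn_H A) (hn_G1 A) (hn_i2 A) (hmv_D E)) n)"
    then have X: "X \<in> carrier (ind_mod (hn_H A) (hn_G1 A) (hn_i2 A) (sub_mod (gr_map (hn_k A)) (cmod C n) (TD n)))"
      by (simp add: ind_complex_def)
    show "hmv_e2 E (n - 1) (cdiff (ind_complex (hn_H A) (hn_G1 A) (hn_i2 A) (hmv_D E)) n X) = cdiff (hmv_C1 E) n (hmv_e2 E n X)"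
      using restriction_natural[OF t t' cm(2) d_sub(1,2) X]
      by (simp add: e e' ind_complex_def)
  qed
qed

lemma left_carrier: "cmod (hmv_left A E) n = ind_mod (hn_H A) G (hn_k A) (sub_mod (gr_map (hn_k A)) (cmod C n) (TD n))"
  and mid_carrier: "cmod (hmv_mid A E) n = N1 n"
  by (simp_all add: hmv_left_def hmv_mid_def ind_complex_def)

lemma inj_eq:
  assumes X: "X \<in> carrier (cmod (hmv_left A E) n)"
  shows "hmv_inj A E n X = tau1 n X \<ominus>\<^bsub>N1 n\<^esub> tau2 n X"
proof -
  interpret t1: transfer G "cmod C n" "hn_H A" "hn_k A" "TD n" "hn_G1 A" "hn_j1 A" "T1 n" "hn_i1 A" "\<one>\<^bsub>G\<^esub>"
    by (rule transfer)
  interpret t2: transfer G "cmod C n" "hn_H A" "hn_k A" "TD n" "hn_G1 A" "hn_j1 A" "T1 n" "hn_i2 A" t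
    by (rule transfer)
  have one1: "\<one>\<^bsub>\<int>[hn_G1 A]\<^esub> \<in> carrier \<int>[hn_G1 A]"
    using t1.E.K.one_closed by (simp add: frag_of_closed)
  have f1: "hmv_e1 E n (t1.I.TP \<one>\<^bsub>\<int>[hn_G1 A]\<^esub> x) = t1.v_inv \<odot>\<^bsub>cmod C n\<^esub> x"
    and f2: "hmv_e2 E n (t2.I.TP \<one>\<^bsub>\<int>[hn_G1 A]\<^esub> x) = t2.v_inv \<odot>\<^bsub>cmod C n\<^esub> x" if "x \<in> TD n" for x
    using t1.restriction_eq[OF refl t1.I.TP_closed[OF one1, of x]] t1.restriction_one[OF that]
      t2.restriction_one[OF that] that by (simp_all add: t2.restriction_def)
  have V: "s = s \<otimes>\<^bsub>\<int>[G]\<^esub> frag_of \<one>\<^bsub>G\<^esub>" if "s \<in> carrier \<int>[G]" for s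
    using t1.D.C.R.r_one[OF that] by simp
  have X': "X \<in> carrier t1.D.b.TM" using X by (simp add: left_carrier)
  let ?\<beta>1 = "\<lambda>s x. t1.E.b.TP s (hmv_e1 E n (t1.I.TP \<one>\<^bsub>\<int>[hn_G1 A]\<^esub> x))"
  let ?\<beta>2 = "\<lambda>s x. t1.E.b.TP (s \<otimes>\<^bsub>\<int>[G]\<^esub> frag_of t) (hmv_e2 E n (t2.I.TP \<one>\<^bsub>\<int>[hn_G1 A]\<^esub> x))"
  have b1: "t1.D.b.balanced (N1 n) ?\<beta>1"
    by (rule t1.D.b.balanced_cong[OF t1.tau_balanced]) (use f1 V in simp)
  have b2: "t1.D.b.balanced (N1 n) ?\<beta>2"
    by (rule t1.D.b.balanced_cong[OF t2.tau_balanced]) (use f2 in simp)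
  have "tensor_lift (N1 n) (\<lambda>s x. ?\<beta>1 s x \<ominus>\<^bsub>N1 n\<^esub> ?\<beta>2 s x) X = tensor_lift (N1 n) ?\<beta>1 X \<ominus>\<^bsub>N1 n\<^esub> tensor_lift (N1 n) ?\<beta>2 X"
    by (rule t1.D.b.lift_diff[OF t1.E.b.abelian_group_TM b1 b2 X'])
  also have "tensor_lift (N1 n) ?\<beta>1 X = tau1 n X" by (rule t1.tau_eq[OF f1 V X'])
  also have "tensor_lift (N1 n) ?\<beta>2 X = tau2 n X" by (rule t2.tau_eq[OF f2 refl X'])
  finally show ?thesis unfolding hmv_inj_def hmv_of_simps(1,2) sub_complex_simps Let_def .
qed

lemma delta_hom: "(\<lambda>X. tau1 n X \<ominus>\<^bsub>N1 n\<^esub> tau2 n X) \<in> mod_hom \<int>[G] (cmod (hmv_left A E) n) (cmod (hmv_mid A E) n)"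
proof -
  interpret t1: transfer G "cmod C n" "hn_H A" "hn_k A" "TD n" "hn_G1 A" "hn_j1 A" "T1 n" "hn_i1 A" "\<one>\<^bsub>G\<^esub>"
    by (rule transfer)
  interpret t2: transfer G "cmod C n" "hn_H A" "hn_k A" "TD n" "hn_G1 A" "hn_j1 A" "T1 n" "hn_i2 A" t
    by (rule transfer)
  interpret N: left_module "\<int>[G]" "N1 n" by (rule t1.E.b.left_module_TM)
  show ?thesis unfolding left_carrier mid_carrier
  proof (rule mod_homI)
    show "additive t1.D.b.TM (N1 n) (\<lambda>X. tau1 n X \<ominus>\<^bsub>N1 n\<^esub> tau2 n X)"
      by (simp add: additive_def t1.tau_facts(1,2) t2.tau_facts(1,2) t1.E.b.TM.add_minus_add)
    fix r X assume "r \<in> carrier \<int>[G]" "X \<in> carrier t1.D.b.TM"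
    then show "tau1 n (r \<odot>\<^bsub>t1.D.b.TM\<^esub> X) \<ominus>\<^bsub>N1 n\<^esub> tau2 n (r \<odot>\<^bsub>t1.D.b.TM\<^esub> X) = r \<odot>\<^bsub>N1 n\<^esub> (tau1 n X \<ominus>\<^bsub>N1 n\<^esub> tau2 n X)"
      by (simp add: mod_hom_smult[OF t1.tau_hom] mod_hom_smult[OF t2.tau_hom]
        t1.tau_facts(1) t2.tau_facts(1) N.smult_minus)
  qed
qed

lemma tau_closed: "X \<in> carrier (cmod (hmv_left A E) n) \<Longrightarrow> tau1 n X \<in> carrier (N1 n)"
  "X \<in> carrier (cmod (hmv_left A E) n) \<Longrightarrow> tau2 n X \<in> carrier (N1 n)"
  unfolding left_carrier by (rule transfer.tau_facts(1)[OF transfer(1)], simp)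
    (rule transfer.tau_facts(1)[OF transfer(2)], simp)

lemma chain_map_inj: "chain_map \<int>[G] (hmv_left A E) (hmv_mid A E) (hmv_inj A E)"
  unfolding chain_map_def
proof (intro conjI allI ballI)
  fix n
  note t1 = transfer(1)[of n] and t2 = transfer(2)[of n]
  note t1' = transfer(1)[of "n - 1"] and t2' = transfer(2)[of "n - 1"]
  show "hmv_inj A E n \<in> mod_hom \<int>[G] (cmod (hmv_left A E) n) (cmod (hmv_mid A E) n)"
    by (rule mod_hom_cong[OF delta_hom chain_complex_dest(1)[OF left_mid(1)] inj_eq])
  fix X assume X: "X \<in> carrier (cmod (hmv_left A E) n)"
  have dX: "cdiff (hmv_left A E) n X \<in> carrier (cmod (hmv_left A E) (n - 1))"
    using chain_complex_dest(2)[OF left_mid(1), of n] X by (auto simp: mod_hom_def)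
  note dm = chain_complex_dest(2)[OF left_mid(2), of n]
  note ad = additive_facts(5)[OF mod_hom_additive[OF dm]
      left_module_abelian[OF chain_complex_dest(1)[OF left_mid(2)]]
      left_module_abelian[OF chain_complex_dest(1)[OF left_mid(2)]], unfolded mid_carrier,
      OF tau_closed(1)[OF X] tau_closed(2)[OF X]]
  show "hmv_inj A E (n - 1) (cdiff (hmv_left A E) n X) = cdiff (hmv_mid A E) n (hmv_inj A E n X)"
    unfolding inj_eq[OF X] inj_eq[OF dX] ad
    using tau_natural[OF t1 t1' cm(2) d_sub(1,2), of X] tau_natural[OF t2 t2' cm(2) d_sub(1,2), of X] X
    unfolding left_carrier
    by (simp add: hmv_left_def hmv_mid_def ind_complex_def)
qed

lemma ev_hom: "ev n \<in> mod_hom \<int>[G] (N1 n) (cmod C n)"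
  by (rule eval_one_hom[OF induced(2)])

lemma chain_map_proj: "chain_map \<int>[G] (hmv_mid A E) C (hmv_proj E)"
  unfolding chain_map_def
proof (intro conjI allI ballI)
  fix n
  show "hmv_proj E n \<in> mod_hom \<int>[G] (cmod (hmv_mid A E) n) (cmod C n)"
    using ev_hom[of n] unfolding mid_carrier by simp
  fix Y assume Y: "Y \<in> carrier (cmod (hmv_mid A E) n)"
  show "hmv_proj E (n - 1) (cdiff (hmv_mid A E) n Y) = cdiff C n (hmv_proj E n Y)"
    using eval_one_natural[OF induced(2) induced(2) cm(2) d_sub(2) Y[unfolded mid_carrier]]
    by (simp add: hmv_mid_def ind_complex_def)
qed

lemma splitting:
  assumes inj: "\<And>n X. X \<in> carrier (cmod (hmv_left A E) n) \<Longrightarrow> tau1 n X \<ominus>\<^bsub>N1 n\<^esub> tau2 n X = \<zero>\<^bsub>N1 n\<^esub> \<Longrightarrow>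
      X = \<zero>\<^bsub>cmod (hmv_left A E) n\<^esub>"
    and comp: "\<And>n X. X \<in> carrier (cmod (hmv_left A E) n) \<Longrightarrow> ev n (tau1 n X \<ominus>\<^bsub>N1 n\<^esub> tau2 n X) = \<zero>\<^bsub>cmod C n\<^esub>"
    and ker: "\<And>n Y. Y \<in> carrier (N1 n) \<Longrightarrow> ev n Y = \<zero>\<^bsub>cmod C n\<^esub> \<Longrightarrow>
      \<exists>X \<in> carrier (cmod (hmv_left A E) n). tau1 n X \<ominus>\<^bsub>N1 n\<^esub> tau2 n X = Y"
    and surj: "\<And>n x. x \<in> carrier (cmod C n) \<Longrightarrow> \<exists>Y \<in> carrier (N1 n). ev n Y = x"
  shows "hmv_splitting A C E"
proof -
  have "inj_on (hmv_inj A E n) (carrier (cmod (hmv_left A E) n)) \<and>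
      hmv_inj A E n ` carrier (cmod (hmv_left A E) n) = {y \<in> carrier (cmod (hmv_mid A E) n). hmv_proj E n y = \<zero>\<^bsub>cmod C n\<^esub>} \<and>
      hmv_proj E n ` carrier (cmod (hmv_mid A E) n) = carrier (cmod C n)" for n
  proof (intro conjI)
    interpret L: left_module "\<int>[G]" "cmod (hmv_left A E) n" by (rule chain_complex_dest(1)[OF left_mid(1)])
    interpret N: left_module "\<int>[G]" "cmod (hmv_mid A E) n" by (rule chain_complex_dest(1)[OF left_mid(2)])
    have ih: "hmv_inj A E n \<in> mod_hom \<int>[G] (cmod (hmv_left A E) n) (cmod (hmv_mid A E) n)"
      and ph: "hmv_proj E n \<in> mod_hom \<int>[G] (cmod (hmv_mid A E) n) (cmod C n)"
      using chain_map_inj chain_map_proj by (simp_all add: chain_map_def)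
    note fi = additive_facts[OF mod_hom_additive[OF ih] L.M.abelian_group_axioms N.M.abelian_group_axioms]
    show "inj_on (hmv_inj A E n) (carrier (cmod (hmv_left A E) n))"
    proof (rule inj_onI)
      fix X X' assume X: "X \<in> carrier (cmod (hmv_left A E) n)" "X' \<in> carrier (cmod (hmv_left A E) n)"
        and eq: "hmv_inj A E n X = hmv_inj A E n X'"
      have D: "X \<ominus>\<^bsub>cmod (hmv_left A E) n\<^esub> X' \<in> carrier (cmod (hmv_left A E) n)" using X by simp
      have "hmv_inj A E n (X \<ominus>\<^bsub>cmod (hmv_left A E) n\<^esub> X') = \<zero>\<^bsub>cmod (hmv_mid A E) n\<^esub>"
        using X eq by (simp add: fi N.M.minus_self)
      then have "X \<ominus>\<^bsub>cmod (hmv_left A E) n\<^esub> X' = \<zero>\<^bsub>cmod (hmv_left A E) n\<^esub>"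
        unfolding inj_eq[OF D] mid_carrier by (intro inj[OF D]) auto
      then show "X = X'" using X L.M.minus_eq_zeroD by blast
    qed
    show "hmv_inj A E n ` carrier (cmod (hmv_left A E) n) = {y \<in> carrier (cmod (hmv_mid A E) n). hmv_proj E n y = \<zero>\<^bsub>cmod C n\<^esub>}"
    proof (intro equalityI subsetI)
      fix y assume "y \<in> hmv_inj A E n ` carrier (cmod (hmv_left A E) n)"
      then obtain X where X: "X \<in> carrier (cmod (hmv_left A E) n)" "y = hmv_inj A E n X" by blast
      then show "y \<in> {y \<in> carrier (cmod (hmv_mid A E) n). hmv_proj E n y = \<zero>\<^bsub>cmod C n\<^esub>}"
        using fi(1)[OF X(1)] comp[OF X(1)] by (simp add: inj_eq)
    next
      fix y assume y: "y \<in> {y \<in> carrier (cmod (hmv_mid A E) n). hmv_proj E n y = \<zero>\<^bsub>cmod C n\<^esub>}"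
      then obtain X where X: "X \<in> carrier (cmod (hmv_left A E) n)" "tau1 n X \<ominus>\<^bsub>N1 n\<^esub> tau2 n X = y"
        using ker[of y n] unfolding mid_carrier by auto
      then have "y = hmv_inj A E n X" using inj_eq[OF X(1)] by simp
      then show "y \<in> hmv_inj A E n ` carrier (cmod (hmv_left A E) n)" using X(1) by blast
    qed
    show "hmv_proj E n ` carrier (cmod (hmv_mid A E) n) = carrier (cmod C n)"
    proof (intro equalityI subsetI)
      fix x assume "x \<in> carrier (cmod C n)"
      then show "x \<in> hmv_proj E n ` carrier (cmod (hmv_mid A E) n)"
        using surj unfolding mid_carrier by (auto simp: image_iff)
    qed (use ph in \<open>auto simp: mod_hom_def\<close>)
  qed
  then show ?thesis
    unfolding hmv_splitting_def short_exact_def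
    using chain_complexes chain_map_e left_mid chain_map_inj chain_map_proj C by blast
qed

end

lemma hmv_family_canonical:
  assumes A: "hnn_extension A" and C: "chain_complex \<int>[hn_G A] C"
  shows "hmv_family A C (\<lambda>n. carrier (cmod C n)) (\<lambda>n. carrier (cmod C n))"
proof -
  have g: "group (hn_H A)" "group (hn_G1 A)" "group (hn_G A)"
    and i: "hn_i1 A \<in> hom (hn_H A) (hn_G1 A)"
    using A by (simp_all add: hnn_extension_def)
  note j = hnn_morphisms[OF A]
  have k: "hn_k A \<in> hom (hn_H A) (hn_G A)" unfolding hn_k_def by (rule hom_compose[OF i j(1)])
  interpret G: group "hn_G A" by (rule g)
  show ?thesis
    by (intro hmv_family.intro A C order_refl closed_family_carrier[OF g(1,3) k C]
      closed_family_carrier[OF g(2,3) j(1) C] left_module.smult_closed[OF chain_complex_dest(1)[OF C]]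
      frag_of_closed G.inv_closed j(2))
qed

context hmv_family
begin

lemma sub_canonical: "hmv_sub A E (hmv_canonical A C)"
proof -
  let ?c = "\<lambda>n. carrier (cmod C n)"
  let ?E = "hmv_of A C ?c ?c"
  interpret c: hmv_family A C ?c ?c by (rule hmv_family_canonical[OF A C])
  have le: "(\<lambda>x. x) ` TD n \<subseteq> ?c n" "(\<lambda>x. x) ` T1 n \<subseteq> ?c n" for n
    using closed_family_subset[OF TD] closed_family_subset[OF T1] by auto
  have s: "subcomplex \<int>[hn_H A] (hmv_D E) (hmv_D ?E)" "subcomplex \<int>[hn_G1 A] (hmv_C1 E) (hmv_C1 ?E)"
    unfolding hmv_of_simps sub_complex_carrier
    by (rule subcomplex_sub[OF groups(1,3) k C TD] subcomplex_sub[OF groups(2,3) j(1) C T1])+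
  have "hmv_mid_incl A ?E n (hmv_inj A E n X) = hmv_inj A ?E n (hmv_left_incl A ?E n X)"
    if X: "X \<in> carrier (cmod (hmv_left A E) n)" for n X
  proof -
    interpret b: induced G "cmod C n" "hn_G1 A" "hn_j1 A" "T1 n" by (rule induced)
    interpret b': induced G "cmod C n" "hn_G1 A" "hn_j1 A" "carrier (cmod C n)" by (rule c.induced)
    have X': "X \<in> carrier (ind_mod (hn_H A) G (hn_k A) (sub_mod (gr_map (hn_k A)) (cmod C n) (TD n)))"
      using X by (simp add: left_carrier)
    have L: "hmv_left_incl A ?E n X \<in> carrier (cmod (hmv_left A ?E) n)"
      using ind_incl_closed[OF groups(1,3) k s(1), of n] X' by (auto simp: c.left_carrier hmv_left_incl_def)
    have h: "(\<lambda>x. x) \<in> mod_hom \<int>[hn_G1 A] b.sub b'.sub"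
      using subcomplex_hom[OF s(2), of n] by simp
    note ad = additive_facts(5)[OF mod_hom_additive[OF ext_map_facts(2)[OF b.b.base_change_axioms b'.b.base_change_axioms h]]
      b.b.abelian_group_TM b'.b.abelian_group_TM tau_closed[OF X]]
    show ?thesis
      unfolding inj_eq[OF X] c.inj_eq[OF L]
      using tau_natural[OF transfer(1) c.transfer(1) id_mod_hom le(1,2) X']
        tau_natural[OF transfer(2) c.transfer(2) id_mod_hom le(1,2) X'] ad
      by (simp add: hmv_mid_incl_def hmv_left_incl_def)
  qed
  moreover have "hmv_proj E n Y = hmv_proj ?E n (hmv_mid_incl A ?E n Y)"
    if Y: "Y \<in> carrier (cmod (hmv_mid A E) n)" for n Y
    using eval_one_natural[OF induced(2) c.induced(2) id_mod_hom le(2) Y[unfolded mid_carrier]]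
    by (simp add: hmv_mid_incl_def)
  ultimately show ?thesis
    unfolding hmv_sub_def hmv_canonical_of using s by blast
qed

end

text \<open>As for amalgams; the sets used for \<open>C1\<close> are \<open>Z b \<union> t\<^sup>-\<^sup>1 Z
  b\<close>, and they inherit the compatibility with the differential because it acts by right
  multiplication.\<close>
theorem hnn_finite_splittings:
  fixes A :: "('h, 'a, 'g) hnn" and C :: "('g \<Rightarrow>\<^sub>0 int, 'm) ch_complex"
  assumes A: "injective_hnn A" and C: "finite_fg_free \<int>[hn_G A] C"
    and F: "finite F" "F \<subseteq> carrier (cmod C m)"
  obtains E :: "('h, 'a, 'g, 'm, 'm, 'm) hmv"
  where "hmv_finite A C E" "hmv_sub A E (hmv_canonical A C)"
    "F \<subseteq> carrier (cmod (hmv_D E) m)" "F \<subseteq> carrier (cmod (hmv_C1 E) m)"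
proof -
  let ?G = "hn_G A" and ?t = "hn_t A"
  let ?S = "hn_j1 A ` carrier (hn_G1 A) \<union> {?t, inv\<^bsub>?G\<^esub> ?t}"
  have he: "hnn_extension A" and inj: "inj_on (hn_i1 A) (carrier (hn_H A))"
    using A by (auto simp: injective_hnn_def)
  have g: "group (hn_H A)" "group (hn_G1 A)" "group ?G"
    and i: "hn_i1 A \<in> hom (hn_H A) (hn_G1 A)"
    using he by (simp_all add: hnn_extension_def)
  note j = hnn_morphisms[OF he]
  have k: "hn_k A \<in> hom (hn_H A) ?G" unfolding hn_k_def by (rule hom_compose[OF i j(1)])
  have injk: "inj_on (hn_k A) (carrier (hn_H A))"
    unfolding hn_k_def
    by (rule comp_inj_on[OF inj inj_on_subset[OF hnn_embeds[OF A]]]) (use hom_in_carrier[OF i] in auto)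
  interpret G: group ?G by (rule g)
  have cc: "chain_complex \<int>[?G] C" using C by (simp add: finite_fg_free_def)
  have "\<exists>B. free_basis \<int>[?G] (cmod C n) B" for n
    using C fg_free_basis unfolding finite_fg_free_def by metis
  then obtain Bas where Bas: "\<And>n. free_basis \<int>[?G] (cmod C n) (Bas n)" by metis
  have free: "free_group_module ?G (cmod C n) (Bas n)" for n
    by (intro free_group_module.intro g Bas)
  have S: "?S \<subseteq> carrier ?G" using hom_in_carrier[OF j(1)] j(2) by auto
  have cl: "\<exists>Z. finite Z \<and> Z \<subseteq> carrier ?G \<and> F \<subseteq> Z \<and> \<one>\<^bsub>?G\<^esub> \<in> Z \<and> connected_by ?G ?S Z"
    if "finite F" "F \<subseteq> carrier ?G" for F
  proof (rule finite_connected[OF g(3) S _ that])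
    fix P x assume "x \<in> carrier ?G" "P \<one>\<^bsub>?G\<^esub>"
      and "\<And>s x. s \<in> ?S \<Longrightarrow> x \<in> carrier ?G \<Longrightarrow> P x \<Longrightarrow> P (s \<otimes>\<^bsub>?G\<^esub> x)"
    then show "P x" by (rule hnn_generated[where P = P, OF he])
  qed blast
  obtain Z where Z: "\<And>n b. b \<in> Bas n \<Longrightarrow> finite (Z n b)" "\<And>n b. b \<in> Bas n \<Longrightarrow> Z n b \<subseteq> carrier ?G"
    "\<And>n b. b \<in> Bas n \<Longrightarrow> \<one>\<^bsub>?G\<^esub> \<in> Z n b" "\<And>n b. b \<in> Bas n \<Longrightarrow> connected_by ?G ?S (Z n b)"
    and step: "\<And>n b b' z g. b \<in> Bas n \<Longrightarrow> b' \<in> Bas (n - 1) \<Longrightarrow> z \<in> Z n b \<Longrightarrow>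
      g \<in> Poly_Mapping.keys (free_basis.coord \<int>[?G] (cmod C (n - 1)) (Bas (n - 1)) (cdiff C n b) b') \<Longrightarrow>
      z \<otimes>\<^bsub>?G\<^esub> g \<in> Z (n - 1) b'"
    and FZ: "\<And>x b. x \<in> F \<Longrightarrow> b \<in> Bas m \<Longrightarrow>
      Poly_Mapping.keys (free_basis.coord \<int>[?G] (cmod C m) (Bas m) x b) \<subseteq> Z m b"
    by (rule connected_family[OF g(3) C Bas cl F]) blast+
  define Z' where "Z' n b = Z n b \<union> (\<lambda>z. inv\<^bsub>?G\<^esub> ?t \<otimes>\<^bsub>?G\<^esub> z) ` Z n b" for n b
  have Z': "finite (Z' n b)" "Z' n b \<subseteq> carrier ?G" if "b \<in> Bas n" for n b
    using Z(1,2)[OF that] j(2) by (auto simp: Z'_def subset_iff)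
  have step': "z \<otimes>\<^bsub>?G\<^esub> g \<in> Z' (n - 1) b'"
    if b: "b \<in> Bas n" "b' \<in> Bas (n - 1)" and z: "z \<in> Z' n b"
      and g: "g \<in> Poly_Mapping.keys (free_basis.coord \<int>[?G] (cmod C (n - 1)) (Bas (n - 1)) (cdiff C n b) b')"
    for n b b' z g
  proof -
    have "cdiff C n b \<in> carrier (cmod C (n - 1))"
      using chain_complex_dest(2)[OF cc, of n] free_basis.basis_closed[OF Bas b(1)] by (auto simp: mod_hom_def)
    then have gc: "g \<in> carrier ?G" using free_basis.coord_closed[OF Bas _ b(2)] g by (auto simp: group_ring_carrier)
    from z consider "z \<in> Z n b" | z0 where "z0 \<in> Z n b" "z = inv\<^bsub>?G\<^esub> ?t \<otimes>\<^bsub>?G\<^esub> z0" unfolding Z'_def by blast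
    then show ?thesis
    proof cases
      case 1
      then show ?thesis using step[OF b _ g] by (simp add: Z'_def)
    next
      case 2
      have "z0 \<in> carrier ?G" using Z(2)[OF b(1)] 2 by auto
      then have "z \<otimes>\<^bsub>?G\<^esub> g = inv\<^bsub>?G\<^esub> ?t \<otimes>\<^bsub>?G\<^esub> (z0 \<otimes>\<^bsub>?G\<^esub> g)" using 2 gc j(2) by (simp add: G.m_assoc)
      then show ?thesis using step[OF b 2(1) g] unfolding Z'_def by blast
    qed
  qed
  have piece: "hnn_piece A (cmod C n) (Bas n) (Z n)" for n
    by (intro hnn_piece.intro he free Z)
  define TD where "TD n = free_group_module.supported ?G (cmod C n) (Bas n) (\<lambda>b. translates (hn_H A) ?G (hn_k A) (Z n b))" for n
  define T1 where "T1 n = free_group_module.supported ?G (cmod C n) (Bas n) (\<lambda>b. translates (hn_G1 A) ?G (hn_j1 A) (Z' n b))" for n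
  have "closed_family (hn_H A) (hn_k A) C TD" unfolding TD_def
    by (rule closed_family_span[where Z = Z and Bas = Bas], rule hnn_piece.free_sub(1)[OF piece], rule cc,
        erule Z(2), erule (3) step)
  moreover have "closed_family (hn_G1 A) (hn_j1 A) C T1" unfolding T1_def
    by (rule closed_family_span[where Z = Z' and Bas = Bas], rule hnn_piece.free_sub(2)[OF piece], rule cc,
        erule Z'(2), erule (3) step')
  ultimately have cf: "closed_family (hn_H A) (hn_k A) C TD" "closed_family (hn_G1 A) (hn_j1 A) C T1" .
  have sub: "TD n \<subseteq> T1 n" "x \<in> TD n \<Longrightarrow> frag_of (inv\<^bsub>?G\<^esub> ?t) \<odot>\<^bsub>cmod C n\<^esub> x \<in> T1 n"
    and free_sub: "fg_free \<int>[hn_H A] (sub_mod (gr_map (hn_k A)) (cmod C n) (TD n))"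
    "fg_free \<int>[hn_G1 A] (sub_mod (gr_map (hn_j1 A)) (cmod C n) (T1 n))" for n x
  proof -
    interpret p: hnn_piece A "cmod C n" "Bas n" "Z n" by (rule piece)
    have one: "frag_of (inv\<^bsub>?G\<^esub> \<one>\<^bsub>?G\<^esub>) \<odot>\<^bsub>cmod C n\<^esub> x = x" if "x \<in> carrier (cmod C n)" for x
      using p.F.smult_one[OF that] by simp
    {
      fix x assume "x \<in> TD n"
      then have "x \<in> p.D.span (Z n)" by (simp add: TD_def)
      from p.T1.span_mono[OF this] one[OF p.D.supported_carrier[OF this]]
      have "x \<in> T1 n" by (simp add: T1_def Z'_def)
    }
    then show "TD n \<subseteq> T1 n" by blast
    show "frag_of (inv\<^bsub>?G\<^esub> ?t) \<odot>\<^bsub>cmod C n\<^esub> x \<in> T1 n" if "x \<in> TD n"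
      using p.T2.span_mono[OF that[unfolded TD_def]] by (simp add: T1_def Z'_def)
    show "fg_free \<int>[hn_H A] (sub_mod (gr_map (hn_k A)) (cmod C n) (TD n))"
      unfolding TD_def by (rule p.D.fg_free_span[OF injk Z(1,2)])
    show "fg_free \<int>[hn_G1 A] (sub_mod (gr_map (hn_j1 A)) (cmod C n) (T1 n))"
      unfolding T1_def by (rule p.E.fg_free_span[OF hnn_embeds[OF A] Z'])
  qed
  interpret f: hmv_family A C TD T1
    by (intro hmv_family.intro he cc cf sub)
  have ev: "tensor_lift (cmod C n) (smult (cmod C n)) = induced.eval (cmod C n) (\<lambda>_. 1)" for n
    by (rule induced.eval_one[OF f.induced(1)])
  have "hmv_splitting A C f.E"
  proof (rule f.splitting)
    fix n
    interpret p: hnn_piece A "cmod C n" "Bas n" "Z n" by (rule piece)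
    have d: "f.tau1 n X \<ominus>\<^bsub>f.N1 n\<^esub> f.tau2 n X = p.delta X" for X
      unfolding p.delta_def T1_def Z'_def ..
    have N: "f.N1 n = p.E.n.b.TM" unfolding T1_def Z'_def ..
    show "X = \<zero>\<^bsub>cmod (hmv_left A f.E) n\<^esub>" if "X \<in> carrier (cmod (hmv_left A f.E) n)"
      "f.tau1 n X \<ominus>\<^bsub>f.N1 n\<^esub> f.tau2 n X = \<zero>\<^bsub>f.N1 n\<^esub>" for X
      using p.delta_injective[of X] that(1) that(2)[unfolded d, unfolded N] unfolding f.left_carrier TD_def by blast
    show "f.ev n (f.tau1 n X \<ominus>\<^bsub>f.N1 n\<^esub> f.tau2 n X) = \<zero>\<^bsub>cmod C n\<^esub>" if "X \<in> carrier (cmod (hmv_left A f.E) n)" for X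
      using p.composite that unfolding d f.left_carrier ev TD_def .
    show "\<exists>X \<in> carrier (cmod (hmv_left A f.E) n). f.tau1 n X \<ominus>\<^bsub>f.N1 n\<^esub> f.tau2 n X = Y"
      if Y: "Y \<in> carrier (f.N1 n)" "f.ev n Y = \<zero>\<^bsub>cmod C n\<^esub>" for Y
      by (rule p.kernel[OF Y[unfolded N ev]]) (unfold f.left_carrier d TD_def, blast)
    show "\<exists>Y \<in> carrier (f.N1 n). f.ev n Y = x" if "x \<in> carrier (cmod C n)" for x
      unfolding ev N
      by (rule bexI[of _ "p.E.sigma x"]) (use p.E.eval_sigma[OF p.one'] p.sigma_facts(1)[of x] that in simp_all)
  qed
  then have "hmv_finite A C f.E"
    unfolding hmv_finite_def
    using C finite_fg_free_sub[OF g(1,3) k C cf(1) free_sub(1)] finite_fg_free_sub[OF g(2,3) j(1) C cf(2) free_sub(2)]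
    by simp
  moreover have "F \<subseteq> TD m"
  proof
    fix x assume x: "x \<in> F"
    interpret p: hnn_piece A "cmod C m" "Bas m" "Z m" by (rule piece)
    have "Poly_Mapping.keys (p.F.coord x b) \<subseteq> translates (hn_H A) ?G (hn_k A) (Z m b)" if "b \<in> Bas m" for b
      using FZ[OF x that] p.D.translates_self[OF Z(2)[OF that]] by blast
    then show "x \<in> TD m" unfolding TD_def p.D.supported_def using x F by auto
  qed
  ultimately show ?thesis
    using sub(1)[of m] f.sub_canonical by (intro that[of f.E]) auto
qed

theorem hnn_union:
  fixes A :: "('h, 'a, 'g) hnn" and C :: "('g \<Rightarrow>\<^sub>0 int, 'm) ch_complex"
  assumes A: "injective_hnn A" and C: "finite_fg_free \<int>[hn_G A] C"
  shows "hmv_union A C {E. hmv_finite A C E \<and> hmv_sub A E (hmv_canonical A C)} (hmv_canonical A C)"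
proof -
  let ?E = "hmv_canonical A C"
  let ?\<E> = "{E. hmv_finite A C E \<and> hmv_sub A E ?E}"
  have he: "hnn_extension A" using A by (simp add: injective_hnn_def)
  have cc: "chain_complex \<int>[hn_G A] C" using C by (simp add: finite_fg_free_def)
  interpret c: hmv_family A C "\<lambda>n. carrier (cmod C n)" "\<lambda>n. carrier (cmod C n)"
    by (rule hmv_family_canonical[OF he cc])
  have s: "subcomplex \<int>[hn_H A] (hmv_D E) (hmv_D ?E)" "subcomplex \<int>[hn_G1 A] (hmv_C1 E) (hmv_C1 ?E)" if "E \<in> ?\<E>" for E
    using that by (simp_all add: hmv_sub_def)
  have big: "\<exists>E \<in> ?\<E>. F \<subseteq> carrier (cmod (hmv_D E) n) \<and> F \<subseteq> carrier (cmod (hmv_C1 E) n)"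
    if "finite F" "F \<subseteq> carrier (cmod C n)" for F n
    using hnn_finite_splittings[OF A C that] by (metis (mono_tags, lifting) mem_Collect_eq)
  have can: "carrier (cmod (hmv_D ?E) n) = carrier (cmod C n)" "carrier (cmod (hmv_C1 ?E) n) = carrier (cmod C n)" for n
    by (simp_all add: hmv_canonical_of)
  have lm: "left_module \<int>[hn_H A] (cmod (hmv_D E) n)" "left_module \<int>[hn_G1 A] (cmod (hmv_C1 E) n)" if "E \<in> ?\<E>" for E n
    using s[OF that] by (auto simp: subcomplex_def chain_complex_def)
  have lmc: "left_module \<int>[hn_H A] (cmod (hmv_D ?E) n)" "left_module \<int>[hn_G1 A] (cmod (hmv_C1 ?E) n)" for n
    using chain_complex_dest(1)[OF c.chain_complexes(1)] chain_complex_dest(1)[OF c.chain_complexes(2)]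
    by (simp_all add: hmv_canonical_of)
  note hom = subcomplex_hom[OF s(1)] subcomplex_hom[OF s(2)]
  have left: "carrier (cmod (hmv_left A E) n) = carrier (ind_mod (hn_H A) (hn_G A) (hn_k A) (cmod (hmv_D E) n))"
    and mid: "carrier (cmod (hmv_mid A E) n) = carrier (ind_mod (hn_G1 A) (hn_G A) (hn_j1 A) (cmod (hmv_C1 E) n))"
    for E :: "('h, 'a, 'g, 'm, 'm, 'm) hmv" and n
    by (simp_all add: hmv_left_def hmv_mid_def ind_complex_def)
  note incl1 = ind_incl_closed[OF c.groups(1,3) c.k s(1)] and incl2 = ind_incl_closed[OF c.groups(2,3) c.j(1) s(2)]
  show ?thesis
    unfolding hmv_union_def
  proof (intro allI conjI equalityI)
    fix n
    show "carrier (cmod (hmv_D ?E) n) \<subseteq> (\<Union>E\<in>?\<E>. carrier (cmod (hmv_D E) n))"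
      "carrier (cmod (hmv_C1 ?E) n) \<subseteq> (\<Union>E\<in>?\<E>. carrier (cmod (hmv_C1 E) n))"
    proof (safe, goal_cases)
      case (1 x)
      then show ?case using big[of "{x}" n] unfolding can by auto
    next
      case (2 x)
      then show ?case using big[of "{x}" n] unfolding can by auto
    qed
    show "(\<Union>E\<in>?\<E>. carrier (cmod (hmv_D E) n)) \<subseteq> carrier (cmod (hmv_D ?E) n)"
      "(\<Union>E\<in>?\<E>. carrier (cmod (hmv_C1 E) n)) \<subseteq> carrier (cmod (hmv_C1 ?E) n)"
      by (rule UN_least, use s in \<open>simp add: subcomplex_def\<close>)+
    show "carrier (cmod C n) \<subseteq> (\<Union>E\<in>?\<E>. carrier (cmod C n))" using big[of "{}" n] by auto
    show "(\<Union>E\<in>?\<E>. carrier (cmod C n)) \<subseteq> carrier (cmod C n)" by blast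
    show "(\<Union>E\<in>?\<E>. hmv_left_incl A ?E n ` carrier (cmod (hmv_left A E) n)) \<subseteq> carrier (cmod (hmv_left A ?E) n)"
      unfolding left hmv_left_incl_def by (rule UN_least) (rule incl1)
    show "(\<Union>E\<in>?\<E>. hmv_mid_incl A ?E n ` carrier (cmod (hmv_mid A E) n)) \<subseteq> carrier (cmod (hmv_mid A ?E) n)"
      unfolding mid hmv_mid_incl_def by (rule UN_least) (rule incl2)
    show "carrier (cmod (hmv_left A ?E) n) \<subseteq> (\<Union>E\<in>?\<E>. hmv_left_incl A ?E n ` carrier (cmod (hmv_left A E) n))"
      unfolding left hmv_left_incl_def
    proof
      fix X assume "X \<in> carrier (ind_mod (hn_H A) (hn_G A) (hn_k A) (cmod (hmv_D ?E) n))"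
      from ind_finite_support[OF c.groups(1,3) c.k lmc(1) this] obtain F where F: "finite F"
        "F \<subseteq> carrier (cmod (hmv_D ?E) n)"
        "\<And>N. left_module \<int>[hn_H A] N \<Longrightarrow> (\<lambda>x. x) \<in> mod_hom \<int>[hn_H A] N (cmod (hmv_D ?E) n) \<Longrightarrow> F \<subseteq> carrier N \<Longrightarrow>
          X \<in> ind_map (hn_H A) (hn_G A) (hn_k A) (cmod (hmv_D ?E) n) (\<lambda>x. x) ` carrier (ind_mod (hn_H A) (hn_G A) (hn_k A) N)"
        by blast
      obtain E where "E \<in> ?\<E>" "F \<subseteq> carrier (cmod (hmv_D E) n)" using big[OF F(1) F(2)[unfolded can]] by blast
      with F(3)[OF lm(1) hom(1)] show "X \<in> (\<Union>E\<in>?\<E>. ind_map (hn_H A) (hn_G A) (hn_k A) (cmod (hmv_D ?E) n) (\<lambda>x. x) `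
          carrier (ind_mod (hn_H A) (hn_G A) (hn_k A) (cmod (hmv_D E) n)))" by blast
    qed
    show "carrier (cmod (hmv_mid A ?E) n) \<subseteq> (\<Union>E\<in>?\<E>. hmv_mid_incl A ?E n ` carrier (cmod (hmv_mid A E) n))"
      unfolding mid hmv_mid_incl_def
    proof
      fix X assume "X \<in> carrier (ind_mod (hn_G1 A) (hn_G A) (hn_j1 A) (cmod (hmv_C1 ?E) n))"
      from ind_finite_support[OF c.groups(2,3) c.j(1) lmc(2) this] obtain F where F: "finite F"
        "F \<subseteq> carrier (cmod (hmv_C1 ?E) n)"
        "\<And>N. left_module \<int>[hn_G1 A] N \<Longrightarrow> (\<lambda>x. x) \<in> mod_hom \<int>[hn_G1 A] N (cmod (hmv_C1 ?E) n) \<Longrightarrow> F \<subseteq> carrier N \<Longrightarrow>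
          X \<in> ind_map (hn_G1 A) (hn_G A) (hn_j1 A) (cmod (hmv_C1 ?E) n) (\<lambda>x. x) ` carrier (ind_mod (hn_G1 A) (hn_G A) (hn_j1 A) N)"
        by blast
      obtain E where "E \<in> ?\<E>" "F \<subseteq> carrier (cmod (hmv_C1 E) n)" using big[OF F(1) F(2)[unfolded can]] by blast
      with F(3)[OF lm(2) hom(2)] show "X \<in> (\<Union>E\<in>?\<E>. ind_map (hn_G1 A) (hn_G A) (hn_j1 A) (cmod (hmv_C1 ?E) n) (\<lambda>x. x) `
          carrier (ind_mod (hn_G1 A) (hn_G A) (hn_j1 A) (cmod (hmv_C1 E) n)))" by blast
    qed
  qed
qed

theorem mainTheorem1:
  fixes A :: "('h, 'a, 'b, 'g) amalgam"
    and B :: "('h, 'a, 'g) hnn"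
    and C :: "('g \<Rightarrow>\<^sub>0 int, 'm) ch_complex"
  shows "(injective_amalgam A \<and> finite_fg_free \<int>[am_G A] C \<longrightarrow>
           amv_union A C {E. amv_finite A C E \<and> amv_sub A E (amv_canonical A C)} (amv_canonical A C) \<and>
           (\<exists>E :: ('h, 'a, 'b, 'g, 'm, 'm, 'm, 'm) amv. amv_finite A C E)) \<and>
         (injective_hnn B \<and> finite_fg_free \<int>[hn_G B] C \<longrightarrow>
           hmv_union B C {E. hmv_finite B C E \<and> hmv_sub B E (hmv_canonical B C)} (hmv_canonical B C) \<and>
           (\<exists>E :: ('h, 'a, 'g, 'm, 'm, 'm) hmv. hmv_finite B C E))"
proof (intro conjI impI)
  assume "injective_amalgam A \<and> finite_fg_free \<int>[am_G A] C"
  then have A: "injective_amalgam A" and C: "finite_fg_free \<int>[am_G A] C" by blast+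
  show "amv_union A C {E. amv_finite A C E \<and> amv_sub A E (amv_canonical A C)} (amv_canonical A C)"
    by (rule amalgam_union[OF A C])
  show "\<exists>E :: ('h, 'a, 'b, 'g, 'm, 'm, 'm, 'm) amv. amv_finite A C E"
    by (rule amalgam_finite_splittings[OF A C finite.emptyI empty_subsetI]) (rule exI)
next
  assume "injective_hnn B \<and> finite_fg_free \<int>[hn_G B] C"
  then have B: "injective_hnn B" and C: "finite_fg_free \<int>[hn_G B] C" by blast+
  show "hmv_union B C {E. hmv_finite B C E \<and> hmv_sub B E (hmv_canonical B C)} (hmv_canonical B C)"
    by (rule hnn_union[OF B C])
  show "\<exists>E :: ('h, 'a, 'g, 'm, 'm, 'm) hmv. hmv_finite B C E"
    by (rule hnn_finite_splittings[OF B C finite.emptyI empty_subsetI]) (rule exI)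
qed


end
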